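(* Let $E$ be an admissible sequentially complete complex locally convex Hausdorff space and $A:=]-\infty,a]$ or $A:=[a,\infty[$ for some $a\in\mathbb{R}$. Then the asymptotic one-sided Fourier transform $$\mathcal{F}_A^{\mathcal{B}}\colon\mathcal{B}(A,E)\to\mathcal{FO}_{\overline{A}}(E)/\mathcal{FO}_{\overline{A}\setminus A}(E),\quad\mathcal{F}_A^{\mathcal{B}}(f):=[(\mathcal{F}\circ\mathcal{R}_A^{-1})(f)],$$ is a linear isomorphism, where the closure $\overline{A}$ is taken in $\overline{\mathbb{R}}$.
   Context: $\mathbb{N}=\{1,2,\dots\}$, $\overline{\mathbb{R}}:=\mathbb{R}\cup\{\pm\infty\}$, $\overline{\mathbb{C}}:=\overline{\mathbb{R}}+i\mathbb{R}$, $\mathbb{H}:=\{z\in\mathbb{C}\mid\operatorname{Im}z>0\}$. $E$ carries a directed system of seminorms $(p_\alpha)_{\alpha\in\mathfrak{A}}$ generating its topology. $\mathcal{O}(\Omega,E)$ and $\mathcal{C}^\infty(\Omega,E)$ are the spaces of $E$-valued holomorphic resp. infinitely continuously partially differentiable functions on an open set $\Omega\subset\mathbb{C}=\mathbb{R}^2$. Put $d(z,M):=\inf_{w\in M}|z-w|$, $d(z,\emptyset):=\infty$. For compact $K\subset\overline{\mathbb{R}}$ and $c>0$, $U_{1/c}(K)$ is the union of $\{z\in\mathbb{C}\mid d(z,K\cap\mathbb{C})<c\}$ with the strip $]1/c,\infty[\,+\,i\,]-c,c[$ if $\infty\in K$ and with the strip $]-\infty,-1/c[\,+\,i\,]-c,c[$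 if $-\infty\in K$. For $n\in\mathbb{N}$ put $S_n(K):=(\mathbb{C}\setminus\overline{U_n(K)})\cap\{z\mid|\operatorname{Im}z|<n\}$ ($U_n(K)$ is $U_{1/c}(K)$ with $c=1/n$). $\mathcal{O}^{exp}(\overline{\mathbb{C}}\setminus K,E)$ is the space of all $f\in\mathcal{O}(\mathbb{C}\setminus K,E)$ with $\sup_{z\in S_n(K)}p_\alpha(f(z))e^{-\frac1n|\operatorname{Re}z|}<\infty$ for all $n\in\mathbb{N}$, $\alpha\in\mathfrak{A}$; $bv_K(E):=\mathcal{O}^{exp}(\overline{\mathbb{C}}\setminus K,E)/\mathcal{O}^{exp}(\overline{\mathbb{C}},E)$. $\mathcal{E}^{exp}(\overline{\mathbb{C}}\setminus K,E)$ is the space of all $f\in\mathcal{C}^\infty(\mathbb{C}\setminus K,E)$ with $\sup_{z\in S_n(K),\,|\beta|\le m}p_\alpha(\partial^\beta f(z))e^{-\frac1n|\operatorname{Re}z|}<\infty$ for all $n\in\mathbb{N}$, $m\in\mathbb{N}_0$, $\alpha\in\mathfrak{A}$. $E$ is admissible if the Cauchy-Riemann operator $\overline{\partial}\colon\mathcal{E}^{exp}(\overline{\mathbb{C}}\setminus K,E)\to\mathcal{E}^{exp}(\overline{\mathbb{C}}\setminus K,E)$ is surjective for every compact $K\subset\overline{\mathbb{R}}$. For closed $A\subset\mathbb{R}$, $\mathcal{B}(A,E):=\mathcal{O}(\mathbb{C}\setminus A,E)/\mathcal{O}(\mathbb{C},E)$. For $A$ a closed half-line and $E$ admissible, the canonical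 map $\mathcal{R}_A\colon\mathcal{O}^{exp}(\overline{\mathbb{C}}\setminus\overline{A},E)/\mathcal{O}^{exp}(\overline{\mathbb{C}}\setminus(\overline{A}\setminus A),E)\to\mathcal{B}(A,E)$, $[F]\mapsto[F]$, is a linear isomorphism ($\overline{A}\setminus A$ is $\{\infty\}$ or $\{-\infty\}$). For $-\infty<a\le\infty$, $\mathcal{FO}_{[a,\infty]}(E)$ is the space of all $f\in\mathcal{O}(-\mathbb{H},E)$ with $\sup_{\operatorname{Im}z\le-\frac1k}p_\alpha(f(z))e^{-\frac1k|z|+a|\operatorname{Im}z|}<\infty$ for all $k\in\mathbb{N}$, $\alpha\in\mathfrak{A}$ ($a$ in the exponent replaced by $k$ if $a=\infty$, i.e. for $\mathcal{FO}_{\{\infty\}}(E)$). For $-\infty\le a<\infty$, $\mathcal{FO}_{[-\infty,a]}(E)$ is the space of all $f\in\mathcal{O}(\mathbb{H},E)$ with $\sup_{\operatorname{Im}z\ge\frac1k}p_\alpha(f(z))e^{-\frac1k|z|-a|\operatorname{Im}z|}<\infty$ for all $k\in\mathbb{N}$, $\alpha\in\mathfrak{A}$ ($a$ in the exponent replaced by $-k$ if $a=-\infty$, i.e. for $\mathcal{FO}_{\{-\infty\}}(E)$). For $K=[a,\infty]$ or $K=[-\infty,a]$, $K\ne\overline{\mathbb{R}}$, the Fourier transform $\mathcal{F}=\mathcal{F}_K\colon bv_K(E)\to\mathcal{FO}_K(E)$ is $\mathcal{F}([F])(\zeta):=\int_{\gamma_K}F(z)e^{-iz\zeta}dz$ (Pettis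 integral), $\gamma_K$ the boundary of $U_{1/c}(K)$ with clockwise orientation, $c>0$ small enough depending on $\zeta$; it is independent of $c$ and of the representative. In the definition of $\mathcal{F}_A^{\mathcal{B}}(f)$ one takes any $G\in\mathcal{O}^{exp}(\overline{\mathbb{C}}\setminus\overline{A},E)$ representing $\mathcal{R}_A^{-1}(f)$, and the class of $\mathcal{F}_{\overline{A}}([G])$ modulo $\mathcal{FO}_{\overline{A}\setminus A}(E)$. *)

theory Defs
  imports "HOL-Analysis.Analysis"
begin

section \<open>Locally convex Hausdorff spaces\<close>

text \<open>
  The topology of the type is the one generated by the seminorms \<open>p \<alpha>\<close>; directedness makes the
  balls of single seminorms a base of neighbourhoods. The Hausdorff property is the class
  \<^class>\<open>t2_space\<close>.
\<close>

locale lcHs = vector_space smul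
  for smul :: "complex \<Rightarrow> 'e::{ab_group_add,t2_space} \<Rightarrow> 'e" +
  fixes p :: "'i \<Rightarrow> 'e \<Rightarrow> real"
  assumes seminorm_add: "p \<alpha> (x + y) \<le> p \<alpha> x + p \<alpha> y"
    and seminorm_scale: "p \<alpha> (smul c x) = cmod c * p \<alpha> x"
    and directed: "\<exists>\<gamma>. \<exists>C>0. \<forall>x. p \<alpha> x \<le> C * p \<gamma> x \<and> p \<beta> x \<le> C * p \<gamma> x"
    and open_iff: "open U \<longleftrightarrow> (\<forall>x\<in>U. \<exists>\<alpha>. \<exists>\<epsilon>>0. \<forall>y. p \<alpha> (y - x) < \<epsilon> \<longrightarrow> y \<in> U)"

locale seq_complete_lcHs = lcHs +
  assumes seq_complete:
    "(\<And>\<alpha> \<epsilon>. 0 < \<epsilon> \<Longrightarrow> \<exists>N. \<forall>m\<ge>N. \<forall>n\<ge>N. p \<alpha> (X m - X n) < \<epsilon>) \<Longrightarrow> convergent X"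


section \<open>Subsets of the plane\<close>

definition cset :: "ereal set \<Rightarrow> complex set" where
  "cset K = {complex_of_real x |x. ereal x \<in> K}"

text \<open>Unlike \<^const>\<open>infdist\<close>, this has the value \<open>\<infinity>\<close> for the empty set.\<close>

definition edist :: "complex \<Rightarrow> complex set \<Rightarrow> ereal" where
  "edist z M = (INF w\<in>M. ereal (cmod (z - w)))"

text \<open>\<open>Unbhd c K\<close> is the set $U_{1/c}(K)$; the parameter is the width \<open>c\<close>, not the index \<open>1/c\<close>.\<close>

definition Unbhd :: "real \<Rightarrow> ereal set \<Rightarrow> complex set" where
  "Unbhd c K = {z. edist z (cset K) < ereal c}
     \<union> (if \<infinity> \<in> K then {z. Re z > 1 / c \<and> \<bar>Im z\<bar> < c} else {})
     \<union> (if -\<infinity> \<in> K then {z. Re z < - (1 / c) \<and> \<bar>Im z\<bar> < c} else {})"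

definition Sn :: "nat \<Rightarrow> ereal set \<Rightarrow> complex set" where
  "Sn n K = - closure (Unbhd (1 / real n) K) \<inter> {z. \<bar>Im z\<bar> < real n}"

text \<open>The domain of the functions in \<open>\<F>\<O>\<^sub>K(E)\<close>, for \<open>K\<close> equal to \<open>[a,\<infinity>]\<close> or \<open>[-\<infinity>,a]\<close>, \<open>K \<noteq> [-\<infinity>,\<infinity>]\<close>.\<close>

definition halfplane :: "ereal set \<Rightarrow> complex set" where
  "halfplane K = (if \<infinity> \<in> K then {z. Im z < 0} else {z. Im z > 0})"

text \<open>
  Clockwise parametrisation, over the whole real line, of the boundary of \<open>Unbhd c K\<close> for
  \<open>K = [a,\<infinity>]\<close> or \<open>K = [-\<infinity>,a]\<close> with real \<open>a\<close>, and \<open>c\<close> so small that the strip of half-width \<open>c\<close> at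
  infinity is already contained in the \<open>c\<close>-neighbourhood of the half-line. The curve
  \<open>a + loop c\<close> runs from \<open>-\<infinity> + ic\<close> to \<open>a + ic\<close>, through the right half of the circle of radius \<open>c\<close>
  about \<open>a\<close> to \<open>a - ic\<close>, and back to \<open>-\<infinity> - ic\<close>; for \<open>[a,\<infinity>]\<close> it is reflected in the point \<open>a\<close>.
\<close>

definition loop :: "real \<Rightarrow> real \<Rightarrow> complex" where
  "loop c t = (if t \<le> -1 then Complex (t + 1) c
               else if t \<le> 1 then of_real c * exp (- (\<i> * of_real (pi * t / 2)))
               else Complex (1 - t) (- c))"

definition contour :: "ereal set \<Rightarrow> real \<Rightarrow> real \<Rightarrow> complex" where
  "contour K c t = (if \<infinity> \<in> K then of_real (real_of_ereal (Inf K)) - loop c t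
                    else of_real (real_of_ereal (Sup K)) + loop c t)"


section \<open>Quotients of spaces of functions\<close>

text \<open>
  A function on \<open>\<Omega>\<close> is represented by the function on \<open>\<complex>\<close> extending it by \<open>0\<close>, so that the
  function spaces below are closed under the pointwise operations.
  \<open>modrel \<Omega> X Y\<close> is congruence, in a space \<open>X\<close> of functions on \<open>\<Omega>\<close>, modulo the restrictions to
  \<open>\<Omega>\<close> of the functions in \<open>Y\<close>; the quotient \<open>X/Y\<close> is then \<open>X // modrel \<Omega> X Y\<close>.
\<close>

definition modrel ::
  "complex set \<Rightarrow> (complex \<Rightarrow> 'e) set \<Rightarrow> (complex \<Rightarrow> 'e) set
    \<Rightarrow> ((complex \<Rightarrow> 'e) \<times> (complex \<Rightarrow> 'e::ab_group_add)) set" where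
  "modrel \<Omega> X Y = {(f, g). f \<in> X \<and> g \<in> X \<and> (\<exists>h\<in>Y. \<forall>z\<in>\<Omega>. f z - g z = h z)}"

definition class_add ::
  "((complex \<Rightarrow> 'e) \<times> (complex \<Rightarrow> 'e::ab_group_add)) set
    \<Rightarrow> (complex \<Rightarrow> 'e) set \<Rightarrow> (complex \<Rightarrow> 'e) set \<Rightarrow> (complex \<Rightarrow> 'e) set" where
  "class_add r P Q = (\<Union>f\<in>P. \<Union>g\<in>Q. r `` {\<lambda>z. f z + g z})"

definition class_scale ::
  "(complex \<Rightarrow> 'e \<Rightarrow> 'e) \<Rightarrow> ((complex \<Rightarrow> 'e) \<times> (complex \<Rightarrow> 'e)) set
    \<Rightarrow> complex \<Rightarrow> (complex \<Rightarrow> 'e) set \<Rightarrow> (complex \<Rightarrow> 'e) set" where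
  "class_scale smul r c P = (\<Union>f\<in>P. r `` {\<lambda>z. smul c (f z)})"

definition linear_iso_quotient ::
  "(complex \<Rightarrow> 'e::ab_group_add \<Rightarrow> 'e) \<Rightarrow> ((complex \<Rightarrow> 'e) set \<Rightarrow> (complex \<Rightarrow> 'e) set)
    \<Rightarrow> (complex \<Rightarrow> 'e) set \<Rightarrow> ((complex \<Rightarrow> 'e) \<times> (complex \<Rightarrow> 'e)) set
    \<Rightarrow> (complex \<Rightarrow> 'e) set \<Rightarrow> ((complex \<Rightarrow> 'e) \<times> (complex \<Rightarrow> 'e)) set \<Rightarrow> bool" where
  "linear_iso_quotient smul T X r Y s \<longleftrightarrow>
     bij_betw T (X // r) (Y // s) \<and>
     (\<forall>P \<in> X // r. \<forall>Q \<in> X // r. T (class_add r P Q) = class_add s (T P) (T Q)) \<and>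
     (\<forall>c. \<forall>P \<in> X // r. T (class_scale smul r c P) = class_scale smul s c (T P))"


context
  fixes smul :: "complex \<Rightarrow> 'e::{ab_group_add,t2_space} \<Rightarrow> 'e"
    and p :: "'i \<Rightarrow> 'e \<Rightarrow> real"
begin

section \<open>Vector-valued calculus\<close>

definition holomorphic_space :: "complex set \<Rightarrow> (complex \<Rightarrow> 'e) set" where
  "holomorphic_space \<Omega> = {f.
     (\<forall>z\<in>\<Omega>. \<exists>l. ((\<lambda>w. smul (inverse (w - z)) (f w - f z)) \<longlongrightarrow> l) (at z)) \<and>
     (\<forall>z. z \<notin> \<Omega> \<longrightarrow> f z = 0)}"

text \<open>The two partial derivatives on \<open>\<complex> = \<real>\<^sup>2\<close> are those in the directions \<open>1\<close> and \<open>\<i>\<close>.\<close>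

definition diff_quotient :: "complex \<Rightarrow> (complex \<Rightarrow> 'e) \<Rightarrow> complex \<Rightarrow> real \<Rightarrow> 'e" where
  "diff_quotient v f z h = smul (of_real (inverse h)) (f (z + of_real h * v) - f z)"

definition pderivative :: "complex \<Rightarrow> (complex \<Rightarrow> 'e) \<Rightarrow> complex \<Rightarrow> 'e" where
  "pderivative v f z = Lim (at 0) (diff_quotient v f z)"

primrec C_on :: "nat \<Rightarrow> complex set \<Rightarrow> (complex \<Rightarrow> 'e) \<Rightarrow> bool" where
  "C_on 0 \<Omega> f \<longleftrightarrow> continuous_on \<Omega> f"
| "C_on (Suc k) \<Omega> f \<longleftrightarrow>
     (\<forall>v\<in>{1, \<i>}. (\<forall>z\<in>\<Omega>. \<exists>l. (diff_quotient v f z \<longlongrightarrow> l) (at 0)) \<and> C_on k \<Omega> (pderivative v f))"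

definition smooth_space :: "complex set \<Rightarrow> (complex \<Rightarrow> 'e) set" where
  "smooth_space \<Omega> = {f. (\<forall>k. C_on k \<Omega> f) \<and> (\<forall>z. z \<notin> \<Omega> \<longrightarrow> f z = 0)}"

definition mixed_pderivative :: "nat \<times> nat \<Rightarrow> (complex \<Rightarrow> 'e) \<Rightarrow> complex \<Rightarrow> 'e" where
  "mixed_pderivative \<beta> f = (pderivative 1 ^^ fst \<beta>) ((pderivative \<i> ^^ snd \<beta>) f)"

definition dbar :: "(complex \<Rightarrow> 'e) \<Rightarrow> complex \<Rightarrow> 'e" where
  "dbar f z = smul (1 / 2) (pderivative 1 f z + smul \<i> (pderivative \<i> f z))"

definition cdual :: "('e \<Rightarrow> complex) set" where
  "cdual = {e'. Vector_Spaces.linear smul (*) e' \<and> continuous_on UNIV e'}"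

definition has_Pettis_integral :: "'b measure \<Rightarrow> ('b \<Rightarrow> 'e) \<Rightarrow> 'e \<Rightarrow> bool" where
  "has_Pettis_integral M g x \<longleftrightarrow>
     (\<forall>e'\<in>cdual. integrable M (\<lambda>t. e' (g t)) \<and> integral\<^sup>L M (\<lambda>t. e' (g t)) = e' x)"


section \<open>Spaces of exponential type and admissibility\<close>

definition Oexp :: "ereal set \<Rightarrow> (complex \<Rightarrow> 'e) set" where
  "Oexp K = {f \<in> holomorphic_space (- cset K).
     \<forall>n\<ge>1. \<forall>\<alpha>. bdd_above ((\<lambda>z. p \<alpha> (f z) * exp (- (1 / real n) * \<bar>Re z\<bar>)) ` Sn n K)}"

definition Eexp :: "ereal set \<Rightarrow> (complex \<Rightarrow> 'e) set" where
  "Eexp K = {f \<in> smooth_space (- cset K).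
     \<forall>n\<ge>1. \<forall>m \<alpha>. bdd_above {p \<alpha> (mixed_pderivative \<beta> f z) * exp (- (1 / real n) * \<bar>Re z\<bar>) |z \<beta>.
                                z \<in> Sn n K \<and> fst \<beta> + snd \<beta> \<le> m}}"

definition admissible :: bool where
  "admissible \<longleftrightarrow>
     (\<forall>K. compact K \<longrightarrow> (\<forall>g\<in>Eexp K. \<exists>f\<in>Eexp K. \<forall>z \<in> - cset K. dbar f z = g z))"


section \<open>Hyperfunctions and the asymptotic Fourier transform\<close>

definition hyper_rel :: "real set \<Rightarrow> ((complex \<Rightarrow> 'e) \<times> (complex \<Rightarrow> 'e)) set" where
  "hyper_rel A = modrel (- (of_real ` A)) (holomorphic_space (- (of_real ` A))) (holomorphic_space UNIV)"

definition bv_rel :: "ereal set \<Rightarrow> ((complex \<Rightarrow> 'e) \<times> (complex \<Rightarrow> 'e)) set" where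
  "bv_rel K = modrel (- cset K) (Oexp K) (Oexp {})"

definition exp_rel :: "real set \<Rightarrow> ((complex \<Rightarrow> 'e) \<times> (complex \<Rightarrow> 'e)) set" where
  "exp_rel A = modrel (- cset (closure (ereal ` A))) (Oexp (closure (ereal ` A)))
                 (Oexp (closure (ereal ` A) - ereal ` A))"

definition R_map :: "real set \<Rightarrow> (complex \<Rightarrow> 'e) set \<Rightarrow> (complex \<Rightarrow> 'e) set" where
  "R_map A P = (\<Union>F\<in>P. hyper_rel A `` {F})"

definition R_inv :: "real set \<Rightarrow> (complex \<Rightarrow> 'e) set \<Rightarrow> (complex \<Rightarrow> 'e) set" where
  "R_inv A = inv_into (Oexp (closure (ereal ` A)) // exp_rel A) (R_map A)"

text \<open>
  The endpoint \<open>a\<close> is recovered from \<open>K\<close> as \<open>Inf K\<close> or \<open>Sup K\<close>; it is infinite for \<open>K = {\<infinity>}\<close> and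
  \<open>K = {-\<infinity>}\<close>, where in the weight it is replaced by \<open>k\<close> and \<open>-k\<close>, respectively.
\<close>

definition FO :: "ereal set \<Rightarrow> (complex \<Rightarrow> 'e) set" where
  "FO K = {f \<in> holomorphic_space (halfplane K). \<forall>k\<ge>1. \<forall>\<alpha>.
     if \<infinity> \<in> K then
       (let a = (if Inf K = \<infinity> then real k else real_of_ereal (Inf K)) in
        bdd_above ((\<lambda>z. p \<alpha> (f z) * exp (- (1 / real k) * cmod z + a * \<bar>Im z\<bar>)) ` {z. Im z \<le> - (1 / real k)}))
     else
       (let a = (if Sup K = -\<infinity> then - real k else real_of_ereal (Sup K)) in
        bdd_above ((\<lambda>z. p \<alpha> (f z) * exp (- (1 / real k) * cmod z - a * \<bar>Im z\<bar>)) ` {z. Im z \<ge> 1 / real k}))}"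

definition FO_rel :: "real set \<Rightarrow> ((complex \<Rightarrow> 'e) \<times> (complex \<Rightarrow> 'e)) set" where
  "FO_rel A = modrel (halfplane (closure (ereal ` A))) (FO (closure (ereal ` A)))
                (FO (closure (ereal ` A) - ereal ` A))"

text \<open>
  The Fourier transform of a class \<open>P \<in> bv\<^sub>K(E)\<close>: the common value of the contour integrals for all
  representatives of \<open>P\<close> and all sufficiently small \<open>c\<close>, where \<open>K\<close> has a real endpoint (see
  \<^const>\<open>contour\<close>).
\<close>

definition fourier :: "ereal set \<Rightarrow> (complex \<Rightarrow> 'e) set \<Rightarrow> complex \<Rightarrow> 'e" where
  "fourier K P \<zeta> = (if \<zeta> \<in> halfplane K then
     (THE x. \<forall>F\<in>P. \<forall>\<^sub>F c in at_right 0.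
        has_Pettis_integral lborel
          (\<lambda>t. smul (vector_derivative (contour K c) (at t))
                 (smul (exp (- \<i> * contour K c t * \<zeta>)) (F (contour K c t)))) x)
     else 0)"

text \<open>
  The union runs over all representatives; it is a single class modulo \<open>FO_rel A\<close> exactly
  if the class does not depend on the representative.
\<close>

definition asymp_fourier :: "real set \<Rightarrow> (complex \<Rightarrow> 'e) set \<Rightarrow> (complex \<Rightarrow> 'e) set" where
  "asymp_fourier A f =
     (\<Union>G\<in>R_inv A f. FO_rel A `` {fourier (closure (ereal ` A)) (bv_rel (closure (ereal ` A)) `` {G})})"

end

end

theory Submission
  imports Defs "HOL-Complex_Analysis.Complex_Analysis"
begin

text \<open>
  The left half-line is reduced to \<open>A = [a,\<infinity>[\<close> by the reflection \<open>z \<mapsto> -z\<close>. Every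
  \<open>f \<in> \<O>(\<complex> - A,E)\<close> has the tempered representative \<open>\<chi>f - u\<close>, where \<open>\<chi>\<close> is a cut-off function and
  admissibility provides \<open>u\<close> with \<open>dbar u = dbar (\<chi>f)\<close>. The Fourier transform is inverted by the
  Laplace integrals \<open>z \<mapsto> \<integral> F(s) exp(i z s) ds\<close>, \<open>F(s) = f(s - i)\<close>, along rays in the lower half-plane
  that turn with \<open>z\<close>. If \<open>f\<close> lies in the space belonging to \<open>{\<infinity>}\<close>, the vertical ray suffices for all
  \<open>z\<close>, so the inverse transform is entire; conversely the contour of an entire function can be pushed
  to the right, so its transform lies in that space. Injectivity follows from Cauchy's formula over
  the unbounded contour, which holds as soon as the transform vanishes and which continues the
  function across the half-line. Scalar statements pass to \<open>E\<close> by the Hahn--Banach theorem, Pettis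
  integrals over the line exist by sequential completeness.
\<close>

section \<open>Seminorms and continuous functionals\<close>

text \<open>Two obstacles shape the proof. Functions in \<open>FO\<close> are controlled only on
  \<open>Im z \<le> - (1 / k)\<close>, with constants depending on \<open>k\<close>, whereas Laplace
  rays start on the real axis. So a shifted function is inverted, and undoing the shift multiplies
  the result by \<open>exp z\<close>, which destroys temperedness. What survives is the class modulo
  entire functions, and this is all that a hyperfunction records; replacing the result by a tempered
  member of its class changes the transform only by an element of the space for
  \<open>{\<infinity>}\<close>. Secondly, the function to be made tempered may grow arbitrarily fast
  towards the half-line and along it. The support of the cut-off therefore becomes so thin at
  infinity that each \<open>Sn n {\<infinity>}\<close> meets it in a bounded set, and admissibility
  is applied to \<open>{\<infinity>}\<close> alone. Integrals over the unbounded contour are never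
  deformed by homotopies: the cut plane is star-shaped, so such an integral is a limit of
  differences of a primitive, and contours are compared by the variation of that primitive along
  vertical segments.\<close>

lemma quotient_estimate:
  fixes \<phi> :: "complex => complex"
  assumes hol: "\<phi> holomorphic_on S" and "open S" and sub: "cball z r \<subseteq> S" and "0 < r"
    and B: "\<And>w. w \<in> cball z r ==> cmod (\<phi> w) \<le> B"
    and w: "w \<in> ball z (r / 2)" "w \<noteq> z"
  shows "cmod ((\<phi> w - \<phi> z) / (w - z) - deriv \<phi> z) \<le> 8 * B / r^2 * cmod (w - z)"
proof -
  have hol2: "(deriv ^^ n) \<phi> holomorphic_on S" for n
    using hol \<open>open S\<close> by (rule holomorphic_higher_deriv)
  have bound: "cmod ((deriv ^^ 2) \<phi> x) \<le> 8 * B / r^2" if x: "x \<in> ball z (r / 2)" for x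
  proof -
    have in_cball: "cball x (r / 2) \<subseteq> cball z r"
    proof
      fix y assume "y \<in> cball x (r / 2)"
      then show "y \<in> cball z r" using x dist_triangle[of z y x] by simp
    qed
    \<comment> \<open>Cauchy's inequality on the disc of radius \<open>r / 2\<close> about
      \<open>x\<close> gives \<open>2 B / (r / 2)^2 = 8 B / r^2\<close>. The bound depends on \<phi>
      only through \<open>B\<close>, so the final estimate is uniform over all functionals of a
      polar and integrates over a parameter.\<close>
    have "cmod ((deriv ^^ 2) \<phi> x) \<le> fact 2 * B / (r / 2)^2"
    proof (rule Cauchy_inequality)
      show "\<phi> holomorphic_on ball x (r / 2)"
        using hol in_cball sub ball_subset_cball by (meson holomorphic_on_subset order_trans)
      show "continuous_on (cball x (r / 2)) \<phi>"
        using hol in_cball sub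
        by (meson holomorphic_on_subset order_trans holomorphic_on_imp_continuous_on)
      show "0 < r / 2" using \<open>0 < r\<close> by simp
      show "cmod (\<phi> y) \<le> B" if "cmod (x - y) = r / 2" for y
        using B in_cball that by (auto simp: subset_iff dist_norm)
    qed
    then show ?thesis by (simp add: power2_eq_square)
  qed
  have "cmod ((deriv ^^ 0) \<phi> w - (\<Sum>i\<le>1. (deriv ^^ i) \<phi> z * (w - z) ^ i / fact i))
        \<le> (8 * B / r^2) * cmod (w - z) ^ Suc 1 / fact 1"
  proof (rule complex_Taylor[where S = "ball z (r / 2)"])
    fix i :: nat and x assume x: "x \<in> ball z (r / 2)"
    have "x \<in> S" using x sub \<open>0 < r\<close> by (auto simp: subset_iff)
    then have "(deriv ^^ i) \<phi> field_differentiable (at x)"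
      using hol2[of i] \<open>open S\<close> holomorphic_on_imp_differentiable_at by blast
    then show "((deriv ^^ i) \<phi> has_field_derivative (deriv ^^ Suc i) \<phi> x) (at x within ball z (r / 2))"
      by (simp add: field_differentiable_derivI has_field_derivative_at_within)
  qed (use bound w \<open>0 < r\<close> in \<open>auto simp: numeral_2_eq_2\<close>)
  then have *: "cmod (\<phi> w - \<phi> z - deriv \<phi> z * (w - z)) \<le> 8 * B / r^2 * cmod (w - z) ^ 2"
    by (simp add: power2_eq_square algebra_simps)
  have "(\<phi> w - \<phi> z) / (w - z) - deriv \<phi> z = (\<phi> w - \<phi> z - deriv \<phi> z * (w - z)) / (w - z)"
    using w by (simp add: field_simps)
  then have "cmod ((\<phi> w - \<phi> z) / (w - z) - deriv \<phi> z)
      \<le> (8 * B / r^2 * cmod (w - z) ^ 2) / cmod (w - z)"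
    by (metis norm_divide divide_right_mono[OF * norm_ge_zero])
  also have "\<dots> = 8 * B / r^2 * cmod (w - z)" using w by (simp add: power2_eq_square)
  finally show ?thesis .
qed

context lcHs
begin

lemma p_zero [simp]: "p \<alpha> 0 = 0"
  using seminorm_scale[of \<alpha> 0 0] by simp

lemma p_minus [simp]: "p \<alpha> (- x) = p \<alpha> x"
  using seminorm_scale[of \<alpha> "-1" x] by simp

lemma p_nonneg [simp]: "0 \<le> p \<alpha> x"
  using seminorm_add[of \<alpha> x "- x"] by simp

lemma p_diff_le: "p \<alpha> (x - y) \<le> p \<alpha> x + p \<alpha> y"
  using seminorm_add[of \<alpha> x "- y"] by simp

lemma p_diff_commute: "p \<alpha> (x - y) = p \<alpha> (y - x)"
  using p_minus[of \<alpha> "x - y"] by simp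

lemma p_triangle: "p \<alpha> (x - z) \<le> p \<alpha> (x - y) + p \<alpha> (y - z)"
  using seminorm_add[of \<alpha> "x - y" "y - z"] by simp

lemma p_reverse: "\<bar>p \<alpha> x - p \<alpha> y\<bar> \<le> p \<alpha> (x - y)"
  using seminorm_add[of \<alpha> "x - y" y] seminorm_add[of \<alpha> "y - x" x] p_diff_commute[of \<alpha> x y]
  by simp

lemma open_p_ball: "open {y. p \<alpha> (y - x) < \<epsilon>}"
proof (subst open_iff, intro ballI)
  fix y assume "y \<in> {y. p \<alpha> (y - x) < \<epsilon>}"
  then have "p \<alpha> (y - x) < \<epsilon>" by simp
  moreover have "p \<alpha> (z - x) \<le> p \<alpha> (z - y) + p \<alpha> (y - x)" for z by (rule p_triangle)
  ultimately show "\<exists>\<beta>. \<exists>\<delta>>0. \<forall>z. p \<beta> (z - y) < \<delta> --> z \<in> {y. p \<alpha> (y - x) < \<epsilon>}"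
    by (intro exI[of _ \<alpha>] exI[of _ "\<epsilon> - p \<alpha> (y - x)"]) (auto, smt (verit))
qed

text \<open>By \<open>open_iff\<close> the balls of single seminorms form a base of neighbourhoods.
  All limits in E are computed through this equivalence: the algebra of limits below is derived from
  seminorm estimates.\<close>

lemma tendsto_iff_p: "(f \<longlongrightarrow> l) F \<longleftrightarrow> (\<forall>\<alpha>. ((\<lambda>x. p \<alpha> (f x - l)) \<longlongrightarrow> 0) F)"
proof
  assume lim: "(f \<longlongrightarrow> l) F"
  show "\<forall>\<alpha>. ((\<lambda>x. p \<alpha> (f x - l)) \<longlongrightarrow> 0) F"
  proof (intro allI tendstoI)
    fix \<alpha> and e :: real assume "0 < e"
    then have "\<forall>\<^sub>F x in F. f x \<in> {y. p \<alpha> (y - l) < e}"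
      by (intro topological_tendstoD[OF lim] open_p_ball) simp
    then show "\<forall>\<^sub>F x in F. dist (p \<alpha> (f x - l)) 0 < e" by simp
  qed
next
  assume R: "\<forall>\<alpha>. ((\<lambda>x. p \<alpha> (f x - l)) \<longlongrightarrow> 0) F"
  show "(f \<longlongrightarrow> l) F"
  proof (rule topological_tendstoI)
    fix S assume "open S" "l \<in> S"
    then obtain \<alpha> \<epsilon> where "\<epsilon> > 0" and sub: "\<forall>y. p \<alpha> (y - l) < \<epsilon> --> y \<in> S"
      unfolding open_iff by blast
    have "\<forall>\<^sub>F x in F. dist (p \<alpha> (f x - l)) 0 < \<epsilon>"
      using R \<open>\<epsilon> > 0\<close> tendstoD by blast
    then show "\<forall>\<^sub>F x in F. f x \<in> S" by eventually_elim (use sub in auto)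
  qed
qed

lemma tendsto_p: "(f \<longlongrightarrow> l) F ==> ((\<lambda>x. p \<alpha> (f x)) \<longlongrightarrow> p \<alpha> l) F"
proof -
  assume "(f \<longlongrightarrow> l) F"
  then have lim: "((\<lambda>x. p \<alpha> (f x - l)) \<longlongrightarrow> 0) F" by (simp add: tendsto_iff_p)
  show ?thesis
    by (rule Lim_transform[OF tendsto_const], rule Lim_null_comparison[OF _ lim])
       (use p_reverse p_diff_commute in \<open>simp add: abs_minus_commute\<close>)
qed

lemma continuous_on_p: "continuous_on S f ==> continuous_on S (\<lambda>x. p \<alpha> (f x))"
  unfolding continuous_on_def by (blast intro: tendsto_p)

lemma tendsto_add_lc:
  fixes f g :: "'x => 'e"
  assumes "(f \<longlongrightarrow> l) F" "(g \<longlongrightarrow> m) F"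
  shows "((\<lambda>x. f x + g x) \<longlongrightarrow> l + m) F"
  unfolding tendsto_iff_p
proof
  fix \<alpha>
  have "((\<lambda>x. p \<alpha> (f x - l) + p \<alpha> (g x - m)) \<longlongrightarrow> 0) F"
    using assms unfolding tendsto_iff_p by (auto intro: tendsto_add_zero)
  moreover have "p \<alpha> (f x + g x - (l + m)) \<le> p \<alpha> (f x - l) + p \<alpha> (g x - m)" for x
    using seminorm_add[of \<alpha> "f x - l" "g x - m"] by (simp add: algebra_simps)
  ultimately show "((\<lambda>x. p \<alpha> (f x + g x - (l + m))) \<longlongrightarrow> 0) F"
    by (auto intro: Lim_null_comparison[rotated])
qed

lemma tendsto_scale_lc:
  fixes f :: "'x => 'e"
  assumes "(c \<longlongrightarrow> d) F" "(f \<longlongrightarrow> l) F"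
  shows "((\<lambda>x. smul (c x) (f x)) \<longlongrightarrow> smul d l) F"
  unfolding tendsto_iff_p
proof
  fix \<alpha>
  have "((\<lambda>x. cmod (c x) * p \<alpha> (f x - l) + cmod (c x - d) * p \<alpha> l) \<longlongrightarrow> cmod d * 0 + cmod (d - d) * p \<alpha> l) F"
    using assms(2) by (intro tendsto_intros assms(1)) (simp add: tendsto_iff_p)
  moreover have "p \<alpha> (smul (c x) (f x) - smul d l) \<le> cmod (c x) * p \<alpha> (f x - l) + cmod (c x - d) * p \<alpha> l" for x
    using seminorm_add[of \<alpha> "smul (c x) (f x - l)" "smul (c x - d) l"]
    unfolding seminorm_scale by (simp add: scale_left_diff_distrib scale_right_diff_distrib)
  ultimately show "((\<lambda>x. p \<alpha> (smul (c x) (f x) - smul d l)) \<longlongrightarrow> 0) F"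
    by (auto intro!: Lim_null_comparison[rotated, where g = "\<lambda>x. cmod (c x) * p \<alpha> (f x - l) + cmod (c x - d) * p \<alpha> l"])
qed

lemma tendsto_minus_lc:
  fixes f :: "'x => 'e"
  shows "(f \<longlongrightarrow> l) F ==> ((\<lambda>x. - f x) \<longlongrightarrow> - l) F"
  using tendsto_scale_lc[OF tendsto_const[of "-1"], of f l F] by simp

lemma tendsto_diff_lc:
  fixes f g :: "'x => 'e"
  shows "(f \<longlongrightarrow> l) F ==> (g \<longlongrightarrow> m) F ==> ((\<lambda>x. f x - g x) \<longlongrightarrow> l - m) F"
  using tendsto_add_lc[OF _ tendsto_minus_lc, of f l F g m] by simp

lemma continuous_on_add_lc:
  fixes f g :: "'x::topological_space => 'e"
  shows "continuous_on S f ==> continuous_on S g ==> continuous_on S (\<lambda>x. f x + g x)"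
  unfolding continuous_on_def by (blast intro: tendsto_add_lc)

lemma continuous_on_scale_lc:
  fixes f :: "'x::topological_space => 'e"
  shows "continuous_on S c ==> continuous_on S f ==> continuous_on S (\<lambda>x. smul (c x) (f x))"
  unfolding continuous_on_def by (blast intro: tendsto_scale_lc)

lemma p_separating: "(\<And>\<alpha>. p \<alpha> x = 0) ==> x = 0"
proof (rule ccontr)
  assume z: "\<And>\<alpha>. p \<alpha> x = 0" and "x \<noteq> 0"
  then obtain U where "open U" "0 \<in> U" "x \<notin> U" using t1_space[of 0 x] by auto
  then obtain \<alpha> \<epsilon> where "\<epsilon> > 0" "\<forall>y. p \<alpha> (y - 0) < \<epsilon> --> y \<in> U" unfolding open_iff by blast
  then have "x \<in> U" using z by simp
  with \<open>x \<notin> U\<close> show False by simp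
qed

section \<open>Continuous functionals and the polars of the seminorm balls\<close>

lemma cdual_iff: "e' \<in> cdual smul \<longleftrightarrow>
    (\<forall>x y. e' (x + y) = e' x + e' y) \<and> (\<forall>c x. e' (smul c x) = c * e' x) \<and> continuous_on UNIV e'"
proof -
  have "vector_space ((*) :: complex => complex => complex)"
    by unfold_locales (auto simp: algebra_simps)
  then show ?thesis
    by (auto simp: cdual_def Vector_Spaces.linear_iff vector_space_axioms)
qed

lemma cdual_add: "e' \<in> cdual smul ==> e' (x + y) = e' x + e' y"
  and cdual_scale: "e' \<in> cdual smul ==> e' (smul c x) = c * e' x"
  and cdual_continuous: "e' \<in> cdual smul ==> continuous_on UNIV e'"
  by (auto simp: cdual_iff)

lemma cdual_zero: "e' \<in> cdual smul ==> e' 0 = 0"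
  using cdual_scale[of e' 0 0] by simp

lemma cdual_minus: "e' \<in> cdual smul ==> e' (- x) = - e' x"
  using cdual_scale[of e' "-1" x] by simp

lemma cdual_diff: "e' \<in> cdual smul ==> e' (x - y) = e' x - e' y"
  using cdual_add[of e' x "- y"] cdual_minus[of e' y] by simp

lemma cdual_sum: "finite I ==> e' \<in> cdual smul ==> e' (sum f I) = (\<Sum>i\<in>I. e' (f i))"
  by (induction I rule: finite_induct) (auto simp: cdual_zero cdual_add)

lemma cdual_tendsto: "e' \<in> cdual smul ==> (f \<longlongrightarrow> l) F ==> ((\<lambda>x. e' (f x)) \<longlongrightarrow> e' l) F"
  using cdual_continuous continuous_on_tendsto_compose[of UNIV e' f l F] by auto

text \<open>If the estimate failed at \<open>y\<close>, the vector \<open>y\<close> divided by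
  \<open>|e' y|\<close> would lie in a ball that \<open>e'\<close> maps into the open unit disc,
  although its image has modulus 1.\<close>

lemma cdual_bound:
  assumes "e' \<in> cdual smul"
  obtains \<gamma> C where "0 < C" "\<And>y. cmod (e' y) \<le> C * p \<gamma> y"
proof -
  have "open (e' -` ball 0 1)"
    using cdual_continuous[OF assms] by (simp add: open_vimage)
  moreover have "0 \<in> e' -` ball 0 1" using cdual_zero[OF assms] by simp
  ultimately obtain \<gamma> \<epsilon> where \<epsilon>: "\<epsilon> > 0" and sub: "\<And>y. p \<gamma> (y - 0) < \<epsilon> ==> y \<in> e' -` ball 0 1"
    unfolding open_iff by blast
  have "cmod (e' y) \<le> (2 / \<epsilon>) * p \<gamma> y" for y
  proof (rule ccontr)
    assume "\<not> ?thesis"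
    then have lt: "(2 / \<epsilon>) * p \<gamma> y < cmod (e' y)" by simp
    then have pos: "0 < cmod (e' y)" using \<epsilon> p_nonneg[of \<gamma> y]
      by (meson divide_nonneg_pos le_less_trans mult_nonneg_nonneg zero_le_numeral)
    let ?t = "1 / cmod (e' y)"
    have "p \<gamma> (smul (of_real ?t) y) < \<epsilon>"
    proof -
      have "p \<gamma> (smul (of_real ?t) y) = ?t * p \<gamma> y" using pos by (simp add: seminorm_scale norm_divide)
      also have "\<dots> < \<epsilon>"
      proof -
        have "2 * p \<gamma> y < \<epsilon> * cmod (e' y)" using lt \<epsilon> by (simp add: field_simps)
        then have "p \<gamma> y < \<epsilon> * cmod (e' y)" using p_nonneg[of \<gamma> y] by linarith
        then show ?thesis using pos by (simp add: field_simps)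
      qed
      finally show ?thesis .
    qed
    then have "cmod (e' (smul (of_real ?t) y)) < 1" using sub by simp
    then show False using pos by (simp add: cdual_scale[OF assms] norm_mult norm_divide)
  qed
  then show thesis using that[of "2 / \<epsilon>" \<gamma>] \<epsilon> by simp
qed

text \<open>The polar of the unit ball of \<open>p \<alpha>\<close>. By \<open>p_le_polar\<close>
  the supremum over it recovers the seminorm, so scalar estimates that are uniform on a polar become
  seminorm estimates.\<close>

definition polar :: "'i => ('e => complex) set" where
  "polar \<alpha> = {e' \<in> cdual smul. \<forall>y. cmod (e' y) \<le> p \<alpha> y}"

lemma polarD: "e' \<in> polar \<alpha> ==> e' \<in> cdual smul" "e' \<in> polar \<alpha> ==> cmod (e' y) \<le> p \<alpha> y"
  by (auto simp: polar_def)

text \<open>Rescaling moves a functional into a polar. Thus an identity linear in the functional has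
  to be checked on polars only, where estimates are uniform.\<close>

lemma cdual_polar:
  assumes "e' \<in> cdual smul"
  obtains \<gamma> C e1 where "0 < C" "e1 \<in> polar \<gamma>" "\<And>y. e' y = of_real C * e1 y"
proof -
  obtain \<gamma> C where C: "0 < C" "\<And>y. cmod (e' y) \<le> C * p \<gamma> y" using cdual_bound[OF assms] by blast
  have "continuous_on UNIV (\<lambda>y. e' y / of_real C)"
    using C by (intro continuous_on_divide cdual_continuous[OF assms] continuous_on_const) auto
  moreover have "cmod (e' y / of_real C) \<le> p \<gamma> y" for y
    using C(1) C(2)[of y] by (simp add: norm_divide divide_le_eq mult.commute)
  ultimately have "(\<lambda>y. e' y / of_real C) \<in> polar \<gamma>"
    unfolding polar_def cdual_iff
    by (simp add: cdual_add[OF assms] cdual_scale[OF assms] add_divide_distrib)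
  then show thesis
    by (rule that[OF C(1)]) (use C(1) in simp)
qed


section \<open>The Hahn--Banach theorem\<close>

text \<open>The extension theorem is proved without partially defined functionals: Zorn's lemma
  yields a minimal sublinear functional below a given one, and minimality forces it to be real
  linear.\<close>

definition sublinear :: "('e => real) => bool" where
  "sublinear q \<longleftrightarrow> (\<forall>x y. q (x + y) \<le> q x + q y) \<and> (\<forall>r x. 0 \<le> r --> q (smul (of_real r) x) = r * q x)"

lemma sublinear_zero: "sublinear q ==> q 0 = 0"
  using scale_zero_left[of 0] unfolding sublinear_def by (metis mult_zero_left of_real_0 order_refl)

lemma sublinear_neg: "sublinear q ==> - q (- x) \<le> q x"
  using sublinear_zero[of q] unfolding sublinear_def by (smt (verit) add.right_inverse)

text \<open>A minimal sublinear functional equals its tilts in all directions \<open>x0\<close>, hence is odd.\<close>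

definition tilt :: "('e => real) => 'e => 'e => real" where
  "tilt q x0 x = (INF t\<in>{0..}. q (x + smul (of_real t) x0) - t * q x0)"

lemma tilt_le:
  assumes "sublinear q" "0 \<le> t"
  shows "tilt q x0 x \<le> q (x + smul (of_real t) x0) - t * q x0"
  unfolding tilt_def
proof (rule cINF_lower)
  show "bdd_below ((\<lambda>t. q (x + smul (of_real t) x0) - t * q x0) ` {0..})"
  proof (rule bdd_belowI2[where m = "- q (- x)"])
    fix t :: real assume "t \<in> {0..}"
    then have "t * q x0 = q (smul (of_real t) x0)" using assms unfolding sublinear_def by simp
    also have "\<dots> = q ((x + smul (of_real t) x0) + (- x))" by simp
    also have "\<dots> \<le> q (x + smul (of_real t) x0) + q (- x)" using assms unfolding sublinear_def by blast
    finally show "- q (- x) \<le> q (x + smul (of_real t) x0) - t * q x0" by simp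
  qed
qed (use assms in simp)

lemma tilt_greatest:
  "(\<And>t. 0 \<le> t ==> m \<le> q (x + smul (of_real t) x0) - t * q x0) ==> m \<le> tilt q x0 x"
  unfolding tilt_def by (rule cINF_greatest) auto

text \<open>For subadditivity the parameters \<open>s\<close> and \<open>t\<close> of the two
  arguments are added. For homogeneity the parameter is rescaled to \<open>r * t\<close>; the
  reverse inequality is the same one with factor \<open>1 / r\<close>.\<close>

lemma sublinear_tilt:
  assumes q: "sublinear q"
  shows "sublinear (tilt q x0)"
proof -
  have add: "tilt q x0 (x + y) \<le> tilt q x0 x + tilt q x0 y" for x y
  proof -
    have *: "tilt q x0 (x + y) \<le> (q (x + smul (of_real s) x0) - s * q x0) + (q (y + smul (of_real t) x0) - t * q x0)"
      if "0 \<le> s" "0 \<le> t" for s t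
    proof -
      have "tilt q x0 (x + y) \<le> q (x + y + smul (of_real (s + t)) x0) - (s + t) * q x0"
        using that by (intro tilt_le q) simp
      also have "x + y + smul (of_real (s + t)) x0 = (x + smul (of_real s) x0) + (y + smul (of_real t) x0)"
        by (simp add: scale_left_distrib algebra_simps)
      also have "q \<dots> \<le> q (x + smul (of_real s) x0) + q (y + smul (of_real t) x0)"
        using q unfolding sublinear_def by blast
      finally show ?thesis by (simp add: algebra_simps)
    qed
    have "tilt q x0 (x + y) - (q (x + smul (of_real s) x0) - s * q x0) \<le> tilt q x0 y" if "0 \<le> s" for s
      by (rule tilt_greatest) (use *[OF that] in \<open>simp add: algebra_simps\<close>)
    then have "tilt q x0 (x + y) - tilt q x0 y \<le> tilt q x0 x"
      by (intro tilt_greatest) (smt (verit))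
    then show ?thesis by simp
  qed
  have le: "tilt q x0 (smul (of_real r) x) \<le> r * tilt q x0 x" if "0 < r" for r x
  proof -
    have "tilt q x0 (smul (of_real r) x) / r \<le> tilt q x0 x"
    proof (rule tilt_greatest)
      fix t :: real assume "0 \<le> t"
      have "tilt q x0 (smul (of_real r) x) \<le> q (smul (of_real r) x + smul (of_real (r * t)) x0) - (r * t) * q x0"
        using \<open>0 \<le> t\<close> \<open>0 < r\<close> by (intro tilt_le q) simp
      also have "smul (of_real r) x + smul (of_real (r * t)) x0 = smul (of_real r) (x + smul (of_real t) x0)"
        by (simp add: scale_right_distrib)
      also have "q \<dots> = r * q (x + smul (of_real t) x0)" using q \<open>0 < r\<close> unfolding sublinear_def by simp
      finally show "tilt q x0 (smul (of_real r) x) / r \<le> q (x + smul (of_real t) x0) - t * q x0"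
        using \<open>0 < r\<close> by (simp add: field_simps)
    qed
    then show ?thesis using \<open>0 < r\<close> by (simp add: field_simps)
  qed
  have hom: "tilt q x0 (smul (of_real r) x) = r * tilt q x0 x" if r: "0 \<le> r" for r x
  proof (cases "r = 0")
    case True
    have "tilt q x0 0 = (INF t\<in>{0::real..}. 0)"
      unfolding tilt_def using q by (intro INF_cong) (auto simp: sublinear_def)
    then show ?thesis using True by simp
  next
    case False
    then have "0 < r" using r by simp
    have "tilt q x0 (smul (of_real (1 / r)) (smul (of_real r) x)) \<le> 1 / r * tilt q x0 (smul (of_real r) x)"
      using \<open>0 < r\<close> by (intro le) simp
    then have "tilt q x0 x \<le> 1 / r * tilt q x0 (smul (of_real r) x)" using \<open>0 < r\<close> by simp
    then have "r * tilt q x0 x \<le> tilt q x0 (smul (of_real r) x)" using \<open>0 < r\<close> by (simp add: field_simps)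
    with le[OF \<open>0 < r\<close>, of x] show ?thesis by simp
  qed
  show ?thesis unfolding sublinear_def using add hom by blast
qed

lemma tilt_le_self: "sublinear q ==> tilt q x0 x \<le> q x"
  using tilt_le[of q 0 x0 x] by simp

lemma tilt_neg: "sublinear q ==> tilt q x0 (- x0) \<le> - q x0"
  using tilt_le[of q 1 x0 "- x0"] sublinear_zero[of q] by simp

lemma minimal_sublinear:
  assumes q0: "sublinear q0"
  obtains m where "sublinear m" "\<And>x. m x \<le> q0 x" "\<And>q. sublinear q ==> (\<And>x. q x \<le> m x) ==> q = m"
proof -
  define S where "S = {q. sublinear q \<and> (\<forall>x. q x \<le> q0 x)}"
  \<comment> \<open>The order is reversed: \<open>P q q'\<close> says that \<open>q'\<close> lies
    below \<open>q\<close>, so the maximal element delivered by Zorn's lemma is a minimal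
    functional.\<close>
  define P where "P = (\<lambda>q q' :: 'e => real. \<forall>x. q' x \<le> q x)"
  have "\<exists>m\<in>S. \<forall>q\<in>S. P m q --> q = m"
  proof (rule predicate_Zorn)
    show "partial_order_on S (relation_of P S)"
      by (rule partial_order_on_relation_ofI) (auto simp: P_def fun_eq_iff intro: order_trans antisym)
  next
    fix C assume C: "C \<in> Chains (relation_of P S)"
    have CS: "C \<subseteq> S" and comp: "\<And>q q'. q \<in> C ==> q' \<in> C ==> P q q' \<or> P q' q"
      using C unfolding Chains_def relation_of_def by auto
    show "\<exists>u\<in>S. \<forall>a\<in>C. P a u"
    proof (cases "C = {}")
      case True
      have "q0 \<in> S" using q0 by (simp add: S_def)
      with True show ?thesis by blast
    next
      case False
      define u where "u = (\<lambda>x. INF q\<in>C. q x)"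
      have bdd: "bdd_below ((\<lambda>q. q x) ` C)" for x
      proof (rule bdd_belowI2[where m = "- q0 (- x)"])
        fix q assume "q \<in> C"
        then have "q \<in> S" using CS by blast
        then show "- q0 (- x) \<le> q x" using sublinear_neg[of q x] unfolding S_def by (smt (verit) mem_Collect_eq)
      qed
      have u_le: "u x \<le> q x" if "q \<in> C" for q x
        unfolding u_def using that bdd by (auto intro: cINF_lower)
      have u_greatest: "m \<le> u x" if "\<And>q. q \<in> C ==> m \<le> q x" for m x
        unfolding u_def using that False by (auto intro: cINF_greatest)
      have sub: "q (x + y) \<le> q x + q y" if "q \<in> C" for q x y
        using that CS unfolding S_def sublinear_def by blast
      have hom: "q (smul (of_real r) x) = r * q x" if "q \<in> C" "0 \<le> r" for q r x
        using that CS unfolding S_def sublinear_def by blast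
      have "u (x + y) \<le> u x + u y" for x y
      proof -
        \<comment> \<open>Subadditivity of the infimum uses the chain condition: the smaller of
          \<open>q1\<close> and \<open>q2\<close> serves for both arguments.\<close>
        have "u (x + y) \<le> q1 x + q2 y" if "q1 \<in> C" "q2 \<in> C" for q1 q2
          using comp[OF that]
        proof
          assume "P q1 q2"
          then show ?thesis using u_le[OF that(2), of "x + y"] sub[OF that(2), of x y]
            unfolding P_def by (smt (verit))
        next
          assume "P q2 q1"
          then show ?thesis using u_le[OF that(1), of "x + y"] sub[OF that(1), of x y]
            unfolding P_def by (smt (verit))
        qed
        then have "u (x + y) - q1 x \<le> q2 y" if "q1 \<in> C" "q2 \<in> C" for q1 q2
          using that by (simp add: diff_le_eq add.commute)
        then have "u (x + y) - q1 x \<le> u y" if "q1 \<in> C" for q1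
          using that by (intro u_greatest)
        then have "u (x + y) - u y \<le> u x" by (intro u_greatest) (simp add: algebra_simps)
        then show ?thesis by simp
      qed
      moreover have "u (smul (of_real r) x) = r * u x" if r: "0 \<le> r" for r x
      proof (rule antisym)
        show "r * u x \<le> u (smul (of_real r) x)"
          by (rule u_greatest) (simp add: hom[OF _ r] mult_left_mono[OF u_le r])
        show "u (smul (of_real r) x) \<le> r * u x"
        proof (cases "r = 0")
          case True
          obtain q where "q \<in> C" using False by blast
          then show ?thesis using u_le[of q "smul (of_real r) x"] hom[of q r x] True by simp
        next
          case nz: False
          have "u (smul (of_real r) x) / r \<le> u x"
            using nz r u_le[of _ "smul (of_real r) x"] hom[of _ r x]
            by (intro u_greatest) (auto simp: field_simps)
          then show ?thesis using nz r by (simp add: field_simps)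
        qed
      qed
      ultimately have "sublinear u" unfolding sublinear_def by blast
      moreover have "u x \<le> q0 x" for x
      proof -
        obtain q where "q \<in> C" using False by blast
        then show ?thesis using u_le[of q x] CS unfolding S_def by (smt (verit) in_mono mem_Collect_eq)
      qed
      ultimately have "u \<in> S" by (simp add: S_def)
      moreover have "\<forall>q\<in>C. P q u" unfolding P_def using u_le by blast
      ultimately show ?thesis by blast
    qed
  qed
  then obtain m where m: "m \<in> S" "\<forall>q\<in>S. P m q --> q = m" by blast
  have m1: "sublinear m" "\<And>x. m x \<le> q0 x" using m(1) by (auto simp: S_def)
  have m2: "q = m" if q: "sublinear q" "\<And>x. q x \<le> m x" for q
  proof -
    have "\<forall>x. q x \<le> q0 x" using q(2) m1(2) order_trans by blast
    then have "q \<in> S" using q(1) by (simp add: S_def)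
    then show ?thesis using m(2) q(2) by (simp add: P_def)
  qed
  show thesis by (rule that[OF m1 m2])
qed

lemma Hahn_Banach:
  obtains e' where "e' \<in> polar \<alpha>" "e' x0 = of_real (p \<alpha> x0)"
proof -
  have sp: "sublinear (p \<alpha>)" unfolding sublinear_def by (auto simp: seminorm_add seminorm_scale)
  \<comment> \<open>Minimising below the tilt in direction \<open>x0\<close>, not below the seminorm
    itself, forces \<open>f (- x0) \<le> - p \<alpha> x0\<close>; the norming property at
    \<open>x0\<close> is thus built in from the start.\<close>
  obtain f where f: "sublinear f" and fle: "\<And>x. f x \<le> tilt (p \<alpha>) x0 x"
    and fmin: "\<And>q. sublinear q ==> (\<And>x. q x \<le> f x) ==> q = f"
    using minimal_sublinear[OF sublinear_tilt[OF sp]] by metis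
  have odd: "f (- x) = - f x" for x
  proof -
    have "tilt f x = f" using f by (intro fmin sublinear_tilt tilt_le_self)
    then have "f (- x) \<le> - f x" using tilt_neg[OF f, of x] by simp
    with sublinear_neg[OF f, of x] show ?thesis by simp
  qed
  have fadd: "f (x + y) = f x + f y" for x y
  proof -
    have "f x \<le> f (x + y) + f (- y)"
      using f unfolding sublinear_def by (metis add_diff_cancel_right' diff_conv_add_uminus)
    moreover have "f (x + y) \<le> f x + f y" using f unfolding sublinear_def by blast
    ultimately show ?thesis using odd by simp
  qed
  have fhom: "f (smul (of_real r) x) = r * f x" for r x
  proof (cases "0 \<le> r")
    case True then show ?thesis using f unfolding sublinear_def by blast
  next
    case False
    then have "f (smul (of_real (- r)) x) = - r * f x"
      using f unfolding sublinear_def by (meson le_cases neg_0_le_iff_le)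
    then show ?thesis using odd[of "smul (of_real r) x"] by simp
  qed
  have fp: "f x \<le> p \<alpha> x" for x using fle[of x] tilt_le_self[OF sp, of x0 x] by simp
  \<comment> \<open>The complex linear functional with real part \<open>f\<close>: its imaginary
    part at \<open>x\<close> must be \<open>- f (i x)\<close>.\<close>
  define e where "e = (\<lambda>x. Complex (f x) (- f (smul \<i> x)))"
  have eadd: "e (x + y) = e x + e y" for x y
    by (simp add: e_def fadd scale_right_distrib complex_eq_iff)
  have escale: "e (smul c x) = c * e x" for c x
  proof -
    have 1: "smul c x = smul (of_real (Re c)) x + smul (of_real (Im c)) (smul \<i> x)"
      by (simp add: scale_left_distrib[symmetric]) (metis complex_eq mult.commute)
    have 2: "smul \<i> (smul c x) = smul (of_real (Re c)) (smul \<i> x) + smul (of_real (- Im c)) x"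
      unfolding 1 scale_right_distrib by (simp add: mult.commute mult.left_commute)
    show ?thesis
      unfolding e_def 2 unfolding 1 by (simp add: fadd fhom complex_eq_iff del: of_real_minus scale_scale) 
  qed
  have ebound: "cmod (e x) \<le> p \<alpha> x" for x
  proof (cases "e x = 0")
    case False
    \<comment> \<open>Rotating \<open>x\<close> by a unimodular factor makes the value of
      \<open>e\<close> real and nonnegative; there it coincides with \<open>f\<close>, which is
      dominated by the seminorm.\<close>
    define u where "u = cnj (e x) / of_real (cmod (e x))"
    have u: "cmod u = 1" using False by (simp add: u_def norm_divide)
    have "e (smul u x) = of_real (cmod (e x))"
    proof -
      have "cnj (e x) * e x = of_real (cmod (e x)) * of_real (cmod (e x))"
        by (metis complex_norm_square mult.commute power2_eq_square of_real_power)
      then show ?thesis using False by (simp add: escale u_def field_simps)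
    qed
    then have "cmod (e x) = f (smul u x)" by (simp add: e_def complex_eq_iff)
    also have "\<dots> \<le> p \<alpha> x" using fp[of "smul u x"] u by (simp add: seminorm_scale)
    finally show ?thesis .
  qed (simp add: p_nonneg)
  have "continuous_on UNIV e"
    unfolding continuous_on_def
  proof
    fix x :: 'e
    have "((\<lambda>y. p \<alpha> (y - x)) \<longlongrightarrow> 0) (at x)"
      using tendsto_ident_at[of x UNIV] unfolding tendsto_iff_p by simp
    then have "((\<lambda>y. e y - e x) \<longlongrightarrow> 0) (at x)"
    proof (rule Lim_null_comparison[rotated])
      have "e y - e x = e (y - x)" for y using eadd[of "y - x" x] by simp
      then show "\<forall>\<^sub>F y in at x. cmod (e y - e x) \<le> p \<alpha> (y - x)" using ebound by simp
    qed
    then show "(e \<longlongrightarrow> e x) (at x)" by (simp add: LIM_zero_iff)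
  qed
  then have "e \<in> polar \<alpha>" using eadd escale ebound by (simp add: polar_def cdual_iff)
  moreover have "e x0 = of_real (p \<alpha> x0)"
  proof -
    have "f (- x0) \<le> - p \<alpha> x0" using fle[of "- x0"] tilt_neg[OF sp, of x0] by simp
    then have "p \<alpha> x0 \<le> Re (e x0)" by (simp add: e_def odd)
    moreover have "cmod (e x0) \<le> p \<alpha> x0" by (rule ebound)
    ultimately have "Re (e x0) = p \<alpha> x0" "cmod (e x0) = p \<alpha> x0"
      using complex_Re_le_cmod[of "e x0"] by auto
    then show ?thesis using cmod_power2[of "e x0"] by (simp add: complex_eq_iff)
  qed
  ultimately show thesis by (rule that)
qed

lemma p_le_polar: "(\<And>e'. e' \<in> polar \<alpha> ==> cmod (e' x) \<le> B) ==> p \<alpha> x \<le> B"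
  by (metis Hahn_Banach abs_of_nonneg norm_of_real p_nonneg)

lemma cdual_eqI: "(\<And>e'. e' \<in> cdual smul ==> e' x = e' y) ==> x = y"
proof -
  assume eq: "\<And>e'. e' \<in> cdual smul ==> e' x = e' y"
  have "p \<alpha> (x - y) \<le> 0" for \<alpha>
    by (rule p_le_polar) (simp add: eq cdual_diff polarD(1))
  then have "x - y = 0" by (intro p_separating antisym) auto
  then show ?thesis by simp
qed

end

section \<open>Vector-valued holomorphic functions\<close>

context lcHs
begin

lemma compact_p_bounded:
  fixes f :: "'x::topological_space => 'e"
  assumes "compact K" "continuous_on K f"
  obtains B where "0 \<le> B" "\<And>z. z \<in> K ==> p \<alpha> (f z) \<le> B"
proof -
  have "compact ((\<lambda>z. p \<alpha> (f z)) ` K)"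
    by (intro compact_continuous_image continuous_on_p assms)
  then have "bounded ((\<lambda>z. p \<alpha> (f z)) ` K)" by (rule compact_imp_bounded)
  then obtain B where "0 < B" "\<forall>y \<in> (\<lambda>z. p \<alpha> (f z)) ` K. norm y \<le> B"
    unfolding bounded_pos by blast
  then show thesis using that[of B] by auto
qed

lemma holomorphic_space_zero: "f \<in> holomorphic_space smul \<Omega> ==> z \<notin> \<Omega> ==> f z = 0"
  by (simp add: holomorphic_space_def)

lemma holomorphic_spaceD:
  "f \<in> holomorphic_space smul \<Omega> ==> z \<in> \<Omega> ==> \<exists>l. ((\<lambda>w. smul (inverse (w - z)) (f w - f z)) \<longlongrightarrow> l) (at z)"
  by (simp add: holomorphic_space_def)

lemma cdual_holomorphic:
  assumes f: "f \<in> holomorphic_space smul \<Omega>" and "open \<Omega>" and e: "e' \<in> cdual smul"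
  shows "(\<lambda>z. e' (f z)) holomorphic_on \<Omega>"
  unfolding holomorphic_on_open[OF \<open>open \<Omega>\<close>]
proof
  fix z assume "z \<in> \<Omega>"
  then obtain l where "((\<lambda>w. smul (inverse (w - z)) (f w - f z)) \<longlongrightarrow> l) (at z)"
    using holomorphic_spaceD[OF f] by blast
  then have "((\<lambda>w. e' (smul (inverse (w - z)) (f w - f z))) \<longlongrightarrow> e' l) (at z)"
    by (rule cdual_tendsto[OF e])
  then have "((\<lambda>w. (e' (f w) - e' (f z)) / (w - z)) \<longlongrightarrow> e' l) (at z)"
    by (simp add: cdual_scale[OF e] cdual_diff[OF e] divide_inverse mult.commute)
  then show "\<exists>f'. ((\<lambda>z. e' (f z)) has_field_derivative f') (at z)"
    unfolding has_field_derivative_iff by blast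
qed

lemma holomorphic_space_continuous:
  assumes f: "f \<in> holomorphic_space smul \<Omega>"
  shows "continuous_on \<Omega> f"
  unfolding continuous_on_def
proof
  fix z assume "z \<in> \<Omega>"
  then obtain l where "((\<lambda>w. smul (inverse (w - z)) (f w - f z)) \<longlongrightarrow> l) (at z)"
    using holomorphic_spaceD[OF f] by blast
  then have "((\<lambda>w. smul (w - z) (smul (inverse (w - z)) (f w - f z)) + f z) \<longlongrightarrow> smul (z - z) l + f z) (at z)"
    by (intro tendsto_add_lc tendsto_scale_lc tendsto_intros)
  then have "((\<lambda>w. smul (w - z) (smul (inverse (w - z)) (f w - f z)) + f z) \<longlongrightarrow> f z) (at z)"
    by simp
  then have "((\<lambda>w. smul (w - z) (smul (inverse (w - z)) (f w - f z)) + f z) \<longlongrightarrow> f z) (at z within \<Omega>)"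
    by (rule tendsto_within_subset) simp
  then show "(f \<longlongrightarrow> f z) (at z within \<Omega>)"
  proof (rule Lim_transform_eventually)
    show "\<forall>\<^sub>F w in at z within \<Omega>. smul (w - z) (smul (inverse (w - z)) (f w - f z)) + f z = f w"
      unfolding eventually_at by (intro exI[of _ 1]) auto
  qed
qed

lemma holomorphic_locally_bounded:
  assumes f: "f \<in> holomorphic_space smul \<Omega>" and "open \<Omega>" "z \<in> \<Omega>"
  obtains B r where "0 < r" "cball z r \<subseteq> \<Omega>" "\<And>w. w \<in> cball z r ==> p \<alpha> (f w) \<le> B"
proof -
  obtain r where r: "0 < r" "cball z r \<subseteq> \<Omega>" using assms open_contains_cball by blast
  obtain B where B: "\<And>w. w \<in> cball z r ==> p \<alpha> (f w) \<le> B"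
    using compact_p_bounded[OF compact_cball continuous_on_subset[OF holomorphic_space_continuous[OF f] r(2)]]
    by metis
  show thesis by (rule that[OF r B])
qed

lemma holomorphic_space_add:
  assumes "f \<in> holomorphic_space smul \<Omega>" "g \<in> holomorphic_space smul \<Omega>"
  shows "(\<lambda>z. f z + g z) \<in> holomorphic_space smul \<Omega>"
proof -
  have "\<exists>l. ((\<lambda>w. smul (inverse (w - z)) (f w + g w - (f z + g z))) \<longlongrightarrow> l) (at z)" if z: "z \<in> \<Omega>" for z
  proof -
    obtain l where l: "((\<lambda>w. smul (inverse (w - z)) (f w - f z)) \<longlongrightarrow> l) (at z)"
      using holomorphic_spaceD[OF assms(1) z] by blast
    obtain m where m: "((\<lambda>w. smul (inverse (w - z)) (g w - g z)) \<longlongrightarrow> m) (at z)"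
      using holomorphic_spaceD[OF assms(2) z] by blast
    from l m have "((\<lambda>w. smul (inverse (w - z)) (f w - f z) + smul (inverse (w - z)) (g w - g z)) \<longlongrightarrow> l + m) (at z)"
      by (rule tendsto_add_lc)
    moreover have "smul (inverse (w - z)) (f w - f z) + smul (inverse (w - z)) (g w - g z)
        = smul (inverse (w - z)) (f w + g w - (f z + g z))" for w
      by (simp only: scale_right_distrib[symmetric] add_diff_add)
    ultimately show ?thesis by auto
  qed
  then show ?thesis using assms by (auto simp: holomorphic_space_def)
qed

lemma holomorphic_space_scale_fun:
  assumes "f \<in> holomorphic_space smul \<Omega>" and c: "c holomorphic_on \<Omega>" and "open \<Omega>"
  shows "(\<lambda>z. smul (c z) (f z)) \<in> holomorphic_space smul \<Omega>"
proof -
  have "\<exists>l. ((\<lambda>w. smul (inverse (w - z)) (smul (c w) (f w) - smul (c z) (f z))) \<longlongrightarrow> l) (at z)" if z: "z \<in> \<Omega>" for z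
  proof -
    obtain l where l: "((\<lambda>w. smul (inverse (w - z)) (f w - f z)) \<longlongrightarrow> l) (at z)"
      using holomorphic_spaceD[OF assms(1) z] by blast
    obtain d where d: "((\<lambda>w. (c w - c z) / (w - z)) \<longlongrightarrow> d) (at z)"
      using c z \<open>open \<Omega>\<close> unfolding holomorphic_on_open[OF \<open>open \<Omega>\<close>] has_field_derivative_iff by blast
    have cont: "(c \<longlongrightarrow> c z) (at z)"
      using holomorphic_on_imp_continuous_on[OF c] that \<open>open \<Omega>\<close>
      by (simp add: continuous_on_eq_continuous_at isCont_def)
    have "((\<lambda>w. smul (c w) (smul (inverse (w - z)) (f w - f z)) + smul ((c w - c z) / (w - z)) (f z))
        \<longlongrightarrow> smul (c z) l + smul d (f z)) (at z)"
      by (intro tendsto_add_lc tendsto_scale_lc l d cont tendsto_const)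
    moreover have "smul (c w) (smul (inverse (w - z)) (f w - f z)) + smul ((c w - c z) / (w - z)) (f z)
        = smul (inverse (w - z)) (smul (c w) (f w) - smul (c z) (f z))" for w
    proof -
      have "smul (inverse (w - z)) (smul (c w) (f w) - smul (c z) (f z))
        = smul (inverse (w - z)) (smul (c w) (f w - f z) + smul (c w - c z) (f z))"
        by (simp add: scale_right_diff_distrib scale_left_diff_distrib)
      then show ?thesis by (simp add: scale_right_distrib divide_inverse mult.commute)
    qed
    ultimately show ?thesis by auto
  qed
  then show ?thesis using assms by (auto simp: holomorphic_space_def)
qed

lemma holomorphic_space_scale:
  assumes "f \<in> holomorphic_space smul \<Omega>"
  shows "(\<lambda>z. smul c (f z)) \<in> holomorphic_space smul \<Omega>"
proof -
  have "\<exists>l. ((\<lambda>w. smul (inverse (w - z)) (smul c (f w) - smul c (f z))) \<longlongrightarrow> l) (at z)" if z: "z \<in> \<Omega>" for z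
  proof -
    obtain l where "((\<lambda>w. smul (inverse (w - z)) (f w - f z)) \<longlongrightarrow> l) (at z)"
      using holomorphic_spaceD[OF assms(1)] z assms by blast
    then have "((\<lambda>w. smul c (smul (inverse (w - z)) (f w - f z))) \<longlongrightarrow> smul c l) (at z)"
      by (intro tendsto_scale_lc tendsto_const)
    then show ?thesis
      by (auto simp: scale_right_diff_distrib[of c, symmetric] mult.commute)
  qed
  then show ?thesis using assms by (auto simp: holomorphic_space_def)
qed

lemma holomorphic_space_diff:
  assumes "f \<in> holomorphic_space smul \<Omega>" "g \<in> holomorphic_space smul \<Omega>"
  shows "(\<lambda>z. f z - g z) \<in> holomorphic_space smul \<Omega>"
  using holomorphic_space_add[OF assms(1) holomorphic_space_scale[OF assms(2), of "-1"]] by simp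

lemma holomorphic_space_cong:
  assumes "open \<Omega>'" "f \<in> holomorphic_space smul \<Omega>'" "z \<in> \<Omega>'" "\<And>w. w \<in> \<Omega>' ==> g w = f w"
  shows "\<exists>l. ((\<lambda>w. smul (inverse (w - z)) (g w - g z)) \<longlongrightarrow> l) (at z)"
proof -
  obtain l where l: "((\<lambda>w. smul (inverse (w - z)) (f w - f z)) \<longlongrightarrow> l) (at z)"
    using holomorphic_spaceD assms by blast
  have "((\<lambda>w. smul (inverse (w - z)) (g w - g z)) \<longlongrightarrow> l) (at z)"
    by (rule Lim_transform_within_open[OF l \<open>open \<Omega>'\<close> \<open>z \<in> \<Omega>'\<close>]) (use assms in auto)
  then show ?thesis by blast
qed

text \<open>Gluing principle: each local model vanishes outside its own domain and only has to agree
  with \<open>f\<close> inside. It serves functions that are given by different formulas in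
  different regions.\<close>

lemma holomorphic_space_localI:
  assumes "\<And>z. z \<in> \<Omega> ==> \<exists>\<Omega>' f'. open \<Omega>' \<and> z \<in> \<Omega>' \<and> f' \<in> holomorphic_space smul \<Omega>' \<and> (\<forall>w\<in>\<Omega>'. f w = f' w)"
    and "\<And>z. z \<notin> \<Omega> ==> f z = 0"
  shows "f \<in> holomorphic_space smul \<Omega>"
proof -
  have "\<exists>l. ((\<lambda>w. smul (inverse (w - z)) (f w - f z)) \<longlongrightarrow> l) (at z)" if z: "z \<in> \<Omega>" for z
  proof -
    obtain \<Omega>' f' where "open \<Omega>'" "z \<in> \<Omega>'" "f' \<in> holomorphic_space smul \<Omega>'" "\<forall>w\<in>\<Omega>'. f w = f' w"
      using assms(1)[OF z] by blast
    then show ?thesis by (intro holomorphic_space_cong[of \<Omega>' f']) auto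
  qed
  with assms(2) show ?thesis by (simp add: holomorphic_space_def)
qed

lemma holomorphic_space_restrict:
  assumes "f \<in> holomorphic_space smul \<Omega>" "open \<Omega>'" "\<Omega>' \<subseteq> \<Omega>"
  shows "(\<lambda>z. if z \<in> \<Omega>' then f z else 0) \<in> holomorphic_space smul \<Omega>'"
proof -
  have "\<exists>l. ((\<lambda>w. smul (inverse (w - z)) ((if w \<in> \<Omega>' then f w else 0) - (if z \<in> \<Omega>' then f z else 0))) \<longlongrightarrow> l) (at z)"
    if z: "z \<in> \<Omega>'" for z
  proof -
    obtain l where l: "((\<lambda>w. smul (inverse (w - z)) (f w - f z)) \<longlongrightarrow> l) (at z)"
      using holomorphic_spaceD[OF assms(1)] z assms by blast
    show ?thesis
      by (rule exI, rule Lim_transform_within_open[OF l \<open>open \<Omega>'\<close> z]) (use z in auto)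
  qed
  then show ?thesis by (simp add: holomorphic_space_def)
qed

end

context seq_complete_lcHs
begin

text \<open>Sequential completeness yields limits of sequences only. A limit is taken along
  \<open>z + 1 / (n + 1)\<close>, and the Cauchy estimate, linear in the distances to
  \<open>z\<close>, then forces \<open>g\<close> towards it along the whole punctured
  neighbourhood.\<close>

lemma lim_exists:
  fixes g :: "complex => 'a"
  assumes est: "\<And>\<alpha>. \<exists>C. \<exists>r>0. \<forall>w w'. w \<in> ball z r - {z} --> w' \<in> ball z r - {z} -->
      p \<alpha> (g w - g w') \<le> C * (dist w z + dist w' z)"
  shows "\<exists>l. (g \<longlongrightarrow> l) (at z)"
proof -
  define y where "y n = z + of_real (1 / real (Suc n))" for n
  have d: "dist (y n) z = 1 / real (Suc n)" for n
    by (simp add: y_def dist_norm norm_divide del: of_nat_Suc of_real_of_nat_eq)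
  have near: "\<exists>N. \<forall>n\<ge>N. dist (y n) z < r" if "0 < r" for r
  proof -
    obtain N where "1 / real (Suc N) < r" using \<open>0 < r\<close> nat_approx_posE by blast
    then have "dist (y n) z < r" if "n \<ge> N" for n
      unfolding d using that by (intro le_less_trans[OF _ \<open>1 / real (Suc N) < r\<close>]) (simp add: frac_le)
    then show ?thesis by blast
  qed
  have in_ball: "y n \<in> ball z r - {z}" if "dist (y n) z < r" for n r
    using that d[of n] by (auto simp: dist_commute)
  have "convergent (\<lambda>n. g (y n))"
  proof (rule seq_complete)
    fix \<alpha> and \<epsilon> :: real assume "0 < \<epsilon>"
    obtain C r where "r > 0" and C: "\<And>w w'. w \<in> ball z r - {z} ==> w' \<in> ball z r - {z} ==>
      p \<alpha> (g w - g w') \<le> C * (dist w z + dist w' z)" using est by meson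
    define r' where "r' = min r (\<epsilon> / (2 * (\<bar>C\<bar> + 1)))"
    have "r' > 0" using \<open>r > 0\<close> \<open>0 < \<epsilon>\<close> by (simp add: r'_def)
    then obtain N where N: "\<And>n. n \<ge> N ==> dist (y n) z < r'" using near by blast
    have "p \<alpha> (g (y m) - g (y n)) < \<epsilon>" if "m \<ge> N" "n \<ge> N" for m n
    proof -
      have "p \<alpha> (g (y m) - g (y n)) \<le> C * (dist (y m) z + dist (y n) z)"
        using N[OF that(1)] N[OF that(2)] by (intro C in_ball) (auto simp: r'_def)
      also have "\<dots> \<le> (\<bar>C\<bar> + 1) * (dist (y m) z + dist (y n) z)"
        by (intro mult_right_mono) auto
      also have "\<dots> < (\<bar>C\<bar> + 1) * (2 * (\<epsilon> / (2 * (\<bar>C\<bar> + 1))))"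
        using N[OF that(1)] N[OF that(2)] by (intro mult_strict_left_mono) (auto simp: r'_def)
      also have "\<dots> = \<epsilon>" by (simp add: field_simps add_eq_0_iff)
      finally show ?thesis .
    qed
    then show "\<exists>N. \<forall>m\<ge>N. \<forall>n\<ge>N. p \<alpha> (g (y m) - g (y n)) < \<epsilon>" by blast
  qed
  then obtain l where l: "(\<lambda>n. g (y n)) \<longlonglongrightarrow> l" unfolding convergent_def by blast
  have "(g \<longlongrightarrow> l) (at z)"
    unfolding tendsto_iff_p
  proof
    fix \<alpha>
    obtain C r where "r > 0" and C: "\<And>w w'. w \<in> ball z r - {z} ==> w' \<in> ball z r - {z} ==>
      p \<alpha> (g w - g w') \<le> C * (dist w z + dist w' z)" using est by meson
    have bound: "p \<alpha> (g w - l) \<le> C * dist w z" if "w \<in> ball z r - {z}" for w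
    proof -
      have lim1: "(\<lambda>n. p \<alpha> (g w - g (y n))) \<longlonglongrightarrow> p \<alpha> (g w - l)"
        by (intro tendsto_p tendsto_diff_lc tendsto_const l)
      have lim2: "(\<lambda>n. C * (dist w z + dist (y n) z)) \<longlonglongrightarrow> C * (dist w z + 0)"
        unfolding d by (intro tendsto_intros LIMSEQ_Suc lim_1_over_n)
      obtain N where "\<And>n. n \<ge> N ==> dist (y n) z < r" using near[OF \<open>r > 0\<close>] by blast
      then have "\<forall>n\<ge>N. p \<alpha> (g w - g (y n)) \<le> C * (dist w z + dist (y n) z)"
        using that in_ball C by blast
      then show ?thesis using LIMSEQ_le[OF lim1 lim2] by auto
    qed
    have "((\<lambda>w. C * dist w z) \<longlongrightarrow> C * dist z z) (at z)" by (intro tendsto_intros)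
    then have "((\<lambda>w. C * dist w z) \<longlongrightarrow> 0) (at z)" by simp
    then show "((\<lambda>w. p \<alpha> (g w - l)) \<longlongrightarrow> 0) (at z)"
    proof (rule Lim_null_comparison[rotated])
      show "\<forall>\<^sub>F w in at z. norm (p \<alpha> (g w - l)) \<le> C * dist w z"
        unfolding eventually_at using \<open>r > 0\<close> bound by (intro exI[of _ r]) (auto simp: dist_commute)
    qed
  qed
  then show ?thesis by blast
qed

text \<open>Local boundedness in \<open>p \<alpha>\<close> bounds all functions
  \<open>e' (f z)\<close> with \<open>e'\<close> in the polar by the same \<open>B\<close>. Hence
  \<open>quotient_estimate\<close> applies to them with one constant, and the vector-valued
  difference quotients satisfy the Cauchy condition of \<open>lim_exists\<close>.\<close>

lemma holomorphic_spaceI: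
  assumes "open \<Omega>" and zero: "\<And>z. z \<notin> \<Omega> ==> f z = 0"
    and weak: "\<And>e'. e' \<in> cdual smul ==> (\<lambda>z. e' (f z)) holomorphic_on \<Omega>"
    and bdd: "\<And>z \<alpha>. z \<in> \<Omega> ==> \<exists>B. \<exists>r>0. cball z r \<subseteq> \<Omega> \<and> (\<forall>w\<in>cball z r. p \<alpha> (f w) \<le> B)"
  shows "f \<in> holomorphic_space smul \<Omega>"
proof -
  have "\<exists>l. ((\<lambda>w. smul (inverse (w - z)) (f w - f z)) \<longlongrightarrow> l) (at z)" if z: "z \<in> \<Omega>" for z
  proof (rule lim_exists)
    fix \<alpha>
    obtain B r where "0 < r" and sub: "cball z r \<subseteq> \<Omega>" and B: "\<forall>w\<in>cball z r. p \<alpha> (f w) \<le> B"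
      using bdd[OF z] by blast
    have "p \<alpha> (smul (inverse (w - z)) (f w - f z) - smul (inverse (w' - z)) (f w' - f z))
        \<le> 8 * B / r^2 * (dist w z + dist w' z)"
      if w: "w \<in> ball z (r / 2) - {z}" and w': "w' \<in> ball z (r / 2) - {z}" for w w'
    proof (rule p_le_polar)
      fix e' assume e': "e' \<in> polar \<alpha>"
      note e = polarD(1)[OF e']
      have B': "cmod (e' (f x)) \<le> B" if "x \<in> cball z r" for x
        using B that polarD(2)[OF e', of "f x"] by force
      have "cmod ((e' (f w) - e' (f z)) / (w - z) - deriv (\<lambda>z. e' (f z)) z) \<le> 8 * B / r^2 * cmod (w - z)"
        using w by (intro quotient_estimate[OF weak[OF e] \<open>open \<Omega>\<close> sub \<open>0 < r\<close> B']) auto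
      moreover have "cmod ((e' (f w') - e' (f z)) / (w' - z) - deriv (\<lambda>z. e' (f z)) z) \<le> 8 * B / r^2 * cmod (w' - z)"
        using w' by (intro quotient_estimate[OF weak[OF e] \<open>open \<Omega>\<close> sub \<open>0 < r\<close> B']) auto
      ultimately have "cmod ((e' (f w) - e' (f z)) / (w - z) - (e' (f w') - e' (f z)) / (w' - z))
          \<le> 8 * B / r^2 * cmod (w - z) + 8 * B / r^2 * cmod (w' - z)"
        by (rule norm_diff_triangle_le[OF _ order_eq_refl[OF norm_minus_commute, THEN order_trans]])
      then show "cmod (e' (smul (inverse (w - z)) (f w - f z) - smul (inverse (w' - z)) (f w' - f z)))
         \<le> 8 * B / r^2 * (dist w z + dist w' z)"
        by (simp add: cdual_diff[OF e] cdual_scale[OF e] divide_inverse dist_norm distrib_left distrib_right mult_ac)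
    qed
    then show "\<exists>C. \<exists>r>0. \<forall>w w'. w \<in> ball z r - {z} --> w' \<in> ball z r - {z} -->
      p \<alpha> (smul (inverse (w - z)) (f w - f z) - smul (inverse (w' - z)) (f w' - f z)) \<le> C * (dist w z + dist w' z)"
      using \<open>0 < r\<close> half_gt_zero by blast
  qed
  then show ?thesis using zero by (auto simp: holomorphic_space_def)
qed

text \<open>The derivative relative to the domain, extended by 0, so that it is again a member of
  \<open>holomorphic_space\<close>.\<close>

definition vderiv :: "complex set => (complex => 'a) => complex => 'a" where
  "vderiv \<Omega> f z = (if z \<in> \<Omega> then Lim (at z) (\<lambda>w. smul (inverse (w - z)) (f w - f z)) else 0)"

lemma vderiv_tendsto:
  assumes "f \<in> holomorphic_space smul \<Omega>" "z \<in> \<Omega>"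
  shows "((\<lambda>w. smul (inverse (w - z)) (f w - f z)) \<longlongrightarrow> vderiv \<Omega> f z) (at z)"
proof -
  obtain l where l: "((\<lambda>w. smul (inverse (w - z)) (f w - f z)) \<longlongrightarrow> l) (at z)"
    using holomorphic_spaceD assms by blast
  then have "vderiv \<Omega> f z = l" using assms by (simp add: vderiv_def tendsto_Lim)
  with l show ?thesis by simp
qed

lemma cdual_vderiv:
  assumes "f \<in> holomorphic_space smul \<Omega>" "z \<in> \<Omega>" and e: "e' \<in> cdual smul"
  shows "e' (vderiv \<Omega> f z) = deriv (\<lambda>z. e' (f z)) z"
proof -
  have "((\<lambda>w. e' (smul (inverse (w - z)) (f w - f z))) \<longlongrightarrow> e' (vderiv \<Omega> f z)) (at z)"
    by (rule cdual_tendsto[OF e vderiv_tendsto[OF assms(1,2)]])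
  then have "((\<lambda>w. (e' (f w) - e' (f z)) / (w - z)) \<longlongrightarrow> e' (vderiv \<Omega> f z)) (at z)"
    by (simp add: cdual_scale[OF e] cdual_diff[OF e] divide_inverse mult.commute)
  then show ?thesis by (rule DERIV_imp_deriv[symmetric, OF has_field_derivative_iff[THEN iffD2]])
qed

lemma vderiv_holomorphic:
  assumes f: "f \<in> holomorphic_space smul \<Omega>" and "open \<Omega>"
  shows "vderiv \<Omega> f \<in> holomorphic_space smul \<Omega>"
proof (rule holomorphic_spaceI[OF \<open>open \<Omega>\<close>])
  show "vderiv \<Omega> f z = 0" if "z \<notin> \<Omega>" for z using that by (simp add: vderiv_def)
  show "(\<lambda>z. e' (vderiv \<Omega> f z)) holomorphic_on \<Omega>" if e: "e' \<in> cdual smul" for e'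
    by (rule holomorphic_transform[OF holomorphic_deriv[OF cdual_holomorphic[OF f \<open>open \<Omega>\<close> e] \<open>open \<Omega>\<close>]])
       (simp add: cdual_vderiv[OF f _ e])
next
  fix z \<alpha> assume "z \<in> \<Omega>"
  obtain B r where r: "0 < r" and sub: "cball z r \<subseteq> \<Omega>" and B: "\<And>w. w \<in> cball z r ==> p \<alpha> (f w) \<le> B"
    using holomorphic_locally_bounded[OF f \<open>open \<Omega>\<close> \<open>z \<in> \<Omega>\<close>] by metis
  have "p \<alpha> (vderiv \<Omega> f w) \<le> B / (r / 2)" if w: "w \<in> cball z (r / 2)" for w
  proof (rule p_le_polar)
    fix e' assume e': "e' \<in> polar \<alpha>"
    note e = polarD(1)[OF e']
    have w2: "cball w (r / 2) \<subseteq> cball z r"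
    proof
      fix y assume "y \<in> cball w (r / 2)"
      then show "y \<in> cball z r" using w dist_triangle[of z y w] by simp
    qed
    have hol: "(\<lambda>z. e' (f z)) holomorphic_on cball w (r / 2)"
      by (rule holomorphic_on_subset[OF cdual_holomorphic[OF f \<open>open \<Omega>\<close> e] order_trans[OF w2 sub]])
    have "cmod ((deriv ^^ 1) (\<lambda>z. e' (f z)) w) \<le> fact 1 * B / (r / 2)^1"
    proof (rule Cauchy_inequality)
      show "(\<lambda>z. e' (f z)) holomorphic_on ball w (r / 2)"
        by (rule holomorphic_on_subset[OF hol ball_subset_cball])
      show "continuous_on (cball w (r / 2)) (\<lambda>z. e' (f z))"
        by (rule holomorphic_on_imp_continuous_on[OF hol])
      show "cmod (e' (f x)) \<le> B" if "cmod (w - x) = r / 2" for x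
      proof -
        have "x \<in> cball w (r / 2)" using that by (simp add: dist_norm)
        then have "p \<alpha> (f x) \<le> B" using B w2 by blast
        then show ?thesis using polarD(2)[OF e', of "f x"] by simp
      qed
    qed (use r in simp)
    moreover have "w \<in> \<Omega>" using w2 sub r by (auto simp: subset_iff)
    ultimately show "cmod (e' (vderiv \<Omega> f w)) \<le> B / (r / 2)"
      by (simp add: cdual_vderiv[OF f _ e])
  qed
  moreover have "cball z (r / 2) \<subseteq> \<Omega>" using subset_cball[of "r / 2" r z] sub r by auto
  ultimately show "\<exists>B. \<exists>r>0. cball z r \<subseteq> \<Omega> \<and> (\<forall>w\<in>cball z r. p \<alpha> (vderiv \<Omega> f w) \<le> B)"
    using r half_gt_zero by blast
qed

end

section \<open>Pettis integrals over the line\<close>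

lemma integrable_exp_abs:
  assumes "0 < \<delta>"
  shows "integrable lborel (\<lambda>t::real. C * exp (- \<delta> * \<bar>t\<bar>))"
proof -
  have *: "integrable lborel (\<lambda>t::real. exp (- \<delta> * t) * indicator {0..} t)"
  proof (rule integrableI_nonneg)
    have "((\<lambda>t. - exp (- \<delta> * t) / \<delta>) \<longlongrightarrow> 0) at_top"
    proof -
      have "((\<lambda>t. exp (- \<delta> * t)) \<longlongrightarrow> 0) at_top"
        using assms by (intro filterlim_compose[OF exp_at_bot] filterlim_tendsto_neg_mult_at_bot[OF tendsto_const]) (auto intro: filterlim_ident)
      then have "((\<lambda>t. - exp (- \<delta> * t) / \<delta>) \<longlongrightarrow> - 0 / \<delta>) at_top"
        using assms by (intro tendsto_intros) auto
      then show ?thesis by simp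
    qed
    then have "(\<integral>\<^sup>+x. ennreal (exp (- \<delta> * x)) * indicator {0..} x \<partial>lborel) = ennreal (0 - (- exp (- \<delta> * 0) / \<delta>))"
      using assms by (intro nn_integral_FTC_atLeast) (auto intro!: derivative_eq_intros)
    then show "(\<integral>\<^sup>+x. ennreal (exp (- \<delta> * x) * indicator {0..} x) \<partial>lborel) < \<infinity>"
      by (simp add: ennreal_mult' ennreal_indicator)
  qed auto
  then have "integrable lborel (\<lambda>t::real. exp (- \<delta> * (0 + (-1) * t)) * indicator {0..} (0 + (-1) * t))"
    by (rule lborel_integrable_real_affine) simp
  from Bochner_Integration.integrable_add[OF * this]
  have sum: "integrable lborel (\<lambda>t::real. exp (- \<delta> * t) * indicator {0..} t + exp (- \<delta> * (0 + (-1) * t)) * indicator {0..} (0 + (-1) * t))" .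
  have "integrable lborel (\<lambda>t::real. exp (- \<delta> * \<bar>t\<bar>))"
    by (rule Bochner_Integration.integrable_bound[OF sum]) (auto simp: indicator_def intro!: AE_I2)
  then show ?thesis by simp
qed

context lcHs
begin

lemma Pettis_unique:
  "has_Pettis_integral smul M g x ==> has_Pettis_integral smul M g y ==> x = y"
  unfolding has_Pettis_integral_def by (rule cdual_eqI) metis

lemma Pettis_add:
  "has_Pettis_integral smul M f x ==> has_Pettis_integral smul M g y
    ==> has_Pettis_integral smul M (\<lambda>t. f t + g t) (x + y)"
  unfolding has_Pettis_integral_def by (simp add: cdual_add)

lemma Pettis_scale:
  "has_Pettis_integral smul M f x ==> has_Pettis_integral smul M (\<lambda>t. smul c (f t)) (smul c x)"
  unfolding has_Pettis_integral_def by (simp add: cdual_scale)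

text \<open>The finite set \<open>S\<close> takes up the corners of the contour, where the integrand
  has no controlled value.\<close>

lemma Pettis_bound:
  assumes "has_Pettis_integral smul lborel g x" "finite S" "integrable lborel D"
    and "\<And>t::real. t \<notin> S ==> p \<alpha> (g t) \<le> D t"
  shows "p \<alpha> x \<le> integral\<^sup>L lborel D"
proof (rule p_le_polar)
  fix e' assume e': "e' \<in> polar \<alpha>"
  then have int: "integrable lborel (\<lambda>t. e' (g t))" and eq: "integral\<^sup>L lborel (\<lambda>t. e' (g t)) = e' x"
    using assms(1) polarD(1)[OF e'] by (auto simp: has_Pettis_integral_def)
  have AE: "AE t in lborel. cmod (e' (g t)) \<le> D t"
  proof (rule AE_I'[of S])
    show "S \<in> null_sets lborel" using \<open>finite S\<close> by (rule finite_imp_null_set_lborel)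
    show "{t \<in> space lborel. \<not> cmod (e' (g t)) \<le> D t} \<subseteq> S"
      using assms(4) polarD(2)[OF e'] by (auto intro: order_trans)
  qed
  have "cmod (e' x) \<le> (LINT t|lborel. cmod (e' (g t)))"
    unfolding eq[symmetric] by (rule integral_norm_bound)
  also have "\<dots> \<le> integral\<^sup>L lborel D"
    using int AE assms(3) by (intro integral_mono_AE) auto
  finally show "cmod (e' x) \<le> integral\<^sup>L lborel D" .
qed

end

context seq_complete_lcHs
begin

text \<open>
  The integral is the limit of Riemann sums over the grid of mesh \<open>1/m\<close> in \<open>[-m,m)\<close>; by dominated
  convergence the error tends to \<open>0\<close> uniformly on each polar.
\<close>

lemma Pettis_exists:
  fixes g :: "real => 'a"
  assumes "finite S" and cont: "continuous_on (- S) g"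
    and bound: "\<And>\<alpha>. \<exists>C \<delta>. 0 < \<delta> \<and> (\<forall>t. t \<notin> S --> p \<alpha> (g t) \<le> C * exp (- \<delta> * \<bar>t\<bar>))"
  shows "\<exists>x. has_Pettis_integral smul lborel g x"
proof -
  \<comment> \<open>Setting the integrand to 0 on \<open>S\<close> makes the exponential bound valid
    at every point, also at grid points of the Riemann sums that happen to lie in
    \<open>S\<close>.\<close>
  define h where "h t = (if t \<in> S then 0 else g t)" for t
  have "open (- S)" using \<open>finite S\<close> by (simp add: finite_imp_closed open_Compl)
  have nullS: "S \<in> null_sets lborel" using \<open>finite S\<close> by (rule finite_imp_null_set_lborel)
  have hbound: "\<exists>C \<delta>. 0 \<le> C \<and> 0 < \<delta> \<and> (\<forall>t. p \<alpha> (h t) \<le> C * exp (- \<delta> * \<bar>t\<bar>))" for \<alpha>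
  proof -
    obtain C \<delta> where \<delta>: "0 < \<delta>" and C: "\<forall>t. t \<notin> S --> p \<alpha> (g t) \<le> C * exp (- \<delta> * \<bar>t\<bar>)" using bound by blast
    have "p \<alpha> (h t) \<le> \<bar>C\<bar> * exp (- \<delta> * \<bar>t\<bar>)" for t
    proof (cases "t \<in> S")
      case False
      have "C * exp (- \<delta> * \<bar>t\<bar>) \<le> \<bar>C\<bar> * exp (- \<delta> * \<bar>t\<bar>)" by (rule mult_right_mono) auto
      moreover have "p \<alpha> (h t) \<le> C * exp (- \<delta> * \<bar>t\<bar>)" using C False by (simp add: h_def)
      ultimately show ?thesis by (rule order_trans[rotated])
    qed (simp add: h_def)
    with \<delta> show ?thesis by (intro exI[of _ "\<bar>C\<bar>"] exI[of _ \<delta>]) simp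
  qed
  have hlim: "(h \<longlongrightarrow> h t) (at t)" if "t \<notin> S" for t
  proof -
    have "(g \<longlongrightarrow> g t) (at t)"
      using cont that \<open>open (- S)\<close> by (simp add: continuous_on_eq_continuous_at isCont_def)
    then have "(h \<longlongrightarrow> g t) (at t)"
      by (rule Lim_transform_within_open[OF _ \<open>open (- S)\<close>]) (use that in \<open>auto simp: h_def\<close>)
    moreover have "h t = g t" using that by (simp add: h_def)
    ultimately show ?thesis by simp
  qed
  have meas_p: "(\<lambda>t. p \<alpha> (v - h t)) \<in> borel_measurable borel" for \<alpha> v
  proof -
    have eq: "(\<lambda>t. p \<alpha> (v - h t)) = (\<lambda>t. if t \<in> - S then p \<alpha> (v - g t) else p \<alpha> v)"
      by (auto simp: h_def)
    have "continuous_on (- S) (\<lambda>t. p \<alpha> (v - g t))"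
      using cont unfolding continuous_on_def by (intro ballI tendsto_p tendsto_diff_lc tendsto_const) blast
    then show ?thesis
      unfolding eq by (rule borel_measurable_continuous_on_if[OF borel_open[OF \<open>open (- S)\<close>] _ continuous_on_const])
  qed
  have meas_e: "(\<lambda>t. e' (h t)) \<in> borel_measurable borel" if e: "e' \<in> cdual smul" for e'
  proof -
    have eq: "(\<lambda>t. e' (h t)) = (\<lambda>t. if t \<in> - S then e' (g t) else 0)"
      by (auto simp: h_def cdual_zero[OF e])
    have "continuous_on (- S) (\<lambda>t. e' (g t))"
      using cont unfolding continuous_on_def by (blast intro: cdual_tendsto[OF e])
    then show ?thesis
      unfolding eq by (rule borel_measurable_continuous_on_if[OF borel_open[OF \<open>open (- S)\<close>] _ continuous_on_const])
  qed
  have int_e: "integrable lborel (\<lambda>t. e' (h t))" if e: "e' \<in> cdual smul" for e'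
  proof -
    obtain \<gamma> K where K: "0 < K" "\<And>y. cmod (e' y) \<le> K * p \<gamma> y" using cdual_bound[OF e] by blast
    obtain C \<delta> where "0 < \<delta>" and C: "\<And>t. p \<gamma> (h t) \<le> C * exp (- \<delta> * \<bar>t\<bar>)" using hbound by blast
    have "cmod (e' (h t)) \<le> (K * C) * exp (- \<delta> * \<bar>t\<bar>)" for t
      using order_trans[OF K(2)[of "h t"] mult_left_mono[OF C[of t], of K]] K(1) by (simp add: mult.assoc)
    then show ?thesis
      using meas_e[OF e]
      by (intro Bochner_Integration.integrable_bound[OF integrable_exp_abs[OF \<open>0 < \<delta>\<close>, of "K * C"]] AE_I2)
         (auto intro: order_trans[OF _ abs_ge_self])
  qed
  define m where "m n = real (Suc n)" for n
  have m1: "1 \<le> m n" for n by (simp add: m_def)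
  \<comment> \<open>The grid point of mesh \<open>1 / m n\<close> directly to the left of
    \<open>t\<close>.\<close>
  define s where "s n t = of_int \<lfloor>m n * t\<rfloor> / m n" for n and t :: real
  have s_le: "\<bar>s n t - t\<bar> \<le> 1 / m n" for n t
  proof -
    have "\<bar>of_int \<lfloor>m n * t\<rfloor> - m n * t\<bar> \<le> 1" by linarith
    moreover have "s n t - t = (of_int \<lfloor>m n * t\<rfloor> - m n * t) / m n"
      using m1[of n] by (simp add: s_def field_simps)
    ultimately show ?thesis using m1[of n] by (simp add: divide_right_mono)
  qed
  define k where "k n t = (if - m n \<le> t \<and> t < m n then h (s n t) else 0)" for n t
  \<comment> \<open>For \<open>t\<close> in \<open>[-m, m)\<close> the integer
    \<open>floor (m t)\<close> runs through exactly these values, from \<open>- m^2\<close>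
    inclusive to \<open>m^2\<close> exclusive.\<close>
  define J where "J n = {- ((int (Suc n))^2) ..< (int (Suc n))^2}" for n
  define X where "X n = (\<Sum>j\<in>J n. smul (of_real (1 / m n)) (h (of_int j / m n)))" for n
  have X_int: "has_bochner_integral lborel (\<lambda>t. e' (k n t)) (e' (X n))" if e: "e' \<in> cdual smul" for e' n
  proof -
    define I where "I j = {of_int j / m n ..< of_int (j + 1) / m n}" for j
    have "has_bochner_integral lborel (\<lambda>t. indicator (I j) t *\<^sub>R e' (h (of_int j / m n))) (measure lborel (I j) *\<^sub>R e' (h (of_int j / m n)))" for j
      using m1[of n] by (intro has_bochner_integral_scaleR_left has_bochner_integral_real_indicator)
        (auto simp: I_def divide_right_mono)
    moreover have "measure lborel (I j) = 1 / m n" for j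
      using m1[of n] by (simp add: I_def divide_right_mono add_divide_distrib)
    ultimately have "has_bochner_integral lborel (\<lambda>t. \<Sum>j\<in>J n. indicator (I j) t *\<^sub>R e' (h (of_int j / m n)))
       (\<Sum>j\<in>J n. (1 / m n) *\<^sub>R e' (h (of_int j / m n)))"
      by (intro has_bochner_integral_sum) simp
    moreover have "(\<Sum>j\<in>J n. (1 / m n) *\<^sub>R e' (h (of_int j / m n))) = e' (X n)"
      by (simp add: X_def cdual_sum[OF _ e] cdual_scale[OF e] J_def scaleR_conv_of_real del: of_real_divide)
    moreover have "(\<Sum>j\<in>J n. indicator (I j) t *\<^sub>R e' (h (of_int j / m n))) = e' (k n t)" for t
    proof -
      have I: "t \<in> I j \<longleftrightarrow> j = \<lfloor>m n * t\<rfloor>" for j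
      proof -
        have "t \<in> I j \<longleftrightarrow> of_int j \<le> m n * t \<and> m n * t < of_int j + 1"
          using m1[of n] unfolding I_def by (auto simp: field_simps)
        also have "\<dots> \<longleftrightarrow> j = \<lfloor>m n * t\<rfloor>" by linarith
        finally show ?thesis .
      qed
      have "(\<Sum>j\<in>J n. indicator (I j) t *\<^sub>R e' (h (of_int j / m n)))
          = (\<Sum>j\<in>J n. if j = \<lfloor>m n * t\<rfloor> then e' (h (of_int j / m n)) else 0)"
        by (intro sum.cong) (auto simp: I indicator_def)
      also have "\<dots> = (if \<lfloor>m n * t\<rfloor> \<in> J n then e' (h (s n t)) else 0)"
        by (simp add: J_def s_def)
      also have "\<lfloor>m n * t\<rfloor> \<in> J n \<longleftrightarrow> - m n \<le> t \<and> t < m n"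
      proof -
        have "\<lfloor>m n * t\<rfloor> \<in> J n \<longleftrightarrow> of_int (- ((int (Suc n))^2)) \<le> m n * t \<and> m n * t < of_int ((int (Suc n))^2)"
          unfolding J_def by (simp only: atLeastLessThan_iff le_floor_iff floor_less_iff)
        also have "\<dots> \<longleftrightarrow> m n * (- m n) \<le> m n * t \<and> m n * t < m n * m n"
        proof -
          have "real_of_int (- ((int (Suc n))^2)) = m n * (- m n)" "real_of_int ((int (Suc n))^2) = m n * m n"
            by (simp_all add: m_def power2_eq_square algebra_simps)
          then show ?thesis by (simp only:)
        qed
        also have "\<dots> \<longleftrightarrow> - m n \<le> t \<and> t < m n"
          using m1[of n] by (simp only: mult_le_cancel_left_pos mult_less_cancel_left_pos)
        finally show ?thesis .
      qed
      finally show ?thesis by (auto simp: k_def cdual_zero[OF e])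
    qed
    ultimately show ?thesis by simp
  qed
  define err where "err \<alpha> n = (LINT t|lborel. p \<alpha> (k n t - h t))" for \<alpha> n
  have meas_err: "(\<lambda>t. p \<alpha> (k n t - h t)) \<in> borel_measurable borel" for \<alpha> n
  proof -
    \<comment> \<open>The floor takes countably many values. This reduces measurability to a fixed
      index \<open>i\<close>, where only one of the two vectors in the seminorm still depends on
      \<open>t\<close> beyond a case distinction.\<close>
    have "(\<lambda>t. (\<lambda>i t. p \<alpha> ((if - m n \<le> t \<and> t < m n then h (of_int i / m n) else 0) - h t)) \<lfloor>m n * t\<rfloor> t) \<in> borel_measurable borel"
    proof (rule measurable_compose_countable[where f = "\<lambda>i t. p \<alpha> ((if - m n \<le> t \<and> t < m n then h (of_int i / m n) else 0) - h t)"])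
      fix i :: int
      have "(\<lambda>t. if - m n \<le> t \<and> t < m n then p \<alpha> (h (of_int i / m n) - h t) else p \<alpha> (0 - h t)) \<in> borel_measurable borel"
        by (intro measurable_If meas_p) measurable
      moreover have "(\<lambda>t. if - m n \<le> t \<and> t < m n then p \<alpha> (h (of_int i / m n) - h t) else p \<alpha> (0 - h t))
         = (\<lambda>t. p \<alpha> ((if - m n \<le> t \<and> t < m n then h (of_int i / m n) else 0) - h t))"
        by auto
      ultimately show "(\<lambda>t. p \<alpha> ((if - m n \<le> t \<and> t < m n then h (of_int i / m n) else 0) - h t)) \<in> borel_measurable borel"
        by simp
    qed measurable
    then show ?thesis unfolding k_def s_def by simp
  qed
  have dom: "\<exists>D. integrable lborel D \<and> (\<forall>n t. p \<alpha> (k n t - h t) \<le> D t)" for \<alpha>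
  proof -
    obtain C \<delta> where "0 \<le> C" "0 < \<delta>" and C: "\<And>t. p \<alpha> (h t) \<le> C * exp (- \<delta> * \<bar>t\<bar>)" using hbound by blast
    have "p \<alpha> (k n t - h t) \<le> (C * exp \<delta> + C) * exp (- \<delta> * \<bar>t\<bar>)" for n t
    proof -
      have "p \<alpha> (k n t) \<le> C * exp \<delta> * exp (- \<delta> * \<bar>t\<bar>)"
      proof (cases "- m n \<le> t \<and> t < m n")
        case True
        \<comment> \<open>The grid point is at most 1 away from \<open>t\<close>, which costs a
          factor \<open>exp \<delta>\<close> in the majorant, independently of the mesh.\<close>
        have "\<bar>s n t - t\<bar> \<le> 1" using s_le[of n t] m1[of n] by (smt (verit) divide_le_eq_1)
        then have "- \<delta> * \<bar>s n t\<bar> \<le> \<delta> + - \<delta> * \<bar>t\<bar>"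
          using mult_left_mono[of "\<bar>t\<bar>" "1 + \<bar>s n t\<bar>" \<delta>] \<open>0 < \<delta>\<close> by (simp add: algebra_simps)
        then have "C * exp (- \<delta> * \<bar>s n t\<bar>) \<le> C * exp (\<delta> + - \<delta> * \<bar>t\<bar>)"
          using \<open>0 \<le> C\<close> by (intro mult_left_mono) auto
        with C[of "s n t"] have "p \<alpha> (h (s n t)) \<le> C * exp (\<delta> + - \<delta> * \<bar>t\<bar>)" by (rule order_trans)
        then show ?thesis using True by (simp only: k_def exp_add mult.assoc if_True simp_thms)
      qed (use \<open>0 \<le> C\<close> in \<open>auto simp: k_def\<close>)
      then show ?thesis using p_diff_le[of \<alpha> "k n t" "h t"] C[of t] by (simp add: algebra_simps)
    qed
    then show ?thesis using integrable_exp_abs[OF \<open>0 < \<delta>\<close>] by blast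
  qed
  have err_lim: "err \<alpha> \<longlonglongrightarrow> 0" for \<alpha>
  proof -
    obtain D where D: "integrable lborel D" "\<And>n t. p \<alpha> (k n t - h t) \<le> D t" using dom by blast
    have "(\<lambda>n. LINT t|lborel. p \<alpha> (k n t - h t)) \<longlonglongrightarrow> (LINT t|(lborel :: real measure). (0::real))"
    proof (rule integral_dominated_convergence[where M = lborel and f = "\<lambda>t. 0::real" and s = "\<lambda>n t. p \<alpha> (k n t - h t)" and w = D])
      show "AE t in lborel. (\<lambda>n. p \<alpha> (k n t - h t)) \<longlonglongrightarrow> 0"
      proof (rule AE_I'[OF nullS])
        show "{t \<in> space lborel. \<not> (\<lambda>n. p \<alpha> (k n t - h t)) \<longlonglongrightarrow> 0} \<subseteq> S"
        proof (clarsimp, rule ccontr)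
          fix t assume not: "\<not> (\<lambda>n. p \<alpha> (k n t - h t)) \<longlonglongrightarrow> 0" and "t \<notin> S"
          have "(\<lambda>n. s n t - t) \<longlonglongrightarrow> 0"
          proof (rule Lim_null_comparison[where g = "\<lambda>n. 1 / m n"])
            show "(\<lambda>n. 1 / m n) \<longlonglongrightarrow> 0" unfolding m_def by (intro LIMSEQ_Suc lim_1_over_n)
            show "\<forall>\<^sub>F n in sequentially. norm (s n t - t) \<le> 1 / m n" using s_le by simp
          qed
          then have "(\<lambda>n. s n t) \<longlonglongrightarrow> t" by (simp add: LIM_zero_iff)
          then have "(\<lambda>n. h (s n t)) \<longlonglongrightarrow> h t"
            using hlim[OF \<open>t \<notin> S\<close>] isCont_tendsto_compose[of t h] by (simp add: isCont_def)
          then have "(\<lambda>n. p \<alpha> (h (s n t) - h t)) \<longlonglongrightarrow> 0" by (simp add: tendsto_iff_p)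
          moreover have "\<forall>\<^sub>F n in sequentially. p \<alpha> (h (s n t) - h t) = p \<alpha> (k n t - h t)"
          proof -
            obtain N where "\<bar>t\<bar> < real N" using reals_Archimedean2 by blast
            then have "\<forall>n\<ge>N. p \<alpha> (h (s n t) - h t) = p \<alpha> (k n t - h t)"
              by (auto simp: k_def m_def)
            then show ?thesis unfolding eventually_sequentially by blast
          qed
          ultimately have "(\<lambda>n. p \<alpha> (k n t - h t)) \<longlonglongrightarrow> 0" by (rule Lim_transform_eventually)
          with not show False by contradiction
        qed
      qed
    qed (use D meas_err in auto)
    then show ?thesis by (simp add: err_def[abs_def])
  qed
  \<comment> \<open>The error of the Riemann sum is bounded by an integral of the seminorm that does
    not involve \<open>e'\<close>. This uniformity makes \<open>X\<close> a Cauchy sequence in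
    E.\<close>
  have X_err: "cmod (e' (X n) - (LINT t|lborel. e' (h t))) \<le> err \<alpha> n" if e': "e' \<in> polar \<alpha>" for e' \<alpha> n
  proof -
    note e = polarD(1)[OF e']
    obtain D where D: "integrable lborel D" "\<And>n t. p \<alpha> (k n t - h t) \<le> D t" using dom by blast
    have int: "integrable lborel (\<lambda>t. p \<alpha> (k n t - h t))"
      using D meas_err by (intro Bochner_Integration.integrable_bound[OF D(1)] AE_I2) (auto intro: order_trans[OF _ abs_ge_self])
    have "e' (X n) - (LINT t|lborel. e' (h t)) = (LINT t|lborel. e' (k n t) - e' (h t))"
      using X_int[OF e, of n] int_e[OF e]
      by (simp add: has_bochner_integral_iff)
    also have "cmod \<dots> \<le> (LINT t|lborel. cmod (e' (k n t) - e' (h t)))"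
      by (rule integral_norm_bound)
    also have "\<dots> \<le> err \<alpha> n"
      unfolding err_def
    proof (rule integral_mono[OF _ int])
      show "integrable lborel (\<lambda>t. cmod (e' (k n t) - e' (h t)))"
        using X_int[OF e, of n] int_e[OF e] by (simp add: has_bochner_integral_iff)
      show "cmod (e' (k n t) - e' (h t)) \<le> p \<alpha> (k n t - h t)" for t
        using polarD(2)[OF e', of "k n t - h t"] by (simp add: cdual_diff[OF e])
    qed
    finally show ?thesis .
  qed
  have "convergent X"
  proof (rule seq_complete)
    fix \<alpha> and \<epsilon> :: real assume "0 < \<epsilon>"
    then obtain N where N: "\<And>n. n \<ge> N ==> \<bar>err \<alpha> n\<bar> < \<epsilon> / 2"
      using err_lim[of \<alpha>] unfolding LIMSEQ_iff by (metis diff_zero half_gt_zero real_norm_def)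
    have "p \<alpha> (X i - X j) < \<epsilon>" if "i \<ge> N" "j \<ge> N" for i j
    proof -
      have "p \<alpha> (X i - X j) \<le> err \<alpha> i + err \<alpha> j"
      proof (rule p_le_polar)
        fix e' assume e': "e' \<in> polar \<alpha>"
        show "cmod (e' (X i - X j)) \<le> err \<alpha> i + err \<alpha> j"
          using X_err[OF e', of i] X_err[OF e', of j] cdual_diff[OF polarD(1)[OF e'], of "X i" "X j"]
            norm_triangle_ineq4[of "e' (X i) - (LINT t|lborel. e' (h t))" "e' (X j) - (LINT t|lborel. e' (h t))"]
          by simp
      qed
      then show ?thesis using N[OF that(1)] N[OF that(2)] by linarith
    qed
    then show "\<exists>N. \<forall>m\<ge>N. \<forall>n\<ge>N. p \<alpha> (X m - X n) < \<epsilon>" by blast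
  qed
  then obtain x where x: "X \<longlonglongrightarrow> x" unfolding convergent_def by blast
  have polar_x: "(LINT t|lborel. e' (h t)) = e' x" if e': "e' \<in> polar \<alpha>" for e' \<alpha>
  proof -
    have "(\<lambda>n. e' (X n) - (LINT t|lborel. e' (h t))) \<longlonglongrightarrow> 0"
      by (rule Lim_null_comparison[OF _ err_lim[of \<alpha>]]) (simp add: X_err[OF e'])
    then have "(\<lambda>n. e' (X n)) \<longlonglongrightarrow> (LINT t|lborel. e' (h t))" by (simp add: LIM_zero_iff)
    moreover have "(\<lambda>n. e' (X n)) \<longlonglongrightarrow> e' x" by (rule cdual_tendsto[OF polarD(1)[OF e'] x])
    ultimately show ?thesis by (rule LIMSEQ_unique)
  qed
  have "integrable lborel (\<lambda>t. e' (g t)) \<and> (LINT t|lborel. e' (g t)) = e' x" if e: "e' \<in> cdual smul" for e'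
  proof -
    obtain \<gamma> K e1 where K: "0 < K" "e1 \<in> polar \<gamma>" "\<And>y. e' y = of_real K * e1 y"
      by (rule cdual_polar[OF e]) (rule that)
    have hx: "(LINT t|lborel. e' (h t)) = e' x" using K polar_x[OF K(2)] by simp
    have AE: "AE t in lborel. e' (h t) = e' (g t)"
      by (rule AE_I'[OF nullS]) (auto simp: h_def)
    have "(\<lambda>t. e' (g t)) \<in> borel_measurable lborel"
    proof -
      have "(\<lambda>t. e' (g t)) = (\<lambda>t. if t \<in> S then e' (g t) else e' (h t))" by (auto simp: h_def)
      moreover have "(\<lambda>t. if t \<in> S then e' (g t) else e' (h t)) \<in> borel_measurable borel"
      proof (rule measurable_discrete_difference[where f = "\<lambda>t. e' (h t)" and X = S])
        show "(\<lambda>t. e' (h t)) \<in> borel_measurable borel" by (rule meas_e[OF e])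
      qed (use \<open>finite S\<close> in \<open>auto intro: countable_finite\<close>)
      ultimately show ?thesis by simp
    qed
    then show ?thesis
      using integrable_cong_AE[OF borel_measurable_integrable[OF int_e[OF e]] _ AE]
        integral_cong_AE[OF borel_measurable_integrable[OF int_e[OF e]] _ AE] int_e[OF e] hx by simp
  qed
  then show ?thesis unfolding has_Pettis_integral_def by blast
qed

text \<open>The difference quotients of \<open>T\<close> are Pettis integrals of those of the scalar
  kernel. The kernel's quotients obey \<open>quotient_estimate\<close> with a constant proportional
  to \<open>D t\<close>, and integrating this gives the hypothesis of
  \<open>lim_exists\<close>.\<close>

lemma Pettis_holomorphic:
  assumes "open \<Omega>" "finite S" and zero: "\<And>z. z \<notin> \<Omega> ==> T z = 0"
    and int: "\<And>z. z \<in> \<Omega> ==> has_Pettis_integral smul lborel (\<lambda>t::real. smul (k t z) (g t)) (T z)"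
    and hol: "\<And>t. t \<notin> S ==> k t holomorphic_on \<Omega>"
    and dom: "\<And>z \<alpha>. z \<in> \<Omega> ==> \<exists>r>0. \<exists>D. cball z r \<subseteq> \<Omega> \<and> integrable lborel D \<and>
       (\<forall>t w. t \<notin> S --> w \<in> cball z r --> cmod (k t w) * p \<alpha> (g t) \<le> D t)"
  shows "T \<in> holomorphic_space smul \<Omega>"
proof -
  have "\<exists>l. ((\<lambda>w. smul (inverse (w - z)) (T w - T z)) \<longlongrightarrow> l) (at z)" if z: "z \<in> \<Omega>" for z
  proof (rule lim_exists)
    fix \<alpha>
    obtain r D where "0 < r" and sub: "cball z r \<subseteq> \<Omega>" and D: "integrable lborel D"
      and kD: "\<And>t w. t \<notin> S ==> w \<in> cball z r ==> cmod (k t w) * p \<alpha> (g t) \<le> D t"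
      using dom[OF z] by meson
    define K where "K = 8 * integral\<^sup>L lborel D / r^2"
    have "p \<alpha> (smul (inverse (w - z)) (T w - T z) - smul (inverse (w' - z)) (T w' - T z))
        \<le> K * (dist w z + dist w' z)"
      if w: "w \<in> ball z (r / 2) - {z}" and w': "w' \<in> ball z (r / 2) - {z}" for w w'
    proof -
      define Q where "Q = (\<lambda>w t. smul ((k t w - k t z) / (w - z)) (g t))"
      have \<Omega>: "w \<in> \<Omega>" "w' \<in> \<Omega>" using w w' sub \<open>0 < r\<close> by (auto simp: subset_iff)
      have Q: "has_Pettis_integral smul lborel (Q w) (smul (inverse (w - z)) (T w - T z))" if "w \<in> \<Omega>" for w
      proof -
        have "has_Pettis_integral smul lborel (\<lambda>t. smul (inverse (w - z)) (smul (k t w) (g t) + smul (-1) (smul (k t z) (g t))))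
          (smul (inverse (w - z)) (T w + smul (-1) (T z)))"
          by (intro Pettis_scale Pettis_add int that z)
        moreover have "smul (inverse (w - z)) (smul (k t w) (g t) + smul (-1) (smul (k t z) (g t))) = Q w t" for t
          by (simp add: Q_def scale_left_diff_distrib[symmetric] scale_right_diff_distrib[symmetric] divide_inverse mult.commute)
        ultimately show ?thesis by simp
      qed
      have QQ: "has_Pettis_integral smul lborel (\<lambda>t. Q w t + smul (-1) (Q w' t))
         (smul (inverse (w - z)) (T w - T z) + smul (-1) (smul (inverse (w' - z)) (T w' - T z)))"
        by (intro Pettis_add Pettis_scale Q \<Omega>)
      have "p \<alpha> (smul (inverse (w - z)) (T w - T z) + smul (-1) (smul (inverse (w' - z)) (T w' - T z)))
          \<le> (LINT t|lborel. 8 / r^2 * (dist w z + dist w' z) * D t)"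
      proof (rule Pettis_bound[OF QQ \<open>finite S\<close>])
        show "integrable lborel (\<lambda>t. 8 / r^2 * (dist w z + dist w' z) * D t)" using D by simp
        fix t assume "t \<notin> S"
        show "p \<alpha> (Q w t + smul (-1) (Q w' t)) \<le> 8 / r^2 * (dist w z + dist w' z) * D t"
        proof (cases "p \<alpha> (g t) = 0")
          case True
          have "0 \<le> D t" using kD[OF \<open>t \<notin> S\<close>, of z] True \<open>0 < r\<close> by simp
          have "p \<alpha> (Q w t + smul (-1) (Q w' t)) \<le> p \<alpha> (Q w t) + p \<alpha> (smul (-1) (Q w' t))"
            by (rule seminorm_add)
          also have "\<dots> = 0" using True unfolding Q_def seminorm_scale by simp
          also have "0 \<le> 8 / r^2 * (dist w z + dist w' z) * D t" using \<open>0 \<le> D t\<close> by simp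
          finally show ?thesis .
        next
          case False
          \<comment> \<open>The bound on the kernel alone arises by dividing the majorant by
            \<open>p \<alpha> (g t)\<close>; hence the separate case in which this seminorm
            vanishes.\<close>
          define b where "b = p \<alpha> (g t)"
          have b: "0 < b" using False p_nonneg[of \<alpha> "g t"] by (simp add: b_def less_le)
          have B: "cmod (k t x) \<le> D t / b" if "x \<in> cball z r" for x
            using kD[OF \<open>t \<notin> S\<close> that] b by (simp add: b_def field_simps)
          have "cmod ((k t w - k t z) / (w - z) - deriv (k t) z) \<le> 8 * (D t / b) / r^2 * cmod (w - z)"
            using w by (intro quotient_estimate[OF hol[OF \<open>t \<notin> S\<close>] \<open>open \<Omega>\<close> sub \<open>0 < r\<close> B]) auto
          moreover have "cmod ((k t w' - k t z) / (w' - z) - deriv (k t) z) \<le> 8 * (D t / b) / r^2 * cmod (w' - z)"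
            using w' by (intro quotient_estimate[OF hol[OF \<open>t \<notin> S\<close>] \<open>open \<Omega>\<close> sub \<open>0 < r\<close> B]) auto
          ultimately have "cmod ((k t w - k t z) / (w - z) - (k t w' - k t z) / (w' - z))
            \<le> 8 * (D t / b) / r^2 * cmod (w - z) + 8 * (D t / b) / r^2 * cmod (w' - z)"
            by (rule norm_diff_triangle_le[OF _ order_eq_refl[OF norm_minus_commute, THEN order_trans]])
          then have "cmod ((k t w - k t z) / (w - z) - (k t w' - k t z) / (w' - z)) * b
            \<le> (8 * (D t / b) / r^2 * cmod (w - z) + 8 * (D t / b) / r^2 * cmod (w' - z)) * b"
            using b by (intro mult_right_mono) auto
          also have "\<dots> = 8 / r^2 * (dist w z + dist w' z) * D t"
            using b by (simp add: field_simps dist_norm add_divide_distrib)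
          finally have *: "cmod ((k t w - k t z) / (w - z) - (k t w' - k t z) / (w' - z)) * b
            \<le> 8 / r^2 * (dist w z + dist w' z) * D t" .
          have "Q w t + smul (-1) (Q w' t) = smul ((k t w - k t z) / (w - z) - (k t w' - k t z) / (w' - z)) (g t)"
            unfolding Q_def scale_left_diff_distrib[of "(k t w - k t z) / (w - z)" "(k t w' - k t z) / (w' - z)"]
            by (simp only: scale_minus_left scale_one add_uminus_conv_diff)
          then show ?thesis using * by (simp add: seminorm_scale b_def)
        qed
      qed
      also have "\<dots> = 8 / r^2 * (dist w z + dist w' z) * integral\<^sup>L lborel D"
        by (rule integral_mult_right_zero)
      also have "\<dots> = K * (dist w z + dist w' z)" by (simp add: K_def)
      finally show ?thesis by simp
    qed
    then show "\<exists>C. \<exists>r>0. \<forall>w w'. w \<in> ball z r - {z} --> w' \<in> ball z r - {z} -->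
      p \<alpha> (smul (inverse (w - z)) (T w - T z) - smul (inverse (w' - z)) (T w' - T z)) \<le> C * (dist w z + dist w' z)"
      using \<open>0 < r\<close> half_gt_zero by blast
  qed
  then show ?thesis using zero by (auto simp: holomorphic_space_def)
qed

end

text \<open>The estimate of \<open>Pettis_holomorphic\<close> in the scalar case, with the
  derivative identified. The differential equations for transforms below depend on its value and not
  only on its existence.\<close>

lemma leibniz_rule_lborel:
  fixes k :: "real => complex => complex"
  assumes "open \<Omega>" "finite S" "0 < r" and sub: "cball z r \<subseteq> \<Omega>"
    and int: "\<And>w. w \<in> \<Omega> ==> integrable lborel (\<lambda>t. k t w)" and int': "integrable lborel k'"
    and hol: "\<And>t. t \<notin> S ==> k t holomorphic_on \<Omega>" and k': "\<And>t. t \<notin> S ==> deriv (k t) z = k' t"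
    and D: "integrable lborel D" and kD: "\<And>t w. t \<notin> S ==> w \<in> cball z r ==> cmod (k t w) \<le> D t"
  shows "((\<lambda>w. LINT t|lborel. k t w) has_field_derivative (LINT t|lborel. k' t)) (at z)"
proof -
  define T where "T w = (LINT t|lborel. k t w)" for w
  have z: "z \<in> \<Omega>" using sub \<open>0 < r\<close> by auto
  have bound: "cmod ((T w - T z) / (w - z) - (LINT t|lborel. k' t)) \<le> 8 * integral\<^sup>L lborel D / r^2 * cmod (w - z)"
    if w: "w \<in> ball z (r / 2)" "w \<noteq> z" for w
  proof -
    have \<Omega>: "w \<in> \<Omega>" using w sub \<open>0 < r\<close> by (auto simp: subset_iff)
    have eq: "(T w - T z) / (w - z) - (LINT t|lborel. k' t) = (LINT t|lborel. (k t w - k t z) / (w - z) - k' t)"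
      unfolding T_def using int[OF \<Omega>] int[OF z] int' by simp
    have "cmod (LINT t|lborel. (k t w - k t z) / (w - z) - k' t) \<le> (LINT t|lborel. cmod ((k t w - k t z) / (w - z) - k' t))"
      by (rule integral_norm_bound)
    also have "\<dots> \<le> (LINT t|lborel. 8 * D t / r^2 * cmod (w - z))"
    proof (rule integral_mono_AE)
      show "integrable lborel (\<lambda>t. cmod ((k t w - k t z) / (w - z) - k' t))" using int[OF \<Omega>] int[OF z] int' by simp
      show "integrable lborel (\<lambda>t. 8 * D t / r^2 * cmod (w - z))" using D by simp
      show "AE t in lborel. cmod ((k t w - k t z) / (w - z) - k' t) \<le> 8 * D t / r^2 * cmod (w - z)"
      proof (rule AE_I'[OF finite_imp_null_set_lborel[OF \<open>finite S\<close>]])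
        show "{t \<in> space lborel. \<not> cmod ((k t w - k t z) / (w - z) - k' t) \<le> 8 * D t / r^2 * cmod (w - z)} \<subseteq> S"
        proof (clarsimp, rule ccontr)
          fix t assume *: "\<not> cmod ((k t w - k t z) / (w - z) - k' t) \<le> 8 * D t * cmod (w - z) / r^2" and t: "t \<notin> S"
          have "cmod ((k t w - k t z) / (w - z) - deriv (k t) z) \<le> 8 * D t / r^2 * cmod (w - z)"
            using w kD[OF t] by (intro quotient_estimate[OF hol[OF t] \<open>open \<Omega>\<close> sub \<open>0 < r\<close>]) auto
          with * k'[OF t] show False by simp
        qed
      qed
    qed
    also have "\<dots> = 8 * integral\<^sup>L lborel D / r^2 * cmod (w - z)" by simp
    finally show ?thesis unfolding eq .
  qed
  have "((\<lambda>w. (T w - T z) / (w - z) - (LINT t|lborel. k' t)) \<longlongrightarrow> 0) (at z)"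
  proof (rule Lim_null_comparison)
    show "\<forall>\<^sub>F w in at z. cmod ((T w - T z) / (w - z) - (LINT t|lborel. k' t)) \<le> 8 * integral\<^sup>L lborel D / r^2 * cmod (w - z)"
      unfolding eventually_at using \<open>0 < r\<close> bound
      by (intro exI[of _ "r / 2"]) (auto simp: dist_commute)
    have "((\<lambda>w. 8 * integral\<^sup>L lborel D / r^2 * cmod (w - z)) \<longlongrightarrow> 8 * integral\<^sup>L lborel D / r^2 * cmod (z - z)) (at z)"
      by (intro tendsto_intros)
    then show "((\<lambda>w. 8 * integral\<^sup>L lborel D / r^2 * cmod (w - z)) \<longlongrightarrow> 0) (at z)" by simp
  qed
  then show ?thesis unfolding has_field_derivative_iff T_def[symmetric] by (simp add: LIM_zero_iff)
qed

section \<open>Scalar integrals over the contour\<close>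

definition slit :: "real => complex set" where
  "slit a = - (complex_of_real ` {a..})"

lemma slit_iff: "z \<in> slit a \<longleftrightarrow> Im z \<noteq> 0 \<or> Re z < a"
proof -
  have "z \<in> complex_of_real ` {a..} \<longleftrightarrow> Im z = 0 \<and> a \<le> Re z"
  proof
    assume "Im z = 0 \<and> a \<le> Re z"
    then show "z \<in> complex_of_real ` {a..}" by (intro image_eqI[of _ _ "Re z"]) (auto simp: complex_eq_iff)
  qed auto
  then show ?thesis by (auto simp: slit_def)
qed

lemma slit_eq: "slit a = {z. 0 < Im z} \<union> {z. Im z < 0} \<union> {z. Re z < a}"
  by (auto simp: slit_iff)

lemma open_slit [simp]: "open (slit a)"
  unfolding slit_eq by (intro open_Un open_halfspace_Im_gt open_halfspace_Im_lt open_halfspace_Re_lt)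

text \<open>The segment from \<open>a - 1\<close> to a point with nonzero imaginary part stays off
  the real axis after its start; for the remaining points it runs on the axis to the left of
  \<open>a\<close>. Star-shapedness provides primitives on the cut plane.\<close>

lemma starlike_slit: "starlike (slit a)"
  unfolding starlike_def
proof (intro bexI ballI subsetI)
  fix z w assume z: "z \<in> slit a" and "w \<in> closed_segment (of_real (a - 1)) z"
  then obtain u where u: "0 \<le> u" "u \<le> 1" and w: "w = (1 - u) *\<^sub>R of_real (a - 1) + u *\<^sub>R z"
    unfolding closed_segment_def by blast
  have Re: "Re w = (1 - u) * (a - 1) + u * Re z" and Im: "Im w = u * Im z" by (simp_all add: w)
  show "w \<in> slit a"
  proof (cases "u = 0 \<or> Im z \<noteq> 0")
    case True
    then show ?thesis using Im Re by (auto simp: slit_iff)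
  next
    case False
    then have "Re z < a" "0 < u" using z u by (auto simp: slit_iff)
    then have "u * Re z < u * a" by simp
    moreover have "(1 - u) * (a - 1) \<le> (1 - u) * a" using u by (intro mult_left_mono) auto
    ultimately have "Re w < (1 - u) * a + u * a" using Re by linarith
    then show ?thesis by (simp add: slit_iff algebra_simps)
  qed
qed (simp add: slit_iff)

lemma slit_primitive:
  assumes "\<psi> holomorphic_on slit a"
  obtains \<Psi> where "\<And>z. z \<in> slit a ==> (\<Psi> has_field_derivative \<psi> z) (at z)"
proof -
  have "\<exists>g. \<forall>x \<in> slit a. (g has_field_derivative \<psi> x) (at x)"
  proof (rule holomorphic_starlike_primitive[where k = "{}"])
    show "continuous_on (slit a) \<psi>" by (rule holomorphic_on_imp_continuous_on[OF assms])
    show "\<psi> field_differentiable at x" if "x \<in> slit a - {}" for x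
      using assms that by (intro holomorphic_on_imp_differentiable_at[OF _ open_slit]) auto
  qed (auto simp: starlike_slit)
  then show thesis using that by blast
qed

section \<open>The contour around a right half-line\<close>

text \<open>This is \<open>contour {ereal a..} c\<close>. It arrives from infinity at height
  \<open>-c\<close>, passes \<open>a\<close> on the left along a half-circle and leaves to infinity
  at height \<open>c\<close>.\<close>

definition hook :: "real => real => real => complex" where
  "hook a c t = of_real a - loop c t"

text \<open>The derivative of \<open>hook\<close> off the two corners; at the corners it is the
  derivative from the left.\<close>

definition hookd :: "real => real => complex" where
  "hookd c t = (if t \<le> -1 then -1 else if t \<le> 1 then of_real c * (\<i> * of_real pi / 2) * exp (- (\<i> * (of_real pi * of_real t / 2))) else 1)"

lemma hook_mid: "-1 \<le> t ==> t \<le> 1 ==> hook a c t = Complex (a - c * cos (pi * t / 2)) (c * sin (pi * t / 2))"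
proof -
  assume t: "-1 \<le> t" "t \<le> 1"
  have *: "exp (- (\<i> * of_real x)) = Complex (cos x) (- sin x)" for x
    using cis_conv_exp[of "- x"] by (simp add: complex_eq_iff)
  show ?thesis
  proof (cases "t = -1")
    case True
    then show ?thesis by (simp add: hook_def loop_def complex_eq_iff)
  next
    case False
    then show ?thesis using t *[of "pi * t / 2"] by (simp add: hook_def loop_def complex_eq_iff)
  qed
qed

lemma hook_right: "1 \<le> t ==> hook a c t = Complex (a + t - 1) c"
proof (cases "t = 1")
  case True
  then show ?thesis using hook_mid[of 1 a c] by simp
qed (simp add: hook_def loop_def complex_eq_iff)

lemma hook_left: "t \<le> -1 ==> hook a c t = Complex (a - t - 1) (- c)"
  by (simp add: hook_def loop_def complex_eq_iff)

text \<open>Clamping the parameter to \<open>[-1, 1]\<close> gives a formula without cases, from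
  which continuity and the coordinate bounds can be read off.\<close>

lemma hook_eq: "hook a c t = Complex (a - c * cos (pi * (max (-1) (min 1 t)) / 2) + max 0 (\<bar>t\<bar> - 1))
    (c * sin (pi * (max (-1) (min 1 t)) / 2))"
proof -
  consider "t \<le> -1" | "-1 \<le> t" "t \<le> 1" | "1 \<le> t" by linarith
  then show ?thesis
  proof cases
    case 2
    then have "max 0 (\<bar>t\<bar> - 1) = 0" "max (-1) (min 1 t) = t" by auto
    then show ?thesis using 2 by (simp only: hook_mid add_0_right)
  qed (simp_all add: hook_left hook_right max_def min_def)
qed

lemma continuous_hook: "continuous_on S (hook a c)"
  unfolding hook_eq[abs_def] complex_eq by (intro continuous_intros) auto

lemma Re_hook_ge: "0 \<le> c ==> a - c \<le> Re (hook a c t)"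
  using mult_left_mono[OF cos_le_one[of "pi * (max (-1) (min 1 t)) / 2"], of c] unfolding hook_eq by simp

lemma Im_hook_le: "0 \<le> c ==> \<bar>Im (hook a c t)\<bar> \<le> c"
  using mult_left_mono[OF abs_sin_le_one[of "pi * (max (-1) (min 1 t)) / 2"], of c]
  unfolding hook_eq by (simp add: abs_mult)

text \<open>On the straight pieces the imaginary part already has modulus \<open>c\<close>. On the
  arc the cosine is nonnegative, so moving from \<open>a\<close> to a point \<open>x\<close> further
  right can only increase the horizontal distance. Consequently points closer than \<open>c\<close>
  to the half-line are never on the contour.\<close>

lemma dist_hook: "0 \<le> c ==> a \<le> x ==> c \<le> cmod (hook a c t - of_real x)"
proof -
  assume c: "0 \<le> c" and x: "a \<le> x"
  consider "t \<le> -1 \<or> 1 \<le> t" | "-1 \<le> t" "t \<le> 1" by linarith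
  then show ?thesis
  proof cases
    case 1
    then have "\<bar>Im (hook a c t - of_real x)\<bar> = c" using c by (auto simp: hook_left hook_right)
    then show ?thesis using abs_Im_le_cmod[of "hook a c t - of_real x"] by simp
  next
    case 2
    define \<theta> where "\<theta> = pi * t / 2"
    have "pi * -1 \<le> pi * t" "pi * t \<le> pi * 1" using 2 by (intro mult_left_mono; simp)+
    then have "0 \<le> c * cos \<theta>" using c unfolding \<theta>_def by (intro mult_nonneg_nonneg cos_ge_zero) auto
    then have "(c * cos \<theta>)^2 \<le> (x - (a - c * cos \<theta>))^2"
      using x by (intro power_mono) auto
    moreover have "c^2 = (c * cos \<theta>)^2 + (c * sin \<theta>)^2"
      by (simp add: power_mult_distrib distrib_left[symmetric])
    ultimately have "c^2 \<le> (a - c * cos \<theta> - x)^2 + (c * sin \<theta>)^2"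
      by (simp add: power2_commute[of x])
    then have "c \<le> sqrt ((a - c * cos \<theta> - x)^2 + (c * sin \<theta>)^2)"
      by (rule real_le_rsqrt)
    then show ?thesis
      using 2 by (simp add: hook_mid cmod_def \<theta>_def)
  qed
qed

lemma hook_slit: "0 < c ==> hook a c t \<in> slit a"
proof -
  assume c: "0 < c"
  have False if "Im (hook a c t) = 0" "a \<le> Re (hook a c t)"
  proof -
    have "hook a c t = of_real (Re (hook a c t))" using that(1) by (simp add: complex_eq_iff)
    then show False using dist_hook[of c a "Re (hook a c t)" t] that c by simp
  qed
  then show ?thesis by (force simp: slit_iff not_less)
qed

lemma hook_deriv:
  assumes "t \<notin> {-1, 1}"
  shows "(hook a c has_vector_derivative hookd c t) (at t)"
proof -
  have lin: "((\<lambda>s. of_real b + of_real d * of_real s + z) has_vector_derivative of_real d) (at t)" for b d :: real and z :: complex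
    by (rule has_vector_derivative_real_field[where f = "\<lambda>s. of_real b + of_real d * s + z"]) (auto intro!: derivative_eq_intros)
  have "t < -1 \<or> (-1 < t \<and> t < 1) \<or> 1 < t" using assms by auto
  then consider "t < -1" | "-1 < t" "t < 1" | "1 < t" by blast
  then show ?thesis
  proof cases
    case 1
    have "(hook a c has_vector_derivative of_real (-1)) (at t)"
      by (rule has_vector_derivative_transform_within_open[OF lin[of "a - 1" "-1" "- \<i> * of_real c"] open_lessThan[of "-1"]])
         (use 1 in \<open>auto simp: hook_left complex_eq_iff\<close>)
    then show ?thesis using 1 by (simp add: hookd_def)
  next
    case 3
    have "(hook a c has_vector_derivative of_real 1) (at t)"
      by (rule has_vector_derivative_transform_within_open[OF lin[of "a - 1" "1" "\<i> * of_real c"] open_greaterThan[of 1]])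
         (use 3 in \<open>auto simp: hook_right complex_eq_iff\<close>)
    then show ?thesis using 3 by (simp add: hookd_def)
  next
    case 2
    have "((\<lambda>s. of_real a - of_real c * exp (- (\<i> * (of_real pi * of_real s / 2)))) has_vector_derivative
        of_real c * (\<i> * of_real pi / 2) * exp (- (\<i> * (of_real pi * of_real t / 2)))) (at t)"
      by (rule has_vector_derivative_real_field[where f = "\<lambda>s. of_real a - of_real c * exp (- (\<i> * (of_real pi * s / 2)))"])
         (auto intro!: derivative_eq_intros)
    then have "(hook a c has_vector_derivative of_real c * (\<i> * of_real pi / 2) * exp (- (\<i> * (of_real pi * of_real t / 2)))) (at t)"
      by (rule has_vector_derivative_transform_within_open[OF _ open_greaterThanLessThan[of "-1" 1]])
         (use 2 in \<open>auto simp: hook_def loop_def\<close>)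
    then show ?thesis using 2 by (simp add: hookd_def)
  qed
qed

lemma vector_derivative_hook: "t \<notin> {-1, 1} ==> vector_derivative (hook a c) (at t) = hookd c t"
  by (rule vector_derivative_at[OF hook_deriv])

lemma cmod_hookd: "0 \<le> c ==> cmod (hookd c t) \<le> 1 + 2 * c"
proof -
  assume c: "0 \<le> c"
  have "cmod (exp (- (\<i> * (of_real pi * of_real t / 2)))) = 1" by (simp add: norm_exp_eq_Re)
  then have "cmod (of_real c * (\<i> * of_real pi / 2) * exp (- (\<i> * (of_real pi * of_real t / 2)))) = c * (pi / 2)"
    using c by (simp add: norm_mult norm_divide)
  also have "\<dots> \<le> c * 2" using c pi_less_4 by (intro mult_left_mono) auto
  finally show ?thesis using c unfolding hookd_def by auto
qed

lemma hookd_outside: "t \<notin> {-1, 1} ==> 1 \<le> \<bar>t\<bar> ==> cmod (hookd c t) = 1"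
  by (auto simp: hookd_def)

lemma continuous_hookd: "continuous_on (- {-1, 1}) (hookd c)"
proof -
  have "isCont (hookd c) t" if t: "t \<notin> {-1, 1}" for t
  proof -
    define m where "m s = of_real c * (\<i> * of_real pi / 2) * exp (- (\<i> * (of_real pi * of_real s / 2)))" for s :: real
    have "t < -1 \<or> (-1 < t \<and> t < 1) \<or> 1 < t" using t by auto
    then consider "t < -1" | "-1 < t" "t < 1" | "1 < t" by blast
    then show ?thesis
    proof cases
      case 1
      have "((\<lambda>s. -1::complex) \<longlongrightarrow> -1) (at t)" by (rule tendsto_const)
      then have "(hookd c \<longlongrightarrow> -1) (at t)"
        by (rule Lim_transform_within_open[OF _ open_lessThan[of "-1"]]) (use 1 in \<open>auto simp: hookd_def\<close>)
      then show ?thesis using 1 by (simp add: isCont_def hookd_def)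
    next
      case 2
      have "(m \<longlongrightarrow> m t) (at t)" unfolding m_def by (intro tendsto_intros) auto
      then have "(hookd c \<longlongrightarrow> m t) (at t)"
        by (rule Lim_transform_within_open[OF _ open_greaterThanLessThan[of "-1" 1]]) (use 2 in \<open>auto simp: hookd_def m_def\<close>)
      then show ?thesis using 2 by (simp add: isCont_def hookd_def m_def)
    next
      case 3
      have "((\<lambda>s. 1::complex) \<longlongrightarrow> 1) (at t)" by (rule tendsto_const)
      then have "(hookd c \<longlongrightarrow> 1) (at t)"
        by (rule Lim_transform_within_open[OF _ open_greaterThan[of 1]]) (use 3 in \<open>auto simp: hookd_def\<close>)
      then show ?thesis using 3 by (simp add: isCont_def hookd_def)
    qed
  qed
  then show ?thesis by (simp add: continuous_at_imp_continuous_on)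
qed

section \<open>Contour integrals as limits of differences of a primitive\<close>

lemma integrable_exp_bounded:
  fixes f :: "real => complex"
  assumes "finite S" and cont: "continuous_on (- S) f" and "0 < \<delta>"
    and bound: "\<And>t. t \<notin> S ==> cmod (f t) \<le> C * exp (- \<delta> * \<bar>t\<bar>)"
  shows "integrable lborel f"
proof (rule Bochner_Integration.integrable_bound[OF integrable_exp_abs[OF \<open>0 < \<delta>\<close>, of C]])
  have "open (- S)" using \<open>finite S\<close> by (simp add: finite_imp_closed open_Compl)
  have "(\<lambda>t. if t \<in> - S then f t else 0) \<in> borel_measurable borel"
    by (rule borel_measurable_continuous_on_if[OF borel_open[OF \<open>open (- S)\<close>] cont continuous_on_const])
  then have "f \<in> borel_measurable borel"
    by (rule measurable_discrete_difference[where X = S]) (use \<open>finite S\<close> in \<open>auto intro: countable_finite\<close>)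
  then show "f \<in> borel_measurable lborel" by simp
  show "AE t in lborel. cmod (f t) \<le> norm (C * exp (- \<delta> * \<bar>t\<bar>))"
  proof (rule AE_I'[OF finite_imp_null_set_lborel[OF \<open>finite S\<close>]])
    have "cmod (f t) \<le> norm (C * exp (- \<delta> * \<bar>t\<bar>))" if "t \<notin> S" for t
      unfolding real_norm_def by (rule order_trans[OF bound[OF that] abs_ge_self])
    then show "{t \<in> space lborel. \<not> cmod (f t) \<le> norm (C * exp (- \<delta> * \<bar>t\<bar>))} \<subseteq> S" by blast
  qed
qed

text \<open>The fundamental theorem of calculus on \<open>[-r, r]\<close> leaves the values of the
  primitive at the two ends, which lie on one vertical line; dominated convergence handles the
  limit. The domain is kept general because the logarithm used later has a cut other than the
  half-line.\<close>

lemma hook_integral: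
  fixes \<psi> \<Psi> :: "complex => complex"
  assumes "0 < c" and hook: "\<And>t. hook a c t \<in> \<Omega>"
    and deriv: "\<And>z. z \<in> \<Omega> ==> (\<Psi> has_field_derivative \<psi> z) (at z)" and cont: "continuous_on \<Omega> \<psi>"
    and "0 < \<delta>" and bound: "\<And>t. 1 < \<bar>t\<bar> ==> cmod (\<psi> (hook a c t)) \<le> C * exp (- \<delta> * \<bar>t\<bar>)"
  shows "integrable lborel (\<lambda>t. hookd c t * \<psi> (hook a c t))" (is "integrable lborel ?F")
    and "((\<lambda>R. \<Psi> (Complex R c) - \<Psi> (Complex R (- c))) \<longlongrightarrow> (LINT t|lborel. hookd c t * \<psi> (hook a c t))) at_top"
proof -
  have cont_comp: "continuous_on UNIV (\<lambda>t. \<psi> (hook a c t))"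
    by (rule continuous_on_compose2[OF cont continuous_hook]) (use hook in auto)
  have "compact ((\<lambda>t. \<psi> (hook a c t)) ` {-1..1})"
    by (intro compact_continuous_image continuous_on_subset[OF cont_comp]) auto
  then have "bounded ((\<lambda>t. \<psi> (hook a c t)) ` {-1..1})" by (rule compact_imp_bounded)
  then obtain B where B: "\<And>t. t \<in> {-1..1} ==> cmod (\<psi> (hook a c t)) \<le> B"
    unfolding bounded_iff by blast
  \<comment> \<open>On \<open>[-1, 1]\<close> the bound \<open>B\<close> is written as
    \<open>B * exp \<delta> * exp (- \<delta>)\<close>, so that one exponential majorant serves on
    the whole line.\<close>
  define C' where "C' = max \<bar>C\<bar> (\<bar>B\<bar> * exp \<delta>)"
  have bound': "cmod (\<psi> (hook a c t)) \<le> C' * exp (- \<delta> * \<bar>t\<bar>)" for t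
  proof (cases "1 < \<bar>t\<bar>")
    case True
    have "C * exp (- \<delta> * \<bar>t\<bar>) \<le> C' * exp (- \<delta> * \<bar>t\<bar>)" by (rule mult_right_mono) (auto simp: C'_def)
    then show ?thesis using bound[OF True] by linarith
  next
    case False
    then have "cmod (\<psi> (hook a c t)) \<le> \<bar>B\<bar>" using B[of t] by fastforce
    also have "\<dots> = \<bar>B\<bar> * exp \<delta> * exp (- \<delta>)" by (simp add: exp_minus)
    also have "\<dots> \<le> C' * exp (- \<delta>)" by (rule mult_right_mono) (auto simp: C'_def)
    also have "\<dots> \<le> C' * exp (- \<delta> * \<bar>t\<bar>)"
      using False \<open>0 < \<delta>\<close> by (intro mult_left_mono) (auto simp: C'_def)
    finally show ?thesis .
  qed
  have boundF: "cmod (?F t) \<le> ((1 + 2 * c) * C') * exp (- \<delta> * \<bar>t\<bar>)" for t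
    using mult_mono[OF cmod_hookd[of c t] bound'[of t]] \<open>0 < c\<close> by (simp add: norm_mult mult.assoc)
  show int: "integrable lborel ?F"
    by (rule integrable_exp_bounded[of "{-1, 1}", OF _ _ \<open>0 < \<delta>\<close> boundF])
       (auto intro!: continuous_intros continuous_hookd continuous_on_subset[OF cont_comp])
  have \<Psi>cont: "continuous_on \<Omega> \<Psi>"
    by (intro continuous_at_imp_continuous_on ballI DERIV_isCont[OF deriv])
  have part: "(LINT t:{-r..r}|lborel. ?F t) = \<Psi> (Complex (a + r - 1) c) - \<Psi> (Complex (a + r - 1) (- c))" if "1 \<le> r" for r
  proof -
    have "(?F has_integral ((\<Psi> \<circ> hook a c) r - (\<Psi> \<circ> hook a c) (- r))) {-r..r}"
    proof (rule fundamental_theorem_of_calculus_interior_strong[where S = "{-1, 1}"])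
      show "((\<Psi> \<circ> hook a c) has_vector_derivative ?F t) (at t)" if "t \<in> {- r<..<r} - {-1, 1}" for t
        using that by (intro field_vector_diff_chain_at hook_deriv deriv hook) auto
      show "continuous_on {- r..r} (\<Psi> \<circ> hook a c)"
        unfolding comp_def by (rule continuous_on_compose2[OF \<Psi>cont continuous_hook]) (use hook in auto)
    qed (use that in auto)
    moreover have "set_integrable lborel {-r..r} ?F"
      unfolding set_integrable_def using int by (intro integrable_mult_indicator) auto
    ultimately show ?thesis
      using that by (simp add: set_borel_integral_eq_integral(2) integral_unique hook_right hook_left)
  qed
  have "((\<lambda>r. LINT t|lborel. indicator {-r..r} t *\<^sub>R ?F t) \<longlongrightarrow> integral\<^sup>L lborel ?F) at_top"
  proof (rule integral_dominated_convergence_at_top[where w = "\<lambda>t. cmod (?F t)"])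
    show "AE t in lborel. ((\<lambda>r. indicator {-r..r} t *\<^sub>R ?F t) \<longlongrightarrow> ?F t) at_top"
    proof (rule AE_I2)
      fix t :: real
      show "((\<lambda>r. indicator {-r..r} t *\<^sub>R ?F t) \<longlongrightarrow> ?F t) at_top"
      proof (rule tendsto_eventually)
        show "\<forall>\<^sub>F r in at_top. indicator {-r..r} t *\<^sub>R ?F t = ?F t"
          using eventually_ge_at_top[of "\<bar>t\<bar>"] by eventually_elim (auto simp: indicator_def)
      qed
    qed
    show "\<forall>\<^sub>F r in at_top. AE t in lborel. norm (indicator {-r..r} t *\<^sub>R ?F t) \<le> cmod (?F t)"
      by (auto simp: indicator_def)
    show "integrable lborel (\<lambda>t. cmod (?F t))" using int by (rule integrable_norm)
  qed (use int in \<open>auto intro: borel_measurable_integrable\<close>)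
  then have "((\<lambda>r. \<Psi> (Complex (a + r - 1) c) - \<Psi> (Complex (a + r - 1) (- c))) \<longlongrightarrow> integral\<^sup>L lborel ?F) at_top"
  proof (rule Lim_transform_eventually)
    show "\<forall>\<^sub>F r in at_top. (LINT t|lborel. indicator {-r..r} t *\<^sub>R ?F t) = \<Psi> (Complex (a + r - 1) c) - \<Psi> (Complex (a + r - 1) (- c))"
      using eventually_ge_at_top[of 1] by eventually_elim (use part in \<open>simp add: set_lebesgue_integral_def\<close>)
  qed
  \<comment> \<open>The ends have real part \<open>a + r - 1\<close>; substituting
    \<open>r = (1 - a) + R\<close> makes the real part itself the limit variable, so limits for
    different \<open>a\<close> become comparable.\<close>
  then have "((\<lambda>R. \<Psi> (Complex (a + ((1 - a) + R) - 1) c) - \<Psi> (Complex (a + ((1 - a) + R) - 1) (- c))) \<longlongrightarrow> integral\<^sup>L lborel ?F) at_top"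
    by (rule filterlim_compose) (rule filterlim_tendsto_add_at_top[OF tendsto_const filterlim_ident])
  then show "((\<lambda>R. \<Psi> (Complex R c) - \<Psi> (Complex R (- c))) \<longlongrightarrow> integral\<^sup>L lborel ?F) at_top"
    by simp
qed

text \<open>The mean value inequality along the vertical segment: its length is fixed while the
  derivative of the primitive decays as the segment moves to the right. Changes of contour are
  reduced to this estimate.\<close>

lemma vertical_limit:
  fixes \<psi> \<Psi> :: "complex => complex"
  assumes deriv: "\<And>R s. R0 \<le> R ==> s \<in> closed_segment y y' ==> (\<Psi> has_field_derivative \<psi> (Complex R s)) (at (Complex R s))"
    and bound: "\<And>R s. R0 \<le> R ==> s \<in> closed_segment y y' ==> cmod (\<psi> (Complex R s)) \<le> C * exp (- \<delta> * R)"
    and "0 < \<delta>"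
  shows "((\<lambda>R. \<Psi> (Complex R y) - \<Psi> (Complex R y')) \<longlongrightarrow> 0) at_top"
proof (rule Lim_null_comparison)
  have est: "cmod (\<Psi> (Complex R y) - \<Psi> (Complex R y')) \<le> C * exp (- \<delta> * R) * \<bar>y - y'\<bar>" if "R0 \<le> R" for R
  proof -
    have seg: "\<exists>s \<in> closed_segment y y'. z = Complex R s" if z: "z \<in> closed_segment (Complex R y) (Complex R y')" for z
    proof -
      obtain u where u: "0 \<le> u" "u \<le> 1" "z = (1 - u) *\<^sub>R Complex R y + u *\<^sub>R Complex R y'"
        using z unfolding closed_segment_def by blast
      have "z = Complex R ((1 - u) *\<^sub>R y + u *\<^sub>R y')" by (simp add: u(3) complex_eq_iff algebra_simps)
      moreover have "(1 - u) *\<^sub>R y + u *\<^sub>R y' \<in> closed_segment y y'" using u unfolding closed_segment_def by blast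
      ultimately show ?thesis by blast
    qed
    have "cmod (\<Psi> (Complex R y) - \<Psi> (Complex R y')) \<le> C * exp (- \<delta> * R) * cmod (Complex R y - Complex R y')"
    proof (rule field_differentiable_bound[OF convex_closed_segment])
      fix z assume "z \<in> closed_segment (Complex R y) (Complex R y')"
      then obtain s where s: "s \<in> closed_segment y y'" "z = Complex R s" using seg by blast
      show "(\<Psi> has_field_derivative \<psi> z) (at z within closed_segment (Complex R y) (Complex R y'))"
        unfolding s(2) by (rule has_field_derivative_at_within[OF deriv[OF that s(1)]])
      show "cmod (\<psi> z) \<le> C * exp (- \<delta> * R)" unfolding s(2) by (rule bound[OF that s(1)])
    qed auto
    also have "cmod (Complex R y - Complex R y') = \<bar>y - y'\<bar>" by (simp add: cmod_def)
    finally show ?thesis .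
  qed
  show "\<forall>\<^sub>F R in at_top. cmod (\<Psi> (Complex R y) - \<Psi> (Complex R y')) \<le> C * exp (- \<delta> * R) * \<bar>y - y'\<bar>"
    using eventually_ge_at_top[of R0] by eventually_elim (rule est)
  have "((\<lambda>R. exp (- \<delta> * R)) \<longlongrightarrow> 0) at_top"
    using \<open>0 < \<delta>\<close> by (intro filterlim_compose[OF exp_at_bot] filterlim_tendsto_neg_mult_at_bot[OF tendsto_const]) (auto intro: filterlim_ident)
  then have "((\<lambda>R. C * exp (- \<delta> * R) * \<bar>y - y'\<bar>) \<longlongrightarrow> C * 0 * \<bar>y - y'\<bar>) at_top"
    by (intro tendsto_intros)
  then show "((\<lambda>R. C * exp (- \<delta> * R) * \<bar>y - y'\<bar>) \<longlongrightarrow> 0) at_top" by simp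
qed

section \<open>Tempered growth and bounds for the Fourier kernel\<close>

text \<open>The part of the condition in \<open>Oexp\<close> that concerns the contour's ends: far
  to the right, away from the axis, at bounded height. It is stated for a real-valued function so
  that it covers seminorms as well as absolute values.\<close>

definition growth :: "real => (complex => real) => bool" where
  "growth a h \<longleftrightarrow> (\<forall>n\<ge>1. \<exists>C. \<forall>z. a \<le> Re z --> 1 / real n \<le> \<bar>Im z\<bar> --> \<bar>Im z\<bar> \<le> real n
     --> h z \<le> C * exp (\<bar>Re z\<bar> / real n))"

lemma growthD:
  assumes "growth a h" "1 \<le> n"
  obtains C where "0 \<le> C" "\<And>z. a \<le> Re z ==> 1 / real n \<le> \<bar>Im z\<bar> ==> \<bar>Im z\<bar> \<le> real n ==> h z \<le> C * exp (\<bar>Re z\<bar> / real n)"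
proof -
  obtain C where C: "\<And>z. a \<le> Re z ==> 1 / real n \<le> \<bar>Im z\<bar> ==> \<bar>Im z\<bar> \<le> real n ==> h z \<le> C * exp (\<bar>Re z\<bar> / real n)"
    using assms unfolding growth_def by blast
  have "h z \<le> \<bar>C\<bar> * exp (\<bar>Re z\<bar> / real n)" if "a \<le> Re z" "1 / real n \<le> \<bar>Im z\<bar>" "\<bar>Im z\<bar> \<le> real n" for z
    by (rule order_trans[OF C[OF that] mult_right_mono[OF abs_ge_self]]) simp
  then show thesis using that[of "\<bar>C\<bar>"] by simp
qed

lemma growth_mono: "growth a h ==> a \<le> b ==> growth b h"
  unfolding growth_def by (meson order_trans)

lemma growth_le: "growth a h ==> (\<And>z. g z \<le> K * h z) ==> 0 \<le> K ==> growth a g"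
  unfolding growth_def
proof (intro allI impI)
  fix n :: nat assume *: "\<forall>n\<ge>1. \<exists>C. \<forall>z. a \<le> Re z --> 1 / real n \<le> \<bar>Im z\<bar> --> \<bar>Im z\<bar> \<le> real n --> h z \<le> C * exp (\<bar>Re z\<bar> / real n)"
    and K: "\<And>z. g z \<le> K * h z" "0 \<le> K" and "1 \<le> n"
  then obtain C where C: "\<And>z. a \<le> Re z ==> 1 / real n \<le> \<bar>Im z\<bar> ==> \<bar>Im z\<bar> \<le> real n ==> h z \<le> C * exp (\<bar>Re z\<bar> / real n)"
    by meson
  show "\<exists>C. \<forall>z. a \<le> Re z --> 1 / real n \<le> \<bar>Im z\<bar> --> \<bar>Im z\<bar> \<le> real n --> g z \<le> C * exp (\<bar>Re z\<bar> / real n)"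
  proof (intro exI[of _ "K * C"] allI impI)
    fix z assume "a \<le> Re z" "1 / real n \<le> \<bar>Im z\<bar>" "\<bar>Im z\<bar> \<le> real n"
    from mult_left_mono[OF C[OF this] K(2)] K(1)[of z]
    show "g z \<le> K * C * exp (\<bar>Re z\<bar> / real n)" by (simp add: mult.assoc)
  qed
qed

lemma growth_add: "growth a g ==> growth a h ==> growth a (\<lambda>z. g z + h z)"
  unfolding growth_def
proof (intro allI impI)
  fix n :: nat assume *: "\<forall>n\<ge>1. \<exists>C. \<forall>z. a \<le> Re z --> 1 / real n \<le> \<bar>Im z\<bar> --> \<bar>Im z\<bar> \<le> real n --> g z \<le> C * exp (\<bar>Re z\<bar> / real n)"
    "\<forall>n\<ge>1. \<exists>C. \<forall>z. a \<le> Re z --> 1 / real n \<le> \<bar>Im z\<bar> --> \<bar>Im z\<bar> \<le> real n --> h z \<le> C * exp (\<bar>Re z\<bar> / real n)"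
    and "1 \<le> n"
  then obtain C D where C: "\<And>z. a \<le> Re z ==> 1 / real n \<le> \<bar>Im z\<bar> ==> \<bar>Im z\<bar> \<le> real n ==> g z \<le> C * exp (\<bar>Re z\<bar> / real n)"
    and D: "\<And>z. a \<le> Re z ==> 1 / real n \<le> \<bar>Im z\<bar> ==> \<bar>Im z\<bar> \<le> real n ==> h z \<le> D * exp (\<bar>Re z\<bar> / real n)"
    by meson
  show "\<exists>C. \<forall>z. a \<le> Re z --> 1 / real n \<le> \<bar>Im z\<bar> --> \<bar>Im z\<bar> \<le> real n --> g z + h z \<le> C * exp (\<bar>Re z\<bar> / real n)"
  proof (intro exI[of _ "C + D"] allI impI)
    fix z assume "a \<le> Re z" "1 / real n \<le> \<bar>Im z\<bar>" "\<bar>Im z\<bar> \<le> real n"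
    from C[OF this] D[OF this]
    show "g z + h z \<le> (C + D) * exp (\<bar>Re z\<bar> / real n)" by (simp add: distrib_right)
  qed
qed

lemma exp_kernel: "cmod (exp (- \<i> * z * \<zeta>)) = exp (Re z * Im \<zeta> + Im z * Re \<zeta>)"
  by (simp add: norm_exp_eq_Re)

lemma nat_large:
  assumes "0 < (\<epsilon>::real)"
  obtains n :: nat where "1 \<le> n" "x \<le> real n" "1 / real n \<le> \<epsilon>"
proof -
  obtain n :: nat where n: "max (max 1 x) (1 / \<epsilon>) \<le> real n" using real_arch_simple by blast
  show thesis
  proof (rule that)
    show "1 \<le> n" "x \<le> real n" using n by auto
    have "1 / \<epsilon> \<le> real n" "1 \<le> real n" using n by auto
    then show "1 / real n \<le> \<epsilon>" using assms by (simp add: field_simps)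
  qed
qed

text \<open>A single bound serves both purposes: the factor in \<zeta> yields the growth of the
  transform, the factor in \<open>t\<close> its convergence. On the ends,
  \<open>\<bar>Im \<zeta>\<bar> \<ge> 1 / k\<close> gives decay of rate \<open>1 / k\<close> in
  \<open>t\<close>, and half of this rate pays for the growth of \<open>h\<close>.\<close>

lemma kernel_bound:
  assumes cont: "continuous_on (slit a) h" and pos: "\<And>z. 0 \<le> h z" and growth: "growth a h"
    and "0 < c" and "1 \<le> k"
  obtains C where "0 \<le> C"
    "\<And>\<zeta> t. Im \<zeta> \<le> - (1 / k) ==> t \<notin> {-1, 1} ==> cmod (hookd c t * exp (- \<i> * hook a c t * \<zeta>)) * h (hook a c t)
       \<le> C * exp (c * \<bar>Re \<zeta>\<bar> - (a - c) * \<bar>Im \<zeta>\<bar>) * exp (- (1 / (2 * k)) * \<bar>t\<bar>)"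
proof -
  \<comment> \<open>The index \<open>n\<close> is so large that the height \<open>c\<close> lies
    between \<open>1 / n\<close> and \<open>n\<close> and that the growth rate \<open>1 / n\<close>
    is at most half of \<open>1 / k\<close>.\<close>
  obtain n :: nat where n: "1 \<le> n" "c \<le> real n" "1 / real n \<le> min c (1 / (2 * k))"
    using nat_large[of "min c (1 / (2 * k))" c] \<open>0 < c\<close> \<open>1 \<le> k\<close> by auto
  obtain D where D: "0 \<le> D" "\<And>z. a \<le> Re z ==> 1 / real n \<le> \<bar>Im z\<bar> ==> \<bar>Im z\<bar> \<le> real n ==> h z \<le> D * exp (\<bar>Re z\<bar> / real n)"
    using growthD[OF growth n(1)] by blast
  have "compact ((\<lambda>t. h (hook a c t)) ` {-1..1})"
    by (intro compact_continuous_image continuous_on_compose2[OF cont continuous_hook] compact_Icc)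
       (use hook_slit[OF \<open>0 < c\<close>] in auto)
  then have "bounded ((\<lambda>t. h (hook a c t)) ` {-1..1})" by (rule compact_imp_bounded)
  then obtain B where "0 < B" and B': "\<And>y. y \<in> (\<lambda>t. h (hook a c t)) ` {-1..1} ==> norm y \<le> B"
    unfolding bounded_pos by blast
  have B: "\<And>t. t \<in> {-1..1} ==> h (hook a c t) \<le> B" "0 \<le> B"
    using B'[OF imageI] \<open>0 < B\<close> pos by fastforce+
  \<comment> \<open>The first entry belongs to the straight pieces, where
    \<open>exp \<bar>a\<bar>\<close> and \<open>exp 1\<close> absorb bounded shifts of the exponent.
    The second belongs to the arc, where \<open>1 + 2 c\<close> bounds the derivative and
    \<open>exp 1\<close> compensates \<open>exp (- 1)\<close>.\<close>
  define C where "C = max (D * exp (\<bar>a\<bar>) * exp 1) ((1 + 2 * c) * B * exp 1)"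
  have "0 \<le> C" using D(1) by (simp add: C_def le_max_iff_disj)
  have main: "cmod (hookd c t * exp (- \<i> * hook a c t * \<zeta>)) * h (hook a c t)
       \<le> C * exp (c * \<bar>Re \<zeta>\<bar> - (a - c) * \<bar>Im \<zeta>\<bar>) * exp (- (1 / (2 * k)) * \<bar>t\<bar>)"
    if \<zeta>: "Im \<zeta> \<le> - (1 / k)" and t: "t \<notin> {-1, 1}" for \<zeta> t
  proof -
    define w where "w = hook a c t"
    define \<eta> where "\<eta> = \<bar>Im \<zeta>\<bar>"
    have "0 < 1 / k" using \<open>1 \<le> k\<close> by simp
    then have "Im \<zeta> < 0" using \<zeta> by linarith
    then have \<eta>: "Im \<zeta> = - \<eta>" "1 / k \<le> \<eta>" using \<zeta> unfolding \<eta>_def by linarith+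
    have "\<bar>Im w * Re \<zeta>\<bar> \<le> c * \<bar>Re \<zeta>\<bar>"
      unfolding abs_mult using Im_hook_le[of c a t] \<open>0 < c\<close> by (intro mult_right_mono) (auto simp: w_def)
    then have e1: "cmod (exp (- \<i> * w * \<zeta>)) \<le> exp (c * \<bar>Re \<zeta>\<bar> - Re w * \<eta>)"
      unfolding exp_kernel \<eta>(1) by simp
    show ?thesis
    proof (cases "1 \<le> \<bar>t\<bar>")
      case True
      have "t \<le> -1 \<or> 1 \<le> t" using True by linarith
      then have Re_w: "Re w = a + (\<bar>t\<bar> - 1)" and Im_w: "\<bar>Im w\<bar> = c"
        using \<open>0 < c\<close> by (auto simp: w_def hook_left hook_right)
      have h: "h w \<le> D * exp (\<bar>Re w\<bar> / real n)"
        using True n by (intro D) (auto simp: Re_w Im_w)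
      define A where "A = 1 / (2 * k)"
      have f1: "\<bar>Re w\<bar> / real n \<le> \<bar>a\<bar> + (\<bar>t\<bar> - 1) * A"
      proof -
        have "\<bar>Re w\<bar> / real n \<le> (\<bar>a\<bar> + (\<bar>t\<bar> - 1)) * (1 / real n)"
          using True n(1) by (simp add: Re_w divide_right_mono)
        also have "\<dots> = \<bar>a\<bar> * (1 / real n) + (\<bar>t\<bar> - 1) * (1 / real n)" by (rule distrib_right)
        also have "\<dots> \<le> \<bar>a\<bar> * 1 + (\<bar>t\<bar> - 1) * A"
          using True n unfolding A_def by (intro add_mono mult_left_mono) auto
        finally show ?thesis by simp
      qed
      have "2 * A \<le> \<eta>" using \<eta>(2) by (simp add: A_def)
      then have f2: "(\<bar>t\<bar> - 1) * (2 * A) \<le> (\<bar>t\<bar> - 1) * \<eta>" using True by (intro mult_left_mono) auto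
      have f3: "A \<le> 1" using \<open>1 \<le> k\<close> by (simp add: A_def)
      have f4: "0 \<le> c * \<eta>" using \<open>0 < c\<close> by (simp add: \<eta>_def)
      have f5: "(\<bar>t\<bar> - 1) * A = \<bar>t\<bar> * A - A" "(\<bar>t\<bar> - 1) * (2 * A) = 2 * (\<bar>t\<bar> * A) - 2 * A"
        "Re w * \<eta> = a * \<eta> + (\<bar>t\<bar> - 1) * \<eta>" "(a - c) * \<eta> = a * \<eta> - c * \<eta>" "- A * \<bar>t\<bar> = - (\<bar>t\<bar> * A)"
        by (simp_all add: Re_w algebra_simps)
      have ex: "(c * \<bar>Re \<zeta>\<bar> - Re w * \<eta>) + \<bar>Re w\<bar> / real n
          \<le> (\<bar>a\<bar> + 1) + ((c * \<bar>Re \<zeta>\<bar> - (a - c) * \<eta>) + (- (1 / (2 * k)) * \<bar>t\<bar>))"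
        unfolding A_def[symmetric] f5(3,4,5) using f1 f2 f3 f4 unfolding f5(1,2) by linarith
      have "cmod (hookd c t * exp (- \<i> * w * \<zeta>)) * h w \<le> exp (c * \<bar>Re \<zeta>\<bar> - Re w * \<eta>) * (D * exp (\<bar>Re w\<bar> / real n))"
        unfolding norm_mult hookd_outside[OF t True] using e1 h pos by (intro mult_mono) auto
      also have "\<dots> = D * exp ((c * \<bar>Re \<zeta>\<bar> - Re w * \<eta>) + \<bar>Re w\<bar> / real n)" by (simp add: exp_add)
      also have "\<dots> \<le> D * exp ((\<bar>a\<bar> + 1) + ((c * \<bar>Re \<zeta>\<bar> - (a - c) * \<eta>) + (- (1 / (2 * k)) * \<bar>t\<bar>)))"
        using ex D(1) by (intro mult_left_mono) auto
      also have "\<dots> = (D * exp \<bar>a\<bar> * exp 1) * (exp (c * \<bar>Re \<zeta>\<bar> - (a - c) * \<eta>) * exp (- (1 / (2 * k)) * \<bar>t\<bar>))"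
        by (simp only: exp_add mult.assoc)
      also have "\<dots> \<le> C * (exp (c * \<bar>Re \<zeta>\<bar> - (a - c) * \<eta>) * exp (- (1 / (2 * k)) * \<bar>t\<bar>))"
        by (rule mult_right_mono) (auto simp: C_def)
      finally show ?thesis by (simp add: w_def \<eta>_def mult.assoc)
    next
      case False
      have h: "h w \<le> B" unfolding w_def using False by (intro B) auto
      have "(a - c) * \<eta> \<le> Re w * \<eta>"
        using Re_hook_ge[of c a t] \<open>0 < c\<close> by (intro mult_right_mono) (auto simp: w_def \<eta>_def)
      then have "cmod (exp (- \<i> * w * \<zeta>)) \<le> exp (c * \<bar>Re \<zeta>\<bar> - (a - c) * \<eta>)"
        by (intro order_trans[OF e1]) simp
      then have "cmod (hookd c t * exp (- \<i> * w * \<zeta>)) * h w \<le> ((1 + 2 * c) * exp (c * \<bar>Re \<zeta>\<bar> - (a - c) * \<eta>)) * B"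
        unfolding norm_mult using h pos cmod_hookd[of c t] \<open>0 < c\<close> by (intro mult_mono) auto
      also have "\<dots> = ((1 + 2 * c) * B * exp 1) * (exp (c * \<bar>Re \<zeta>\<bar> - (a - c) * \<eta>) * exp (- 1))"
        by (simp add: exp_minus field_simps)
      also have "\<dots> \<le> C * (exp (c * \<bar>Re \<zeta>\<bar> - (a - c) * \<eta>) * exp (- 1))"
        by (rule mult_right_mono) (auto simp: C_def)
      also have "\<dots> \<le> C * (exp (c * \<bar>Re \<zeta>\<bar> - (a - c) * \<eta>) * exp (- (1 / (2 * k)) * \<bar>t\<bar>))"
      proof -
        have "1 / (2 * k) * \<bar>t\<bar> \<le> 1 * 1" using False \<open>1 \<le> k\<close> by (intro mult_mono) auto
        then show ?thesis using \<open>0 \<le> C\<close> by (intro mult_left_mono) auto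
      qed
      finally show ?thesis by (simp add: w_def \<eta>_def mult.assoc)
    qed
  qed
  show thesis by (rule that[OF \<open>0 \<le> C\<close> main])
qed

section \<open>The scalar Fourier integral\<close>

definition kint :: "real => real => (complex => complex) => complex => complex" where
  "kint a c \<phi> \<zeta> = (LINT t|lborel. hookd c t * (exp (- \<i> * hook a c t * \<zeta>) * \<phi> (hook a c t)))"

lemma kernel_decay:
  assumes hol: "\<phi> holomorphic_on slit a" and gr: "growth a (\<lambda>z. cmod (\<phi> z))" and \<zeta>: "Im \<zeta> < 0" and "0 < c"
  obtains C \<delta> where "0 < \<delta>" "\<And>t. 1 < \<bar>t\<bar> ==> cmod (exp (- \<i> * hook a c t * \<zeta>) * \<phi> (hook a c t)) \<le> C * exp (- \<delta> * \<bar>t\<bar>)"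
proof -
  obtain n :: nat where n: "1 \<le> n" "0 \<le> real n" "1 / real n \<le> - Im \<zeta>"
    using nat_large[of "- Im \<zeta>" 0] \<zeta> by auto
  have n1: "1 \<le> real n" using n(1) by simp
  obtain C where C: "\<And>\<zeta> t. Im \<zeta> \<le> - (1 / real n) ==> t \<notin> {-1, 1} ==> cmod (hookd c t * exp (- \<i> * hook a c t * \<zeta>)) * cmod (\<phi> (hook a c t))
       \<le> C * exp (c * \<bar>Re \<zeta>\<bar> - (a - c) * \<bar>Im \<zeta>\<bar>) * exp (- (1 / (2 * real n)) * \<bar>t\<bar>)"
    using kernel_bound[OF continuous_on_norm[OF holomorphic_on_imp_continuous_on[OF hol]] norm_ge_zero gr \<open>0 < c\<close> n1] by metis
  show thesis
  proof (rule that)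
    show "0 < 1 / (2 * real n)" using n(1) by simp
    fix t :: real assume t: "1 < \<bar>t\<bar>"
    have "t \<notin> {-1, 1}" using t by auto
    from C[OF _ this, of \<zeta>] n(3) hookd_outside[OF this] t
    show "cmod (exp (- \<i> * hook a c t * \<zeta>) * \<phi> (hook a c t))
        \<le> C * exp (c * \<bar>Re \<zeta>\<bar> - (a - c) * \<bar>Im \<zeta>\<bar>) * exp (- (1 / (2 * real n)) * \<bar>t\<bar>)"
      by (simp add: norm_mult)
  qed
qed

lemma kint_limit:
  assumes hol: "\<phi> holomorphic_on slit a" and gr: "growth a (\<lambda>z. cmod (\<phi> z))" and \<zeta>: "Im \<zeta> < 0" and "0 < c"
    and \<Psi>: "\<And>z. z \<in> slit a ==> (\<Psi> has_field_derivative exp (- \<i> * z * \<zeta>) * \<phi> z) (at z)"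
  shows "((\<lambda>R. \<Psi> (Complex R c) - \<Psi> (Complex R (- c))) \<longlongrightarrow> kint a c \<phi> \<zeta>) at_top"
proof -
  obtain C \<delta> where "0 < \<delta>" "\<And>t. 1 < \<bar>t\<bar> ==> cmod (exp (- \<i> * hook a c t * \<zeta>) * \<phi> (hook a c t)) \<le> C * exp (- \<delta> * \<bar>t\<bar>)"
    using kernel_decay[OF hol gr \<zeta> \<open>0 < c\<close>] by metis
  then show ?thesis
    unfolding kint_def using holomorphic_on_imp_continuous_on[OF hol]
    by (intro hook_integral(2)[OF \<open>0 < c\<close> hook_slit[OF \<open>0 < c\<close>] \<Psi>]) (auto intro!: continuous_intros)
qed

lemma kint_integrable:
  assumes hol: "\<phi> holomorphic_on slit a" and gr: "growth a (\<lambda>z. cmod (\<phi> z))" and \<zeta>: "Im \<zeta> < 0" and "0 < c"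
  shows "integrable lborel (\<lambda>t. hookd c t * (exp (- \<i> * hook a c t * \<zeta>) * \<phi> (hook a c t)))"
proof -
  have "(\<lambda>z. exp (- \<i> * z * \<zeta>) * \<phi> z) holomorphic_on slit a" using hol by (intro holomorphic_intros)
  then obtain \<Psi> where \<Psi>: "\<And>z. z \<in> slit a ==> (\<Psi> has_field_derivative exp (- \<i> * z * \<zeta>) * \<phi> z) (at z)"
    by (rule slit_primitive) (rule that)
  obtain C \<delta> where "0 < \<delta>" "\<And>t. 1 < \<bar>t\<bar> ==> cmod (exp (- \<i> * hook a c t * \<zeta>) * \<phi> (hook a c t)) \<le> C * exp (- \<delta> * \<bar>t\<bar>)"
    using kernel_decay[OF hol gr \<zeta> \<open>0 < c\<close>] by metis
  then show ?thesis
    using holomorphic_on_imp_continuous_on[OF hol]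
    by (intro hook_integral(1)[OF \<open>0 < c\<close> hook_slit[OF \<open>0 < c\<close>] \<Psi>]) (auto intro!: continuous_intros)
qed

lemma kint_linear:
  assumes "\<phi> holomorphic_on slit a" "growth a (\<lambda>z. cmod (\<phi> z))" "\<theta> holomorphic_on slit a" "growth a (\<lambda>z. cmod (\<theta> z))"
    and "Im \<zeta> < 0" "0 < c"
  shows "kint a c (\<lambda>z. x * \<phi> z + y * \<theta> z) \<zeta> = x * kint a c \<phi> \<zeta> + y * kint a c \<theta> \<zeta>"
proof -
  have "kint a c (\<lambda>z. x * \<phi> z + y * \<theta> z) \<zeta> = (LINT t|lborel. x * (hookd c t * (exp (- \<i> * hook a c t * \<zeta>) * \<phi> (hook a c t)))
      + y * (hookd c t * (exp (- \<i> * hook a c t * \<zeta>) * \<theta> (hook a c t))))"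
    unfolding kint_def by (rule Bochner_Integration.integral_cong) (auto simp: algebra_simps)
  also have "\<dots> = x * kint a c \<phi> \<zeta> + y * kint a c \<theta> \<zeta>"
    unfolding kint_def using kint_integrable[OF assms(1,2,5,6)] kint_integrable[OF assms(3,4,5,6)]
    by (subst Bochner_Integration.integral_add) auto
  finally show ?thesis .
qed

lemma kint_cong: "0 < c ==> (\<And>z. z \<in> slit a ==> \<phi> z = \<theta> z) ==> kint a c \<phi> \<zeta> = kint a c \<theta> \<zeta>"
  unfolding kint_def by (simp add: hook_slit)

text \<open>Growth of rate at most half of \<open>- Im \<zeta>\<close> is outweighed by the
  exponential kernel, which leaves the other half as decay. The set \<open>S\<close> of heights must
  stay away from 0, since nothing is assumed near the half-line.\<close>

lemma growth_vertical:
  assumes gr: "growth a (\<lambda>z. cmod (\<phi> z))" and \<zeta>: "Im \<zeta> < 0" and "0 < l"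
    and seg: "\<And>s. s \<in> S ==> l \<le> \<bar>s\<bar>" "\<And>s. s \<in> S ==> \<bar>s\<bar> \<le> u"
  obtains C \<delta> where "0 < \<delta>" "\<And>R s. max a 0 \<le> R ==> s \<in> S ==> cmod (exp (- \<i> * Complex R s * \<zeta>) * \<phi> (Complex R s)) \<le> C * exp (- \<delta> * R)"
proof -
  define \<eta> where "\<eta> = - Im \<zeta>"
  obtain n :: nat where n: "1 \<le> n" "u \<le> real n" "1 / real n \<le> min l (\<eta> / 2)"
    using nat_large[of "min l (\<eta> / 2)" u] \<zeta> \<open>0 < l\<close> by (auto simp: \<eta>_def)
  obtain D where D: "0 \<le> D" "\<And>z. a \<le> Re z ==> 1 / real n \<le> \<bar>Im z\<bar> ==> \<bar>Im z\<bar> \<le> real n ==> cmod (\<phi> z) \<le> D * exp (\<bar>Re z\<bar> / real n)"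
    using growthD[OF gr n(1)] by metis
  show thesis
  proof (rule that)
    show "0 < \<eta> / 2" using \<zeta> by (simp add: \<eta>_def)
    fix R s :: real assume R: "max a 0 \<le> R" and s: "s \<in> S"
    have ls: "l \<le> \<bar>s\<bar>" "\<bar>s\<bar> \<le> u" using seg s by auto
    have "cmod (\<phi> (Complex R s)) \<le> D * exp (\<bar>R\<bar> / real n)"
      using D(2)[of "Complex R s"] ls n R by auto
    also have "\<dots> \<le> D * exp (R * (\<eta> / 2))"
    proof -
      have "R * (1 / real n) \<le> R * (\<eta> / 2)" using n R by (intro mult_left_mono) auto
      then show ?thesis using R D(1) by (intro mult_left_mono) auto
    qed
    finally have 1: "cmod (\<phi> (Complex R s)) \<le> D * exp (R * (\<eta> / 2))" .
    have "\<bar>s * Re \<zeta>\<bar> \<le> u * \<bar>Re \<zeta>\<bar>" unfolding abs_mult using ls by (intro mult_right_mono) auto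
    then have 2: "cmod (exp (- \<i> * Complex R s * \<zeta>)) \<le> exp (- R * \<eta> + u * \<bar>Re \<zeta>\<bar>)"
      unfolding exp_kernel by (simp add: \<eta>_def)
    have "cmod (exp (- \<i> * Complex R s * \<zeta>) * \<phi> (Complex R s)) \<le> exp (- R * \<eta> + u * \<bar>Re \<zeta>\<bar>) * (D * exp (R * (\<eta> / 2)))"
      unfolding norm_mult using 1 2 by (intro mult_mono) auto
    also have "\<dots> = D * exp ((- R * \<eta> + u * \<bar>Re \<zeta>\<bar>) + R * (\<eta> / 2))" by (simp only: exp_add mult_ac)
    also have "(- R * \<eta> + u * \<bar>Re \<zeta>\<bar>) + R * (\<eta> / 2) = u * \<bar>Re \<zeta>\<bar> + - (\<eta> / 2) * R" by (simp add: algebra_simps)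
    also have "D * exp \<dots> = D * exp (u * \<bar>Re \<zeta>\<bar>) * exp (- (\<eta> / 2) * R)" by (simp only: exp_add mult.assoc)
    finally show "cmod (exp (- \<i> * Complex R s * \<zeta>) * \<phi> (Complex R s)) \<le> (D * exp (u * \<bar>Re \<zeta>\<bar>)) * exp (- (\<eta> / 2) * R)" .
  qed
qed

text \<open>Both integrals are limits of differences of the same primitive. The heights
  \<open>c\<close> and \<open>c'\<close> are joined by vertical segments above the axis (\<sigma> =
  1) and below it (\<sigma> = -1), where the growth condition is available.\<close>

lemma kint_indep:
  assumes hol: "\<phi> holomorphic_on slit a" and gr: "growth a (\<lambda>z. cmod (\<phi> z))" and \<zeta>: "Im \<zeta> < 0" and c: "0 < c" "0 < c'"
  shows "kint a c \<phi> \<zeta> = kint a c' \<phi> \<zeta>"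
proof -
  have "(\<lambda>z. exp (- \<i> * z * \<zeta>) * \<phi> z) holomorphic_on slit a" using hol by (intro holomorphic_intros)
  then obtain \<Psi> where \<Psi>: "\<And>z. z \<in> slit a ==> (\<Psi> has_field_derivative exp (- \<i> * z * \<zeta>) * \<phi> z) (at z)"
    by (rule slit_primitive) (rule that)
  have vert: "((\<lambda>R. \<Psi> (Complex R (\<sigma> * c)) - \<Psi> (Complex R (\<sigma> * c'))) \<longlongrightarrow> 0) at_top" if \<sigma>: "\<sigma> = 1 \<or> \<sigma> = -1" for \<sigma> :: real
  proof -
    have seg: "min c c' \<le> \<bar>s\<bar> \<and> \<bar>s\<bar> \<le> max c c'" if s: "s \<in> closed_segment (\<sigma> * c) (\<sigma> * c')" for s
      using s \<sigma> c by (auto simp: closed_segment_eq_real_ivl split: if_splits)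
    obtain C \<delta> where \<delta>: "0 < \<delta>" and C: "\<And>R s. max a 0 \<le> R ==> s \<in> closed_segment (\<sigma> * c) (\<sigma> * c') ==>
        cmod (exp (- \<i> * Complex R s * \<zeta>) * \<phi> (Complex R s)) \<le> C * exp (- \<delta> * R)"
      using growth_vertical[OF gr \<zeta>, of "min c c'" "closed_segment (\<sigma> * c) (\<sigma> * c')" "max c c'"] seg c
      by (metis min_less_iff_conj)
    show ?thesis
    proof (rule vertical_limit[OF _ C \<delta>])
      fix R s assume "s \<in> closed_segment (\<sigma> * c) (\<sigma> * c')"
      then have "s \<noteq> 0" using seg[of s] c by auto
      then show "(\<Psi> has_field_derivative exp (- \<i> * Complex R s * \<zeta>) * \<phi> (Complex R s)) (at (Complex R s))"
        by (intro \<Psi>) (simp add: slit_iff)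
    qed
  qed
  have l1: "((\<lambda>R. (\<Psi> (Complex R c) - \<Psi> (Complex R (- c))) - (\<Psi> (Complex R c') - \<Psi> (Complex R (- c'))))
     \<longlongrightarrow> kint a c \<phi> \<zeta> - kint a c' \<phi> \<zeta>) at_top"
    by (intro tendsto_diff kint_limit[OF hol gr \<zeta> _ \<Psi>] c)
  have l2: "((\<lambda>R. (\<Psi> (Complex R (1 * c)) - \<Psi> (Complex R (1 * c'))) - (\<Psi> (Complex R (-1 * c)) - \<Psi> (Complex R (-1 * c'))))
     \<longlongrightarrow> 0 - 0) at_top"
    by (intro tendsto_diff vert) auto
  have eq: "(\<Psi> (Complex R (1 * c)) - \<Psi> (Complex R (1 * c'))) - (\<Psi> (Complex R (-1 * c)) - \<Psi> (Complex R (-1 * c')))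
     = (\<Psi> (Complex R c) - \<Psi> (Complex R (- c))) - (\<Psi> (Complex R c') - \<Psi> (Complex R (- c')))" for R
    by simp
  have "kint a c \<phi> \<zeta> - kint a c' \<phi> \<zeta> = 0 - 0"
    by (rule tendsto_unique[OF trivial_limit_at_top_linorder l1 l2[unfolded eq]])
  then show ?thesis by simp
qed

lemma entire_primitive:
  assumes "\<psi> holomorphic_on UNIV"
  obtains \<Psi> where "\<And>z::complex. (\<Psi> has_field_derivative \<psi> z) (at z)"
  using holomorphic_convex_primitive'[OF convex_UNIV open_UNIV assms] by auto

text \<open>For an entire integrand the primitive is entire, and the limit in
  \<open>kint_limit\<close> involves only its values at the heights \<open>c\<close> and
  \<open>-c\<close>; the endpoint has disappeared from it.\<close>

lemma kint_shift:
  assumes hol: "\<phi> holomorphic_on UNIV" and gr: "growth a (\<lambda>z. cmod (\<phi> z))" and \<zeta>: "Im \<zeta> < 0" and c: "0 < c" and "a \<le> b"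
  shows "kint a c \<phi> \<zeta> = kint b c \<phi> \<zeta>"
proof -
  have "(\<lambda>z. exp (- \<i> * z * \<zeta>) * \<phi> z) holomorphic_on UNIV" using hol by (intro holomorphic_intros)
  then obtain \<Psi> where \<Psi>: "\<And>z. (\<Psi> has_field_derivative exp (- \<i> * z * \<zeta>) * \<phi> z) (at z)"
    by (rule entire_primitive) blast
  have 1: "((\<lambda>R. \<Psi> (Complex R c) - \<Psi> (Complex R (- c))) \<longlongrightarrow> kint a c \<phi> \<zeta>) at_top"
    by (rule kint_limit[OF holomorphic_on_subset[OF hol] gr \<zeta> c \<Psi>]) simp
  have 2: "((\<lambda>R. \<Psi> (Complex R c) - \<Psi> (Complex R (- c))) \<longlongrightarrow> kint b c \<phi> \<zeta>) at_top"
    by (rule kint_limit[OF holomorphic_on_subset[OF hol] growth_mono[OF gr \<open>a \<le> b\<close>] \<zeta> c \<Psi>]) simp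
  show ?thesis by (rule tendsto_unique[OF trivial_limit_at_top_linorder 1 2])
qed

text \<open>With a bound across the real axis the whole vertical segment between the two ends of the
  contour is available to \<open>vertical_limit\<close>. This makes the transform independent of the
  representative of a class modulo tempered entire functions.\<close>

lemma kint_zero:
  assumes hol: "\<phi> holomorphic_on UNIV" and \<zeta>: "Im \<zeta> < 0" and c: "0 < c"
    and gr: "\<And>n::nat. 1 \<le> n ==> \<exists>C. \<forall>z. a \<le> Re z --> \<bar>Im z\<bar> \<le> real n --> cmod (\<phi> z) \<le> C * exp (\<bar>Re z\<bar> / real n)"
  shows "kint a c \<phi> \<zeta> = 0"
proof -
  have gr': "growth a (\<lambda>z. cmod (\<phi> z))" unfolding growth_def using gr by meson
  have "(\<lambda>z. exp (- \<i> * z * \<zeta>) * \<phi> z) holomorphic_on UNIV" using hol by (intro holomorphic_intros)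
  then obtain \<Psi> where \<Psi>: "\<And>z. (\<Psi> has_field_derivative exp (- \<i> * z * \<zeta>) * \<phi> z) (at z)"
    by (rule entire_primitive) blast
  have 1: "((\<lambda>R. \<Psi> (Complex R c) - \<Psi> (Complex R (- c))) \<longlongrightarrow> kint a c \<phi> \<zeta>) at_top"
    by (rule kint_limit[OF holomorphic_on_subset[OF hol] gr' \<zeta> c \<Psi>]) simp
  define \<eta> where "\<eta> = - Im \<zeta>"
  obtain n :: nat where n: "1 \<le> n" "c \<le> real n" "1 / real n \<le> \<eta> / 2"
    using nat_large[of "\<eta> / 2" c] \<zeta> by (auto simp: \<eta>_def)
  obtain C where C: "\<And>z. a \<le> Re z ==> \<bar>Im z\<bar> \<le> real n ==> cmod (\<phi> z) \<le> C * exp (\<bar>Re z\<bar> / real n)"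
    using gr[OF n(1)] by blast
  have 2: "((\<lambda>R. \<Psi> (Complex R c) - \<Psi> (Complex R (- c))) \<longlongrightarrow> 0) at_top"
  proof (rule vertical_limit[OF \<Psi>])
    show "0 < \<eta> / 2" using \<zeta> by (simp add: \<eta>_def)
    fix R s assume R: "max a 0 \<le> R" and "s \<in> closed_segment c (- c)"
    then have s: "\<bar>s\<bar> \<le> c" using c by (auto simp: closed_segment_eq_real_ivl split: if_splits)
    have "cmod (\<phi> (Complex R s)) \<le> C * exp (\<bar>R\<bar> / real n)" using C[of "Complex R s"] s n R by auto
    also have "\<dots> \<le> \<bar>C\<bar> * exp (R * (\<eta> / 2))"
    proof -
      have "R * (1 / real n) \<le> R * (\<eta> / 2)" using n R by (intro mult_left_mono) auto
      then show ?thesis using R by (intro mult_mono) auto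
    qed
    finally have 1: "cmod (\<phi> (Complex R s)) \<le> \<bar>C\<bar> * exp (R * (\<eta> / 2))" .
    have "\<bar>s * Re \<zeta>\<bar> \<le> c * \<bar>Re \<zeta>\<bar>" unfolding abs_mult using s by (intro mult_right_mono) auto
    then have 2: "cmod (exp (- \<i> * Complex R s * \<zeta>)) \<le> exp (- R * \<eta> + c * \<bar>Re \<zeta>\<bar>)"
      unfolding exp_kernel by (simp add: \<eta>_def)
    have "cmod (exp (- \<i> * Complex R s * \<zeta>) * \<phi> (Complex R s)) \<le> exp (- R * \<eta> + c * \<bar>Re \<zeta>\<bar>) * (\<bar>C\<bar> * exp (R * (\<eta> / 2)))"
      unfolding norm_mult using 1 2 by (intro mult_mono) auto
    also have "\<dots> = \<bar>C\<bar> * exp ((- R * \<eta> + c * \<bar>Re \<zeta>\<bar>) + R * (\<eta> / 2))" by (simp only: exp_add mult_ac)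
    also have "(- R * \<eta> + c * \<bar>Re \<zeta>\<bar>) + R * (\<eta> / 2) = c * \<bar>Re \<zeta>\<bar> + - (\<eta> / 2) * R" by (simp add: algebra_simps)
    also have "\<bar>C\<bar> * exp \<dots> = \<bar>C\<bar> * exp (c * \<bar>Re \<zeta>\<bar>) * exp (- (\<eta> / 2) * R)" by (simp only: exp_add mult.assoc)
    finally show "cmod (exp (- \<i> * Complex R s * \<zeta>) * \<phi> (Complex R s)) \<le> (\<bar>C\<bar> * exp (c * \<bar>Re \<zeta>\<bar>)) * exp (- (\<eta> / 2) * R)" .
  qed
  show ?thesis by (rule tendsto_unique[OF trivial_limit_at_top_linorder 1 2])
qed

section \<open>Cauchy's formula over the unbounded contour\<close>

lemma Ln_uminus:
  "0 < Im u ==> Ln (- u) = Ln u - \<i> * pi" "Im u < 0 ==> Ln (- u) = Ln u + \<i> * pi"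
proof -
  have e: "exp (\<i> * of_real pi) = -1" "exp (- (\<i> * of_real pi)) = -1"
    by (simp_all add: exp_minus)
  show "Ln (- u) = Ln u - \<i> * pi" if u: "0 < Im u"
  proof (rule Ln_unique)
    have nz: "u \<noteq> 0" using u by auto
    then have "0 < Im (Ln u) \<and> Im (Ln u) < pi" using Im_Ln_pos_lt u by blast
    then show "- pi < Im (Ln u - \<i> * pi)" "Im (Ln u - \<i> * pi) \<le> pi" by auto
    show "exp (Ln u - \<i> * pi) = - u" using nz e by (simp add: exp_diff)
  qed
  show "Ln (- u) = Ln u + \<i> * pi" if u: "Im u < 0"
  proof (rule Ln_unique)
    have nz: "u \<noteq> 0" using u by auto
    then have "\<not> 0 \<le> Im (Ln u)" using Im_Ln_pos_le[OF nz] Im_Ln_le_pi[OF nz] u by auto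
    moreover have "- pi < Im (Ln u)" using mpi_less_Im_Ln[OF nz] .
    ultimately show "- pi < Im (Ln u + \<i> * pi)" "Im (Ln u + \<i> * pi) \<le> pi" by auto
    show "exp (Ln u + \<i> * pi) = - u" using nz e by (simp add: exp_add)
  qed
qed

text \<open>Up to a constant factor the integrand is \<open>1 / (w - z1)\<close> plus an entire
  function, with primitive \<open>Ln (- (w - z1))\<close> plus an entire one. The cut of this branch
  runs from \<open>z1\<close> to the right and never meets the contour. On a vertical segment far to
  the right it is compared with \<open>Ln (w - z1)\<close>, whose variation there tends to 0; the
  two branches differ by opposite multiples of \<open>i \<pi>\<close> above and below
  \<open>z1\<close>, which produces the residue.\<close>

lemma hook_log_integral:
  assumes \<zeta>: "Im \<zeta> < 0" and x: "a \<le> x" and z1: "cmod (z1 - of_real x) < c"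
  shows "integrable lborel (\<lambda>t. hookd c t * (exp (- \<i> * hook a c t * \<zeta>) / (hook a c t - z1)))" (is ?int)
    and "(LINT t|lborel. hookd c t * (exp (- \<i> * hook a c t * \<zeta>) / (hook a c t - z1))) = - 2 * pi * \<i> * exp (- \<i> * z1 * \<zeta>)"
proof -
  have c: "0 < c" using z1 norm_ge_zero le_less_trans by blast
  define \<Omega> where "\<Omega> = {w. w - z1 \<in> slit 0}"
  define \<eta> where "\<eta> = - Im \<zeta>"
  have "0 < \<eta>" using \<zeta> by (simp add: \<eta>_def)
  define g where "g w = (if w = z1 then deriv (\<lambda>w. exp (- \<i> * (w - z1) * \<zeta>)) z1
      else (exp (- \<i> * (w - z1) * \<zeta>) - exp (- \<i> * (z1 - z1) * \<zeta>)) / (w - z1))" for w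
  have "g holomorphic_on UNIV"
    unfolding g_def by (rule pole_lemma_open) (auto intro!: holomorphic_intros)
  then obtain \<Gamma> where \<Gamma>: "\<And>z. (\<Gamma> has_field_derivative g z) (at z)" by (rule entire_primitive) blast
  have sum: "inverse (w - z1) + g w = exp (- \<i> * (w - z1) * \<zeta>) / (w - z1)" if "w \<noteq> z1" for w
    using that by (simp add: g_def field_simps)
  have split: "exp (- \<i> * w * \<zeta>) / (w - z1) = exp (- \<i> * z1 * \<zeta>) * (exp (- \<i> * (w - z1) * \<zeta>) / (w - z1))" for w
    by (simp add: exp_add[symmetric] algebra_simps)
  define \<Psi> where "\<Psi> w = exp (- \<i> * z1 * \<zeta>) * (Ln (- (w - z1)) + \<Gamma> w)" for w
  define \<psi> where "\<psi> w = exp (- \<i> * w * \<zeta>) / (w - z1)" for w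
  have \<Psi>: "(\<Psi> has_field_derivative \<psi> w) (at w)" if w: "w \<in> \<Omega>" for w
  proof -
    have ne: "w \<noteq> z1" using w by (auto simp: \<Omega>_def slit_iff)
    have "- (w - z1) \<notin> \<real>\<^sub>\<le>\<^sub>0" using w by (auto simp: \<Omega>_def slit_iff complex_nonpos_Reals_iff)
    then have "((\<lambda>w. Ln (- (w - z1))) has_field_derivative inverse (w - z1)) (at w)"
      using ne by (auto intro!: derivative_eq_intros simp: field_simps)
    then have "(\<Psi> has_field_derivative exp (- \<i> * z1 * \<zeta>) * (inverse (w - z1) + g w)) (at w)"
      unfolding \<Psi>_def by (intro DERIV_cmult DERIV_add \<Gamma>)
    then show ?thesis unfolding \<psi>_def split[of w] sum[OF ne] .
  qed
  \<comment> \<open>If the contour hit the cut at \<open>z1 + s\<close> with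
    \<open>s \<ge> 0\<close>, its distance from \<open>x + s\<close> would be
    \<open>|z1 - x| < c\<close>, against \<open>dist_hook\<close>.\<close>
  have hook_\<Omega>: "hook a c t \<in> \<Omega>" for t
  proof (rule ccontr)
    assume "\<not> ?thesis"
    then have im: "Im (hook a c t - z1) = 0" and re: "0 \<le> Re (hook a c t - z1)" by (auto simp: \<Omega>_def slit_iff)
    define s where "s = Re (hook a c t - z1)"
    have "hook a c t = z1 + of_real s" using im by (simp add: complex_eq_iff s_def)
    then have eq: "hook a c t - of_real (x + s) = z1 - of_real x" by simp
    have "c \<le> cmod (hook a c t - of_real (x + s))"
      using c x re by (intro dist_hook) (auto simp: s_def)
    then show False using z1 unfolding eq by linarith
  qed
  have cont: "continuous_on \<Omega> \<psi>" unfolding \<psi>_def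
    by (intro continuous_intros) (auto simp: \<Omega>_def slit_iff)
  have hol1: "(\<lambda>z. 1) holomorphic_on slit a" by (rule holomorphic_intros)
  have gr1: "growth a (\<lambda>z. cmod 1)"
    unfolding growth_def by (intro allI impI exI[of _ 1]) auto
  obtain C \<delta> where \<delta>: "0 < \<delta>" and C: "\<And>t. 1 < \<bar>t\<bar> ==> cmod (exp (- \<i> * hook a c t * \<zeta>) * 1) \<le> C * exp (- \<delta> * \<bar>t\<bar>)"
    using kernel_decay[OF hol1 gr1 \<zeta> c] by metis
  have imz: "\<bar>Im z1\<bar> < c" using z1 abs_Im_le_cmod[of "z1 - of_real x"] by simp
  have bound: "cmod (\<psi> (hook a c t)) \<le> C / (c - \<bar>Im z1\<bar>) * exp (- \<delta> * \<bar>t\<bar>)" if t: "1 < \<bar>t\<bar>" for t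
  proof -
    have "t \<le> -1 \<or> 1 \<le> t" using t by auto
    then have "\<bar>Im (hook a c t)\<bar> = c" using c by (auto simp: hook_left hook_right)
    then have "c - \<bar>Im z1\<bar> \<le> \<bar>Im (hook a c t - z1)\<bar>" by simp
    also have "\<dots> \<le> cmod (hook a c t - z1)" by (rule abs_Im_le_cmod)
    finally have 1: "c - \<bar>Im z1\<bar> \<le> cmod (hook a c t - z1)" .
    have "cmod (\<psi> (hook a c t)) = cmod (exp (- \<i> * hook a c t * \<zeta>)) / cmod (hook a c t - z1)"
      by (simp add: \<psi>_def norm_divide)
    also have "\<dots> \<le> (C * exp (- \<delta> * \<bar>t\<bar>)) / (c - \<bar>Im z1\<bar>)"
    proof (rule frac_le)
      show "0 \<le> C * exp (- \<delta> * \<bar>t\<bar>)" by (rule order_trans[OF norm_ge_zero C[OF t]])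
      show "cmod (exp (- \<i> * hook a c t * \<zeta>)) \<le> C * exp (- \<delta> * \<bar>t\<bar>)" using C[OF t] by (simp only: mult_1_right)
    qed (use 1 imz in auto)
    finally show ?thesis by simp
  qed
  note hi = hook_integral[OF c hook_\<Omega> \<Psi> cont \<delta> bound]
  show ?int using hi(1) by (simp add: \<psi>_def)
  define R0 where "R0 = max 0 (Re z1 + 1)"
  \<comment> \<open>The branch with the cut to the left, holomorphic on the vertical segments once
    \<open>R\<close> exceeds \<open>Re z1 + 1\<close>.\<close>
  define \<Theta> where "\<Theta> w = Ln (w - z1) + \<Gamma> w" for w
  have lim0: "((\<lambda>R. \<Theta> (Complex R c) - \<Theta> (Complex R (- c))) \<longlongrightarrow> 0) at_top"
  proof (rule vertical_limit[of R0 c "- c" \<Theta> "\<lambda>w. exp (- \<i> * (w - z1) * \<zeta>) / (w - z1)" "exp (\<bar>Re z1\<bar> * \<eta> + (c + \<bar>Im z1\<bar>) * \<bar>Re \<zeta>\<bar>)" \<eta>])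
    fix R s assume R: "R0 \<le> R" and "s \<in> closed_segment c (- c)"
    then have s: "\<bar>s\<bar> \<le> c" using c by (auto simp: closed_segment_eq_real_ivl split: if_splits)
    let ?w = "Complex R s"
    have re: "1 \<le> Re (?w - z1)" using R by (simp add: R0_def)
    then have ne: "?w \<noteq> z1" and np: "?w - z1 \<notin> \<real>\<^sub>\<le>\<^sub>0" by (auto simp: complex_nonpos_Reals_iff)
    have "((\<lambda>w. Ln (w - z1)) has_field_derivative inverse (?w - z1)) (at ?w)"
      using np by (auto intro!: derivative_eq_intros)
    then have "(\<Theta> has_field_derivative inverse (?w - z1) + g ?w) (at ?w)"
      unfolding \<Theta>_def by (intro DERIV_add \<Gamma>)
    then show "(\<Theta> has_field_derivative exp (- \<i> * (?w - z1) * \<zeta>) / (?w - z1)) (at ?w)"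
      unfolding sum[OF ne] .
    have 1: "1 \<le> cmod (?w - z1)" using re complex_Re_le_cmod[of "?w - z1"] by linarith
    have "cmod (exp (- \<i> * (?w - z1) * \<zeta>) / (?w - z1)) \<le> cmod (exp (- \<i> * (?w - z1) * \<zeta>)) / 1"
      unfolding norm_divide using 1 by (intro divide_left_mono) auto
    also have "\<dots> = exp ((R - Re z1) * - \<eta> + (s - Im z1) * Re \<zeta>)"
      using exp_kernel[of "?w - z1" \<zeta>] by (simp add: \<eta>_def)
    also have "\<dots> \<le> exp ((\<bar>Re z1\<bar> * \<eta> + (c + \<bar>Im z1\<bar>) * \<bar>Re \<zeta>\<bar>) + - \<eta> * R)"
    proof -
      have "(s - Im z1) * Re \<zeta> \<le> \<bar>s - Im z1\<bar> * \<bar>Re \<zeta>\<bar>" by (simp add: abs_mult[symmetric])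
      also have "\<dots> \<le> (c + \<bar>Im z1\<bar>) * \<bar>Re \<zeta>\<bar>" using s by (intro mult_right_mono) auto
      finally have 1: "(s - Im z1) * Re \<zeta> \<le> (c + \<bar>Im z1\<bar>) * \<bar>Re \<zeta>\<bar>" .
      have "Re z1 * \<eta> \<le> \<bar>Re z1\<bar> * \<eta>" using \<open>0 < \<eta>\<close> by (intro mult_right_mono) auto
      moreover have "(R - Re z1) * - \<eta> = - \<eta> * R + Re z1 * \<eta>" by (simp add: algebra_simps)
      ultimately show ?thesis using 1 unfolding exp_le_cancel_iff by linarith
    qed
    also have "\<dots> = exp (\<bar>Re z1\<bar> * \<eta> + (c + \<bar>Im z1\<bar>) * \<bar>Re \<zeta>\<bar>) * exp (- \<eta> * R)" by (rule exp_add)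
    finally show "cmod (exp (- \<i> * (?w - z1) * \<zeta>) / (?w - z1)) \<le> exp (\<bar>Re z1\<bar> * \<eta> + (c + \<bar>Im z1\<bar>) * \<bar>Re \<zeta>\<bar>) * exp (- \<eta> * R)" .
  qed (rule \<open>0 < \<eta>\<close>)
  have "((\<lambda>R. exp (- \<i> * z1 * \<zeta>) * ((\<Theta> (Complex R c) - \<Theta> (Complex R (- c))) - 2 * \<i> * pi)) \<longlongrightarrow> exp (- \<i> * z1 * \<zeta>) * (0 - 2 * \<i> * pi)) at_top"
    by (intro tendsto_intros lim0)
  moreover have "exp (- \<i> * z1 * \<zeta>) * ((\<Theta> (Complex R c) - \<Theta> (Complex R (- c))) - 2 * \<i> * pi) = \<Psi> (Complex R c) - \<Psi> (Complex R (- c))" for R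
  proof -
    have "Ln (- (Complex R c - z1)) = Ln (Complex R c - z1) - \<i> * pi" using imz by (intro Ln_uminus) auto
    moreover have "Ln (- (Complex R (- c) - z1)) = Ln (Complex R (- c) - z1) + \<i> * pi" using imz by (intro Ln_uminus) auto
    ultimately show ?thesis unfolding \<Psi>_def \<Theta>_def by (simp only:) (simp add: algebra_simps)
  qed
  ultimately have "((\<lambda>R. \<Psi> (Complex R c) - \<Psi> (Complex R (- c))) \<longlongrightarrow> exp (- \<i> * z1 * \<zeta>) * (0 - 2 * \<i> * pi)) at_top"
    by simp
  then have "(LINT t|lborel. hookd c t * \<psi> (hook a c t)) = exp (- \<i> * z1 * \<zeta>) * (0 - 2 * \<i> * pi)"
    using tendsto_unique[OF trivial_limit_at_top_linorder hi(2)] by blast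
  then show "(LINT t|lborel. hookd c t * (exp (- \<i> * hook a c t * \<zeta>) / (hook a c t - z1))) = - 2 * pi * \<i> * exp (- \<i> * z1 * \<zeta>)"
    by (simp add: \<psi>_def)
qed

text \<open>
  For \<open>q w = (\<phi> w - \<phi> z) / (w - z)\<close> the function \<open>exp (\<i> z \<zeta>) * kint a c q \<zeta>\<close> of \<open>\<zeta>\<close> has derivative
  \<open>0\<close> and tends to \<open>0\<close> for \<open>\<zeta> \<rightarrow> -\<i> \<infinity>\<close> if \<open>Re z < a\<close>, hence \<open>kint a c q\<close> vanishes.
\<close>

lemma kint_eq_zero_imp_Cauchy:
  assumes hol: "\<phi> holomorphic_on slit a" and gr: "growth a (\<lambda>z. cmod (\<phi> z))"
    and zero: "\<And>\<zeta>. Im \<zeta> < 0 ==> kint a 1 \<phi> \<zeta> = 0"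
    and z: "Re z < a" and c: "cmod (z - of_real a) < c"
  shows "(LINT t|lborel. hookd c t * (exp (z - hook a c t) / (hook a c t - z) * \<phi> (hook a c t))) = - 2 * pi * \<i> * \<phi> z"
proof -
  have c0: "0 < c" using c norm_ge_zero le_less_trans by blast
  \<comment> \<open>The value at \<open>z\<close> removes the singularity. Where growth is demanded,
    that is for \<open>a \<le> Re w\<close>, the denominator is at least \<open>a - Re z\<close>, so
    \<open>q\<close> inherits the growth of \<phi>.\<close>
  define q where "q w = (if w = z then deriv \<phi> z else (\<phi> w - \<phi> z) / (w - z))" for w
  have holq: "q holomorphic_on slit a"
    unfolding q_def by (rule pole_lemma_open[OF hol open_slit])
  have hol1: "(\<lambda>w. 1) holomorphic_on slit a" by (rule holomorphic_intros)
  have gr1: "growth a (\<lambda>z. cmod 1)"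
    unfolding growth_def by (intro allI impI exI[of _ 1]) auto
  have grq: "growth a (\<lambda>w. cmod (q w))"
    unfolding growth_def
  proof (intro allI impI)
    fix n :: nat assume n: "1 \<le> n"
    obtain D where D: "0 \<le> D" "\<And>z. a \<le> Re z ==> 1 / real n \<le> \<bar>Im z\<bar> ==> \<bar>Im z\<bar> \<le> real n ==> cmod (\<phi> z) \<le> D * exp (\<bar>Re z\<bar> / real n)"
      using growthD[OF gr n] by metis
    have "cmod (q w) \<le> (D + cmod (\<phi> z)) / (a - Re z) * exp (\<bar>Re w\<bar> / real n)"
      if w: "a \<le> Re w" "1 / real n \<le> \<bar>Im w\<bar>" "\<bar>Im w\<bar> \<le> real n" for w
    proof -
      have d: "a - Re z \<le> cmod (w - z)" using w(1) complex_Re_le_cmod[of "w - z"] by simp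
      have "w \<noteq> z" using w z by auto
      then have "cmod (q w) = cmod (\<phi> w - \<phi> z) / cmod (w - z)" by (simp add: q_def norm_divide)
      also have "\<dots> \<le> (D * exp (\<bar>Re w\<bar> / real n) + cmod (\<phi> z) * 1) / (a - Re z)"
        using d z D(2)[OF w] norm_triangle_ineq4[of "\<phi> w" "\<phi> z"] D(1)
        by (intro frac_le) (auto intro: add_nonneg_nonneg)
      also have "\<dots> \<le> (D * exp (\<bar>Re w\<bar> / real n) + cmod (\<phi> z) * exp (\<bar>Re w\<bar> / real n)) / (a - Re z)"
        using z by (intro divide_right_mono add_left_mono mult_left_mono) auto
      also have "\<dots> = (D + cmod (\<phi> z)) / (a - Re z) * exp (\<bar>Re w\<bar> / real n)" by (simp add: distrib_right)
      finally show ?thesis .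
    qed
    then show "\<exists>C. \<forall>w. a \<le> Re w --> 1 / real n \<le> \<bar>Im w\<bar> --> \<bar>Im w\<bar> \<le> real n --> cmod (q w) \<le> C * exp (\<bar>Re w\<bar> / real n)"
      by blast
  qed
  have zero1: "kint a 1 (\<lambda>z. 1) \<zeta> = 0" if "Im \<zeta> < 0" for \<zeta>
    by (rule kint_zero[OF _ that]) (auto intro!: holomorphic_intros exI[of _ 1])
  have lin: "kint a 1 (\<lambda>w. (w - z) * q w) \<zeta> = 0" if \<zeta>: "Im \<zeta> < 0" for \<zeta>
  proof -
    have "(w - z) * q w = 1 * \<phi> w + (- \<phi> z) * 1" for w by (simp add: q_def)
    then have "kint a 1 (\<lambda>w. (w - z) * q w) \<zeta> = 1 * kint a 1 \<phi> \<zeta> + (- \<phi> z) * kint a 1 (\<lambda>w. 1) \<zeta>"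
      using kint_linear[OF hol gr hol1 gr1 \<zeta>, of 1 1 "- \<phi> z"] by simp
    then show ?thesis using zero[OF \<zeta>] zero1[OF \<zeta>] by simp
  qed
  define \<Omega> where "\<Omega> = {\<zeta>. Im \<zeta> < 0}"
  have "open \<Omega>" unfolding \<Omega>_def by (rule open_halfspace_Im_lt)
  have cont: "continuous_on (slit a) (\<lambda>w. cmod (q w))"
    using holomorphic_on_imp_continuous_on[OF holq] by (intro continuous_intros)
  define T where "T \<zeta> = (LINT t|lborel. hookd 1 t * (exp (- \<i> * (hook a 1 t - z) * \<zeta>) * q (hook a 1 t)))" for \<zeta>
  have ex: "exp (- \<i> * (w - z) * \<zeta>) = exp (\<i> * z * \<zeta>) * exp (- \<i> * w * \<zeta>)" for w \<zeta>
    by (simp add: exp_add[symmetric] algebra_simps)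
  have T: "T \<zeta> = exp (\<i> * z * \<zeta>) * kint a 1 q \<zeta>" for \<zeta>
    unfolding T_def kint_def ex by (subst integral_mult_right_zero[symmetric]) (simp add: mult_ac)
  \<comment> \<open>Differentiation in \<zeta> produces a factor proportional to
    \<open>w - z\<close>, which cancels the denominator of \<open>q\<close> and leaves the transform
    of \<open>\<phi>\<close> minus a constant, zero by \<open>lin\<close>.\<close>
  have deriv0: "(T has_field_derivative 0) (at \<zeta>0)" if \<zeta>0: "\<zeta>0 \<in> \<Omega>" for \<zeta>0
  proof -
    define r where "r = - Im \<zeta>0 / 2"
    have r: "0 < r" using \<zeta>0 by (simp add: r_def \<Omega>_def)
    have im: "Im \<zeta> \<le> - r" if "\<zeta> \<in> cball \<zeta>0 r" for \<zeta>
    proof -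
      have "\<bar>Im (\<zeta> - \<zeta>0)\<bar> \<le> r" using abs_Im_le_cmod[of "\<zeta> - \<zeta>0"] that by (simp add: dist_norm norm_minus_commute)
      then show ?thesis by (simp add: r_def)
    qed
    have sub: "cball \<zeta>0 r \<subseteq> \<Omega>" using im r by (force simp: \<Omega>_def)
    obtain n :: nat where n: "1 \<le> n" "0 \<le> real n" "1 / real n \<le> r" using nat_large[OF r] by blast
    have n1: "1 \<le> real n" using n(1) by simp
    obtain C where C: "0 \<le> C" "\<And>\<zeta> t. Im \<zeta> \<le> - (1 / real n) ==> t \<notin> {-1, 1} ==> cmod (hookd 1 t * exp (- \<i> * hook a 1 t * \<zeta>)) * cmod (q (hook a 1 t))
       \<le> C * exp (1 * \<bar>Re \<zeta>\<bar> - (a - 1) * \<bar>Im \<zeta>\<bar>) * exp (- (1 / (2 * real n)) * \<bar>t\<bar>)"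
      using kernel_bound[OF cont norm_ge_zero grq zero_less_one n1] by metis
    have "compact ((\<lambda>\<zeta>. cmod (exp (\<i> * z * \<zeta>)) * exp (1 * \<bar>Re \<zeta>\<bar> - (a - 1) * \<bar>Im \<zeta>\<bar>)) ` cball \<zeta>0 r)"
      by (intro compact_continuous_image continuous_intros compact_cball)
    then have "bounded ((\<lambda>\<zeta>. cmod (exp (\<i> * z * \<zeta>)) * exp (1 * \<bar>Re \<zeta>\<bar> - (a - 1) * \<bar>Im \<zeta>\<bar>)) ` cball \<zeta>0 r)"
      by (rule compact_imp_bounded)
    then obtain E where E: "\<And>\<zeta>. \<zeta> \<in> cball \<zeta>0 r ==> cmod (exp (\<i> * z * \<zeta>)) * exp (1 * \<bar>Re \<zeta>\<bar> - (a - 1) * \<bar>Im \<zeta>\<bar>) \<le> E"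
      unfolding bounded_iff by fastforce
    have "((\<lambda>\<zeta>. LINT t|lborel. hookd 1 t * (exp (- \<i> * (hook a 1 t - z) * \<zeta>) * q (hook a 1 t)))
       has_field_derivative (LINT t|lborel. hookd 1 t * (- \<i> * (hook a 1 t - z) * exp (- \<i> * (hook a 1 t - z) * \<zeta>0) * q (hook a 1 t)))) (at \<zeta>0)"
    proof (rule leibniz_rule_lborel[OF \<open>open \<Omega>\<close> _ r sub, where S = "{-1, 1}" and D = "\<lambda>t. (C * E) * exp (- (1 / (2 * real n)) * \<bar>t\<bar>)"])
      show "integrable lborel (\<lambda>t. hookd 1 t * (exp (- \<i> * (hook a 1 t - z) * w) * q (hook a 1 t)))" if "w \<in> \<Omega>" for w
      proof -
        have "integrable lborel (\<lambda>t. exp (\<i> * z * w) * (hookd 1 t * (exp (- \<i> * hook a 1 t * w) * q (hook a 1 t))))"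
          using kint_integrable[OF holq grq, of w 1] that by (simp add: \<Omega>_def)
        then show ?thesis unfolding ex by (simp only: mult_ac)
      qed
      show "integrable lborel (\<lambda>t. hookd 1 t * (- \<i> * (hook a 1 t - z) * exp (- \<i> * (hook a 1 t - z) * \<zeta>0) * q (hook a 1 t)))"
      proof -
        have rel: "(w - z) * q w = \<phi> w - \<phi> z" for w by (simp add: q_def)
        have "integrable lborel (\<lambda>t. - \<i> * exp (\<i> * z * \<zeta>0) * (hookd 1 t * (exp (- \<i> * hook a 1 t * \<zeta>0) * \<phi> (hook a 1 t)))
          + - \<i> * exp (\<i> * z * \<zeta>0) * (- \<phi> z) * (hookd 1 t * (exp (- \<i> * hook a 1 t * \<zeta>0) * 1)))"
          using kint_integrable[OF hol gr, of \<zeta>0 1] kint_integrable[OF hol1 gr1, of \<zeta>0 1] \<zeta>0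
          by (intro Bochner_Integration.integrable_add integrable_mult_right) (auto simp: \<Omega>_def)
        moreover have "hookd 1 t * (- \<i> * (hook a 1 t - z) * exp (- \<i> * (hook a 1 t - z) * \<zeta>0) * q (hook a 1 t))
          = - \<i> * exp (\<i> * z * \<zeta>0) * (hookd 1 t * (exp (- \<i> * hook a 1 t * \<zeta>0) * \<phi> (hook a 1 t)))
          + - \<i> * exp (\<i> * z * \<zeta>0) * (- \<phi> z) * (hookd 1 t * (exp (- \<i> * hook a 1 t * \<zeta>0) * 1))" for t
        proof -
          have key: "h * (- \<i> * w * (E * Y) * Q) = - \<i> * E * (h * (Y * P)) + - \<i> * E * (- P') * (h * (Y * 1))"
            if "w * Q = P - P'" for h w E Y Q P P' :: complex
          proof -
            have "h * (- \<i> * w * (E * Y) * Q) = - \<i> * h * E * Y * (w * Q)" by (simp add: mult_ac)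
            then show ?thesis unfolding that by (simp add: algebra_simps)
          qed
          show ?thesis unfolding ex by (rule key[OF rel])
        qed
        ultimately show ?thesis by (simp only:)
      qed
      show "(\<lambda>\<zeta>. hookd 1 t * (exp (- \<i> * (hook a 1 t - z) * \<zeta>) * q (hook a 1 t))) holomorphic_on \<Omega>" for t
        by (intro holomorphic_intros)
      show "deriv (\<lambda>\<zeta>. hookd 1 t * (exp (- \<i> * (hook a 1 t - z) * \<zeta>) * q (hook a 1 t))) \<zeta>0
          = hookd 1 t * (- \<i> * (hook a 1 t - z) * exp (- \<i> * (hook a 1 t - z) * \<zeta>0) * q (hook a 1 t))" for t
        by (rule DERIV_imp_deriv) (auto intro!: derivative_eq_intros)
      show "integrable lborel (\<lambda>t. (C * E) * exp (- (1 / (2 * real n)) * \<bar>t\<bar>))"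
        using n(1) by (intro integrable_exp_abs) auto
      fix t \<zeta> assume t: "t \<notin> {-1, 1::real}" and w: "\<zeta> \<in> cball \<zeta>0 r"
      have "Im \<zeta> \<le> - (1 / real n)" using im[OF w] n(3) by linarith
      note CC = C(2)[OF this t]
      have "cmod (hookd 1 t * (exp (- \<i> * (hook a 1 t - z) * \<zeta>) * q (hook a 1 t)))
          = cmod (exp (\<i> * z * \<zeta>)) * (cmod (hookd 1 t * exp (- \<i> * hook a 1 t * \<zeta>)) * cmod (q (hook a 1 t)))"
        unfolding ex by (simp only: norm_mult mult_ac)
      also have "\<dots> \<le> cmod (exp (\<i> * z * \<zeta>)) * (C * exp (1 * \<bar>Re \<zeta>\<bar> - (a - 1) * \<bar>Im \<zeta>\<bar>) * exp (- (1 / (2 * real n)) * \<bar>t\<bar>))"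
        by (rule mult_left_mono[OF CC norm_ge_zero])
      also have "\<dots> = (cmod (exp (\<i> * z * \<zeta>)) * exp (1 * \<bar>Re \<zeta>\<bar> - (a - 1) * \<bar>Im \<zeta>\<bar>)) * (C * exp (- (1 / (2 * real n)) * \<bar>t\<bar>))"
        by (simp only: mult_ac)
      also have "\<dots> \<le> E * (C * exp (- (1 / (2 * real n)) * \<bar>t\<bar>))"
        using C(1) by (intro mult_right_mono[OF E[OF w]]) auto
      finally show "cmod (hookd 1 t * (exp (- \<i> * (hook a 1 t - z) * \<zeta>) * q (hook a 1 t))) \<le> (C * E) * exp (- (1 / (2 * real n)) * \<bar>t\<bar>)"
        by (simp only: mult_ac)
    qed simp
    moreover have "(LINT t|lborel. hookd 1 t * (- \<i> * (hook a 1 t - z) * exp (- \<i> * (hook a 1 t - z) * \<zeta>0) * q (hook a 1 t)))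
       = - \<i> * exp (\<i> * z * \<zeta>0) * kint a 1 (\<lambda>w. (w - z) * q w) \<zeta>0"
      unfolding kint_def ex by (subst integral_mult_right_zero[symmetric]) (simp add: mult_ac)
    ultimately show ?thesis using lin[of \<zeta>0] \<zeta>0 by (simp add: T_def[abs_def] \<Omega>_def)
  qed
  have const: "T \<zeta> = T (- \<i>)" if "\<zeta> \<in> \<Omega>" for \<zeta>
  proof (rule has_field_derivative_zero_constant[of \<Omega> T, THEN exE])
    show "convex \<Omega>" unfolding \<Omega>_def by (rule convex_halfspace_Im_lt)
    show "(T has_field_derivative 0) (at x within \<Omega>)" if "x \<in> \<Omega>" for x
      by (rule has_field_derivative_at_within[OF deriv0[OF that]])
    fix d assume "\<forall>x\<in>\<Omega>. T x = d"
    then show ?thesis using that by (simp add: \<Omega>_def)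
  qed
  \<comment> \<open>Half the distance from \<open>z\<close> to the line \<open>Re w = a\<close>:
    this contour stays to the right of \<open>z\<close>, and the exponents \<open>Re z\<close> and
    \<open>-(a - c')\<close> add up to \<open>-c'\<close>.\<close>
  define c' where "c' = (a - Re z) / 2"
  have c': "0 < c'" using z by (simp add: c'_def)
  obtain C where C: "0 \<le> C" "\<And>\<zeta> t. Im \<zeta> \<le> - (1 / 1) ==> t \<notin> {-1, 1} ==> cmod (hookd c' t * exp (- \<i> * hook a c' t * \<zeta>)) * cmod (q (hook a c' t))
       \<le> C * exp (c' * \<bar>Re \<zeta>\<bar> - (a - c') * \<bar>Im \<zeta>\<bar>) * exp (- (1 / (2 * 1)) * \<bar>t\<bar>)"
    using kernel_bound[OF cont norm_ge_zero grq c' order_refl] by metis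
  define I where "I = (LINT t|lborel. C * exp (- (1 / (2 * 1)) * \<bar>t::real\<bar>))"
  have Tbound: "cmod (T (- \<i>)) \<le> I * exp (- c' * \<eta>)" if \<eta>: "1 \<le> \<eta>" for \<eta>
  proof -
    define \<zeta> where "\<zeta> = Complex 0 (- \<eta>)"
    have \<zeta>: "Im \<zeta> \<le> - (1 / 1)" "Im \<zeta> < 0" using \<eta> by (auto simp: \<zeta>_def)
    have ints: "integrable lborel (\<lambda>t. C * exp (- (1 / (2 * 1)) * \<bar>t::real\<bar>))" by (rule integrable_exp_abs) simp
    have "cmod (kint a c' q \<zeta>) \<le> (LINT t|lborel. cmod (hookd c' t * (exp (- \<i> * hook a c' t * \<zeta>) * q (hook a c' t))))"
      unfolding kint_def by (rule integral_norm_bound)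
    also have "\<dots> \<le> (LINT t|lborel. exp (- (a - c') * \<eta>) * (C * exp (- (1 / (2 * 1)) * \<bar>t\<bar>)))"
    proof (rule integral_mono_AE)
      show "integrable lborel (\<lambda>t. cmod (hookd c' t * (exp (- \<i> * hook a c' t * \<zeta>) * q (hook a c' t))))"
        by (rule integrable_norm[OF kint_integrable[OF holq grq \<zeta>(2) c']])
      show "integrable lborel (\<lambda>t. exp (- (a - c') * \<eta>) * (C * exp (- (1 / (2 * 1)) * \<bar>t::real\<bar>)))"
        by (rule integrable_mult_right[OF ints])
      have "cmod (hookd c' t * (exp (- \<i> * hook a c' t * \<zeta>) * q (hook a c' t))) \<le> exp (- (a - c') * \<eta>) * (C * exp (- (1 / (2 * 1)) * \<bar>t\<bar>))"
        if "t \<notin> {-1, 1}" for t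
        using C(2)[OF \<zeta>(1) that] \<eta> by (simp add: \<zeta>_def norm_mult algebra_simps)
      then show "AE t in lborel. cmod (hookd c' t * (exp (- \<i> * hook a c' t * \<zeta>) * q (hook a c' t))) \<le> exp (- (a - c') * \<eta>) * (C * exp (- (1 / (2 * 1)) * \<bar>t\<bar>))"
        by (intro AE_I'[of "{-1, 1}"]) (auto intro: finite_imp_null_set_lborel)
    qed
    also have "\<dots> = exp (- (a - c') * \<eta>) * I" unfolding I_def by (rule integral_mult_right_zero)
    finally have "cmod (kint a c' q \<zeta>) \<le> exp (- (a - c') * \<eta>) * I" .
    moreover have "T (- \<i>) = exp (\<i> * z * \<zeta>) * kint a c' q \<zeta>"
      using const[of \<zeta>] T[of \<zeta>] kint_indep[OF holq grq \<zeta>(2), of 1 c'] c' \<zeta>(2) by (simp add: \<Omega>_def)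
    moreover have "cmod (exp (\<i> * z * \<zeta>)) = exp (Re z * \<eta>)" by (simp add: norm_exp_eq_Re \<zeta>_def)
    ultimately have "cmod (T (- \<i>)) \<le> exp (Re z * \<eta>) * (exp (- (a - c') * \<eta>) * I)"
      by (simp add: norm_mult)
    also have "\<dots> = I * exp (Re z * \<eta> + - (a - c') * \<eta>)" by (simp only: exp_add mult_ac)
    also have "Re z * \<eta> + - (a - c') * \<eta> = - c' * \<eta>" by (simp add: c'_def field_simps)
    finally show ?thesis .
  qed
  have "((\<lambda>\<eta>. I * exp (- c' * \<eta>)) \<longlongrightarrow> I * 0) at_top"
    using c' by (intro tendsto_intros filterlim_compose[OF exp_at_bot] filterlim_tendsto_neg_mult_at_bot[OF tendsto_const]) (auto intro: filterlim_ident)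
  moreover have "\<forall>\<^sub>F \<eta> in at_top. cmod (T (- \<i>)) \<le> I * exp (- c' * \<eta>)"
    using eventually_ge_at_top[of 1] by eventually_elim (rule Tbound)
  ultimately have "cmod (T (- \<i>)) \<le> I * 0"
    by (rule tendsto_lowerbound) (rule trivial_limit_at_top_linorder)
  then have "T (- \<i>) = 0" by simp
  then have "kint a 1 q (- \<i>) = 0" using T[of "- \<i>"] by simp
  \<comment> \<open>At \<zeta> = -i the Fourier kernel is \<open>exp (- w)\<close>. The vanishing of
    this one value becomes a Cauchy formula whose extra factor \<open>exp (z - w)\<close> makes the
    integral over the unbounded contour converge.\<close>
  then have kq: "kint a c q (- \<i>) = 0" using kint_indep[OF holq grq _ c0, of "- \<i>" 1] by simp
  have ne: "hook a c t \<noteq> z" for t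
    using dist_hook[of c a a t] c c0 by auto
  have e1: "exp (- \<i> * w * (- \<i>)) = exp (- w)" for w
  proof -
    have "- \<i> * w * (- \<i>) = - w" by (simp add: complex_eq_iff)
    then show ?thesis by (simp only:)
  qed
  \<comment> \<open>The pole term split off from \<open>q\<close>. Since \<open>z\<close> is closer
    than \<open>c\<close> to \<open>a\<close>, \<open>hook_log_integral\<close> applies to
    it.\<close>
  define g where "g t = hookd c t * (exp (- \<i> * hook a c t * (- \<i>)) / (hook a c t - z))" for t
  have g: "integrable lborel g" "integral\<^sup>L lborel g = - 2 * pi * \<i> * exp (- \<i> * z * (- \<i>))"
    unfolding g_def using hook_log_integral[of "- \<i>" a a z c] c by auto
  have f: "integrable lborel (\<lambda>t. hookd c t * (exp (- \<i> * hook a c t * (- \<i>)) * q (hook a c t)))"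
    by (rule kint_integrable[OF holq grq _ c0]) simp
  have eq: "hookd c t * (exp (z - hook a c t) / (hook a c t - z) * \<phi> (hook a c t))
      = exp z * (hookd c t * (exp (- \<i> * hook a c t * (- \<i>)) * q (hook a c t))) + exp z * \<phi> z * g t" for t
  proof -
    have key: "h * (E * M / d * P) = E * (h * (M * ((P - Z) / d))) + E * Z * (h * (M / d))" for h E M d P Z :: complex
      by (simp add: divide_inverse algebra_simps)
    have "exp (z - hook a c t) = exp z * exp (- hook a c t)" by (simp add: exp_add[symmetric])
    then show ?thesis using ne[of t] key by (simp only: g_def q_def e1 if_False)
  qed
  have "(LINT t|lborel. hookd c t * (exp (z - hook a c t) / (hook a c t - z) * \<phi> (hook a c t)))
      = exp z * kint a c q (- \<i>) + exp z * \<phi> z * integral\<^sup>L lborel g"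
    unfolding eq kint_def using f g(1) by (subst Bochner_Integration.integral_add) auto
  also have "\<dots> = exp z * \<phi> z * (- 2 * pi * \<i> * exp (- z))" using kq g(2) unfolding e1 by simp
  also have "\<dots> = - 2 * pi * \<i> * \<phi> z" by (simp add: exp_minus)
  finally show ?thesis .
qed

section \<open>The inverse transform\<close>

text \<open>An open half-plane around the closed lower one, in which the rays run. It is the domain
  of a function on \<open>Im z < 0\<close> after the shift by i.\<close>

definition lower :: "complex set" where
  "lower = {s. Im s < 1}"

text \<open>The growth condition of \<open>FO\<close> after the shift, on the closed lower
  half-plane, where \<open>a * Im s = - a * \<bar>Im s\<bar>\<close>.\<close>

definition mgrowth :: "real => (complex => real) => bool" where
  "mgrowth a h \<longleftrightarrow> (\<forall>k\<ge>1. \<exists>C. \<forall>s. Im s \<le> 0 --> h s \<le> C * exp (cmod s / real k + a * Im s))"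

text \<open>The exponential rate at which \<open>exp (i z s)\<close> times a function of growth
  \<open>exp (a * Im s)\<close> decays along the ray \<open>s = u t\<close>. It is linear in
  \<open>u\<close>, which matters when two rays are joined by a chord.\<close>

definition rate :: "complex => real => complex => real" where
  "rate u a z = Im (z * u) - a * Im u"

definition rk :: "complex => complex => real => complex" where
  "rk u z t = u * exp (\<i> * z * (u * of_real t))"

text \<open>The Laplace integral over the ray in direction \<open>u\<close>; the factor
  \<open>u\<close> inside \<open>rk\<close> is the derivative of the parametrisation. Extension by 0
  to negative \<open>t\<close> puts the integral on the whole line, where the Pettis integral is set
  up.\<close>

definition Lr :: "complex => (complex => complex) => complex => complex" where
  "Lr u f z = (LINT t|lborel. rk u z t * (if 0 < t then f (u * of_real t) else 0))"

definition dir :: "complex => bool" where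
  "dir u \<longleftrightarrow> cmod u = 1 \<and> Im u \<le> 0"

lemma lower_props: "open lower" "convex lower"
  unfolding lower_def by (rule open_halfspace_Im_lt convex_halfspace_Im_lt)+

lemma dir_lower: "dir u ==> 0 \<le> t ==> u * of_real t \<in> lower \<and> Im (u * of_real t) \<le> 0"
proof -
  assume "dir u" "0 \<le> t"
  then have "Im u * t \<le> 0" by (intro mult_nonpos_nonneg) (auto simp: dir_def)
  then show ?thesis by (simp add: lower_def)
qed

lemma mgrowth_le: "mgrowth a h ==> (\<And>s. Im s \<le> 0 ==> g s \<le> K * h s) ==> 0 \<le> K ==> mgrowth a g"
  unfolding mgrowth_def
proof (intro allI impI)
  fix k :: nat assume *: "\<forall>k\<ge>1. \<exists>C. \<forall>s. Im s \<le> 0 --> h s \<le> C * exp (cmod s / real k + a * Im s)"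
    and g: "\<And>s. Im s \<le> 0 ==> g s \<le> K * h s" and K: "0 \<le> K" and k: "1 \<le> k"
  obtain C where C: "\<And>s. Im s \<le> 0 ==> h s \<le> C * exp (cmod s / real k + a * Im s)" using * k by blast
  have "g s \<le> (K * C) * exp (cmod s / real k + a * Im s)" if "Im s \<le> 0" for s
    using order_trans[OF g[OF that] mult_left_mono[OF C[OF that] K]] by (simp only: mult.assoc)
  then show "\<exists>C. \<forall>s. Im s \<le> 0 --> g s \<le> C * exp (cmod s / real k + a * Im s)" by blast
qed

text \<open>The additional factor \<open>s\<close> is absorbed by passing from \<open>k\<close> to
  \<open>2 k\<close>: with \<open>y = cmod s / (2 k)\<close> one has \<open>y \<le> exp y\<close>.
  It appears on differentiating the Laplace integral in \<open>z\<close>.\<close>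

lemma mgrowth_mult_id:
  assumes m: "mgrowth a (\<lambda>s. cmod (f s))"
  shows "mgrowth a (\<lambda>s. cmod (\<i> * s * f s))"
  unfolding mgrowth_def
proof (intro allI impI)
  fix k :: nat assume k: "1 \<le> k"
  have "1 \<le> 2 * k" using k by simp
  then obtain C where C: "\<And>s. Im s \<le> 0 ==> cmod (f s) \<le> C * exp (cmod s / real (2 * k) + a * Im s)"
    using m unfolding mgrowth_def by blast
  have "cmod (\<i> * s * f s) \<le> (2 * real k * \<bar>C\<bar>) * exp (cmod s / real k + a * Im s)" if s: "Im s \<le> 0" for s
  proof -
    define y where "y = cmod s / real (2 * k)"
    have "y \<le> exp y" using exp_ge_add_one_self[of y] by linarith
    moreover have "cmod s = 2 * real k * y" using k by (simp add: y_def)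
    ultimately have 1: "cmod s \<le> 2 * real k * exp y" using k by (simp add: mult_left_mono)
    have "cmod (f s) \<le> \<bar>C\<bar> * exp (y + a * Im s)"
      unfolding y_def by (rule order_trans[OF C[OF s] mult_right_mono[OF abs_ge_self]]) simp
    then have "cmod s * cmod (f s) \<le> (2 * real k * exp y) * (\<bar>C\<bar> * exp (y + a * Im s))"
      using 1 by (intro mult_mono) auto
    then have "cmod (\<i> * s * f s) \<le> (2 * real k * exp y) * (\<bar>C\<bar> * exp (y + a * Im s))"
      by (simp add: norm_mult)
    also have "\<dots> = (2 * real k * \<bar>C\<bar>) * exp (y + (y + a * Im s))" by (simp only: exp_add mult_ac)
    also have "y + (y + a * Im s) = cmod s / real k + a * Im s" using k by (simp add: y_def)
    finally show ?thesis .
  qed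
  then show "\<exists>C. \<forall>s. Im s \<le> 0 --> cmod (\<i> * s * f s) \<le> C * exp (cmod s / real k + a * Im s)" by blast
qed

section \<open>Laplace integrals along a fixed ray\<close>

lemma cmod_rk: "dir u ==> cmod (rk u z t) = exp (- Im (z * u) * t)"
proof -
  assume u: "dir u"
  have "Re (\<i> * z * (u * of_real t)) = - Im (z * u) * t" by (simp add: algebra_simps)
  then show ?thesis using u by (simp only: rk_def norm_mult norm_exp_eq_Re dir_def mult_1_left)
qed

text \<open>Half of the rate \<open>r\<close> pays for the subexponential factor
  \<open>exp (cmod s / k)\<close>. The constant is the same for all \<open>z\<close> of rate at
  least \<open>r\<close>, which yields dominated convergence and uniform bounds at once.\<close>

lemma ray_bound:
  assumes m: "mgrowth a h" and u: "dir u" and r: "0 < r"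
  obtains C where "0 \<le> C" "\<And>z t. r \<le> rate u a z ==> 0 < t ==> cmod (rk u z t) * h (u * of_real t) \<le> C * exp (- (r / 2) * \<bar>t\<bar>)"
proof -
  obtain k :: nat where k: "1 \<le> k" "0 \<le> real k" "1 / real k \<le> r / 2" using nat_large[of "r / 2" 0] r by auto
  obtain C where C: "\<And>s. Im s \<le> 0 ==> h s \<le> C * exp (cmod s / real k + a * Im s)"
    using m k(1) unfolding mgrowth_def by blast
  have "cmod (rk u z t) * h (u * of_real t) \<le> \<bar>C\<bar> * exp (- (r / 2) * \<bar>t\<bar>)" if rz: "r \<le> rate u a z" and t: "0 < t" for z t
  proof -
    have "h (u * of_real t) \<le> C * exp (cmod (u * of_real t) / real k + a * Im (u * of_real t))"
      using dir_lower[OF u, of t] t by (intro C) auto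
    also have "\<dots> \<le> \<bar>C\<bar> * exp (cmod (u * of_real t) / real k + a * Im (u * of_real t))"
      by (intro mult_right_mono) auto
    also have "cmod (u * of_real t) / real k + a * Im (u * of_real t) = t * (1 / real k) + a * Im u * t"
      using u t by (simp add: norm_mult dir_def)
    finally have "cmod (rk u z t) * h (u * of_real t) \<le> exp (- Im (z * u) * t) * (\<bar>C\<bar> * exp (t * (1 / real k) + a * Im u * t))"
      unfolding cmod_rk[OF u] by (rule mult_left_mono) simp
    also have "\<dots> = \<bar>C\<bar> * exp (- Im (z * u) * t + (t * (1 / real k) + a * Im u * t))" by (simp only: exp_add mult_ac)
    also have "- Im (z * u) * t + (t * (1 / real k) + a * Im u * t) = t * (1 / real k) - t * rate u a z"
      by (simp add: rate_def algebra_simps)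
    also have "\<bar>C\<bar> * exp (t * (1 / real k) - t * rate u a z) \<le> \<bar>C\<bar> * exp (- (r / 2) * \<bar>t\<bar>)"
    proof -
      have m1: "t * (1 / real k) \<le> t * (r / 2)" using t k(3) by (intro mult_left_mono) auto
      have m2: "t * r \<le> t * rate u a z" using t rz by (intro mult_left_mono) auto
      have m3: "t * (r / 2) = (t * r) / 2" "- (r / 2) * \<bar>t\<bar> = - ((t * r) / 2)" using t by simp_all
      have "t * (1 / real k) - t * rate u a z \<le> - (r / 2) * \<bar>t\<bar>" unfolding m3(2) using m1 m2 unfolding m3(1) by linarith
      then show ?thesis by (intro mult_left_mono) auto
    qed
    finally show ?thesis .
  qed
  then show thesis using that[of "\<bar>C\<bar>"] by simp
qed

lemma continuous_half_line:
  fixes g :: "real => 'x::topological_space"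
  assumes "continuous_on {0<..} g"
  shows "continuous_on (- {0}) (\<lambda>t. if 0 < t then g t else c)"
proof -
  have "continuous_on ({0<..} \<union> {..<0}) (\<lambda>t. if 0 < t then g t else c)"
  proof (rule continuous_on_open_Un)
    show "continuous_on {0<..} (\<lambda>t. if 0 < t then g t else c)"
      by (rule continuous_on_eq[OF assms]) simp
    show "continuous_on {..<0} (\<lambda>t. if 0 < t then g t else c)"
      by (rule continuous_on_eq[OF continuous_on_const[of _ c]]) simp
  qed auto
  moreover have "- {0} = {0<..} \<union> {..<0::real}" by auto
  ultimately show ?thesis by (simp only:)
qed

lemma continuous_rk: "continuous_on S (rk u z)"
  unfolding rk_def by (intro continuous_intros)

lemma continuous_ray:
  assumes "continuous_on lower f" "dir u"
  shows "continuous_on {0<..} (\<lambda>t. f (u * complex_of_real t))"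
  by (rule continuous_on_compose2[OF assms(1)]) (use dir_lower[OF assms(2)] in \<open>auto intro!: continuous_intros\<close>)

lemma Lr_integrable:
  assumes cont: "continuous_on lower f" and m: "mgrowth a (\<lambda>s. cmod (f s))" and u: "dir u" and r: "0 < rate u a z"
  shows "integrable lborel (\<lambda>t. rk u z t * (if 0 < t then f (u * of_real t) else 0))"
proof -
  obtain C where C: "0 \<le> C" "\<And>z' t. rate u a z \<le> rate u a z' ==> 0 < t ==> cmod (rk u z' t) * cmod (f (u * of_real t)) \<le> C * exp (- (rate u a z / 2) * \<bar>t\<bar>)"
    using ray_bound[OF m u r] by metis
  have r2: "0 < rate u a z / 2" using r by simp
  show ?thesis
  proof (rule integrable_exp_bounded[of "{0}", OF _ _ r2])
    show "continuous_on (- {0}) (\<lambda>t. rk u z t * (if 0 < t then f (u * of_real t) else 0))"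
      by (intro continuous_on_mult continuous_rk continuous_half_line continuous_ray[OF cont u])
    show "cmod (rk u z t * (if 0 < t then f (u * of_real t) else 0)) \<le> C * exp (- (rate u a z / 2) * \<bar>t\<bar>)" for t
      using C(2)[OF order_refl, of t] C(1) by (auto simp: norm_mult)
  qed simp
qed

lemma Lr_limit:
  assumes hol: "f holomorphic_on lower" and m: "mgrowth a (\<lambda>s. cmod (f s))" and u: "dir u" and r: "0 < rate u a z"
    and F: "\<And>s. s \<in> lower ==> (F has_field_derivative exp (\<i> * z * s) * f s) (at s)"
  shows "((\<lambda>R. F (u * of_real R) - F 0) \<longlongrightarrow> Lr u f z) at_top"
proof -
  define g where "g t = rk u z t * (if 0 < t then f (u * of_real t) else 0)" for t
  have int: "integrable lborel g"
    unfolding g_def by (rule Lr_integrable[OF holomorphic_on_imp_continuous_on[OF hol] m u r])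
  have part: "(LINT t:{-R..R}|lborel. g t) = F (u * of_real R) - F 0" if R: "0 < R" for R
  proof -
    \<comment> \<open>Frozen at its value in 0 for negative \<open>t\<close>, matching the integrand
      that was extended by 0.\<close>
    define G where "G t = F (u * of_real (max 0 t))" for t
    have "(g has_integral (G R - G (- R))) {-R..R}"
    proof (rule fundamental_theorem_of_calculus_interior_strong[where S = "{0}"])
      fix t assume t: "t \<in> {- R<..<R} - {0}"
      show "(G has_vector_derivative g t) (at t)"
      proof (cases "0 < t")
        case True
        have "u * of_real t \<in> lower" using True dir_lower[OF u, of t] by simp
        from DERIV_chain'[OF DERIV_cmult_Id[of u] F[OF this]]
        have "((\<lambda>s. F (u * s)) has_field_derivative (exp (\<i> * z * (u * of_real t)) * f (u * of_real t)) * u) (at (of_real t))" .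
        then have "((\<lambda>s. F (u * s)) has_field_derivative u * (exp (\<i> * z * (u * of_real t)) * f (u * of_real t))) (at (of_real t))"
          by (simp only: mult.commute)
        then have "((\<lambda>s. F (u * of_real s)) has_vector_derivative u * (exp (\<i> * z * (u * of_real t)) * f (u * of_real t))) (at t)"
          by (rule has_vector_derivative_real_field)
        then have "(G has_vector_derivative u * (exp (\<i> * z * (u * of_real t)) * f (u * of_real t))) (at t)"
          by (rule has_vector_derivative_transform_within_open[OF _ open_greaterThan[of 0]])
             (use True in \<open>auto simp: G_def\<close>)
        then show ?thesis using True by (simp add: g_def rk_def mult.assoc)
      next
        case False
        have "((\<lambda>s. F 0) has_vector_derivative 0) (at t)" by (rule has_vector_derivative_const)
        then have "(G has_vector_derivative 0) (at t)"
          by (rule has_vector_derivative_transform_within_open[OF _ open_lessThan[of 0]])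
             (use False t in \<open>auto simp: G_def\<close>)
        then show ?thesis using False by (simp add: g_def)
      qed
    next
      have "continuous_on lower F" by (intro continuous_at_imp_continuous_on ballI DERIV_isCont[OF F])
      then show "continuous_on {-R..R} G"
        unfolding G_def
        by (rule continuous_on_compose2) (use dir_lower[OF u] in \<open>auto intro!: continuous_intros\<close>)
    qed (use R in auto)
    moreover have "set_integrable lborel {-R..R} g"
      unfolding set_integrable_def using int by (intro integrable_mult_indicator) auto
    ultimately show ?thesis
      using R by (simp add: set_borel_integral_eq_integral(2) integral_unique G_def)
  qed
  have "((\<lambda>R. LINT t|lborel. indicator {-R..R} t *\<^sub>R g t) \<longlongrightarrow> integral\<^sup>L lborel g) at_top"
  proof (rule integral_dominated_convergence_at_top[where w = "\<lambda>t. cmod (g t)"])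
    show "AE t in lborel. ((\<lambda>r. indicator {-r..r} t *\<^sub>R g t) \<longlongrightarrow> g t) at_top"
    proof (rule AE_I2)
      fix t :: real
      show "((\<lambda>r. indicator {-r..r} t *\<^sub>R g t) \<longlongrightarrow> g t) at_top"
      proof (rule tendsto_eventually)
        show "\<forall>\<^sub>F r in at_top. indicator {-r..r} t *\<^sub>R g t = g t"
          using eventually_ge_at_top[of "\<bar>t\<bar>"] by eventually_elim (auto simp: indicator_def)
      qed
    qed
    show "\<forall>\<^sub>F r in at_top. AE t in lborel. norm (indicator {-r..r} t *\<^sub>R g t) \<le> cmod (g t)"
      by (auto simp: indicator_def)
    show "integrable lborel (\<lambda>t. cmod (g t))" using int by (rule integrable_norm)
  qed (use int in \<open>auto intro: borel_measurable_integrable\<close>)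
  then have "((\<lambda>R. F (u * of_real R) - F 0) \<longlongrightarrow> integral\<^sup>L lborel g) at_top"
  proof (rule Lim_transform_eventually)
    show "\<forall>\<^sub>F R in at_top. (LINT t|lborel. indicator {-R..R} t *\<^sub>R g t) = F (u * of_real R) - F 0"
      using eventually_gt_at_top[of 0] by eventually_elim (use part in \<open>simp add: set_lebesgue_integral_def\<close>)
  qed
  then show ?thesis unfolding Lr_def g_def .
qed

lemma lower_primitive:
  assumes "\<psi> holomorphic_on lower"
  obtains F where "\<And>s. s \<in> lower ==> (F has_field_derivative \<psi> s) (at s)"
proof -
  obtain F where F: "\<And>s. s \<in> lower ==> (F has_field_derivative \<psi> s) (at s within lower)"
    using holomorphic_convex_primitive'[OF lower_props(2,1) assms] by blast
  have "(F has_field_derivative \<psi> s) (at s)" if s: "s \<in> lower" for s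
    using F[OF s] at_within_open[OF s lower_props(1)] by simp
  then show thesis by (rule that)
qed

text \<open>Cauchy's theorem in the sector spanned by the two rays.\<close>

lemma Lr_agree:
  assumes hol: "f holomorphic_on lower" and m: "mgrowth a (\<lambda>s. cmod (f s))"
    and u: "dir u" "0 < rate u a z" and v: "dir v" "0 < rate v a z"
  shows "Lr u f z = Lr v f z"
proof -
  have "(\<lambda>s. exp (\<i> * z * s) * f s) holomorphic_on lower" using hol by (intro holomorphic_intros)
  then obtain F where F: "\<And>s. s \<in> lower ==> (F has_field_derivative exp (\<i> * z * s) * f s) (at s)"
    by (rule lower_primitive) (rule that)
  define \<rho> where "\<rho> = min (rate u a z) (rate v a z)"
  have \<rho>: "0 < \<rho>" using u v by (simp add: \<rho>_def)
  obtain k :: nat where k: "1 \<le> k" "0 \<le> real k" "1 / real k \<le> \<rho> / 2" using nat_large[of "\<rho> / 2" 0] \<rho> by auto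
  obtain C where C: "\<And>s. Im s \<le> 0 ==> cmod (f s) \<le> C * exp (cmod s / real k + a * Im s)"
    using m k(1) unfolding mgrowth_def by blast
  have est: "cmod (F (u * of_real R) - F (v * of_real R)) \<le> (\<bar>C\<bar> * (8 / \<rho>)) * exp (- (\<rho> / 4) * R)" if R: "0 < R" for R
  proof -
    have "cmod (F (u * of_real R) - F (v * of_real R)) \<le> \<bar>C\<bar> * exp (- (\<rho> / 2) * R) * cmod (u * of_real R - v * of_real R)"
    proof (rule field_differentiable_bound[OF convex_closed_segment])
      fix s assume "s \<in> closed_segment (u * of_real R) (v * of_real R)"
      then obtain \<theta> where \<theta>: "0 \<le> \<theta>" "\<theta> \<le> 1" and s: "s = (1 - \<theta>) *\<^sub>R (u * of_real R) + \<theta> *\<^sub>R (v * of_real R)"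
        unfolding closed_segment_def by blast
      have Im: "Im s = R * ((1 - \<theta>) * Im u + \<theta> * Im v)" by (simp add: s algebra_simps)
      have "(1 - \<theta>) * Im u + \<theta> * Im v \<le> 0"
        using \<theta> u(1) v(1) by (intro add_nonpos_nonpos mult_nonneg_nonpos) (auto simp: dir_def)
      then have Ims: "Im s \<le> 0" unfolding Im using R by (simp add: mult_nonneg_nonpos)
      then have "s \<in> lower" by (simp add: lower_def)
      then show "(F has_field_derivative exp (\<i> * z * s) * f s) (at s within closed_segment (u * of_real R) (v * of_real R))"
        by (rule has_field_derivative_at_within[OF F])
      have "cmod s \<le> (1 - \<theta>) * cmod (u * of_real R) + \<theta> * cmod (v * of_real R)"
        unfolding s using \<theta> norm_triangle_ineq[of "(1 - \<theta>) *\<^sub>R (u * of_real R)" "\<theta> *\<^sub>R (v * of_real R)"] by simp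
      also have "\<dots> = R" using u(1) v(1) R by (simp add: norm_mult dir_def algebra_simps)
      finally have cs: "cmod s \<le> R" .
      \<comment> \<open>The endpoints are joined by a chord instead of an arc. By linearity of the
        rate in the direction the exponent on the chord is a convex combination of the two values at
        its ends, hence at most \<open>- R * \<rho>\<close>.\<close>
      have "a * Im s - Im (z * s) = - R * ((1 - \<theta>) * rate u a z + \<theta> * rate v a z)"
        by (simp add: s rate_def algebra_simps)
      moreover have "\<rho> \<le> (1 - \<theta>) * rate u a z + \<theta> * rate v a z"
      proof -
        have "\<rho> = (1 - \<theta>) * \<rho> + \<theta> * \<rho>" by (simp add: algebra_simps)
        also have "\<dots> \<le> (1 - \<theta>) * rate u a z + \<theta> * rate v a z"
          using \<theta> by (intro add_mono mult_left_mono) (auto simp: \<rho>_def)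
        finally show ?thesis .
      qed
      ultimately have e2: "a * Im s - Im (z * s) \<le> - R * \<rho>" using R by (simp add: mult_left_mono)
      have e3: "cmod s * (1 / real k) \<le> R * (\<rho> / 2)" using cs k R by (intro mult_mono) auto
      have "Re (\<i> * z * s) = - Im (z * s)" by simp
      then have "cmod (exp (\<i> * z * s) * f s) = exp (- Im (z * s)) * cmod (f s)"
        by (simp only: norm_mult norm_exp_eq_Re)
      also have "\<dots> \<le> exp (- Im (z * s)) * (\<bar>C\<bar> * exp (cmod s / real k + a * Im s))"
        by (intro mult_left_mono order_trans[OF C[OF Ims]] mult_right_mono) auto
      also have "\<dots> = \<bar>C\<bar> * exp (- Im (z * s) + (cmod s / real k + a * Im s))" by (simp only: exp_add mult_ac)
      also have "\<dots> \<le> \<bar>C\<bar> * exp (- (\<rho> / 2) * R)"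
      proof -
        have m3: "cmod s * (1 / real k) = cmod s / real k" "R * (\<rho> / 2) = (R * \<rho>) / 2" "- (\<rho> / 2) * R = - ((R * \<rho>) / 2)"
          "- R * \<rho> = - (R * \<rho>)" by simp_all
        have "- Im (z * s) + (cmod s / real k + a * Im s) \<le> - (\<rho> / 2) * R"
          using e2 e3 unfolding m3 by linarith
        then show ?thesis by (intro mult_left_mono) auto
      qed
      finally show "cmod (exp (\<i> * z * s) * f s) \<le> \<bar>C\<bar> * exp (- (\<rho> / 2) * R)" .
    qed auto
    also have "\<dots> \<le> \<bar>C\<bar> * exp (- (\<rho> / 2) * R) * ((8 / \<rho>) * exp ((\<rho> / 4) * R))"
    proof -
      \<comment> \<open>The length of the chord grows linearly and is absorbed by half of the
        remaining decay, leaving the rate \<open>\<rho> / 4\<close>.\<close>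
      have "cmod (u * of_real R - v * of_real R) \<le> 2 * R"
        using norm_triangle_ineq4[of "u * of_real R" "v * of_real R"] u(1) v(1) R by (simp add: norm_mult dir_def)
      also have "\<dots> = (8 / \<rho>) * ((\<rho> / 4) * R)" using \<rho> by simp
      also have "\<dots> \<le> (8 / \<rho>) * exp ((\<rho> / 4) * R)"
      proof (rule mult_left_mono)
        show "(\<rho> / 4) * R \<le> exp ((\<rho> / 4) * R)" using exp_ge_add_one_self[of "(\<rho> / 4) * R"] by linarith
      qed (use \<rho> in simp)
      finally show ?thesis by (intro mult_left_mono) auto
    qed
    also have "\<dots> = (\<bar>C\<bar> * (8 / \<rho>)) * exp (- (\<rho> / 2) * R + (\<rho> / 4) * R)" by (simp only: exp_add mult_ac)
    also have "- (\<rho> / 2) * R + (\<rho> / 4) * R = - (\<rho> / 4) * R" by simp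
    finally show ?thesis .
  qed
  have l0: "((\<lambda>R. F (u * of_real R) - F (v * of_real R)) \<longlongrightarrow> 0) at_top"
  proof (rule Lim_null_comparison)
    show "\<forall>\<^sub>F R in at_top. cmod (F (u * of_real R) - F (v * of_real R)) \<le> (\<bar>C\<bar> * (8 / \<rho>)) * exp (- (\<rho> / 4) * R)"
      using eventually_gt_at_top[of 0] by eventually_elim (rule est)
    have "((\<lambda>R. exp (- (\<rho> / 4) * R)) \<longlongrightarrow> 0) at_top"
      using \<rho> by (intro filterlim_compose[OF exp_at_bot] filterlim_tendsto_neg_mult_at_bot[OF tendsto_const]) (auto intro: filterlim_ident)
    then have "((\<lambda>R. (\<bar>C\<bar> * (8 / \<rho>)) * exp (- (\<rho> / 4) * R)) \<longlongrightarrow> (\<bar>C\<bar> * (8 / \<rho>)) * 0) at_top"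
      by (intro tendsto_intros)
    then show "((\<lambda>R. (\<bar>C\<bar> * (8 / \<rho>)) * exp (- (\<rho> / 4) * R)) \<longlongrightarrow> 0) at_top" by simp
  qed
  have l1: "((\<lambda>R. (F (u * of_real R) - F 0) - (F (v * of_real R) - F 0)) \<longlongrightarrow> Lr u f z - Lr v f z) at_top"
    by (intro tendsto_diff Lr_limit[OF hol m _ _ F] u v)
  have eq: "(F (u * of_real R) - F 0) - (F (v * of_real R) - F 0) = F (u * of_real R) - F (v * of_real R)" for R by simp
  have "Lr u f z - Lr v f z = 0" by (rule tendsto_unique[OF trivial_limit_at_top_linorder l1[unfolded eq] l0])
  then show ?thesis by simp
qed

lemma rate_continuous: "continuous_on S (rate u a)"
  unfolding rate_def by (intro continuous_intros)

lemma open_rate: "open {z. r < rate u a z}"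
  by (intro open_Collect_less continuous_on_const rate_continuous)

lemma rate_diff: "dir u ==> \<bar>rate u a z - rate u a w\<bar> \<le> cmod (z - w)"
proof -
  assume "dir u"
  have "rate u a z - rate u a w = Im ((z - w) * u)" by (simp add: rate_def algebra_simps)
  then show ?thesis using abs_Im_le_cmod[of "(z - w) * u"] \<open>dir u\<close> by (simp add: norm_mult dir_def)
qed

lemma Lr_deriv:
  assumes hol: "f holomorphic_on lower" and m: "mgrowth a (\<lambda>s. cmod (f s))" and u: "dir u" and r: "0 < rate u a z"
  shows "(Lr u f has_field_derivative Lr u (\<lambda>s. \<i> * s * f s) z) (at z)"
proof -
  define \<Omega> where "\<Omega> = {z. 0 < rate u a z}"
  define r2 where "r2 = rate u a z / 2"
  have r2: "0 < r2" "0 < r2 / 2" using r by (auto simp: r2_def)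
  have near: "r2 \<le> rate u a w" if "w \<in> cball z r2" for w
    using rate_diff[OF u, of a z w] that by (auto simp: r2_def dist_norm)
  obtain C where C: "0 \<le> C" "\<And>z t. r2 \<le> rate u a z ==> 0 < t ==> cmod (rk u z t) * cmod (f (u * of_real t)) \<le> C * exp (- (r2 / 2) * \<bar>t\<bar>)"
    using ray_bound[OF m u r2(1)] by metis
  have cont: "continuous_on lower f" by (rule holomorphic_on_imp_continuous_on[OF hol])
  have cont2: "continuous_on lower (\<lambda>s. \<i> * s * f s)" by (intro continuous_intros cont)
  have "((\<lambda>w. LINT t|lborel. rk u w t * (if 0 < t then f (u * of_real t) else 0)) has_field_derivative
      (LINT t|lborel. rk u z t * (if 0 < t then \<i> * (u * of_real t) * f (u * of_real t) else 0))) (at z)"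
  proof (rule leibniz_rule_lborel[where \<Omega> = \<Omega> and S = "{}" and r = r2 and D = "\<lambda>t. C * exp (- (r2 / 2) * \<bar>t\<bar>)"])
    show "open \<Omega>" unfolding \<Omega>_def by (rule open_rate)
    show "cball z r2 \<subseteq> \<Omega>" using near r2 by (force simp: \<Omega>_def)
    show "integrable lborel (\<lambda>t. rk u w t * (if 0 < t then f (u * of_real t) else 0))" if "w \<in> \<Omega>" for w
      using that by (intro Lr_integrable[OF cont m u]) (simp add: \<Omega>_def)
    show "integrable lborel (\<lambda>t. rk u z t * (if 0 < t then \<i> * (u * of_real t) * f (u * of_real t) else 0))"
      by (rule Lr_integrable[OF cont2 mgrowth_mult_id[OF m] u r])
    show "(\<lambda>w. rk u w t * (if 0 < t then f (u * of_real t) else 0)) holomorphic_on \<Omega>" for t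
      unfolding rk_def by (intro holomorphic_intros)
    show "deriv (\<lambda>w. rk u w t * (if 0 < t then f (u * of_real t) else 0)) z
        = rk u z t * (if 0 < t then \<i> * (u * of_real t) * f (u * of_real t) else 0)" for t
      unfolding rk_def by (rule DERIV_imp_deriv) (auto intro!: derivative_eq_intros)
    show "integrable lborel (\<lambda>t. C * exp (- (r2 / 2) * \<bar>t\<bar>))" by (rule integrable_exp_abs[OF r2(2)])
    show "cmod (rk u w t * (if 0 < t then f (u * of_real t) else 0)) \<le> C * exp (- (r2 / 2) * \<bar>t\<bar>)"
      if "w \<in> cball z r2" for t w
      using C(2)[OF near[OF that], of t] C(1) by (auto simp: norm_mult)
  qed (use r2 in auto)
  then show ?thesis by (simp add: Lr_def[abs_def])
qed

lemma Lr_linear: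
  assumes "continuous_on lower f" "mgrowth a (\<lambda>s. cmod (f s))" "continuous_on lower g" "mgrowth a (\<lambda>s. cmod (g s))"
    and "dir u" "0 < rate u a z"
  shows "Lr u (\<lambda>s. x * f s + y * g s) z = x * Lr u f z + y * Lr u g z"
proof -
  have "Lr u (\<lambda>s. x * f s + y * g s) z = (LINT t|lborel. x * (rk u z t * (if 0 < t then f (u * of_real t) else 0))
      + y * (rk u z t * (if 0 < t then g (u * of_real t) else 0)))"
    unfolding Lr_def by (rule Bochner_Integration.integral_cong) (auto simp: algebra_simps)
  also have "\<dots> = x * Lr u f z + y * Lr u g z"
    unfolding Lr_def using Lr_integrable[OF assms(1,2,5,6)] Lr_integrable[OF assms(3,4,5,6)]
    by (subst Bochner_Integration.integral_add) auto
  finally show ?thesis .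
qed

lemma mgrowth_exp: "mgrowth a (\<lambda>s. cmod (exp (- \<i> * of_real a * s)))"
  unfolding mgrowth_def
  by (intro allI impI exI[of _ 1]) (simp add: norm_exp_eq_Re)

lemma Lr_exp:
  assumes u: "dir u" and r: "0 < rate u a z"
  shows "Lr u (\<lambda>s. exp (- \<i> * of_real a * s)) z = \<i> / (z - of_real a)"
proof -
  define F where "F s = exp (\<i> * (z - of_real a) * s) / (\<i> * (z - of_real a))" for s
  have ne: "z \<noteq> of_real a" using r by (auto simp: rate_def)
  have F: "(F has_field_derivative exp (\<i> * z * s) * exp (- \<i> * of_real a * s)) (at s)" for s
  proof -
    have "(F has_field_derivative exp (\<i> * (z - of_real a) * s)) (at s)"
      unfolding F_def using ne by (auto intro!: derivative_eq_intros)
    moreover have "exp (\<i> * (z - of_real a) * s) = exp (\<i> * z * s) * exp (- \<i> * of_real a * s)"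
      by (simp add: exp_add[symmetric] algebra_simps)
    ultimately show ?thesis by (simp only:)
  qed
  have l1: "((\<lambda>R. F (u * of_real R) - F 0) \<longlongrightarrow> Lr u (\<lambda>s. exp (- \<i> * of_real a * s)) z) at_top"
    by (rule Lr_limit[OF _ mgrowth_exp u r F]) (intro holomorphic_intros)
  have "((\<lambda>R. F (u * of_real R)) \<longlongrightarrow> 0) at_top"
  proof (rule Lim_null_comparison)
    have "cmod (F (u * of_real R)) = exp (- rate u a z * R) / cmod (z - of_real a)" for R
    proof -
      have "Re (\<i> * (z - of_real a) * (u * of_real R)) = - rate u a z * R" by (simp add: rate_def algebra_simps)
      then show ?thesis by (simp only: F_def norm_divide norm_mult norm_exp_eq_Re norm_ii mult_1_left)
    qed
    then show "\<forall>\<^sub>F R in at_top. cmod (F (u * of_real R)) \<le> exp (- rate u a z * R) / cmod (z - of_real a)" by simp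
    have "((\<lambda>R. exp (- rate u a z * R)) \<longlongrightarrow> 0) at_top"
      using r by (intro filterlim_compose[OF exp_at_bot] filterlim_tendsto_neg_mult_at_bot[OF tendsto_const]) (auto intro: filterlim_ident)
    then have "((\<lambda>R. exp (- rate u a z * R) / cmod (z - of_real a)) \<longlongrightarrow> 0 / cmod (z - of_real a)) at_top"
      using ne by (intro tendsto_intros) auto
    then show "((\<lambda>R. exp (- rate u a z * R) / cmod (z - of_real a)) \<longlongrightarrow> 0) at_top" by simp
  qed
  then have l2: "((\<lambda>R. F (u * of_real R) - F 0) \<longlongrightarrow> 0 - F 0) at_top" by (intro tendsto_intros)
  have "Lr u (\<lambda>s. exp (- \<i> * of_real a * s)) z = 0 - F 0"
    by (rule tendsto_unique[OF trivial_limit_at_top_linorder l1 l2])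
  also have "\<dots> = \<i> / (z - of_real a)" using ne by (simp add: F_def field_simps)
  finally show ?thesis .
qed

section \<open>The inverse transform with rays depending on the point\<close>

text \<open>Three directions suffice: the vertical ray has rate \<open>a - Re z\<close>, the two
  horizontal ones have rates \<open>Im z\<close> and \<open>- Im z\<close>, so one of them is
  positive at every point of the cut plane.\<close>

definition sel :: "real => complex => complex" where
  "sel a z = (if Re z < a then - \<i> else if 0 < Im z then 1 else -1)"

lemma dir_simps [simp]: "dir 1" "dir (- 1)" "dir (- \<i>)"
  by (simp_all add: dir_def)

lemma dir_sel [simp]: "dir (sel a z)"
  by (simp add: sel_def)

lemma rate_simps: "rate 1 a z = Im z" "rate (- 1) a z = - Im z" "rate (- \<i>) a z = a - Re z"
  by (simp_all add: rate_def)

lemma rate_sel: "z \<in> slit a ==> 0 < rate (sel a z) a z"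
  by (auto simp: sel_def rate_simps slit_iff)

lemma rate_sel_slit: "0 < rate (sel a z) a w ==> w \<in> slit a"
  by (auto simp: sel_def rate_simps slit_iff split: if_splits)

definition Lg :: "real => (complex => complex) => complex => complex" where
  "Lg a f z = Lr (sel a z) f z"

text \<open>The direction jumps with the point, but by \<open>Lr_agree\<close> the ray chosen at
  \<open>z\<close> may be kept fixed on the whole open set where its rate is positive. This reduces
  regularity to a fixed ray.\<close>

lemma Lg_eq:
  assumes "f holomorphic_on lower" "mgrowth a (\<lambda>s. cmod (f s))" "0 < rate (sel a z) a w"
  shows "Lg a f w = Lr (sel a z) f w"
  unfolding Lg_def
  by (rule Lr_agree[OF assms(1,2)]) (use assms(3) rate_sel[OF rate_sel_slit[OF assms(3)]] in auto)

lemma Lg_deriv: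
  assumes hol: "f holomorphic_on lower" and m: "mgrowth a (\<lambda>s. cmod (f s))" and z: "z \<in> slit a"
  shows "(Lg a f has_field_derivative Lg a (\<lambda>s. \<i> * s * f s) z) (at z)"
proof -
  have "(Lr (sel a z) f has_field_derivative Lg a (\<lambda>s. \<i> * s * f s) z) (at z)"
    unfolding Lg_def by (rule Lr_deriv[OF hol m dir_sel rate_sel[OF z]])
  then show ?thesis
    by (rule has_field_derivative_transform_within_open[OF _ open_rate[of 0 "sel a z" a]])
       (use rate_sel[OF z] Lg_eq[OF hol m] in auto)
qed

lemma Lg_holomorphic:
  assumes hol: "f holomorphic_on lower" and m: "mgrowth a (\<lambda>s. cmod (f s))"
  shows "Lg a f holomorphic_on slit a"
  using Lg_deriv[OF hol m] by (auto simp: holomorphic_on_open)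

lemma Lr_bound:
  assumes C: "\<And>z t. r \<le> rate u a z ==> 0 < t ==> cmod (rk u z t) * h (u * of_real t) \<le> C * exp (- (r / 2) * \<bar>t\<bar>)"
    and "0 \<le> C" "0 < r" and fh: "\<And>s. cmod (f s) \<le> h s" and r: "r \<le> rate u a z"
    and cont: "continuous_on lower f" and m: "mgrowth a (\<lambda>s. cmod (f s))" and u: "dir u"
  shows "cmod (Lr u f z) \<le> (LINT t|lborel. C * exp (- (r / 2) * \<bar>t\<bar>))"
proof -
  have int: "integrable lborel (\<lambda>t. rk u z t * (if 0 < t then f (u * of_real t) else 0))"
    using r \<open>0 < r\<close> by (intro Lr_integrable[OF cont m u]) auto
  have "cmod (Lr u f z) \<le> (LINT t|lborel. cmod (rk u z t * (if 0 < t then f (u * of_real t) else 0)))"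
    unfolding Lr_def by (rule integral_norm_bound)
  also have "\<dots> \<le> (LINT t|lborel. C * exp (- (r / 2) * \<bar>t\<bar>))"
  proof (rule integral_mono)
    show "integrable lborel (\<lambda>t. C * exp (- (r / 2) * \<bar>t\<bar>))" using \<open>0 < r\<close> by (intro integrable_exp_abs) auto
    show "integrable lborel (\<lambda>t. cmod (rk u z t * (if 0 < t then f (u * of_real t) else 0)))"
      by (rule integrable_norm[OF int])
    show "cmod (rk u z t * (if 0 < t then f (u * of_real t) else 0)) \<le> C * exp (- (r / 2) * \<bar>t\<bar>)" for t
    proof (cases "0 < t")
      case True
      have "cmod (rk u z t) * cmod (f (u * of_real t)) \<le> cmod (rk u z t) * h (u * of_real t)"
        by (rule mult_left_mono[OF fh norm_ge_zero])
      with C[OF r True] True show ?thesis by (simp add: norm_mult)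
    qed (use \<open>0 \<le> C\<close> in simp)
  qed
  finally show ?thesis .
qed

text \<open>For \<open>a \<le> Re z\<close> only the horizontal rays occur, with rate
  \<open>\<bar>Im z\<bar> \<ge> 1 / n\<close>; the transform is then even bounded by a
  constant.\<close>

lemma Lg_growth:
  assumes hol: "f holomorphic_on lower" and m: "mgrowth a (\<lambda>s. cmod (f s))"
  shows "growth a (\<lambda>z. cmod (Lg a f z))"
  unfolding growth_def
proof (intro allI impI)
  fix n :: nat assume "1 \<le> n"
  then have r: "0 < 1 / real n" by simp
  obtain C1 where C1: "0 \<le> C1" "\<And>z t. 1 / real n \<le> rate 1 a z ==> 0 < t ==> cmod (rk 1 z t) * cmod (f (1 * of_real t)) \<le> C1 * exp (- (1 / real n / 2) * \<bar>t\<bar>)"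
    using ray_bound[OF m dir_simps(1) r] by metis
  obtain C2 where C2: "0 \<le> C2" "\<And>z t. 1 / real n \<le> rate (-1) a z ==> 0 < t ==> cmod (rk (-1) z t) * cmod (f (-1 * of_real t)) \<le> C2 * exp (- (1 / real n / 2) * \<bar>t\<bar>)"
    using ray_bound[OF m dir_simps(2) r] by metis
  note cont = holomorphic_on_imp_continuous_on[OF hol]
  define B where "B = max (LINT t|lborel. C1 * exp (- (1 / real n / 2) * \<bar>t::real\<bar>)) (LINT t|lborel. C2 * exp (- (1 / real n / 2) * \<bar>t::real\<bar>))"
  have "cmod (Lg a f z) \<le> \<bar>B\<bar> * exp (\<bar>Re z\<bar> / real n)" if z: "a \<le> Re z" "1 / real n \<le> \<bar>Im z\<bar>" for z
  proof -
    have "cmod (Lg a f z) \<le> B"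
    proof (cases "0 < Im z")
      case True
      then have "cmod (Lr 1 f z) \<le> (LINT t|lborel. C1 * exp (- (1 / real n / 2) * \<bar>t::real\<bar>))"
        using z by (intro Lr_bound[OF C1(2) C1(1) r order_refl _ cont m dir_simps(1)]) (auto simp: rate_simps)
      then show ?thesis using True z by (simp add: Lg_def sel_def B_def)
    next
      case False
      then have "cmod (Lr (-1) f z) \<le> (LINT t|lborel. C2 * exp (- (1 / real n / 2) * \<bar>t::real\<bar>))"
        using z by (intro Lr_bound[OF C2(2) C2(1) r order_refl _ cont m dir_simps(2)]) (auto simp: rate_simps)
      then show ?thesis using False z by (simp add: Lg_def sel_def B_def)
    qed
    also have "B \<le> \<bar>B\<bar> * 1" by simp
    also have "\<dots> \<le> \<bar>B\<bar> * exp (\<bar>Re z\<bar> / real n)" by (intro mult_left_mono) auto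
    finally show ?thesis .
  qed
  then show "\<exists>C. \<forall>z. a \<le> Re z --> 1 / real n \<le> \<bar>Im z\<bar> --> \<bar>Im z\<bar> \<le> real n --> cmod (Lg a f z) \<le> C * exp (\<bar>Re z\<bar> / real n)"
    by blast
qed

text \<open>
  Subtracting \<open>f \<zeta> * exp (- \<i> a (s - \<zeta>))\<close>, whose transform is explicit, leaves \<open>(s - \<zeta>) * q s\<close>;
  for this function the integrand has the global primitive \<open>- \<i> exp (- \<i> z \<zeta>) * Lg a q z\<close>, which
  decays along the contour.
\<close>

lemma kint_Lg:
  fixes f :: "complex => complex"
  assumes hol: "f holomorphic_on lower" and m: "mgrowth a (\<lambda>s. cmod (f s))" and \<zeta>: "Im \<zeta> < 0" and c: "0 < c"
  shows "kint a c (Lg a f) \<zeta> = 2 * pi * f \<zeta>"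
proof -
  define E where "E s = exp (- \<i> * of_real a * s)" for s
  define A where "A = f \<zeta> * exp (\<i> * of_real a * \<zeta>)"
  have holE: "E holomorphic_on lower" unfolding E_def by (intro holomorphic_intros)
  have mE: "mgrowth a (\<lambda>s. cmod (E s))" unfolding E_def by (rule mgrowth_exp)
  define g where "g s = f s - A * E s" for s
  have holg: "g holomorphic_on lower" unfolding g_def by (intro holomorphic_intros hol holE)
  have g0: "g \<zeta> = 0" by (simp add: g_def A_def E_def exp_minus)
  define q where "q s = (if s = \<zeta> then deriv g \<zeta> else (g s - g \<zeta>) / (s - \<zeta>))" for s
  have holq: "q holomorphic_on lower"
    unfolding q_def by (rule pole_lemma_open[OF holg lower_props(1)])
  have gq: "g s = (s - \<zeta>) * q s" for s by (simp add: q_def g0)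
  have mq: "mgrowth a (\<lambda>s. cmod (q s))"
    unfolding mgrowth_def
  proof (intro allI impI)
    fix k :: nat assume k: "1 \<le> k"
    obtain C where C: "\<And>s. Im s \<le> 0 ==> cmod (f s) \<le> C * exp (cmod s / real k + a * Im s)"
      using m k unfolding mgrowth_def by blast
    have "cball \<zeta> 1 \<subseteq> lower"
    proof
      fix s assume "s \<in> cball \<zeta> 1"
      then have "\<bar>Im (s - \<zeta>)\<bar> \<le> 1" using abs_Im_le_cmod[of "s - \<zeta>"] by (simp add: dist_norm norm_minus_commute)
      then show "s \<in> lower" using \<zeta> by (simp add: lower_def)
    qed
    then have "compact (q ` cball \<zeta> 1)"
      by (intro compact_continuous_image continuous_on_subset[OF holomorphic_on_imp_continuous_on[OF holq]] compact_cball)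
    then have "bounded (q ` cball \<zeta> 1)" by (rule compact_imp_bounded)
    then obtain B where B: "\<And>s. s \<in> cball \<zeta> 1 ==> cmod (q s) \<le> B" unfolding bounded_iff by blast
    define K where "K = \<bar>a\<bar> * (cmod \<zeta> + 1)"
    \<comment> \<open>On the unit disc about \<zeta> the quotient is bounded by compactness and
      \<open>exp K\<close> compensates the least value of the weight; outside, division by
      \<open>s - \<zeta>\<close> does not increase the modulus.\<close>
    define C' where "C' = max (\<bar>C\<bar> + cmod A) (\<bar>B\<bar> * exp K)"
    have "cmod (q s) \<le> C' * exp (cmod s / real k + a * Im s)" if s: "Im s \<le> 0" for s
    proof (cases "s \<in> cball \<zeta> 1")
      case True
      have cs: "cmod s \<le> cmod \<zeta> + 1" using True norm_triangle_ineq2[of s \<zeta>] by (simp add: dist_norm norm_minus_commute)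
      have "\<bar>a * Im s\<bar> \<le> K" unfolding K_def abs_mult
        using abs_Im_le_cmod[of s] cs by (intro mult_left_mono) auto
      moreover have "0 \<le> cmod s / real k" by simp
      ultimately have "- K \<le> cmod s / real k + a * Im s" by linarith
      then have e: "1 \<le> exp K * exp (cmod s / real k + a * Im s)" by (simp add: exp_add[symmetric])
      have "cmod (q s) \<le> \<bar>B\<bar> * 1" using B[OF True] by simp
      also have "\<dots> \<le> \<bar>B\<bar> * (exp K * exp (cmod s / real k + a * Im s))" using e by (intro mult_left_mono) auto
      also have "\<dots> = (\<bar>B\<bar> * exp K) * exp (cmod s / real k + a * Im s)" by (simp only: mult.assoc)
      also have "\<dots> \<le> C' * exp (cmod s / real k + a * Im s)" by (intro mult_right_mono) (auto simp: C'_def)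
      finally show ?thesis .
    next
      case False
      then have d: "1 < cmod (s - \<zeta>)" by (simp add: dist_norm norm_minus_commute)
      then have ne: "s \<noteq> \<zeta>" by auto
      have cE: "cmod (E s) = exp (a * Im s)" by (simp add: E_def norm_exp_eq_Re)
      have "cmod (q s) = cmod (g s) / cmod (s - \<zeta>)" using ne by (simp add: q_def g0 norm_divide)
      also have "\<dots> \<le> cmod (g s) / 1" using d by (intro divide_left_mono) auto
      also have "\<dots> \<le> cmod (f s) + cmod A * exp (a * Im s)"
        using norm_triangle_ineq4[of "f s" "A * E s"] by (simp add: g_def norm_mult cE)
      also have "\<dots> \<le> \<bar>C\<bar> * exp (cmod s / real k + a * Im s) + cmod A * exp (cmod s / real k + a * Im s)"
        by (intro add_mono mult_left_mono order_trans[OF C[OF s]] mult_right_mono) auto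
      also have "\<dots> = (\<bar>C\<bar> + cmod A) * exp (cmod s / real k + a * Im s)" by (simp only: distrib_right)
      also have "\<dots> \<le> C' * exp (cmod s / real k + a * Im s)" by (intro mult_right_mono) (auto simp: C'_def)
      finally show ?thesis .
    qed
    then show "\<exists>C. \<forall>s. Im s \<le> 0 --> cmod (q s) \<le> C * exp (cmod s / real k + a * Im s)" by blast
  qed
  have hol1: "(\<lambda>z. 1 / (z - of_real a)) holomorphic_on slit a"
    by (intro holomorphic_intros) (auto simp: slit_iff)
  have gr1: "growth a (\<lambda>z. cmod (1 / (z - of_real a)))"
    unfolding growth_def
  proof (intro allI impI)
    fix n :: nat assume n: "1 \<le> n"
    have "cmod (1 / (z - of_real a)) \<le> real n * exp (\<bar>Re z\<bar> / real n)" if z: "1 / real n \<le> \<bar>Im z\<bar>" for z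
    proof -
      have "1 / real n \<le> cmod (z - of_real a)" using abs_Im_le_cmod[of "z - of_real a"] z by simp
      moreover have "0 < 1 / real n" using n by simp
      ultimately have "1 / cmod (z - of_real a) \<le> 1 / (1 / real n)"
        by (intro divide_left_mono mult_pos_pos) linarith+
      also have "\<dots> = real n * 1" by simp
      also have "\<dots> \<le> real n * exp (\<bar>Re z\<bar> / real n)" by (intro mult_left_mono) auto
      finally show ?thesis by (simp add: norm_divide)
    qed
    then show "\<exists>C. \<forall>z. a \<le> Re z --> 1 / real n \<le> \<bar>Im z\<bar> --> \<bar>Im z\<bar> \<le> real n --> cmod (1 / (z - of_real a)) \<le> C * exp (\<bar>Re z\<bar> / real n)"
      by blast
  qed
  note holL = Lg_holomorphic[OF hol m] and grL = Lg_growth[OF hol m]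
  \<comment> \<open>On the cut plane this is the transform of \<open>g\<close>, because
    \<open>E\<close> has the transform \<open>i / (z - a)\<close> by \<open>Lr_exp\<close>.\<close>
  define \<phi> where "\<phi> z = 1 * Lg a f z + (- A * \<i>) * (1 / (z - of_real a))" for z
  have hol\<phi>: "\<phi> holomorphic_on slit a" unfolding \<phi>_def by (intro holomorphic_intros holL hol1) 
  have gr\<phi>: "growth a (\<lambda>z. cmod (\<phi> z))"
  proof (rule growth_le[where K = 1])
    show "growth a (\<lambda>z. cmod (Lg a f z) + cmod (A * \<i>) * cmod (1 / (z - of_real a)))"
      by (intro growth_add grL growth_le[OF gr1, of _ "cmod (A * \<i>)"]) auto
    show "cmod (\<phi> z) \<le> 1 * (cmod (Lg a f z) + cmod (A * \<i>) * cmod (1 / (z - of_real a)))" for z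
      using norm_triangle_ineq[of "Lg a f z" "(- A * \<i>) * (1 / (z - of_real a))"] unfolding \<phi>_def norm_mult by simp
  qed simp
  have lin: "kint a c \<phi> \<zeta> = 1 * kint a c (Lg a f) \<zeta> + (- A * \<i>) * kint a c (\<lambda>z. 1 / (z - of_real a)) \<zeta>"
    unfolding \<phi>_def by (rule kint_linear[OF holL grL hol1 gr1 \<zeta> c])
  have log: "kint a c (\<lambda>z. 1 / (z - of_real a)) \<zeta> = - 2 * pi * \<i> * exp (- \<i> * of_real a * \<zeta>)"
    using hook_log_integral(2)[OF \<zeta> order_refl, of "of_real a" a c] c by (simp add: kint_def)
  define \<Psi> where "\<Psi> z = - \<i> * (exp (- \<i> * z * \<zeta>) * Lg a q z)" for z
  \<comment> \<open>The splitting \<open>s * q s = g s + \<zeta> * q s\<close>. Its last term is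
    exactly what differentiating \<open>exp (- i z \<zeta>)\<close> in the product \<Psi>
    cancels.\<close>
  have key: "Lg a (\<lambda>s. \<i> * s * q s) z = \<i> * \<phi> z + \<i> * \<zeta> * Lg a q z" if z: "z \<in> slit a" for z
  proof -
    define u where "u = sel a z"
    have u: "dir u" "0 < rate u a z" using rate_sel[OF z] by (auto simp: u_def)
    have cq: "continuous_on lower q" by (rule holomorphic_on_imp_continuous_on[OF holq])
    have cf: "continuous_on lower f" by (rule holomorphic_on_imp_continuous_on[OF hol])
    have cE: "continuous_on lower E" by (rule holomorphic_on_imp_continuous_on[OF holE])
    have cg: "continuous_on lower g" by (rule holomorphic_on_imp_continuous_on[OF holg])
    have mg: "mgrowth a (\<lambda>s. cmod (g s))"
      unfolding mgrowth_def
    proof (intro allI impI)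
      fix k :: nat assume k: "1 \<le> k"
      obtain C where C: "\<And>s. Im s \<le> 0 ==> cmod (f s) \<le> C * exp (cmod s / real k + a * Im s)"
        using m k unfolding mgrowth_def by blast
      obtain D where D: "\<And>s. Im s \<le> 0 ==> cmod (E s) \<le> D * exp (cmod s / real k + a * Im s)"
        using mE k unfolding mgrowth_def by blast
      have "cmod (g s) \<le> (C + cmod A * D) * exp (cmod s / real k + a * Im s)" if s: "Im s \<le> 0" for s
        using norm_triangle_ineq4[of "f s" "A * E s"] C[OF s] mult_left_mono[OF D[OF s] norm_ge_zero[of A]]
        by (simp add: g_def norm_mult algebra_simps)
      then show "\<exists>C. \<forall>s. Im s \<le> 0 --> cmod (g s) \<le> C * exp (cmod s / real k + a * Im s)" by blast
    qed
    have "Lr u (\<lambda>s. \<i> * s * q s) z = Lr u (\<lambda>s. \<i> * g s + \<i> * \<zeta> * q s) z"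
      by (simp add: gq algebra_simps)
    also have "\<dots> = \<i> * Lr u g z + \<i> * \<zeta> * Lr u q z"
      by (rule Lr_linear[OF cg mg cq mq u])
    also have "Lr u g z = Lr u (\<lambda>s. 1 * f s + (- A) * E s) z"
      by (simp add: g_def[abs_def])
    also have "\<dots> = 1 * Lr u f z + (- A) * Lr u E z"
      by (rule Lr_linear[OF cf m cE mE u])
    also have "Lr u E z = \<i> / (z - of_real a)"
      unfolding E_def by (rule Lr_exp[OF u])
    finally show ?thesis by (simp add: Lg_def u_def[symmetric] \<phi>_def)
  qed
  have \<Psi>: "(\<Psi> has_field_derivative exp (- \<i> * z * \<zeta>) * \<phi> z) (at z)" if z: "z \<in> slit a" for z
  proof -
    have "(\<Psi> has_field_derivative - \<i> * (exp (- \<i> * z * \<zeta>) * (- \<i> * \<zeta>) * Lg a q z + exp (- \<i> * z * \<zeta>) * Lg a (\<lambda>s. \<i> * s * q s) z)) (at z)"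
      unfolding \<Psi>_def by (auto intro!: derivative_eq_intros Lg_deriv[OF holq mq z])
    moreover have "- \<i> * (e * (- \<i> * \<zeta>) * l + e * (\<i> * p + \<i> * \<zeta> * l)) = e * p" for e l p
      by (simp add: algebra_simps)
    ultimately show ?thesis unfolding key[OF z] by (simp only:)
  qed
  have l1: "((\<lambda>R. \<Psi> (Complex R c) - \<Psi> (Complex R (- c))) \<longlongrightarrow> kint a c \<phi> \<zeta>) at_top"
    by (rule kint_limit[OF hol\<phi> gr\<phi> \<zeta> c \<Psi>])
  obtain C \<delta> where \<delta>: "0 < \<delta>" and C: "\<And>R s. max a 0 \<le> R ==> s \<in> {c, - c} ==> cmod (exp (- \<i> * Complex R s * \<zeta>) * Lg a q (Complex R s)) \<le> C * exp (- \<delta> * R)"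
  proof -
    have "\<And>s. s \<in> {c, - c} ==> c \<le> \<bar>s\<bar>" "\<And>s. s \<in> {c, - c} ==> \<bar>s\<bar> \<le> c" using c by auto
    from growth_vertical[OF Lg_growth[OF holq mq] \<zeta> c this] show thesis using that by metis
  qed
  have lim: "((\<lambda>R. \<Psi> (Complex R s)) \<longlongrightarrow> 0) at_top" if s: "s \<in> {c, - c}" for s
  proof (rule Lim_null_comparison)
    show "\<forall>\<^sub>F R in at_top. cmod (\<Psi> (Complex R s)) \<le> C * exp (- \<delta> * R)"
      using eventually_ge_at_top[of "max a 0"]
    proof eventually_elim
      case (elim R)
      have "cmod (\<Psi> (Complex R s)) = cmod (exp (- \<i> * Complex R s * \<zeta>) * Lg a q (Complex R s))"
        unfolding \<Psi>_def norm_mult by simp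
      then show ?case using C[OF elim s] by (simp only:)
    qed
    have "((\<lambda>R. exp (- \<delta> * R)) \<longlongrightarrow> 0) at_top"
      using \<delta> by (intro filterlim_compose[OF exp_at_bot] filterlim_tendsto_neg_mult_at_bot[OF tendsto_const]) (auto intro: filterlim_ident)
    then have "((\<lambda>R. C * exp (- \<delta> * R)) \<longlongrightarrow> C * 0) at_top" by (intro tendsto_intros)
    then show "((\<lambda>R. C * exp (- \<delta> * R)) \<longlongrightarrow> 0) at_top" by simp
  qed
  have l2: "((\<lambda>R. \<Psi> (Complex R c) - \<Psi> (Complex R (- c))) \<longlongrightarrow> 0 - 0) at_top"
    by (intro tendsto_diff lim) auto
  have "kint a c \<phi> \<zeta> = 0 - 0" by (rule tendsto_unique[OF trivial_limit_at_top_linorder l1 l2])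
  \<comment> \<open>The integral of \<phi> vanishes, so only the explicit pole at \<open>a\<close>
    contributes: the factors \<open>i\<close> and \<open>- 2 \<pi> i\<close> combine to
    \<open>2 \<pi>\<close>, and \<open>A\<close> was chosen so that the exponentials cancel.\<close>
  then have "kint a c (Lg a f) \<zeta> = A * \<i> * (- 2 * pi * \<i> * exp (- \<i> * of_real a * \<zeta>))"
    using lin unfolding log by (simp add: eq_neg_iff_add_eq_0)
  also have "\<dots> = 2 * pi * f \<zeta> * (exp (\<i> * of_real a * \<zeta>) * exp (- \<i> * of_real a * \<zeta>))"
  proof -
    have key: "F * X * \<i> * (- P * \<i> * Y) = P * F * (X * Y)" for F X Y P :: complex
    proof -
      have "F * X * \<i> * (- P * \<i> * Y) = - (\<i> * \<i>) * (P * F * (X * Y))"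
        by (simp only: mult_ac mult_minus_left mult_minus_right)
      then show ?thesis by simp
    qed
    have m2: "complex_of_real (- 2 * pi) = - complex_of_real (2 * pi)" by simp
    show ?thesis unfolding A_def m2 key by (rule refl)
  qed
  also have "exp (\<i> * of_real a * \<zeta>) * exp (- \<i> * of_real a * \<zeta>) = 1"
    by (simp add: exp_add[symmetric])
  finally show ?thesis by simp
qed

section \<open>The vector-valued Fourier transform\<close>

context seq_complete_lcHs
begin

text \<open>The space in which the transform is computed. It contains \<open>Oexp\<close> and all
  inverse transforms and, in contrast to \<open>Oexp\<close>, it is stable under multiplication by
  \<open>exp (- z)\<close>, which is large only to the left of \<open>a\<close>.\<close>

definition Wsp :: "real => (complex => 'a) set" where
  "Wsp a = {\<phi> \<in> holomorphic_space smul (slit a). \<forall>\<alpha>. growth a (\<lambda>z. p \<alpha> (\<phi> z))}"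

lemma Wsp_weak:
  assumes \<phi>: "\<phi> \<in> Wsp a" and e: "e' \<in> cdual smul"
  shows "(\<lambda>z. e' (\<phi> z)) holomorphic_on slit a" "growth a (\<lambda>z. cmod (e' (\<phi> z)))"
proof -
  show "(\<lambda>z. e' (\<phi> z)) holomorphic_on slit a"
    using \<phi> by (intro cdual_holomorphic[OF _ open_slit e]) (simp add: Wsp_def)
  obtain \<gamma> C where C: "0 < C" "\<And>y. cmod (e' y) \<le> C * p \<gamma> y" using cdual_bound[OF e] by metis
  have gr: "growth a (\<lambda>z. p \<gamma> (\<phi> z))" using \<phi> by (simp add: Wsp_def)
  show "growth a (\<lambda>z. cmod (e' (\<phi> z)))" by (rule growth_le[OF gr C(2)]) (use C(1) in simp)
qed

lemma Wsp_bound: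
  assumes \<phi>: "\<phi> \<in> Wsp a" and "0 < c" and "1 \<le> k"
  obtains C where "0 \<le> C"
    "\<And>\<zeta> t. Im \<zeta> \<le> - (1 / k) ==> t \<notin> {-1, 1} ==> cmod (hookd c t * exp (- \<i> * hook a c t * \<zeta>)) * p \<alpha> (\<phi> (hook a c t))
       \<le> C * exp (c * \<bar>Re \<zeta>\<bar> - (a - c) * \<bar>Im \<zeta>\<bar>) * exp (- (1 / (2 * k)) * \<bar>t\<bar>)"
proof -
  have hol: "\<phi> \<in> holomorphic_space smul (slit a)" and gr: "growth a (\<lambda>z. p \<alpha> (\<phi> z))"
    using \<phi> by (auto simp: Wsp_def)
  show thesis
    by (rule kernel_bound[OF continuous_on_p[OF holomorphic_space_continuous[OF hol]] p_nonneg gr assms(2,3)]) (rule that)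
qed

lemma continuous_on_hook:
  assumes \<phi>: "\<phi> \<in> Wsp a" and c: "0 < c"
  shows "continuous_on S (\<lambda>t. \<phi> (hook a c t))"
proof -
  have "continuous_on (slit a) \<phi>" using \<phi> by (intro holomorphic_space_continuous) (simp add: Wsp_def)
  then show ?thesis
    by (rule continuous_on_compose2[OF _ continuous_hook]) (use hook_slit[OF c] in auto)
qed

definition has_FT :: "real => (complex => 'a) => complex => 'a => bool" where
  "has_FT a \<phi> \<zeta> x \<longleftrightarrow> (\<forall>c>0. has_Pettis_integral smul lborel
     (\<lambda>t. smul (hookd c t * exp (- \<i> * hook a c t * \<zeta>)) (\<phi> (hook a c t))) x)"

lemma has_FT_kint:
  assumes "has_Pettis_integral smul lborel (\<lambda>t. smul (hookd c t * exp (- \<i> * hook a c t * \<zeta>)) (\<phi> (hook a c t))) x"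
    and e: "e' \<in> cdual smul"
  shows "e' x = kint a c (\<lambda>z. e' (\<phi> z)) \<zeta>"
proof -
  have "(LINT t|lborel. e' (smul (hookd c t * exp (- \<i> * hook a c t * \<zeta>)) (\<phi> (hook a c t)))) = e' x"
    using assms(1)[unfolded has_Pettis_integral_def, rule_format, OF e] by simp
  then show ?thesis unfolding kint_def cdual_scale[OF e] mult.assoc by (rule sym)
qed

text \<open>For each width separately the integral exists by the exponential bound; that the values
  coincide is tested with functionals, where it is \<open>kint_indep\<close>.\<close>

lemma has_FT_ex:
  assumes \<phi>: "\<phi> \<in> Wsp a" and \<zeta>: "Im \<zeta> < 0"
  shows "\<exists>x. has_FT a \<phi> \<zeta> x"
proof -
  obtain n :: nat where n: "1 \<le> n" "0 \<le> real n" "1 / real n \<le> - Im \<zeta>"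
    using nat_large[of "- Im \<zeta>" 0] \<zeta> by auto
  have n1: "1 \<le> real n" using n(1) by simp
  have ex: "\<exists>x. has_Pettis_integral smul lborel (\<lambda>t. smul (hookd c t * exp (- \<i> * hook a c t * \<zeta>)) (\<phi> (hook a c t))) x"
    if c: "0 < c" for c
  proof (rule Pettis_exists[of "{-1, 1}"])
    show "continuous_on (- {-1, 1}) (\<lambda>t. smul (hookd c t * exp (- \<i> * hook a c t * \<zeta>)) (\<phi> (hook a c t)))"
      by (intro continuous_on_scale_lc continuous_intros continuous_hookd continuous_hook continuous_on_hook[OF \<phi> c])
    fix \<alpha>
    obtain C where C: "\<And>\<zeta> t. Im \<zeta> \<le> - (1 / real n) ==> t \<notin> {-1, 1} ==> cmod (hookd c t * exp (- \<i> * hook a c t * \<zeta>)) * p \<alpha> (\<phi> (hook a c t))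
       \<le> C * exp (c * \<bar>Re \<zeta>\<bar> - (a - c) * \<bar>Im \<zeta>\<bar>) * exp (- (1 / (2 * real n)) * \<bar>t\<bar>)"
      using Wsp_bound[OF \<phi> c n1, of \<alpha>] by metis
    show "\<exists>C \<delta>. 0 < \<delta> \<and> (\<forall>t. t \<notin> {-1, 1} --> p \<alpha> (smul (hookd c t * exp (- \<i> * hook a c t * \<zeta>)) (\<phi> (hook a c t))) \<le> C * exp (- \<delta> * \<bar>t\<bar>))"
    proof (intro exI conjI allI impI)
      show "0 < 1 / (2 * real n)" using n(1) by simp
      show "p \<alpha> (smul (hookd c t * exp (- \<i> * hook a c t * \<zeta>)) (\<phi> (hook a c t)))
          \<le> (C * exp (c * \<bar>Re \<zeta>\<bar> - (a - c) * \<bar>Im \<zeta>\<bar>)) * exp (- (1 / (2 * real n)) * \<bar>t\<bar>)" if "t \<notin> {-1, 1}" for t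
        unfolding seminorm_scale using n(3) by (intro C[OF _ that]) linarith
    qed
  qed simp
  obtain x where x: "has_Pettis_integral smul lborel (\<lambda>t. smul (hookd 1 t * exp (- \<i> * hook a 1 t * \<zeta>)) (\<phi> (hook a 1 t))) x"
    using ex[OF zero_less_one] by blast
  have "has_Pettis_integral smul lborel (\<lambda>t. smul (hookd c t * exp (- \<i> * hook a c t * \<zeta>)) (\<phi> (hook a c t))) x" if c: "0 < c" for c
  proof -
    obtain y where y: "has_Pettis_integral smul lborel (\<lambda>t. smul (hookd c t * exp (- \<i> * hook a c t * \<zeta>)) (\<phi> (hook a c t))) y"
      using ex[OF c] by blast
    have "y = x"
    proof (rule cdual_eqI)
      fix e' assume e: "e' \<in> cdual smul"
      show "e' y = e' x"
        unfolding has_FT_kint[OF x e] has_FT_kint[OF y e] by (rule kint_indep[OF Wsp_weak[OF \<phi> e] \<zeta> c zero_less_one])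
    qed
    with y show ?thesis by simp
  qed
  then show ?thesis unfolding has_FT_def by blast
qed

lemma has_FT_unique: "has_FT a \<phi> \<zeta> x ==> has_FT a \<phi> \<zeta> y ==> x = y"
  unfolding has_FT_def using Pettis_unique zero_less_one by blast

definition FT :: "real => (complex => 'a) => complex => 'a" where
  "FT a \<phi> \<zeta> = (if Im \<zeta> < 0 then (THE x. has_FT a \<phi> \<zeta> x) else 0)"

lemma has_FT_FT:
  assumes "\<phi> \<in> Wsp a" "Im \<zeta> < 0"
  shows "has_FT a \<phi> \<zeta> (FT a \<phi> \<zeta>)"
proof -
  obtain x where x: "has_FT a \<phi> \<zeta> x" using has_FT_ex[OF assms] by blast
  have "FT a \<phi> \<zeta> = x" unfolding FT_def using assms(2) by (simp, intro the_equality x has_FT_unique[OF _ x])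
  with x show ?thesis by simp
qed

lemma FT_Pettis:
  "\<phi> \<in> Wsp a ==> Im \<zeta> < 0 ==> 0 < c ==> has_Pettis_integral smul lborel
     (\<lambda>t. smul (hookd c t * exp (- \<i> * hook a c t * \<zeta>)) (\<phi> (hook a c t))) (FT a \<phi> \<zeta>)"
  using has_FT_FT unfolding has_FT_def by blast

lemma FT_kint:
  "\<phi> \<in> Wsp a ==> Im \<zeta> < 0 ==> 0 < c ==> e' \<in> cdual smul ==> e' (FT a \<phi> \<zeta>) = kint a c (\<lambda>z. e' (\<phi> z)) \<zeta>"
  by (rule has_FT_kint[OF FT_Pettis])

lemma FT_bound:
  assumes \<phi>: "\<phi> \<in> Wsp a" and k: "1 \<le> k"
  obtains C where "0 \<le> C" "\<And>\<zeta>. Im \<zeta> \<le> - (1 / k) ==> p \<alpha> (FT a \<phi> \<zeta>) \<le> C * exp (cmod \<zeta> / k - a * \<bar>Im \<zeta>\<bar>)"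
proof -
  define c where "c = 1 / (2 * k)"
  have c: "0 < c" using k by (simp add: c_def)
  obtain C where C: "0 \<le> C" "\<And>\<zeta> t. Im \<zeta> \<le> - (1 / k) ==> t \<notin> {-1, 1} ==> cmod (hookd c t * exp (- \<i> * hook a c t * \<zeta>)) * p \<alpha> (\<phi> (hook a c t))
       \<le> C * exp (c * \<bar>Re \<zeta>\<bar> - (a - c) * \<bar>Im \<zeta>\<bar>) * exp (- (1 / (2 * k)) * \<bar>t\<bar>)"
    using Wsp_bound[OF \<phi> c k, of \<alpha>] by metis
  define J where "J = (LINT t|lborel. exp (- (1 / (2 * k)) * \<bar>t::real\<bar>))"
  have J: "0 \<le> J" unfolding J_def by (rule integral_nonneg_AE) simp
  have int: "integrable lborel (\<lambda>t::real. B * exp (- (1 / (2 * k)) * \<bar>t\<bar>))" for B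
    using k by (intro integrable_exp_abs) auto
  show thesis
  proof (rule that)
    show "0 \<le> C * J" using C(1) J by simp
    fix \<zeta> assume \<zeta>: "Im \<zeta> \<le> - (1 / k)"
    have "0 < 1 / k" using k by simp
    then have \<zeta>0: "Im \<zeta> < 0" using \<zeta> by linarith
    have "p \<alpha> (FT a \<phi> \<zeta>) \<le> (LINT t|lborel. (C * exp (c * \<bar>Re \<zeta>\<bar> - (a - c) * \<bar>Im \<zeta>\<bar>)) * exp (- (1 / (2 * k)) * \<bar>t\<bar>))"
      by (rule Pettis_bound[OF FT_Pettis[OF \<phi> \<zeta>0 c], of "{-1, 1}"]) (use int C(2)[OF \<zeta>] in \<open>simp_all add: seminorm_scale\<close>)
    also have "\<dots> = (C * exp (c * \<bar>Re \<zeta>\<bar> - (a - c) * \<bar>Im \<zeta>\<bar>)) * J"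
      unfolding J_def by (rule integral_mult_right_zero)
    also have "\<dots> = (C * J) * exp (c * \<bar>Re \<zeta>\<bar> - (a - c) * \<bar>Im \<zeta>\<bar>)" by (simp only: mult_ac)
    also have "\<dots> \<le> (C * J) * exp (cmod \<zeta> / k - a * \<bar>Im \<zeta>\<bar>)"
    proof -
      have "c * \<bar>Re \<zeta>\<bar> + c * \<bar>Im \<zeta>\<bar> \<le> c * cmod \<zeta> + c * cmod \<zeta>"
        using c abs_Re_le_cmod[of \<zeta>] abs_Im_le_cmod[of \<zeta>] by (intro add_mono mult_left_mono) auto
      also have "\<dots> = cmod \<zeta> / k" using k by (simp add: c_def)
      finally have "c * \<bar>Re \<zeta>\<bar> - (a - c) * \<bar>Im \<zeta>\<bar> \<le> cmod \<zeta> / k - a * \<bar>Im \<zeta>\<bar>" by (simp add: algebra_simps)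
      then show ?thesis using C(1) J by (intro mult_left_mono) auto
    qed
    finally show "p \<alpha> (FT a \<phi> \<zeta>) \<le> (C * J) * exp (cmod \<zeta> / k - a * \<bar>Im \<zeta>\<bar>)" .
  qed
qed

lemma FT_holomorphic:
  assumes \<phi>: "\<phi> \<in> Wsp a"
  shows "FT a \<phi> \<in> holomorphic_space smul {\<zeta>. Im \<zeta> < 0}"
proof (rule Pettis_holomorphic[where S = "{-1, 1}" and k = "\<lambda>t \<zeta>. hookd 1 t * exp (- \<i> * hook a 1 t * \<zeta>)" and g = "\<lambda>t. \<phi> (hook a 1 t)"])
  show "open {\<zeta>. Im \<zeta> < 0}" by (rule open_halfspace_Im_lt)
  show "FT a \<phi> \<zeta> = 0" if "\<zeta> \<notin> {\<zeta>. Im \<zeta> < 0}" for \<zeta> using that by (simp add: FT_def)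
  show "has_Pettis_integral smul lborel (\<lambda>t. smul (hookd 1 t * exp (- \<i> * hook a 1 t * \<zeta>)) (\<phi> (hook a 1 t))) (FT a \<phi> \<zeta>)"
    if "\<zeta> \<in> {\<zeta>. Im \<zeta> < 0}" for \<zeta> using that by (intro FT_Pettis[OF \<phi>]) auto
  show "(\<lambda>\<zeta>. hookd 1 t * exp (- \<i> * hook a 1 t * \<zeta>)) holomorphic_on {\<zeta>. Im \<zeta> < 0}" for t
    by (intro holomorphic_intros)
  fix \<zeta>0 \<alpha> assume "\<zeta>0 \<in> {\<zeta>. Im \<zeta> < 0}"
  define r where "r = - Im \<zeta>0 / 2"
  have r: "0 < r" using \<open>\<zeta>0 \<in> _\<close> by (simp add: r_def)
  have im: "Im \<zeta> \<le> - r" if "\<zeta> \<in> cball \<zeta>0 r" for \<zeta>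
  proof -
    have "\<bar>Im (\<zeta> - \<zeta>0)\<bar> \<le> r" using abs_Im_le_cmod[of "\<zeta> - \<zeta>0"] that by (simp add: dist_norm norm_minus_commute)
    then show ?thesis by (simp add: r_def)
  qed
  have sub: "cball \<zeta>0 r \<subseteq> {\<zeta>. Im \<zeta> < 0}" using im r by force
  obtain n :: nat where n: "1 \<le> n" "0 \<le> real n" "1 / real n \<le> r" using nat_large[OF r] by blast
  have n1: "1 \<le> real n" using n(1) by simp
  obtain C where C: "0 \<le> C" "\<And>\<zeta> t. Im \<zeta> \<le> - (1 / real n) ==> t \<notin> {-1, 1} ==> cmod (hookd 1 t * exp (- \<i> * hook a 1 t * \<zeta>)) * p \<alpha> (\<phi> (hook a 1 t))
       \<le> C * exp (1 * \<bar>Re \<zeta>\<bar> - (a - 1) * \<bar>Im \<zeta>\<bar>) * exp (- (1 / (2 * real n)) * \<bar>t\<bar>)"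
    using Wsp_bound[OF \<phi> zero_less_one n1, of \<alpha>] by metis
  have "compact ((\<lambda>\<zeta>. exp (1 * \<bar>Re \<zeta>\<bar> - (a - 1) * \<bar>Im \<zeta>\<bar>)) ` cball \<zeta>0 r)"
    by (intro compact_continuous_image continuous_intros compact_cball)
  then have "bounded ((\<lambda>\<zeta>. exp (1 * \<bar>Re \<zeta>\<bar> - (a - 1) * \<bar>Im \<zeta>\<bar>)) ` cball \<zeta>0 r)"
    by (rule compact_imp_bounded)
  then obtain E where E0: "\<And>y. y \<in> (\<lambda>\<zeta>. exp (1 * \<bar>Re \<zeta>\<bar> - (a - 1) * \<bar>Im \<zeta>\<bar>)) ` cball \<zeta>0 r ==> norm y \<le> E"
    unfolding bounded_iff by blast
  have E: "exp (1 * \<bar>Re \<zeta>\<bar> - (a - 1) * \<bar>Im \<zeta>\<bar>) \<le> E" if "\<zeta> \<in> cball \<zeta>0 r" for \<zeta>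
    using E0[OF imageI[OF that]] by simp
  have "cmod (hookd 1 t * exp (- \<i> * hook a 1 t * \<zeta>)) * p \<alpha> (\<phi> (hook a 1 t)) \<le> (C * E) * exp (- (1 / (2 * real n)) * \<bar>t\<bar>)"
    if t: "t \<notin> {-1, 1}" and w: "\<zeta> \<in> cball \<zeta>0 r" for t \<zeta>
  proof -
    have "Im \<zeta> \<le> - (1 / real n)" using im[OF w] n(3) by linarith
    note C(2)[OF this t]
    also have "C * exp (1 * \<bar>Re \<zeta>\<bar> - (a - 1) * \<bar>Im \<zeta>\<bar>) * exp (- (1 / (2 * real n)) * \<bar>t\<bar>) \<le> C * E * exp (- (1 / (2 * real n)) * \<bar>t\<bar>)"
      using C(1) E[OF w] by (intro mult_right_mono mult_left_mono) auto
    finally show ?thesis .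
  qed
  moreover have "integrable lborel (\<lambda>t::real. (C * E) * exp (- (1 / (2 * real n)) * \<bar>t\<bar>))"
    using n(1) by (intro integrable_exp_abs) auto
  ultimately show "\<exists>r>0. \<exists>D. cball \<zeta>0 r \<subseteq> {\<zeta>. Im \<zeta> < 0} \<and> integrable lborel D \<and> (\<forall>t w. t \<notin> {-1, 1} --> w \<in> cball \<zeta>0 r
       --> cmod (hookd 1 t * exp (- \<i> * hook a 1 t * w)) * p \<alpha> (\<phi> (hook a 1 t)) \<le> D t)"
    using r sub by blast
qed simp

lemma Wsp_add: "\<phi> \<in> Wsp a ==> \<psi> \<in> Wsp a ==> (\<lambda>z. \<phi> z + \<psi> z) \<in> Wsp a"
proof -
  assume \<phi>: "\<phi> \<in> Wsp a" and \<psi>: "\<psi> \<in> Wsp a"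
  have "growth a (\<lambda>z. p \<alpha> (\<phi> z + \<psi> z))" for \<alpha>
  proof (rule growth_le[of a _ _ 1])
    show "growth a (\<lambda>z. p \<alpha> (\<phi> z) + p \<alpha> (\<psi> z))" using \<phi> \<psi> by (intro growth_add) (auto simp: Wsp_def)
  qed (auto simp: seminorm_add)
  then show ?thesis using \<phi> \<psi> by (simp add: Wsp_def holomorphic_space_add)
qed

lemma Wsp_scale: "\<phi> \<in> Wsp a ==> (\<lambda>z. smul c (\<phi> z)) \<in> Wsp a"
proof -
  assume \<phi>: "\<phi> \<in> Wsp a"
  have "growth a (\<lambda>z. p \<alpha> (smul c (\<phi> z)))" for \<alpha>
    by (rule growth_le[of a "\<lambda>z. p \<alpha> (\<phi> z)" _ "cmod c"]) (use \<phi> in \<open>auto simp: Wsp_def seminorm_scale\<close>)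
  then show ?thesis using \<phi> by (simp add: Wsp_def holomorphic_space_scale)
qed

lemma Wsp_diff: "\<phi> \<in> Wsp a ==> \<psi> \<in> Wsp a ==> (\<lambda>z. \<phi> z - \<psi> z) \<in> Wsp a"
  using Wsp_add[OF _ Wsp_scale[of \<psi> a "-1"]] by simp

lemma FT_add:
  assumes "\<phi> \<in> Wsp a" "\<psi> \<in> Wsp a"
  shows "FT a (\<lambda>z. \<phi> z + \<psi> z) \<zeta> = FT a \<phi> \<zeta> + FT a \<psi> \<zeta>"
proof (cases "Im \<zeta> < 0")
  case True
  have "has_Pettis_integral smul lborel (\<lambda>t. smul (hookd 1 t * exp (- \<i> * hook a 1 t * \<zeta>)) (\<phi> (hook a 1 t) + \<psi> (hook a 1 t))) (FT a \<phi> \<zeta> + FT a \<psi> \<zeta>)"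
    unfolding scale_right_distrib by (intro Pettis_add FT_Pettis assms True zero_less_one)
  then show ?thesis
    by (rule Pettis_unique[OF FT_Pettis[OF Wsp_add[OF assms] True zero_less_one]])
qed (simp add: FT_def)

lemma FT_scale:
  assumes "\<phi> \<in> Wsp a"
  shows "FT a (\<lambda>z. smul c (\<phi> z)) \<zeta> = smul c (FT a \<phi> \<zeta>)"
proof (cases "Im \<zeta> < 0")
  case True
  have "has_Pettis_integral smul lborel (\<lambda>t. smul c (smul (hookd 1 t * exp (- \<i> * hook a 1 t * \<zeta>)) (\<phi> (hook a 1 t)))) (smul c (FT a \<phi> \<zeta>))"
    by (intro Pettis_scale FT_Pettis assms True zero_less_one)
  then have "has_Pettis_integral smul lborel (\<lambda>t. smul (hookd 1 t * exp (- \<i> * hook a 1 t * \<zeta>)) (smul c (\<phi> (hook a 1 t)))) (smul c (FT a \<phi> \<zeta>))"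
    by (simp add: mult.commute)
  then show ?thesis
    by (rule Pettis_unique[OF FT_Pettis[OF Wsp_scale[OF assms] True zero_less_one]])
qed (simp add: FT_def)

lemma FT_diff:
  assumes "\<phi> \<in> Wsp a" "\<psi> \<in> Wsp a"
  shows "FT a (\<lambda>z. \<phi> z - \<psi> z) \<zeta> = FT a \<phi> \<zeta> - FT a \<psi> \<zeta>"
  using FT_add[OF assms(1) Wsp_scale[OF assms(2), of "-1"], of \<zeta>] FT_scale[OF assms(2), of "-1" \<zeta>] by simp

text \<open>The contour of an entire function may start at any \<open>b \<ge> a\<close>. Cutting
  \<open>h\<close> off outside \<open>slit b\<close> only restores the convention of extension by 0;
  the integrand on the contour is unchanged. The bound for the endpoint \<open>b\<close> then holds
  for the transform belonging to \<open>a\<close>.\<close>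

lemma Wsp_entire:
  assumes \<phi>: "\<phi> \<in> Wsp a" and h: "h \<in> holomorphic_space smul UNIV" and eq: "\<And>z. z \<in> slit a ==> h z = \<phi> z" and "a \<le> b"
  shows "(\<lambda>z. if z \<in> slit b then h z else 0) \<in> Wsp b"
    and "FT b (\<lambda>z. if z \<in> slit b then h z else 0) = FT a \<phi>"
proof -
  let ?hb = "\<lambda>z. if z \<in> slit b then h z else 0"
  have gr: "growth a (\<lambda>z. p \<alpha> (h z))" for \<alpha>
  proof -
    have "growth a (\<lambda>z. p \<alpha> (\<phi> z))" using \<phi> by (simp add: Wsp_def)
    moreover have "p \<alpha> (h z) = p \<alpha> (\<phi> z)" if "1 / real n \<le> \<bar>Im z\<bar>" "1 \<le> n" for z and n :: nat
    proof -
      have "0 < 1 / real n" using that by simp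
      then have "Im z \<noteq> 0" using that by linarith
      then show ?thesis by (simp add: eq slit_iff)
    qed
    ultimately show ?thesis unfolding growth_def by simp
  qed
  have "growth b (\<lambda>z. p \<alpha> (?hb z))" for \<alpha>
    by (rule growth_le[OF growth_mono[OF gr \<open>a \<le> b\<close>], where K = 1]) auto
  then show hb: "?hb \<in> Wsp b"
    using holomorphic_space_restrict[OF h open_slit] by (simp add: Wsp_def)
  show "FT b ?hb = FT a \<phi>"
  proof
    fix \<zeta>
    show "FT b ?hb \<zeta> = FT a \<phi> \<zeta>"
    proof (cases "Im \<zeta> < 0")
      case True
      show ?thesis
      proof (rule cdual_eqI)
        fix e' assume e: "e' \<in> cdual smul"
        have hol: "(\<lambda>z. e' (h z)) holomorphic_on UNIV" by (rule cdual_holomorphic[OF h open_UNIV e])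
        obtain \<gamma> C where C: "0 < C" "\<And>y. cmod (e' y) \<le> C * p \<gamma> y" using cdual_bound[OF e] by metis
        have gre: "growth a (\<lambda>z. cmod (e' (h z)))" by (rule growth_le[OF gr C(2)]) (use C(1) in simp)
        have "e' (FT b ?hb \<zeta>) = kint b 1 (\<lambda>z. e' (?hb z)) \<zeta>" by (rule FT_kint[OF hb True zero_less_one e])
        also have "\<dots> = kint b 1 (\<lambda>z. e' (h z)) \<zeta>" by (rule kint_cong) auto
        also have "\<dots> = kint a 1 (\<lambda>z. e' (h z)) \<zeta>" by (rule kint_shift[OF hol gre True zero_less_one \<open>a \<le> b\<close>, symmetric])
        also have "\<dots> = kint a 1 (\<lambda>z. e' (\<phi> z)) \<zeta>" by (rule kint_cong) (auto simp: eq)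
        also have "\<dots> = e' (FT a \<phi> \<zeta>)" by (rule FT_kint[OF \<phi> True zero_less_one e, symmetric])
        finally show "e' (FT b ?hb \<zeta>) = e' (FT a \<phi> \<zeta>)" .
      qed
    qed (simp add: FT_def)
  qed
qed

text \<open>Testing with functionals reduces this to \<open>kint_zero\<close>. It shows that two
  representatives of the same class modulo tempered entire functions have the same
  transform.\<close>

lemma FT_zero:
  assumes \<phi>: "\<phi> \<in> Wsp a" and h: "h \<in> holomorphic_space smul UNIV" and eq: "\<And>z. z \<in> slit a ==> h z = \<phi> z"
    and gr: "\<And>n::nat. \<And>\<alpha>. 1 \<le> n ==> \<exists>C. \<forall>z. a \<le> Re z --> \<bar>Im z\<bar> \<le> real n --> p \<alpha> (h z) \<le> C * exp (\<bar>Re z\<bar> / real n)"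
  shows "FT a \<phi> \<zeta> = 0"
proof (cases "Im \<zeta> < 0")
  case True
  show ?thesis
  proof (rule cdual_eqI)
    fix e' assume e: "e' \<in> cdual smul"
    have hol: "(\<lambda>z. e' (h z)) holomorphic_on UNIV" by (rule cdual_holomorphic[OF h open_UNIV e])
    obtain \<gamma> K where K: "0 < K" "\<And>y. cmod (e' y) \<le> K * p \<gamma> y" using cdual_bound[OF e] by metis
    have "e' (FT a \<phi> \<zeta>) = kint a 1 (\<lambda>z. e' (\<phi> z)) \<zeta>" by (rule FT_kint[OF \<phi> True zero_less_one e])
    also have "\<dots> = kint a 1 (\<lambda>z. e' (h z)) \<zeta>" by (rule kint_cong) (auto simp: eq)
    also have "\<dots> = 0"
    proof (rule kint_zero[OF hol True zero_less_one])
      fix n :: nat assume "1 \<le> n"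
      then obtain C where C: "\<And>z. a \<le> Re z ==> \<bar>Im z\<bar> \<le> real n ==> p \<gamma> (h z) \<le> C * exp (\<bar>Re z\<bar> / real n)"
        using gr by meson
      have "cmod (e' (h z)) \<le> (K * C) * exp (\<bar>Re z\<bar> / real n)" if "a \<le> Re z" "\<bar>Im z\<bar> \<le> real n" for z
        using order_trans[OF K(2) mult_left_mono[OF C[OF that], of K]] K(1) by (simp add: mult.assoc)
      then show "\<exists>C. \<forall>z. a \<le> Re z --> \<bar>Im z\<bar> \<le> real n --> cmod (e' (h z)) \<le> C * exp (\<bar>Re z\<bar> / real n)" by blast
    qed
    finally show "e' (FT a \<phi> \<zeta>) = e' 0" by (simp add: cdual_zero[OF e])
  qed
qed (simp add: FT_def)

text \<open>The identity \<open>exp (- i z \<zeta>) * exp (- z) = exp (- i z (\<zeta> - i))\<close>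
  turns the factor into a translation of the transform.\<close>

lemma Wsp_exp:
  assumes \<phi>: "\<phi> \<in> Wsp a"
  shows "(\<lambda>z. smul (exp (- z)) (\<phi> z)) \<in> Wsp a" and "Im \<zeta> < 0 ==> FT a (\<lambda>z. smul (exp (- z)) (\<phi> z)) \<zeta> = FT a \<phi> (\<zeta> - \<i>)"
proof -
  have hol: "\<phi> \<in> holomorphic_space smul (slit a)" using \<phi> by (simp add: Wsp_def)
  have "growth a (\<lambda>z. p \<alpha> (smul (exp (- z)) (\<phi> z)))" for \<alpha>
    unfolding growth_def
  proof (intro allI impI)
    fix n :: nat assume "1 \<le> n"
    moreover have "growth a (\<lambda>z. p \<alpha> (\<phi> z))" using \<phi> by (simp add: Wsp_def)
    ultimately obtain C where C: "\<And>z. a \<le> Re z ==> 1 / real n \<le> \<bar>Im z\<bar> ==> \<bar>Im z\<bar> \<le> real n ==> p \<alpha> (\<phi> z) \<le> C * exp (\<bar>Re z\<bar> / real n)"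
      using growthD by metis
    have "p \<alpha> (smul (exp (- z)) (\<phi> z)) \<le> (exp (- a) * C) * exp (\<bar>Re z\<bar> / real n)"
      if z: "a \<le> Re z" "1 / real n \<le> \<bar>Im z\<bar>" "\<bar>Im z\<bar> \<le> real n" for z
    proof -
      have "p \<alpha> (smul (exp (- z)) (\<phi> z)) = exp (- Re z) * p \<alpha> (\<phi> z)" by (simp add: seminorm_scale norm_exp_eq_Re)
      also have "\<dots> \<le> exp (- a) * (C * exp (\<bar>Re z\<bar> / real n))"
        using z C[OF z] by (intro mult_mono) auto
      finally show ?thesis by (simp only: mult.assoc)
    qed
    then show "\<exists>C. \<forall>z. a \<le> Re z --> 1 / real n \<le> \<bar>Im z\<bar> --> \<bar>Im z\<bar> \<le> real n --> p \<alpha> (smul (exp (- z)) (\<phi> z)) \<le> C * exp (\<bar>Re z\<bar> / real n)"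
      by blast
  qed
  then show W: "(\<lambda>z. smul (exp (- z)) (\<phi> z)) \<in> Wsp a"
  proof -
    have "(\<lambda>z. exp (- z)) holomorphic_on slit a" by (intro holomorphic_intros)
    from holomorphic_space_scale_fun[OF hol this open_slit] show ?thesis
      using \<open>\<And>\<alpha>. growth a (\<lambda>z. p \<alpha> (smul (exp (- z)) (\<phi> z)))\<close> by (simp add: Wsp_def)
  qed
  show "FT a (\<lambda>z. smul (exp (- z)) (\<phi> z)) \<zeta> = FT a \<phi> (\<zeta> - \<i>)" if \<zeta>: "Im \<zeta> < 0"
  proof -
    have eq: "hookd 1 t * exp (- \<i> * w * \<zeta>) * exp (- w) = hookd 1 t * exp (- \<i> * w * (\<zeta> - \<i>))" for t w
      by (simp add: exp_add[symmetric] algebra_simps)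
    have "has_Pettis_integral smul lborel (\<lambda>t. smul (hookd 1 t * exp (- \<i> * hook a 1 t * \<zeta>)) (smul (exp (- hook a 1 t)) (\<phi> (hook a 1 t)))) (FT a \<phi> (\<zeta> - \<i>))"
      unfolding scale_scale eq by (rule FT_Pettis[OF \<phi> _ zero_less_one]) (use \<zeta> in simp)
    then show ?thesis
      by (rule Pettis_unique[OF FT_Pettis[OF W \<zeta> zero_less_one]])
  qed
qed

end

section \<open>The vector-valued inverse transform\<close>

context seq_complete_lcHs
begin

text \<open>Continuity is what the existence of the ray integrals requires of \<open>F\<close>
  itself; holomorphy enters only after applying functionals and is therefore imposed weakly.\<close>

definition Msp :: "real => (complex => 'a) set" where
  "Msp a = {F. continuous_on lower F \<and> (\<forall>e'\<in>cdual smul. (\<lambda>s. e' (F s)) holomorphic_on lower)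
     \<and> (\<forall>\<alpha>. mgrowth a (\<lambda>s. p \<alpha> (F s)))}"

lemma Msp_weak:
  assumes F: "F \<in> Msp a" and e: "e' \<in> cdual smul"
  shows "(\<lambda>s. e' (F s)) holomorphic_on lower" "mgrowth a (\<lambda>s. cmod (e' (F s)))"
proof -
  show "(\<lambda>s. e' (F s)) holomorphic_on lower" using F e by (simp add: Msp_def)
  obtain \<gamma> C where C: "0 < C" "\<And>y. cmod (e' y) \<le> C * p \<gamma> y" using cdual_bound[OF e] by metis
  have m: "mgrowth a (\<lambda>s. p \<gamma> (F s))" using F by (simp add: Msp_def)
  show "mgrowth a (\<lambda>s. cmod (e' (F s)))" by (rule mgrowth_le[OF m C(2)]) (use C(1) in simp)
qed

text \<open>The vector-valued \<open>Lr\<close>. The description denotes the integral at points of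
  positive rate; no default is set elsewhere, which allows one formula for all endpoints
  \<open>a\<close>.\<close>

definition RE :: "complex => (complex => 'a) => complex => 'a" where
  "RE u F z = (THE x. has_Pettis_integral smul lborel (\<lambda>t. smul (rk u z t) (if 0 < t then F (u * of_real t) else 0)) x)"

lemma RE_Pettis:
  assumes F: "F \<in> Msp a" and u: "dir u" and r: "0 < rate u a z"
  shows "has_Pettis_integral smul lborel (\<lambda>t. smul (rk u z t) (if 0 < t then F (u * of_real t) else 0)) (RE u F z)"
proof -
  have cont: "continuous_on lower F" using F by (simp add: Msp_def)
  have "\<exists>x. has_Pettis_integral smul lborel (\<lambda>t. smul (rk u z t) (if 0 < t then F (u * of_real t) else 0)) x"
  proof (rule Pettis_exists[of "{0}"])
    have "continuous_on {0<..} (\<lambda>t. F (u * complex_of_real t))"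
      by (rule continuous_on_compose2[OF cont]) (use dir_lower[OF u] in \<open>auto intro!: continuous_intros\<close>)
    then show "continuous_on (- {0}) (\<lambda>t. smul (rk u z t) (if 0 < t then F (u * of_real t) else 0))"
      by (intro continuous_on_scale_lc continuous_rk continuous_half_line)
    fix \<alpha>
    have m: "mgrowth a (\<lambda>s. p \<alpha> (F s))" using F by (simp add: Msp_def)
    obtain C where C: "0 \<le> C" "\<And>z' t. rate u a z \<le> rate u a z' ==> 0 < t ==> cmod (rk u z' t) * p \<alpha> (F (u * of_real t)) \<le> C * exp (- (rate u a z / 2) * \<bar>t\<bar>)"
      using ray_bound[OF m u r] by metis
    have "p \<alpha> (smul (rk u z t) (if 0 < t then F (u * of_real t) else 0)) \<le> C * exp (- (rate u a z / 2) * \<bar>t\<bar>)" for t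
    proof (cases "0 < t")
      case True
      then show ?thesis using C(2)[OF order_refl True] by (simp add: seminorm_scale)
    qed (use C(1) in simp)
    moreover have "0 < rate u a z / 2" using r by simp
    ultimately show "\<exists>C \<delta>. 0 < \<delta> \<and> (\<forall>t. t \<notin> {0} --> p \<alpha> (smul (rk u z t) (if 0 < t then F (u * of_real t) else 0)) \<le> C * exp (- \<delta> * \<bar>t\<bar>))"
      by blast
  qed simp
  then show ?thesis unfolding RE_def by (rule theI'[OF ex_ex1I]) (rule Pettis_unique)
qed

lemma RE_weak:
  assumes F: "F \<in> Msp a" and u: "dir u" and r: "0 < rate u a z" and e: "e' \<in> cdual smul"
  shows "e' (RE u F z) = Lr u (\<lambda>s. e' (F s)) z"
proof -
  have "(LINT t|lborel. e' (smul (rk u z t) (if 0 < t then F (u * of_real t) else 0))) = e' (RE u F z)"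
    using RE_Pettis[OF F u r] e by (simp add: has_Pettis_integral_def)
  moreover have "e' (smul (rk u z t) (if 0 < t then F (u * of_real t) else 0)) = rk u z t * (if 0 < t then e' (F (u * of_real t)) else 0)" for t
    by (simp add: cdual_scale[OF e] cdual_zero[OF e])
  ultimately show ?thesis by (simp only: Lr_def)
qed

text \<open>The majorant from \<open>ray_bound\<close> is formed with the seminorm, so it bounds the
  scalar integrals for the entire polar at once.\<close>

lemma RE_bounded:
  assumes F: "F \<in> Msp a" and u: "dir u" and r: "0 < r"
  obtains B where "\<And>z. r \<le> rate u a z ==> p \<alpha> (RE u F z) \<le> B"
proof -
  have m: "mgrowth a (\<lambda>s. p \<alpha> (F s))" using F by (simp add: Msp_def)
  obtain C where C: "0 \<le> C" "\<And>z t. r \<le> rate u a z ==> 0 < t ==> cmod (rk u z t) * p \<alpha> (F (u * of_real t)) \<le> C * exp (- (r / 2) * \<bar>t\<bar>)"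
    using ray_bound[OF m u r] by metis
  have "p \<alpha> (RE u F z) \<le> (LINT t|lborel. C * exp (- (r / 2) * \<bar>t\<bar>))" if rz: "r \<le> rate u a z" for z
  proof (rule p_le_polar)
    fix e' assume e': "e' \<in> polar \<alpha>"
    note e = polarD(1)[OF e']
    have "0 < rate u a z" using r rz by linarith
    then have "e' (RE u F z) = Lr u (\<lambda>s. e' (F s)) z" by (rule RE_weak[OF F u _ e])
    moreover have "cmod (Lr u (\<lambda>s. e' (F s)) z) \<le> (LINT t|lborel. C * exp (- (r / 2) * \<bar>t\<bar>))"
      by (rule Lr_bound[OF C(2) C(1) r polarD(2)[OF e'] rz holomorphic_on_imp_continuous_on[OF Msp_weak(1)[OF F e]] Msp_weak(2)[OF F e] u])
    ultimately show "cmod (e' (RE u F z)) \<le> (LINT t|lborel. C * exp (- (r / 2) * \<bar>t\<bar>))" by simp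
  qed
  then show thesis by (rule that)
qed

definition LE :: "real => (complex => 'a) => complex => 'a" where
  "LE a F z = (if z \<in> slit a then RE (sel a z) F z else 0)"

lemma LE_weak:
  assumes F: "F \<in> Msp a" and z: "z \<in> slit a" and e: "e' \<in> cdual smul"
  shows "e' (LE a F z) = Lg a (\<lambda>s. e' (F s)) z"
  using z RE_weak[OF F dir_sel rate_sel[OF z] e] by (simp add: LE_def Lg_def)

lemma LE_eq:
  assumes F: "F \<in> Msp a" and r: "0 < rate (sel a z) a w"
  shows "LE a F w = RE (sel a z) F w"
proof (rule cdual_eqI)
  fix e' assume e: "e' \<in> cdual smul"
  show "e' (LE a F w) = e' (RE (sel a z) F w)"
    unfolding LE_weak[OF F rate_sel_slit[OF r] e] RE_weak[OF F dir_sel r e] by (rule Lg_eq[OF Msp_weak[OF F e] r])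
qed

lemma LE_Wsp:
  assumes F: "F \<in> Msp a"
  shows "LE a F \<in> Wsp a"
proof -
  have "LE a F \<in> holomorphic_space smul (slit a)"
  proof (rule holomorphic_spaceI[OF open_slit])
    show "LE a F z = 0" if "z \<notin> slit a" for z using that by (simp add: LE_def)
    show "(\<lambda>z. e' (LE a F z)) holomorphic_on slit a" if e: "e' \<in> cdual smul" for e'
      by (rule holomorphic_transform[OF Lg_holomorphic[OF Msp_weak[OF F e]]]) (simp add: LE_weak[OF F _ e])
    fix z \<alpha> assume z: "z \<in> slit a"
    define r where "r = rate (sel a z) a z / 2"
    have r: "0 < r" using rate_sel[OF z] by (simp add: r_def)
    have near: "r \<le> rate (sel a z) a w" if "w \<in> cball z r" for w
      using rate_diff[OF dir_sel, of a z a z w] that by (auto simp: r_def dist_norm)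
    obtain B where B: "\<And>w. r \<le> rate (sel a z) a w ==> p \<alpha> (RE (sel a z) F w) \<le> B"
      by (rule RE_bounded[OF F dir_sel r]) (rule that)
    have "p \<alpha> (LE a F w) \<le> B \<and> w \<in> slit a" if w: "w \<in> cball z r" for w
    proof -
      have "0 < rate (sel a z) a w" using near[OF w] r by linarith
      then show ?thesis using B[OF near[OF w]] LE_eq[OF F, of z w] rate_sel_slit by metis
    qed
    then show "\<exists>B. \<exists>r>0. cball z r \<subseteq> slit a \<and> (\<forall>w\<in>cball z r. p \<alpha> (LE a F w) \<le> B)"
      using r by blast
  qed
  moreover have "growth a (\<lambda>z. p \<alpha> (LE a F z))" for \<alpha>
    unfolding growth_def
  proof (intro allI impI)
    fix n :: nat assume "1 \<le> n"
    then have n: "0 < 1 / real n" by simp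
    obtain B1 where B1: "\<And>w. 1 / real n \<le> rate 1 a w ==> p \<alpha> (RE 1 F w) \<le> B1"
      by (rule RE_bounded[OF F dir_simps(1) n]) (rule that)
    obtain B2 where B2: "\<And>w. 1 / real n \<le> rate (-1) a w ==> p \<alpha> (RE (-1) F w) \<le> B2"
      by (rule RE_bounded[OF F dir_simps(2) n]) (rule that)
    have "p \<alpha> (LE a F z) \<le> (\<bar>B1\<bar> + \<bar>B2\<bar>) * exp (\<bar>Re z\<bar> / real n)" if z: "a \<le> Re z" "1 / real n \<le> \<bar>Im z\<bar>" for z
    proof -
      have "Im z \<noteq> 0" using z n by linarith
      then have s: "z \<in> slit a" by (simp add: slit_iff)
      have "p \<alpha> (LE a F z) \<le> \<bar>B1\<bar> + \<bar>B2\<bar>"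
      proof (cases "0 < Im z")
        case True
        then have "p \<alpha> (RE 1 F z) \<le> B1" using z by (intro B1) (simp add: rate_simps)
        moreover have "LE a F z = RE 1 F z" using s True z by (simp add: LE_def sel_def)
        ultimately show ?thesis by simp
      next
        case False
        then have "p \<alpha> (RE (-1) F z) \<le> B2" using z by (intro B2) (simp add: rate_simps)
        moreover have "LE a F z = RE (-1) F z" using s False z by (simp add: LE_def sel_def)
        ultimately show ?thesis by simp
      qed
      also have "\<dots> = (\<bar>B1\<bar> + \<bar>B2\<bar>) * 1" by simp
      also have "\<dots> \<le> (\<bar>B1\<bar> + \<bar>B2\<bar>) * exp (\<bar>Re z\<bar> / real n)" by (intro mult_left_mono) auto
      finally show ?thesis .
    qed
    then show "\<exists>C. \<forall>z. a \<le> Re z --> 1 / real n \<le> \<bar>Im z\<bar> --> \<bar>Im z\<bar> \<le> real n --> p \<alpha> (LE a F z) \<le> C * exp (\<bar>Re z\<bar> / real n)"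
      by blast
  qed
  ultimately show ?thesis by (simp add: Wsp_def)
qed

lemma FT_LE:
  assumes F: "F \<in> Msp a" and \<zeta>: "Im \<zeta> < 0"
  shows "FT a (LE a F) \<zeta> = smul (of_real (2 * pi)) (F \<zeta>)"
proof (rule cdual_eqI)
  fix e' assume e: "e' \<in> cdual smul"
  have "e' (FT a (LE a F) \<zeta>) = kint a 1 (\<lambda>z. e' (LE a F z)) \<zeta>"
    by (rule FT_kint[OF LE_Wsp[OF F] \<zeta> zero_less_one e])
  also have "\<dots> = kint a 1 (Lg a (\<lambda>s. e' (F s))) \<zeta>"
    by (rule kint_cong[OF zero_less_one]) (rule LE_weak[OF F _ e])
  also have "\<dots> = of_real (2 * pi) * e' (F \<zeta>)"
    using kint_Lg[OF Msp_weak[OF F e] \<zeta> zero_less_one] by simp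
  finally show "e' (FT a (LE a F) \<zeta>) = e' (smul (of_real (2 * pi)) (F \<zeta>))" by (simp add: cdual_scale[OF e])
qed

lemma LE_entire:
  assumes F: "\<And>b. F \<in> Msp b"
  shows "RE (- \<i>) F \<in> holomorphic_space smul UNIV" and "\<And>z. z \<in> slit a ==> RE (- \<i>) F z = LE a F z"
proof -
  show "RE (- \<i>) F \<in> holomorphic_space smul UNIV"
  proof (rule holomorphic_spaceI[OF open_UNIV])
    fix e' assume e: "e' \<in> cdual smul"
    have "\<exists>D. ((\<lambda>z. e' (RE (- \<i>) F z)) has_field_derivative D) (at z)" for z
    proof -
      have r: "0 < rate (- \<i>) (Re z + 1) z" by (simp add: rate_simps)
      have "(Lr (- \<i>) (\<lambda>s. e' (F s)) has_field_derivative Lr (- \<i>) (\<lambda>s. \<i> * s * e' (F s)) z) (at z)"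
        by (rule Lr_deriv[OF Msp_weak[OF F e] dir_simps(3) r])
      moreover have "Lr (- \<i>) (\<lambda>s. e' (F s)) = (\<lambda>z. e' (RE (- \<i>) F z))"
      proof
        fix w
        have "0 < rate (- \<i>) (Re w + 1) w" by (simp add: rate_simps)
        then show "Lr (- \<i>) (\<lambda>s. e' (F s)) w = e' (RE (- \<i>) F w)" by (rule RE_weak[OF F dir_simps(3) _ e, symmetric])
      qed
      ultimately show ?thesis by auto
    qed
    then show "(\<lambda>z. e' (RE (- \<i>) F z)) holomorphic_on UNIV" by (simp add: holomorphic_on_open)
  next
    fix z :: complex and \<alpha>
    \<comment> \<open>With the endpoint \<open>Re z + 2\<close> the vertical ray has rate at least 1
      on the closed unit disc about \<open>z\<close>.\<close>
    obtain B where B: "\<And>w. 1 \<le> rate (- \<i>) (Re z + 2) w ==> p \<alpha> (RE (- \<i>) F w) \<le> B"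
      by (rule RE_bounded[OF F dir_simps(3) zero_less_one]) (rule that)
    have "p \<alpha> (RE (- \<i>) F w) \<le> B" if "w \<in> cball z 1" for w
    proof (rule B)
      have "\<bar>Re (z - w)\<bar> \<le> 1" using that abs_Re_le_cmod[of "z - w"] by (simp add: dist_norm)
      then show "1 \<le> rate (- \<i>) (Re z + 2) w" by (simp add: rate_simps)
    qed
    then show "\<exists>B. \<exists>r>0. cball z r \<subseteq> UNIV \<and> (\<forall>w\<in>cball z r. p \<alpha> (RE (- \<i>) F w) \<le> B)"
      by (intro exI[of _ B] exI[of _ 1]) auto
  qed simp
  show "RE (- \<i>) F z = LE a F z" if z: "z \<in> slit a" for z
  proof (rule cdual_eqI)
    fix e' assume e: "e' \<in> cdual smul"
    \<comment> \<open>An endpoint to the right of both \<open>a\<close> and \<open>z\<close> gives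
      the vertical ray and the selected ray positive rates simultaneously, so that
      \<open>Lr_agree\<close> applies.\<close>
    define b where "b = max a (Re z + 1)"
    have r1: "0 < rate (- \<i>) b z" by (simp add: rate_simps b_def)
    have r2: "0 < rate (sel a z) b z" using z by (auto simp: sel_def rate_simps b_def slit_iff)
    have "e' (RE (- \<i>) F z) = Lr (- \<i>) (\<lambda>s. e' (F s)) z" by (rule RE_weak[OF F dir_simps(3) r1 e])
    also have "\<dots> = Lr (sel a z) (\<lambda>s. e' (F s)) z" by (rule Lr_agree[OF Msp_weak[OF F e] dir_simps(3) r1 dir_sel r2])
    also have "\<dots> = e' (LE a F z)" using LE_weak[OF F z e] by (simp add: Lg_def)
    finally show "e' (RE (- \<i>) F z) = e' (LE a F z)" .
  qed
qed

section \<open>Injectivity of the Fourier transform\<close>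

text \<open>The open \<open>c\<close>-neighbourhood of the half-line, a convex region that the
  contour of width \<open>c\<close> does not meet and that exhausts the plane as \<open>c\<close>
  grows.\<close>

definition tube :: "real => real => complex set" where
  "tube a c = {z. \<exists>x\<ge>a. cmod (z - of_real x) < c}"

lemma open_tube: "open (tube a c)"
proof -
  have "tube a c = (\<Union>x\<in>{a..}. ball (of_real x) c)" by (auto simp: tube_def dist_norm norm_minus_commute)
  then show ?thesis by auto
qed

lemma convex_tube: "convex (tube a c)"
proof (rule convexI)
  fix z w and u v :: real assume z: "z \<in> tube a c" and w: "w \<in> tube a c" and u: "0 \<le> u" "0 \<le> v" "u + v = 1"
  obtain x y where x: "a \<le> x" "cmod (z - of_real x) < c" and y: "a \<le> y" "cmod (w - of_real y) < c"
    using z w by (auto simp: tube_def)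
  have "a = u * a + v * a" using u by (simp add: distrib_right[symmetric])
  also have "\<dots> \<le> u * x + v * y" using u x y by (intro add_mono mult_left_mono) auto
  finally have 1: "a \<le> u * x + v * y" .
  have "u *\<^sub>R z + v *\<^sub>R w - of_real (u * x + v * y) = u *\<^sub>R (z - of_real x) + v *\<^sub>R (w - of_real y)"
    by (simp add: scaleR_conv_of_real algebra_simps)
  also have "cmod \<dots> \<le> u * cmod (z - of_real x) + v * cmod (w - of_real y)"
    using u norm_triangle_ineq[of "u *\<^sub>R (z - of_real x)" "v *\<^sub>R (w - of_real y)"] by simp
  also have "\<dots> < c" using x y u by (intro convex_bound_lt) auto
  finally show "u *\<^sub>R z + v *\<^sub>R w \<in> tube a c" using 1 by (auto simp: tube_def)
qed

lemma tube_mono: "c \<le> d ==> tube a c \<subseteq> tube a d"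
  by (auto simp: tube_def intro: less_le_trans)

text \<open>The Cauchy kernel multiplied by \<open>exp (z - w)\<close>: this factor equals 1 at the
  pole and supplies the decay along the unbounded contour that a function in \<open>Wsp\<close>
  lacks.\<close>

definition ck :: "real => real => real => complex => complex" where
  "ck a c t z = hookd c t * (exp (z - hook a c t) / (hook a c t - z))"

text \<open>The factor \<open>exp (- w)\<close> is the Fourier kernel at \<zeta> = -i, so
  \<open>Wsp_bound\<close> with \<open>k = 1\<close> controls the numerator. By
  \<open>dist_hook\<close> the denominator is at least the distance \<open>c\<close> diminished by
  that of \<open>z\<close> from \<open>x\<close>.\<close>

lemma ck_bound:
  assumes \<phi>: "\<phi> \<in> Wsp a" and c: "0 < c"
  obtains C where "0 \<le> C" "\<And>z x t. a \<le> x ==> cmod (z - of_real x) < c ==> t \<notin> {-1, 1} ==>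
     cmod (ck a c t z) * p \<alpha> (\<phi> (hook a c t)) \<le> C * exp (Re z) / (c - cmod (z - of_real x)) * exp (- (1 / 2) * \<bar>t\<bar>)"
proof -
  obtain C where C: "0 \<le> C" "\<And>\<zeta> t. Im \<zeta> \<le> - (1 / 1) ==> t \<notin> {-1, 1} ==> cmod (hookd c t * exp (- \<i> * hook a c t * \<zeta>)) * p \<alpha> (\<phi> (hook a c t))
       \<le> C * exp (c * \<bar>Re \<zeta>\<bar> - (a - c) * \<bar>Im \<zeta>\<bar>) * exp (- (1 / (2 * 1)) * \<bar>t\<bar>)"
    using Wsp_bound[OF \<phi> c order_refl, of \<alpha>] by metis
  show thesis
  proof (rule that)
    show "0 \<le> C * exp (- (a - c))" using C(1) by simp
    fix z x t assume x: "a \<le> x" and z: "cmod (z - of_real x) < c" and t: "t \<notin> {-1, 1::real}"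
    have d: "c - cmod (z - of_real x) \<le> cmod (hook a c t - z)"
      using dist_hook[of c a x t] c x norm_triangle_ineq[of "hook a c t - z" "z - of_real x"] by simp
    have e: "exp (- \<i> * w * (- \<i>)) = exp (- w)" for w
    proof -
      have "- \<i> * w * (- \<i>) = - w" by (simp add: complex_eq_iff)
      then show ?thesis by (simp only:)
    qed
    have C': "cmod (hookd c t * exp (- hook a c t)) * p \<alpha> (\<phi> (hook a c t)) \<le> C * exp (- (a - c)) * exp (- (1 / 2) * \<bar>t\<bar>)"
      using C(2)[of "- \<i>" t] t unfolding e by simp
    have key: "cmod (h * (u * v / d)) * r = (cmod u * (cmod (h * v) * r)) / cmod d" for h u v d :: complex and r
      by (simp add: norm_mult norm_divide)
    have "cmod (ck a c t z) * p \<alpha> (\<phi> (hook a c t))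
        = (cmod (exp z) * (cmod (hookd c t * exp (- hook a c t)) * p \<alpha> (\<phi> (hook a c t)))) / cmod (hook a c t - z)"
      unfolding ck_def diff_conv_add_uminus[of z] exp_add by (rule key)
    also have "\<dots> \<le> (exp (Re z) * (C * exp (- (a - c)) * exp (- (1 / 2) * \<bar>t\<bar>))) / (c - cmod (z - of_real x))"
    proof (rule frac_le)
      show "cmod (exp z) * (cmod (hookd c t * exp (- hook a c t)) * p \<alpha> (\<phi> (hook a c t)))
          \<le> exp (Re z) * (C * exp (- (a - c)) * exp (- (1 / 2) * \<bar>t\<bar>))"
        unfolding norm_exp_eq_Re by (rule mult_left_mono[OF C']) simp
      show "0 \<le> exp (Re z) * (C * exp (- (a - c)) * exp (- (1 / 2) * \<bar>t\<bar>))" using C(1) by simp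
    qed (use d z in simp_all)
    also have "\<dots> = (C * exp (- (a - c))) * exp (Re z) / (c - cmod (z - of_real x)) * exp (- (1 / 2) * \<bar>t\<bar>)"
      by simp
    finally show "cmod (ck a c t z) * p \<alpha> (\<phi> (hook a c t)) \<le> (C * exp (- (a - c))) * exp (Re z) / (c - cmod (z - of_real x)) * exp (- (1 / 2) * \<bar>t\<bar>)" .
  qed
qed

lemma hook_ne_tube: "z \<in> tube a c ==> hook a c t \<noteq> z"
proof -
  assume "z \<in> tube a c"
  then obtain x where x: "a \<le> x" "cmod (z - of_real x) < c" by (auto simp: tube_def)
  have "0 \<le> c" using x(2) norm_ge_zero[of "z - of_real x"] by linarith
  then show ?thesis using dist_hook[of c a x t] x by auto
qed

definition CT :: "real => real => (complex => 'a) => complex => 'a" where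
  "CT a c \<phi> z = (if z \<in> tube a c then (THE x. has_Pettis_integral smul lborel (\<lambda>t. smul (ck a c t z) (\<phi> (hook a c t))) x) else 0)"

lemma CT_Pettis:
  assumes \<phi>: "\<phi> \<in> Wsp a" and c: "0 < c" and z: "z \<in> tube a c"
  shows "has_Pettis_integral smul lborel (\<lambda>t. smul (ck a c t z) (\<phi> (hook a c t))) (CT a c \<phi> z)"
proof -
  have "\<exists>x. has_Pettis_integral smul lborel (\<lambda>t. smul (ck a c t z) (\<phi> (hook a c t))) x"
  proof (rule Pettis_exists[of "{-1, 1}"])
    show "continuous_on (- {-1, 1}) (\<lambda>t. smul (ck a c t z) (\<phi> (hook a c t)))"
      unfolding ck_def using hook_ne_tube[OF z]
      by (intro continuous_on_scale_lc continuous_intros continuous_hookd continuous_hook continuous_on_hook[OF \<phi> c]) auto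
    fix \<alpha>
    obtain C where C: "\<And>z x t. a \<le> x ==> cmod (z - of_real x) < c ==> t \<notin> {-1, 1} ==>
       cmod (ck a c t z) * p \<alpha> (\<phi> (hook a c t)) \<le> C * exp (Re z) / (c - cmod (z - of_real x)) * exp (- (1 / 2) * \<bar>t\<bar>)"
      using ck_bound[OF \<phi> c, of \<alpha>] by metis
    obtain x where x: "a \<le> x" "cmod (z - of_real x) < c" using z by (auto simp: tube_def)
    show "\<exists>C \<delta>. 0 < \<delta> \<and> (\<forall>t. t \<notin> {-1, 1} --> p \<alpha> (smul (ck a c t z) (\<phi> (hook a c t))) \<le> C * exp (- \<delta> * \<bar>t\<bar>))"
    proof (intro exI conjI allI impI)
      show "p \<alpha> (smul (ck a c t z) (\<phi> (hook a c t))) \<le> (C * exp (Re z) / (c - cmod (z - of_real x))) * exp (- (1 / 2) * \<bar>t\<bar>)"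
        if "t \<notin> {-1, 1}" for t
        unfolding seminorm_scale by (rule C[OF x that])
    qed simp
  qed simp
  then have "has_Pettis_integral smul lborel (\<lambda>t. smul (ck a c t z) (\<phi> (hook a c t))) (THE x. has_Pettis_integral smul lborel (\<lambda>t. smul (ck a c t z) (\<phi> (hook a c t))) x)"
    by (rule theI'[OF ex_ex1I]) (rule Pettis_unique)
  then show ?thesis using z by (simp add: CT_def)
qed

lemma CT_holomorphic:
  assumes \<phi>: "\<phi> \<in> Wsp a" and c: "0 < c"
  shows "CT a c \<phi> \<in> holomorphic_space smul (tube a c)"
proof (rule Pettis_holomorphic[where S = "{-1, 1}" and k = "ck a c" and g = "\<lambda>t. \<phi> (hook a c t)"])
  show "open (tube a c)" by (rule open_tube)
  show "CT a c \<phi> z = 0" if "z \<notin> tube a c" for z using that by (simp add: CT_def)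
  show "has_Pettis_integral smul lborel (\<lambda>t. smul (ck a c t z) (\<phi> (hook a c t))) (CT a c \<phi> z)" if "z \<in> tube a c" for z
    by (rule CT_Pettis[OF \<phi> c that])
  show "ck a c t holomorphic_on tube a c" for t
    unfolding ck_def[abs_def] using hook_ne_tube by (intro holomorphic_intros) auto
  fix z \<alpha> assume z: "z \<in> tube a c"
  then obtain x where x: "a \<le> x" "cmod (z - of_real x) < c" by (auto simp: tube_def)
  obtain C where C: "0 \<le> C" "\<And>z x t. a \<le> x ==> cmod (z - of_real x) < c ==> t \<notin> {-1, 1} ==>
     cmod (ck a c t z) * p \<alpha> (\<phi> (hook a c t)) \<le> C * exp (Re z) / (c - cmod (z - of_real x)) * exp (- (1 / 2) * \<bar>t\<bar>)"
    using ck_bound[OF \<phi> c, of \<alpha>] by metis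
  define r where "r = (c - cmod (z - of_real x)) / 2"
  have r: "0 < r" using x by (simp add: r_def)
  have near: "cmod (w - of_real x) \<le> c - r" if "w \<in> cball z r" for w
    using that norm_triangle_ineq[of "w - z" "z - of_real x"] by (simp add: r_def dist_norm norm_minus_commute field_simps)
  have sub: "cball z r \<subseteq> tube a c"
  proof
    fix w assume "w \<in> cball z r"
    then have "cmod (w - of_real x) < c" using near[of w] r by linarith
    then show "w \<in> tube a c" using x(1) by (auto simp: tube_def)
  qed
  have "cmod (ck a c t w) * p \<alpha> (\<phi> (hook a c t)) \<le> (C * exp (Re z + r) / r) * exp (- (1 / 2) * \<bar>t\<bar>)"
    if t: "t \<notin> {-1, 1}" and w: "w \<in> cball z r" for t w
  proof -
    have lt: "cmod (w - of_real x) < c" using near[OF w] r by linarith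
    have "Re w \<le> Re z + r" using w complex_Re_le_cmod[of "w - z"] by (simp add: dist_norm norm_minus_commute)
    then have "C * exp (Re w) / (c - cmod (w - of_real x)) \<le> C * exp (Re z + r) / r"
      using near[OF w] r C(1) by (intro frac_le mult_left_mono) auto
    then have "C * exp (Re w) / (c - cmod (w - of_real x)) * exp (- (1 / 2) * \<bar>t\<bar>) \<le> C * exp (Re z + r) / r * exp (- (1 / 2) * \<bar>t\<bar>)"
      by (rule mult_right_mono) simp
    with C(2)[OF x(1) lt t] show ?thesis by (rule order_trans)
  qed
  moreover have "integrable lborel (\<lambda>t::real. (C * exp (Re z + r) / r) * exp (- (1 / 2) * \<bar>t\<bar>))"
    by (intro integrable_exp_abs) auto
  ultimately show "\<exists>r>0. \<exists>D. cball z r \<subseteq> tube a c \<and> integrable lborel D \<and> (\<forall>t w. t \<notin> {-1, 1} --> w \<in> cball z r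
      --> cmod (ck a c t w) * p \<alpha> (\<phi> (hook a c t)) \<le> D t)"
    using r sub by blast
qed simp

lemma CT_Cauchy:
  assumes \<phi>: "\<phi> \<in> Wsp a" and zero: "\<And>\<zeta>. Im \<zeta> < 0 ==> FT a \<phi> \<zeta> = 0"
    and z: "Re z < a" "cmod (z - of_real a) < c" and e: "e' \<in> cdual smul"
  shows "e' (CT a c \<phi> z) = - 2 * pi * \<i> * e' (\<phi> z)"
proof -
  have c: "0 < c" using z(2) norm_ge_zero le_less_trans by blast
  have zt: "z \<in> tube a c" using z(2) by (auto simp: tube_def)
  have "(LINT t|lborel. e' (smul (ck a c t z) (\<phi> (hook a c t)))) = e' (CT a c \<phi> z)"
    using CT_Pettis[OF \<phi> c zt] e by (simp add: has_Pettis_integral_def)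
  moreover have "e' (smul (ck a c t z) (\<phi> (hook a c t))) = hookd c t * (exp (z - hook a c t) / (hook a c t - z) * e' (\<phi> (hook a c t)))" for t
    by (simp add: cdual_scale[OF e] ck_def mult.assoc)
  moreover have "kint a 1 (\<lambda>z. e' (\<phi> z)) \<zeta> = 0" if "Im \<zeta> < 0" for \<zeta>
    using FT_kint[OF \<phi> that zero_less_one e] zero[OF that] cdual_zero[OF e] by simp
  ultimately show ?thesis
    using kint_eq_zero_imp_Cauchy[OF Wsp_weak[OF \<phi> e] _ z] by simp
qed

text \<open>Where \<open>Re z < a\<close>, close to \<open>a\<close>, both integrals equal
  \<open>- 2 \<pi> i \<phi>\<close> by \<open>CT_Cauchy\<close>. The narrower tube is connected, so
  the identity theorem carries the equality to all of it, including the half-line.\<close>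

lemma CT_indep:
  assumes \<phi>: "\<phi> \<in> Wsp a" and zero: "\<And>\<zeta>. Im \<zeta> < 0 ==> FT a \<phi> \<zeta> = 0"
    and c: "0 < c" "0 < d" and z: "z \<in> tube a c" "z \<in> tube a d"
  shows "CT a c \<phi> z = CT a d \<phi> z"
proof -
  have main: "CT a c \<phi> z = CT a d \<phi> z" if c: "0 < c" "c \<le> d" and z: "z \<in> tube a c" for c d
  proof (rule cdual_eqI)
    fix e' assume e: "e' \<in> cdual smul"
    define U where "U = {z. Re z < a} \<inter> ball (of_real a) c"
    show "e' (CT a c \<phi> z) = e' (CT a d \<phi> z)"
    proof (rule analytic_continuation_open[where s = U and s' = "tube a c"
          and f = "\<lambda>z. e' (CT a c \<phi> z)" and g = "\<lambda>z. e' (CT a d \<phi> z)"])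
      show "open U" unfolding U_def by (intro open_Int open_halfspace_Re_lt open_ball)
      show "open (tube a c)" by (rule open_tube)
      have "of_real (a - c / 2) \<in> U" using c by (simp add: U_def dist_norm)
      then show "U \<noteq> {}" by blast
      show "connected (tube a c)" by (rule convex_connected[OF convex_tube])
      show "U \<subseteq> tube a c" by (auto simp: U_def tube_def dist_norm norm_minus_commute)
      show "(\<lambda>z. e' (CT a c \<phi> z)) holomorphic_on tube a c"
        by (rule cdual_holomorphic[OF CT_holomorphic[OF \<phi> c(1)] open_tube e])
      have "0 < d" using c by linarith
      then show "(\<lambda>z. e' (CT a d \<phi> z)) holomorphic_on tube a c"
        by (rule holomorphic_on_subset[OF cdual_holomorphic[OF CT_holomorphic[OF \<phi>] open_tube e] tube_mono[OF c(2)]])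
      show "e' (CT a c \<phi> w) = e' (CT a d \<phi> w)" if "w \<in> U" for w
        using that c CT_Cauchy[OF \<phi> zero _ _ e, of w c] CT_Cauchy[OF \<phi> zero _ _ e, of w d]
        by (simp add: U_def dist_norm norm_minus_commute)
      show "z \<in> tube a c" by (rule z)
    qed
  qed
  show ?thesis
  proof (cases "c \<le> d")
    case True
    then show ?thesis by (intro main c z)
  next
    case False
    then have "d \<le> c" by simp
    then show ?thesis using main[OF c(2) _ z(2)] by simp
  qed
qed

text \<open>The Cauchy integrals over wider and wider contours are continuations of one another and
  define an entire function. On the cut plane it coincides with \<phi> by the identity theorem,
  starting from a half-disc to the left of \<open>a\<close>.\<close>

lemma FT_injective:
  assumes \<phi>: "\<phi> \<in> Wsp a" and zero: "\<And>\<zeta>. Im \<zeta> < 0 ==> FT a \<phi> \<zeta> = 0"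
  obtains h where "h \<in> holomorphic_space smul UNIV" "\<And>z. z \<in> slit a ==> h z = \<phi> z"
proof -
  define K where "K = inverse (- 2 * of_real pi * \<i>)"
  \<comment> \<open>A width for which \<open>z\<close> lies in the tube, since its distance from the
    point \<open>a\<close> of the half-line is smaller by 1.\<close>
  define rad where "rad z = cmod (z - of_real a) + 1" for z
  have rad: "0 < rad z" "z \<in> tube a (rad z)" for z
    by (auto simp: rad_def tube_def add_nonneg_pos intro!: exI[of _ a])
  define h where "h z = smul K (CT a (rad z) \<phi> z)" for z
  have h_eq: "h z = smul K (CT a c \<phi> z)" if "0 < c" "z \<in> tube a c" for z c
    unfolding h_def using CT_indep[OF \<phi> zero rad(1) that(1) rad(2) that(2)] by simp
  have hol: "h \<in> holomorphic_space smul UNIV"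
  proof (rule holomorphic_space_localI)
    fix z
    have "(\<lambda>w. smul K (CT a (rad z) \<phi> w)) \<in> holomorphic_space smul (tube a (rad z))"
      by (rule holomorphic_space_scale[OF CT_holomorphic[OF \<phi> rad(1)]])
    then show "\<exists>\<Omega>' f'. open \<Omega>' \<and> z \<in> \<Omega>' \<and> f' \<in> holomorphic_space smul \<Omega>' \<and> (\<forall>w\<in>\<Omega>'. h w = f' w)"
      by (intro exI[of _ "tube a (rad z)"] exI[of _ "\<lambda>w. smul K (CT a (rad z) \<phi> w)"] conjI open_tube rad(2) ballI h_eq[OF rad(1)])
  qed simp
  have "h z = \<phi> z" if z: "z \<in> slit a" for z
  proof (rule cdual_eqI)
    fix e' assume e: "e' \<in> cdual smul"
    define U where "U = {z. Re z < a} \<inter> ball (of_real a) 1"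
    show "e' (h z) = e' (\<phi> z)"
    proof (rule analytic_continuation_open[where s = U and s' = "slit a"
          and f = "\<lambda>z. e' (h z)" and g = "\<lambda>z. e' (\<phi> z)"])
      show "open U" unfolding U_def by (intro open_Int open_halfspace_Re_lt open_ball)
      have "of_real (a - 1 / 2) \<in> U" by (simp add: U_def dist_norm)
      then show "U \<noteq> {}" by blast
      show "connected (slit a)" by (rule starlike_imp_connected[OF starlike_slit])
      show "U \<subseteq> slit a" by (auto simp: U_def slit_iff)
      show "(\<lambda>z. e' (h z)) holomorphic_on slit a"
        by (rule holomorphic_on_subset[OF cdual_holomorphic[OF hol open_UNIV e]]) simp
      show "(\<lambda>z. e' (\<phi> z)) holomorphic_on slit a" by (rule Wsp_weak(1)[OF \<phi> e])
      fix w assume w: "w \<in> U"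
      then have w': "Re w < a" "cmod (w - of_real a) < 1" by (auto simp: U_def dist_norm norm_minus_commute)
      have "h w = smul K (CT a 1 \<phi> w)" using w' by (intro h_eq) (auto simp: tube_def)
      then have "e' (h w) = K * (- 2 * pi * \<i> * e' (\<phi> w))"
        using CT_Cauchy[OF \<phi> zero w' e] by (simp add: cdual_scale[OF e])
      also have "\<dots> = e' (\<phi> w)" by (simp add: K_def field_simps)
      finally show "e' (h w) = e' (\<phi> w)" .
    qed (use z in auto)
  qed
  with hol show thesis by (rule that)
qed

end

section \<open>Smooth cutoff functions\<close>

text \<open>The classical function \<open>exp (- 1 / t)\<close> multiplied by polynomials in
  \<open>1 / t\<close>. The polynomials make the family closed under differentiation: the chain rule
  turns \<open>P\<close> into \<open>x^2 * (P - P')\<close>.\<close>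

definition flat :: "real poly => real => real" where
  "flat P t = (if 0 < t then poly P (inverse t) * exp (- inverse t) else 0)"

lemma flat_deriv: "(flat P has_real_derivative flat ([:0, 0, 1:] * (P - pderiv P)) t) (at t)"
proof -
  consider "0 < t" | "t < 0" | "t = 0" by linarith
  then show ?thesis
  proof cases
    case 1
    have "((\<lambda>t. poly P (inverse t) * exp (- inverse t)) has_real_derivative
        poly P (inverse t) * (exp (- inverse t) * inverse t ^ 2) + poly (pderiv P) (inverse t) * - (inverse t ^ 2) * exp (- inverse t)) (at t)"
      using 1 by (auto intro!: derivative_eq_intros DERIV_chain'[OF _ poly_DERIV] simp: power2_eq_square)
    moreover have "poly P (inverse t) * (exp (- inverse t) * inverse t ^ 2) + poly (pderiv P) (inverse t) * - (inverse t ^ 2) * exp (- inverse t)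
        = flat ([:0, 0, 1:] * (P - pderiv P)) t"
      using 1 by (simp add: flat_def power2_eq_square algebra_simps)
    ultimately have "((\<lambda>t. poly P (inverse t) * exp (- inverse t)) has_real_derivative flat ([:0, 0, 1:] * (P - pderiv P)) t) (at t)"
      by (simp only:)
    then show ?thesis
      by (rule has_field_derivative_transform_within_open[OF _ open_greaterThan[of 0]]) (use 1 in \<open>auto simp: flat_def\<close>)
  next
    case 2
    have "((\<lambda>t::real. 0::real) has_real_derivative 0) (at t)" by (rule DERIV_const)
    then have "(flat P has_real_derivative 0) (at t)"
      by (rule has_field_derivative_transform_within_open[OF _ open_lessThan[of 0]]) (use 2 in \<open>auto simp: flat_def\<close>)
    then show ?thesis using 2 by (simp add: flat_def)
  next
    case 3
    \<comment> \<open>The difference quotient at 0 is again of the same form, with the polynomial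
      \<open>x * P\<close>; it tends to 0 because the exponential beats every polynomial at
      infinity.\<close>
    define Q where "Q = [:0, 1:] * P"
    have "((\<lambda>x. \<Sum>i\<le>degree Q. coeff Q i * (x ^ i / exp x)) \<longlongrightarrow> (\<Sum>i\<le>degree Q. coeff Q i * 0)) at_top"
      by (intro tendsto_sum tendsto_mult tendsto_const tendsto_power_div_exp_0)
    moreover have "(\<Sum>i\<le>degree Q. coeff Q i * (x ^ i / exp x)) = poly Q x * exp (- x)" for x
      by (simp add: poly_altdef sum_distrib_right exp_minus divide_inverse mult.assoc)
    ultimately have "((\<lambda>x. poly Q x * exp (- x)) \<longlongrightarrow> 0) at_top" by simp
    then have "((\<lambda>t. poly Q (inverse t) * exp (- inverse t)) \<longlongrightarrow> 0) (at_right 0)"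
      by (rule filterlim_compose[OF _ filterlim_inverse_at_top_right])
    then have right: "((\<lambda>t. (flat P t - flat P 0) / (t - 0)) \<longlongrightarrow> 0) (at_right 0)"
    proof (rule Lim_transform_eventually)
      show "\<forall>\<^sub>F t in at_right 0. poly Q (inverse t) * exp (- inverse t) = (flat P t - flat P 0) / (t - 0)"
        using eventually_at_right_less[of 0] by eventually_elim (simp add: flat_def Q_def divide_inverse mult_ac)
    qed
    have "((\<lambda>t::real. 0::real) \<longlongrightarrow> 0) (at_left 0)" by (rule tendsto_const)
    then have left: "((\<lambda>t. (flat P t - flat P 0) / (t - 0)) \<longlongrightarrow> 0) (at_left 0)"
    proof (rule Lim_transform_eventually)
      have "\<forall>\<^sub>F t in at_left (0::real). t < 0" by (simp add: eventually_at_filter)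
      then show "\<forall>\<^sub>F t in at_left 0. 0 = (flat P t - flat P 0) / (t - 0)"
        by eventually_elim (simp add: flat_def)
    qed
    have "(flat P has_real_derivative 0) (at 0)"
      unfolding has_field_derivative_iff by (rule filterlim_split_at[OF left right])
    then show ?thesis using 3 by (simp add: flat_def)
  qed
qed

text \<open>A class of smooth real functions on the plane closed under partial derivatives.\<close>

inductive smf :: "(complex => real) => bool" where
  smf_const: "smf (\<lambda>z. c)"
| smf_Re: "smf Re"
| smf_Im: "smf Im"
| smf_add: "smf f ==> smf g ==> smf (\<lambda>z. f z + g z)"
| smf_mult: "smf f ==> smf g ==> smf (\<lambda>z. f z * g z)"
| smf_flat: "smf f ==> smf (\<lambda>z. flat P (f z))"
| smf_inverse: "smf f ==> (\<And>z. f z \<noteq> 0) ==> smf (\<lambda>z. inverse (f z))"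

lemma smf_partial:
  assumes "smf f"
  shows "\<exists>f1 f2. smf f1 \<and> smf f2 \<and> (\<forall>z. (f has_derivative (\<lambda>h. f1 z * Re h + f2 z * Im h)) (at z))"
  using assms
proof induction
  case (smf_const c)
  show ?case
    by (intro exI[of _ "\<lambda>z. 0"] conjI smf.smf_const allI) (simp add: has_derivative_const)
next
  case smf_Re
  show ?case
    by (intro exI[of _ "\<lambda>z. 1"] exI[of _ "\<lambda>z. 0"] conjI smf.smf_const allI)
       (simp add: bounded_linear_imp_has_derivative[OF bounded_linear_Re])
next
  case smf_Im
  show ?case
    by (intro exI[of _ "\<lambda>z. 0"] exI[of _ "\<lambda>z. 1"] conjI smf.smf_const allI)
       (simp add: bounded_linear_imp_has_derivative[OF bounded_linear_Im])
next
  case (smf_add f g)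
  then obtain f1 f2 g1 g2 where fg: "smf f1" "smf f2" "smf g1" "smf g2"
    "\<And>z. (f has_derivative (\<lambda>h. f1 z * Re h + f2 z * Im h)) (at z)"
    "\<And>z. (g has_derivative (\<lambda>h. g1 z * Re h + g2 z * Im h)) (at z)" by blast
  show ?case
  proof (intro exI conjI allI)
    show "smf (\<lambda>z. f1 z + g1 z)" "smf (\<lambda>z. f2 z + g2 z)" by (intro smf.smf_add fg)+
    show "((\<lambda>z. f z + g z) has_derivative (\<lambda>h. (f1 z + g1 z) * Re h + (f2 z + g2 z) * Im h)) (at z)" for z
      by (rule has_derivative_eq_rhs[OF has_derivative_add[OF fg(5,6)]]) (simp add: fun_eq_iff algebra_simps)
  qed
next
  case (smf_mult f g)
  then obtain f1 f2 g1 g2 where fg: "smf f1" "smf f2" "smf g1" "smf g2"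
    "\<And>z. (f has_derivative (\<lambda>h. f1 z * Re h + f2 z * Im h)) (at z)"
    "\<And>z. (g has_derivative (\<lambda>h. g1 z * Re h + g2 z * Im h)) (at z)" by blast
  show ?case
  proof (intro exI conjI allI)
    show "smf (\<lambda>z. f z * g1 z + f1 z * g z)" "smf (\<lambda>z. f z * g2 z + f2 z * g z)"
      by (intro smf.smf_add smf.smf_mult fg smf_mult.hyps)+
    show "((\<lambda>z. f z * g z) has_derivative (\<lambda>h. (f z * g1 z + f1 z * g z) * Re h + (f z * g2 z + f2 z * g z) * Im h)) (at z)" for z
      by (rule has_derivative_eq_rhs[OF has_derivative_mult[OF fg(5,6)]]) (simp add: fun_eq_iff algebra_simps)
  qed
next
  case (smf_flat f P)
  then obtain f1 f2 where f: "smf f1" "smf f2" "\<And>z. (f has_derivative (\<lambda>h. f1 z * Re h + f2 z * Im h)) (at z)" by blast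
  define d where "d z = flat ([:0, 0, 1:] * (P - pderiv P)) (f z)" for z
  have d: "smf d" unfolding d_def by (rule smf.smf_flat[OF smf_flat.hyps])
  show ?case
  proof (intro exI conjI allI)
    show "smf (\<lambda>z. d z * f1 z)" "smf (\<lambda>z. d z * f2 z)" by (intro smf.smf_mult d f)+
    show "((\<lambda>z. flat P (f z)) has_derivative (\<lambda>h. (d z * f1 z) * Re h + (d z * f2 z) * Im h)) (at z)" for z
      by (rule has_derivative_eq_rhs[OF has_derivative_compose[OF f(3) flat_deriv[THEN has_field_derivative_imp_has_derivative]]])
         (simp add: fun_eq_iff d_def algebra_simps)
  qed
next
  case (smf_inverse f)
  then obtain f1 f2 where f: "smf f1" "smf f2" "\<And>z. (f has_derivative (\<lambda>h. f1 z * Re h + f2 z * Im h)) (at z)" by blast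
  define d where "d z = (-1) * (inverse (f z) * inverse (f z))" for z
  have d: "smf d" unfolding d_def by (intro smf.smf_mult smf.smf_const smf.smf_inverse[OF smf_inverse.hyps])
  show ?case
  proof (intro exI conjI allI)
    show "smf (\<lambda>z. d z * f1 z)" "smf (\<lambda>z. d z * f2 z)" by (intro smf.smf_mult d f)+
    show "((\<lambda>z. inverse (f z)) has_derivative (\<lambda>h. (d z * f1 z) * Re h + (d z * f2 z) * Im h)) (at z)" for z
      by (rule has_derivative_eq_rhs[OF Deriv.has_derivative_inverse[OF smf_inverse.hyps(2) f(3)]])
         (simp add: fun_eq_iff d_def algebra_simps)
  qed
qed

lemma smf_continuous: "smf f ==> continuous_on S f"
proof -
  assume "smf f"
  then obtain f1 f2 where "\<And>z. (f has_derivative (\<lambda>h. f1 z * Re h + f2 z * Im h)) (at z)" using smf_partial by blast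
  then have "isCont f z" for z by (rule has_derivative_continuous)
  then show ?thesis by (simp add: continuous_at_imp_continuous_on)
qed

section \<open>The cut-off function of the half-line\<close>

definition step :: "real => real" where
  "step x = flat 1 x * inverse (flat 1 x + flat 1 (1 - x))"

lemma step_den: "flat 1 x + flat 1 (1 - x) \<noteq> 0"
proof -
  have "0 < flat 1 x + flat 1 (1 - x)" unfolding flat_def by (auto intro: add_pos_pos)
  then show ?thesis by simp
qed

lemma step_zero: "x \<le> 0 ==> step x = 0" and step_one: "1 \<le> x ==> step x = 1"
  by (auto simp: step_def flat_def)

lemma smf_step: "smf f ==> smf (\<lambda>z. step (f z))"
proof -
  assume f: "smf f"
  have g: "smf (\<lambda>z. 1 + (-1) * f z)" by (intro smf.intros f)
  have "smf (\<lambda>z. flat 1 (f z) * inverse (flat 1 (f z) + flat 1 (1 + (-1) * f z)))"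
    using step_den by (intro smf_mult smf_inverse smf_add smf_flat f g) simp
  then show ?thesis by (simp add: step_def)
qed

text \<open>The quadratic factor controls the width of the cut-off:
  \<open>\<bar>qf a z\<bar> \<le> 1\<close> means
  \<open>\<bar>Im z\<bar> \<le> 1 / (1 + (Re z - a)^2)\<close>. Far to the right this is thinner
  than every strip \<open>\<bar>Im z\<bar> < 1 / n\<close>, and such strips are removed from
  \<open>Sn n {\<infinity>}\<close>. Hence a cut-off function needs no growth condition to be
  tempered.\<close>

definition qf :: "real => complex => real" where
  "qf a z = (1 + (Re z - a)^2) * Im z"

text \<open>The first factor rises from 0 to 1 between \<open>Re z = a - 1\<close> and
  \<open>Re z = a - 1 / 2\<close>. The second falls from 1 to 0 while the square of
  \<open>qf a z\<close> runs from \<open>1 / 2\<close> to 1. These are the bounds in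
  \<open>inner_nbhd\<close> and \<open>outer_region\<close>.\<close>

definition cutoff :: "real => complex => real" where
  "cutoff a z = step (2 * (Re z - a) + 2) * step (2 - 2 * (qf a z)^2)"

definition inner_nbhd :: "real => complex set" where
  "inner_nbhd a = {z. Re z - a > - 1 / 2} \<inter> {z. (qf a z)^2 < 1 / 2}"

definition outer_region :: "real => complex set" where
  "outer_region a = {z. Re z - a < - 1} \<union> {z. 1 < (qf a z)^2}"

lemma smf_cutoff: "smf (cutoff a)"
proof -
  have X: "smf (\<lambda>z. Re z + (- a))" by (intro smf.intros)
  have q: "smf (\<lambda>z. (1 + (Re z + (- a)) * (Re z + (- a))) * Im z)" by (intro smf.intros X)
  have "smf (\<lambda>z. step (2 * (Re z + (- a)) + 2) * step (2 + (-2) * (((1 + (Re z + (- a)) * (Re z + (- a))) * Im z) * ((1 + (Re z + (- a)) * (Re z + (- a))) * Im z))))"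
    by (intro smf_mult smf_step smf_add smf_const X q)
  then show ?thesis by (simp add: cutoff_def[abs_def] qf_def power2_eq_square)
qed

lemma cutoff_inner: "z \<in> inner_nbhd a ==> cutoff a z = 1"
  unfolding inner_nbhd_def cutoff_def by (simp add: step_one)

lemma cutoff_outer: "z \<in> outer_region a ==> cutoff a z = 0"
  unfolding outer_region_def cutoff_def by (auto simp: step_zero)

lemma continuous_qf: "continuous_on S (qf a)"
  unfolding qf_def by (intro continuous_intros)

lemma open_regions: "open (inner_nbhd a)" "open (outer_region a)"
  unfolding inner_nbhd_def outer_region_def
  by (intro open_Int open_Un open_Collect_less continuous_intros continuous_qf)+

lemma slit_inner: "z \<notin> slit a ==> z \<in> inner_nbhd a"
  by (auto simp: slit_iff inner_nbhd_def qf_def)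

lemma smf_local_zero:
  assumes "open V" and zero: "\<And>z. z \<in> V ==> f z = c"
    and d: "(f has_derivative (\<lambda>h. f1 * Re h + f2 * Im h)) (at z)" and z: "z \<in> V"
  shows "f1 = 0" "f2 = (0::real)"
proof -
  have "((\<lambda>z. c) has_derivative (\<lambda>h. 0)) (at z)" by (rule has_derivative_const)
  then have "(f has_derivative (\<lambda>h. 0)) (at z)"
    by (rule has_derivative_transform_within_open[OF _ \<open>open V\<close> z]) (use zero in simp)
  then have eq: "(\<lambda>h. f1 * Re h + f2 * Im h) = (\<lambda>h. 0)" using d has_derivative_unique by blast
  show "f1 = 0" using fun_cong[OF eq, of 1] by simp
  show "f2 = 0" using fun_cong[OF eq, of \<i>] by simp
qed

lemma smf_quotient:
  assumes d: "(f has_derivative (\<lambda>h. f1 * Re h + f2 * Im h)) (at z)" and v: "v = 1 \<or> v = \<i>"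
  shows "((\<lambda>h. (f (z + of_real h * v) - f z) / h) \<longlongrightarrow> (if v = 1 then f1 else f2)) (at 0)"
proof -
  have "((\<lambda>h::real. z + of_real h * v) has_derivative (\<lambda>h. of_real h * v)) (at 0)"
    by (auto intro!: derivative_eq_intros)
  then have "((\<lambda>h. f (z + of_real h * v)) has_derivative (\<lambda>h. f1 * Re (of_real h * v) + f2 * Im (of_real h * v))) (at 0)"
    by (rule has_derivative_compose) (use d in simp)
  then have "((\<lambda>h. f (z + of_real h * v)) has_real_derivative (if v = 1 then f1 else f2)) (at 0)"
    unfolding has_field_derivative_def
    by (rule has_derivative_eq_rhs) (use v in \<open>auto simp: fun_eq_iff\<close>)
  then show ?thesis unfolding has_field_derivative_iff by simp
qed

section \<open>The Cauchy--Riemann equation\<close>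

text \<open>The increment is split into a horizontal and a vertical leg. The horizontal one is
  governed by the derivative at \<open>z\<close> alone. The vertical one starts at a moving point,
  so it takes the mean value inequality and the continuity of \<open>D \<i>\<close>. Complex
  differentiability results from the Cauchy-Riemann equation.\<close>

lemma Cauchy_Riemann_holomorphic:
  fixes f :: "complex => complex"
  assumes "open \<Omega>"
    and lim: "\<And>v z. v = 1 \<or> v = \<i> ==> z \<in> \<Omega> ==> ((\<lambda>h. of_real (inverse h) * (f (z + of_real h * v) - f z)) \<longlongrightarrow> D v z) (at 0)"
    and cont: "continuous_on \<Omega> (D \<i>)"
    and CR: "\<And>z. z \<in> \<Omega> ==> D 1 z + \<i> * D \<i> z = 0"
  shows "f holomorphic_on \<Omega>"
proof -
  have deriv: "((\<lambda>t. f (w + of_real t * v)) has_vector_derivative D v (w + of_real t * v)) (at t)"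
    if v: "v = 1 \<or> v = \<i>" and "w + of_real t * v \<in> \<Omega>" for v w and t :: real
  proof -
    have "((\<lambda>h. of_real (inverse h) * (f (w + of_real t * v + of_real h * v) - f (w + of_real t * v))) \<longlongrightarrow> D v (w + of_real t * v)) (at 0)"
      by (rule lim[OF that])
    then have "((\<lambda>h. cmod (of_real (inverse h) * (f (w + of_real t * v + of_real h * v) - f (w + of_real t * v)) - D v (w + of_real t * v))) \<longlongrightarrow> 0) (at 0)"
      by (rule tendsto_norm_zero[OF LIM_zero])
    then have "((\<lambda>h. cmod (f (w + of_real (t + h) * v) - f (w + of_real t * v) - h *\<^sub>R D v (w + of_real t * v)) / \<bar>h\<bar>) \<longlongrightarrow> 0) (at 0)"
    proof (rule Lim_transform_eventually)
      have "cmod (of_real (inverse h) * (x - y) - d) = cmod (x - y - h *\<^sub>R d) / \<bar>h\<bar>" if "h \<noteq> 0" for x y d :: complex and h :: real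
      proof -
        have "x - y - h *\<^sub>R d = of_real h * (of_real (inverse h) * (x - y) - d)"
          using that by (simp add: scaleR_conv_of_real right_diff_distrib flip: of_real_mult mult.assoc)
        then show ?thesis using that by (simp add: norm_mult)
      qed
      moreover have "w + of_real t * v + of_real h * v = w + of_real (t + h) * v" for h :: real
        by (simp add: distrib_right)
      ultimately show "\<forall>\<^sub>F h in at 0. cmod (of_real (inverse h) * (f (w + of_real t * v + of_real h * v) - f (w + of_real t * v)) - D v (w + of_real t * v))
          = cmod (f (w + of_real (t + h) * v) - f (w + of_real t * v) - h *\<^sub>R D v (w + of_real t * v)) / \<bar>h\<bar>"
        by (auto simp: eventually_at_filter add.assoc distrib_right)
    qed
    then show ?thesis
      unfolding has_vector_derivative_def has_derivative_at by (auto intro: bounded_linear_scaleR_left)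
  qed
  have "\<exists>d. (f has_field_derivative d) (at z)" if z: "z \<in> \<Omega>" for z
  proof -
    have D: "D \<i> z = \<i> * D 1 z"
    proof -
      have "\<i> * (D 1 z + \<i> * D \<i> z) = 0" using CR[OF z] by simp
      then show ?thesis by (simp add: distrib_left)
    qed
    have "((\<lambda>w. (f w - f z) / (w - z) - D 1 z) \<longlongrightarrow> 0) (at z)"
    proof (rule tendstoI)
      fix \<epsilon> :: real assume \<epsilon>: "0 < \<epsilon>"
      have "(D \<i> \<longlongrightarrow> D \<i> z) (at z)"
        using cont z \<open>open \<Omega>\<close> by (simp add: continuous_on_eq_continuous_at isCont_def)
      then obtain r1 where r1: "0 < r1" "\<And>w. w \<noteq> z ==> dist w z < r1 ==> dist (D \<i> w) (D \<i> z) < \<epsilon> / 3"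
        using tendstoD[of "D \<i>" "D \<i> z" "at z" "\<epsilon> / 3"] \<epsilon> unfolding eventually_at by auto
      have "((\<lambda>h. of_real (inverse h) * (f (z + of_real h * 1) - f z)) \<longlongrightarrow> D 1 z) (at 0)" using lim[of 1 z] z by simp
      then obtain r2 where r2: "0 < r2" "\<And>h. h \<noteq> 0 ==> \<bar>h\<bar> < r2 ==> dist (of_real (inverse h) * (f (z + of_real h) - f z)) (D 1 z) < \<epsilon> / 3"
        using tendstoD[of "\<lambda>h. of_real (inverse h) * (f (z + of_real h * 1) - f z)" "D 1 z" "at 0" "\<epsilon> / 3"] \<epsilon>
        unfolding eventually_at by auto
      obtain r3 where r3: "0 < r3" "ball z r3 \<subseteq> \<Omega>" using \<open>open \<Omega>\<close> z open_contains_ball by blast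
      define r where "r = min r1 (min r2 r3)"
      have r: "0 < r" using r1 r2 r3 by (simp add: r_def)
      have "dist ((f w - f z) / (w - z) - D 1 z) 0 < \<epsilon>" if w: "w \<noteq> z" "dist w z < r" for w
      proof -
        define s t where "s = Re (w - z)" and "t = Im (w - z)"
        have wz: "w - z = of_real s + of_real t * \<i>" by (simp add: s_def t_def complex_eq_iff)
        have cw: "cmod (w - z) < r" using w by (simp add: dist_norm)
        have s: "\<bar>s\<bar> \<le> cmod (w - z)" and t: "\<bar>t\<bar> \<le> cmod (w - z)"
          unfolding s_def t_def by (rule abs_Re_le_cmod abs_Im_le_cmod)+
        define z' where "z' = z + of_real s"
        have A: "cmod (f z' - f z - of_real s * D 1 z) \<le> \<epsilon> / 3 * cmod (w - z)"
        proof (cases "s = 0")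
          case False
          have "\<bar>s\<bar> < r2" using s cw by (simp add: r_def)
          from r2(2)[OF False this]
          have q: "cmod (of_real (inverse s) * (f (z + of_real s) - f z) - D 1 z) \<le> \<epsilon> / 3" unfolding dist_norm by (rule less_imp_le)
          have "f z' - f z - of_real s * D 1 z = of_real s * (of_real (inverse s) * (f (z + of_real s) - f z) - D 1 z)"
            using False by (simp add: z'_def right_diff_distrib flip: mult.assoc)
          then have "cmod (f z' - f z - of_real s * D 1 z) = \<bar>s\<bar> * cmod (of_real (inverse s) * (f (z + of_real s) - f z) - D 1 z)"
            by (simp only: norm_mult norm_of_real)
          also have "\<dots> \<le> \<bar>s\<bar> * (\<epsilon> / 3)" by (rule mult_left_mono[OF q abs_ge_zero])
          also have "\<dots> \<le> cmod (w - z) * (\<epsilon> / 3)" using s \<epsilon> by (intro mult_right_mono) auto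
          finally show ?thesis by (simp add: mult.commute)
        qed (use \<epsilon> in \<open>simp add: z'_def\<close>)
        \<comment> \<open>Along the vertical leg the linear part with the fixed slope at
          \<open>z\<close> is subtracted; the derivative of the remainder is small because
          \<open>D \<i>\<close> is continuous at \<open>z\<close> and the leg stays in the
          disc.\<close>
        have B: "cmod (f w - f z' - of_real t * D \<i> z) \<le> \<epsilon> / 3 * cmod (w - z)"
        proof -
          define F where "F x = f (z' + of_real x * \<i>) - of_real x * D \<i> z" for x :: real
          have in_ball: "dist (z' + of_real x * \<i>) z < r" if x: "x \<in> closed_segment 0 t" for x
          proof -
            have "\<bar>x\<bar> \<le> \<bar>t\<bar>" using x by (auto simp: closed_segment_eq_real_ivl split: if_splits)
            then have "s^2 + x^2 \<le> s^2 + t^2" by (simp add: abs_le_square_iff)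
            then have "cmod (of_real s + of_real x * \<i>) \<le> cmod (w - z)"
              unfolding wz by (simp add: cmod_def)
            moreover have "z' + of_real x * \<i> - z = of_real s + of_real x * \<i>" by (simp add: z'_def)
            ultimately show ?thesis using cw by (simp only: dist_norm)
          qed
          have F': "(F has_vector_derivative (D \<i> (z' + of_real x * \<i>) - D \<i> z)) (at x within closed_segment 0 t)"
            if x: "x \<in> closed_segment 0 t" for x
          proof -
            have "z' + of_real x * \<i> \<in> \<Omega>" using in_ball[OF x] r3 by (auto simp: r_def dist_commute)
            then have "((\<lambda>x. f (z' + of_real x * \<i>)) has_vector_derivative D \<i> (z' + of_real x * \<i>)) (at x)"
              by (intro deriv) auto
            moreover have "((\<lambda>x. of_real x * D \<i> z) has_vector_derivative D \<i> z) (at x)"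
              by (rule has_vector_derivative_real_field[where f = "\<lambda>y. y * D \<i> z"]) (auto intro!: derivative_eq_intros)
            ultimately have "(F has_vector_derivative (D \<i> (z' + of_real x * \<i>) - D \<i> z)) (at x)"
              unfolding F_def[abs_def] by (rule has_vector_derivative_diff)
            then show ?thesis by (rule has_vector_derivative_at_within)
          qed
          have "cmod (F t - F 0) \<le> \<epsilon> / 3 * norm (t - 0)"
          proof (rule differentiable_bound[OF convex_closed_segment[of 0 t], where x = t and y = 0 and f = F
                and f' = "\<lambda>x h. h *\<^sub>R (D \<i> (z' + of_real x * \<i>) - D \<i> z)"])
            fix x assume x: "x \<in> closed_segment 0 t"
            show "(F has_derivative (\<lambda>h. h *\<^sub>R (D \<i> (z' + of_real x * \<i>) - D \<i> z))) (at x within closed_segment 0 t)"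
              using F'[OF x] by (simp add: has_vector_derivative_def)
            have "cmod (D \<i> (z' + of_real x * \<i>) - D \<i> z) \<le> \<epsilon> / 3"
            proof (cases "z' + of_real x * \<i> = z")
              case False
              have "dist (z' + of_real x * \<i>) z < r1" using in_ball[OF x] by (simp add: r_def)
              from r1(2)[OF False this] show ?thesis by (simp add: dist_norm)
            qed (use \<epsilon> in simp)
            then have "norm (y *\<^sub>R (D \<i> (z' + of_real x * \<i>) - D \<i> z)) \<le> \<epsilon> / 3 * norm y" for y
              unfolding norm_scaleR real_norm_def mult.commute[of "\<epsilon> / 3"] by (rule mult_left_mono) simp
            then show "onorm (\<lambda>h. h *\<^sub>R (D \<i> (z' + of_real x * \<i>) - D \<i> z)) \<le> \<epsilon> / 3"
              by (rule onorm_le)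
          qed auto
          also have "\<dots> \<le> \<epsilon> / 3 * cmod (w - z)" using t \<epsilon> by (intro mult_left_mono) auto
          also have "F t - F 0 = f w - f z' - of_real t * D \<i> z"
          proof -
            have "z' + of_real t * \<i> = w" using wz by (simp add: z'_def algebra_simps)
            then show ?thesis by (simp add: F_def)
          qed
          finally show ?thesis .
        qed
        have ne: "w - z \<noteq> 0" using w by simp
        have "(f w - f z) / (w - z) - D 1 z = (f w - f z - (w - z) * D 1 z) / (w - z)"
          using ne by (simp add: diff_divide_distrib)
        moreover have "f w - f z - (w - z) * D 1 z = (f z' - f z - of_real s * D 1 z) + (f w - f z' - of_real t * D \<i> z)"
          unfolding wz D by (simp add: algebra_simps)
        ultimately have "cmod ((f w - f z) / (w - z) - D 1 z)
            = cmod ((f z' - f z - of_real s * D 1 z) + (f w - f z' - of_real t * D \<i> z)) / cmod (w - z)"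
          by (simp only: norm_divide)
        also have "\<dots> \<le> (\<epsilon> / 3 * cmod (w - z) + \<epsilon> / 3 * cmod (w - z)) / cmod (w - z)"
          by (rule divide_right_mono[OF norm_triangle_le[OF add_mono[OF A B]] norm_ge_zero])
        also have "\<dots> = 2 * \<epsilon> / 3" using ne by (simp add: field_simps)
        also have "\<dots> < \<epsilon>" using \<epsilon> by simp
        finally show ?thesis by (simp add: dist_norm)
      qed
      then show "\<forall>\<^sub>F w in at z. dist ((f w - f z) / (w - z) - D 1 z) 0 < \<epsilon>"
        unfolding eventually_at using r by (intro exI[of _ r]) auto
    qed
    then have "(f has_field_derivative D 1 z) (at z)"
      unfolding has_field_derivative_iff by (simp add: LIM_zero_iff)
    then show ?thesis by blast
  qed
  then show ?thesis by (simp add: holomorphic_on_open[OF \<open>open \<Omega>\<close>])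
qed

section \<open>The sets \<open>Unbhd\<close> and \<open>Sn\<close> for the half-line and for the
  point at infinity\<close>

lemma edist_empty: "edist z {} = \<infinity>"
  by (simp add: edist_def top_ereal_def)

lemma edist_less: "edist z M < ereal c \<longleftrightarrow> (\<exists>w\<in>M. cmod (z - w) < c)"
  by (simp add: edist_def INF_less_iff)

lemma cset_infinite [simp]: "cset {\<infinity>} = {}" "cset {} = {}"
  by (auto simp: cset_def)

lemma cset_half: "cset {ereal a..} = complex_of_real ` {a..}"
  by (auto simp: cset_def)

lemma slit_cset: "- cset {ereal a..} = slit a"
  by (simp add: cset_half slit_def)

lemma Unbhd_infinity: "Unbhd c {\<infinity>} = {z. 1 / c < Re z \<and> \<bar>Im z\<bar> < c}"
  by (auto simp: Unbhd_def edist_empty)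

lemma Sn_infinity: "z \<in> Sn n {\<infinity>} ==> Re z \<le> real n \<or> 1 / real n \<le> \<bar>Im z\<bar>"
proof (rule ccontr)
  assume z: "z \<in> Sn n {\<infinity>}" and "\<not> (Re z \<le> real n \<or> 1 / real n \<le> \<bar>Im z\<bar>)"
  then have "z \<in> Unbhd (1 / real n) {\<infinity>}" by (simp add: Unbhd_infinity)
  then show False using z closure_subset unfolding Sn_def by blast
qed

context seq_complete_lcHs
begin

lemma Unbhd_half: "Unbhd c {ereal a..} = tube a c \<union> {z. 1 / c < Re z \<and> \<bar>Im z\<bar> < c}"
  by (auto simp: Unbhd_def edist_less cset_half tube_def)

lemma Sn_half_subset: "Sn n {ereal a..} \<subseteq> Sn n {\<infinity>} - tube a (1 / real n)"
proof -
  have "closure (Unbhd (1 / real n) {\<infinity>}) \<subseteq> closure (Unbhd (1 / real n) {ereal a..})"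
    by (rule closure_mono) (auto simp: Unbhd_infinity Unbhd_half)
  moreover have "tube a (1 / real n) \<subseteq> closure (Unbhd (1 / real n) {ereal a..})"
    using closure_subset by (auto simp: Unbhd_half)
  ultimately show ?thesis by (auto simp: Sn_def)
qed


text \<open>Outside the outer region \<open>(1 + (Re z - a)^2) * \<bar>Im z\<bar> \<le> 1\<close>.
  Points of \<open>Sn n {\<infinity>}\<close> with \<open>Re z > n\<close> satisfy
  \<open>\<bar>Im z\<bar> \<ge> 1 / n\<close>, and together this limits \<open>(Re z - a)^2\<close>
  by \<open>n\<close>.\<close>

lemma inner_region_bound:
  assumes z: "z \<in> Sn n {\<infinity>}" "z \<notin> outer_region a" and n: "1 \<le> n"
  shows "z \<in> cball 0 (\<bar>a\<bar> + real n + 2)"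
proof -
  have re: "a - 1 \<le> Re z" and q: "(qf a z)^2 \<le> 1" using z(2) by (auto simp: outer_region_def)
  have "\<bar>qf a z\<bar> \<le> 1" using q by (simp add: abs_square_le_1)
  then have q: "(1 + (Re z - a)^2) * \<bar>Im z\<bar> \<le> 1" by (simp add: qf_def abs_mult add_nonneg_nonneg)
  have im: "\<bar>Im z\<bar> \<le> 1"
  proof -
    have "1 * \<bar>Im z\<bar> \<le> (1 + (Re z - a)^2) * \<bar>Im z\<bar>" by (rule mult_right_mono) auto
    with q show ?thesis by simp
  qed
  have "Re z \<le> \<bar>a\<bar> + real n"
  proof (cases "Re z \<le> real n")
    case False
    then have "1 / real n \<le> \<bar>Im z\<bar>" using Sn_infinity[OF z(1)] by simp
    then have "(1 + (Re z - a)^2) * (1 / real n) \<le> (1 + (Re z - a)^2) * \<bar>Im z\<bar>" by (rule mult_left_mono) simp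
    then have "(1 + (Re z - a)^2) * (1 / real n) \<le> 1" using q by linarith
    then have "1 + (Re z - a)^2 \<le> real n" using n by (simp add: field_simps)
    moreover have "real n \<le> (real n)^2" using n by (simp add: power2_eq_square)
    ultimately have "(Re z - a)^2 \<le> (real n)^2" by linarith
    then have "\<bar>Re z - a\<bar> \<le> real n" by (simp add: abs_le_square_iff[symmetric])
    then show ?thesis by linarith
  qed simp
  then have "\<bar>Re z\<bar> \<le> \<bar>a\<bar> + real n + 1" using re by linarith
  then show ?thesis using cmod_le[of z] im by simp
qed

lemma exp_weight_le: "0 \<le> x ==> x \<le> (B::real) ==> x * exp (- (1 / real n) * \<bar>r\<bar>) \<le> B"
proof -
  assume x: "0 \<le> x" "x \<le> B"
  have "x * exp (- (1 / real n) * \<bar>r\<bar>) \<le> x * 1" by (rule mult_left_mono[OF _ x(1)]) simp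
  then show ?thesis using x by simp
qed

lemma continuous_on_diff_lc:
  fixes f :: "'x::topological_space => 'a"
  shows "continuous_on S f ==> continuous_on S g ==> continuous_on S (\<lambda>x. f x - g x)"
  unfolding continuous_on_def by (blast intro: tendsto_diff_lc)

section \<open>Partial derivatives of products of cut-off and holomorphic functions\<close>

lemma diff_quotient_cong:
  assumes "open U" "z \<in> U" "\<And>w. w \<in> U ==> f w = g w" "(diff_quotient smul v g z \<longlongrightarrow> l) (at 0)"
  shows "(diff_quotient smul v f z \<longlongrightarrow> l) (at 0)"
  using assms(4)
proof (rule Lim_transform_eventually)
  have "((\<lambda>h::real. z + of_real h * v) \<longlongrightarrow> z + of_real 0 * v) (at 0)" by (intro tendsto_intros)
  then have "\<forall>\<^sub>F h::real in at 0. z + of_real h * v \<in> U"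
    using assms(1,2) by (intro topological_tendstoD) auto
  then show "\<forall>\<^sub>F h in at 0. diff_quotient smul v g z h = diff_quotient smul v f z h"
    by eventually_elim (simp add: diff_quotient_def assms(2,3))
qed

lemma diff_quotient_diff:
  assumes "(diff_quotient smul v f z \<longlongrightarrow> l) (at 0)" "(diff_quotient smul v g z \<longlongrightarrow> m) (at 0)"
  shows "(diff_quotient smul v (\<lambda>z. f z - g z) z \<longlongrightarrow> l - m) (at 0)"
proof -
  have "diff_quotient smul v (\<lambda>z. f z - g z) z = (\<lambda>h. diff_quotient smul v f z h - diff_quotient smul v g z h)"
    by (simp add: fun_eq_iff diff_quotient_def flip: scale_right_diff_distrib)
  with tendsto_diff_lc[OF assms] show ?thesis by (simp only:)
qed

lemma diff_quotient_add:
  assumes "(diff_quotient smul v f z \<longlongrightarrow> l) (at 0)" "(diff_quotient smul v g z \<longlongrightarrow> m) (at 0)"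
  shows "(diff_quotient smul v (\<lambda>z. f z + g z) z \<longlongrightarrow> l + m) (at 0)"
proof -
  have "diff_quotient smul v (\<lambda>z. f z + g z) z = (\<lambda>h. diff_quotient smul v f z h + diff_quotient smul v g z h)"
    by (simp add: fun_eq_iff diff_quotient_def add_diff_add flip: scale_right_distrib)
  with tendsto_add_lc[OF assms] show ?thesis by (simp only:)
qed

lemma diff_quotient_holomorphic:
  assumes g: "g \<in> holomorphic_space smul \<Omega>" and z: "z \<in> \<Omega>" and v: "v \<noteq> 0"
  shows "(diff_quotient smul v g z \<longlongrightarrow> smul v (vderiv \<Omega> g z)) (at 0)"
proof -
  have "filterlim (\<lambda>h::real. z + of_real h * v) (at z) (at 0)"
    unfolding filterlim_at
  proof
    show "\<forall>\<^sub>F h::real in at 0. z + of_real h * v \<in> UNIV \<and> z + of_real h * v \<noteq> z"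
      using v by (simp add: eventually_at_filter)
    have "((\<lambda>h::real. z + of_real h * v) \<longlongrightarrow> z + of_real 0 * v) (at 0)" by (intro tendsto_intros)
    then show "((\<lambda>h::real. z + of_real h * v) \<longlongrightarrow> z) (at 0)" by simp
  qed
  from filterlim_compose[OF vderiv_tendsto[OF g z] this]
  have "((\<lambda>h::real. smul v (smul (inverse (z + of_real h * v - z)) (g (z + of_real h * v) - g z))) \<longlongrightarrow> smul v (vderiv \<Omega> g z)) (at 0)"
    by (rule tendsto_scale_lc[OF tendsto_const])
  moreover have "smul v (smul (inverse (z + of_real h * v - z)) x) = smul (of_real (inverse h)) x" for h :: real and x
    using v by simp
  ultimately show ?thesis by (simp only: diff_quotient_def[abs_def])
qed

lemma diff_quotient_product:
  assumes d: "(\<phi> has_derivative (\<lambda>h. f1 * Re h + f2 * Im h)) (at z)" and v: "v = 1 \<or> v = \<i>"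
    and g: "g \<in> holomorphic_space smul \<Omega>" and \<Omega>: "open \<Omega>" "z \<in> \<Omega>"
  shows "(diff_quotient smul v (\<lambda>z. smul (of_real (\<phi> z)) (g z)) z \<longlongrightarrow>
     smul (of_real (if v = 1 then f1 else f2)) (g z) + smul (of_real (\<phi> z)) (smul v (vderiv \<Omega> g z))) (at 0)"
proof -
  have v0: "v \<noteq> 0" using v by auto
  have "isCont (\<lambda>h::real. z + of_real h * v) 0" by (intro continuous_intros)
  then have "((\<lambda>h::real. z + of_real h * v) \<longlongrightarrow> z) (at 0)" by (simp add: isCont_def)
  moreover have "(g \<longlongrightarrow> g z) (nhds z)"
    using holomorphic_space_continuous[OF g] \<Omega> by (simp add: continuous_on_eq_continuous_at continuous_at tendsto_at_iff_tendsto_nhds)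
  ultimately have gl: "((\<lambda>h::real. g (z + of_real h * v)) \<longlongrightarrow> g z) (at 0)" by (rule filterlim_compose[rotated])
  have lim: "((\<lambda>h. smul (of_real ((\<phi> (z + of_real h * v) - \<phi> z) / h)) (g (z + of_real h * v)) + smul (of_real (\<phi> z)) (diff_quotient smul v g z h))
     \<longlongrightarrow> smul (of_real (if v = 1 then f1 else f2)) (g z) + smul (of_real (\<phi> z)) (smul v (vderiv \<Omega> g z))) (at 0)"
    by (intro tendsto_add_lc tendsto_scale_lc tendsto_const tendsto_of_real gl smf_quotient[OF d v]
          diff_quotient_holomorphic[OF g \<Omega>(2) v0])
  have key: "smul ((b - c) / h) x + smul c (smul (inverse h) (x - y)) = smul (inverse h) (smul b x - smul c y)"
    for b c h :: complex and x y
  proof -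
    have "(b - c) / h = inverse h * b - inverse h * c" unfolding divide_inverse by (simp add: algebra_simps)
    then show ?thesis by (simp add: scale_right_diff_distrib scale_left_diff_distrib mult.commute)
  qed
  have "diff_quotient smul v (\<lambda>z. smul (of_real (\<phi> z)) (g z)) z h
      = smul (of_real ((\<phi> (z + of_real h * v) - \<phi> z) / h)) (g (z + of_real h * v)) + smul (of_real (\<phi> z)) (diff_quotient smul v g z h)" for h
    unfolding diff_quotient_def of_real_inverse of_real_divide of_real_diff by (rule key[symmetric])
  then show ?thesis using lim by (simp add: diff_quotient_def[abs_def])
qed

text \<open>Smooth on the whole plane as soon as \<open>V\<close> is a neighbourhood of the half-line.\<close>

inductive cut :: "real => complex set => (complex => 'a) => bool" for a V where
  cut_product: "smf \<phi> ==> (\<And>z. z \<in> V ==> \<phi> z = 0) ==> g \<in> holomorphic_space smul (slit a)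
     ==> cut a V (\<lambda>z. smul (of_real (\<phi> z)) (g z))"
| cut_add: "cut a V w ==> cut a V w' ==> cut a V (\<lambda>z. w z + w' z)"

lemma cut_zero: "cut a V w ==> z \<in> V ==> w z = 0"
  by (induction rule: cut.induct) auto

lemma cut_continuous:
  assumes "cut a V w" and V: "open V" "V \<union> slit a = UNIV"
  shows "continuous_on UNIV w"
  using assms(1)
proof (induction rule: cut.induct)
  case (cut_product \<phi> g)
  have "continuous_on (V \<union> slit a) (\<lambda>z. smul (of_real (\<phi> z)) (g z))"
  proof (rule continuous_on_open_Un[OF V(1) open_slit])
    show "continuous_on V (\<lambda>z. smul (of_real (\<phi> z)) (g z))"
      by (rule continuous_on_eq[OF continuous_on_const[of _ 0]]) (simp add: cut_product)
    show "continuous_on (slit a) (\<lambda>z. smul (of_real (\<phi> z)) (g z))"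
      by (intro continuous_on_scale_lc continuous_intros smf_continuous holomorphic_space_continuous cut_product)
  qed
  then show ?case by (simp add: V)
qed (rule continuous_on_add_lc)

text \<open>The product rule gives two products of the same kind, one with the derivative of the
  real factor and one with that of the holomorphic factor; this is why the class is closed under
  sums. On \<open>V\<close> the function is locally 0, so the singularities of \<open>g\<close> are
  invisible.\<close>

lemma cut_deriv:
  assumes "cut a V w" and V: "open V" "V \<union> slit a = UNIV" and v: "v = 1 \<or> v = \<i>"
  shows "\<exists>w'. cut a V w' \<and> (\<forall>z. (diff_quotient smul v w z \<longlongrightarrow> w' z) (at 0))"
  using assms(1)
proof (induction rule: cut.induct)
  case (cut_product \<phi> g)
  obtain f1 f2 where f: "smf f1" "smf f2" "\<And>z. (\<phi> has_derivative (\<lambda>h. f1 z * Re h + f2 z * Im h)) (at z)"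
    using smf_partial[OF cut_product(1)] by blast
  define d where "d z = (if v = 1 then f1 z else f2 z)" for z
  have "smf d" unfolding d_def using f by (cases "v = 1") simp_all
  moreover have "d z = 0" if "z \<in> V" for z
    using smf_local_zero[OF V(1) cut_product(2) f(3) that] by (simp add: d_def)
  ultimately have d: "smf d" "\<And>z. z \<in> V ==> d z = 0" by auto
  define w' where "w' z = smul (of_real (d z)) (g z) + smul (of_real (\<phi> z)) (smul v (vderiv (slit a) g z))" for z
  have "cut a V w'"
    unfolding w'_def[abs_def]
    by (intro cut.intros d cut_product holomorphic_space_scale vderiv_holomorphic open_slit)
  moreover have "(diff_quotient smul v (\<lambda>z. smul (of_real (\<phi> z)) (g z)) z \<longlongrightarrow> w' z) (at 0)" for z
  proof (cases "z \<in> V")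
    case True
    have "(diff_quotient smul v (\<lambda>z. 0) z \<longlongrightarrow> 0) (at 0)" by (simp add: diff_quotient_def[abs_def])
    then have "(diff_quotient smul v (\<lambda>z. smul (of_real (\<phi> z)) (g z)) z \<longlongrightarrow> 0) (at 0)"
      by (rule diff_quotient_cong[OF V(1) True, rotated]) (simp add: cut_product(2))
    moreover have "w' z = 0" using True by (simp add: w'_def d cut_product(2))
    ultimately show ?thesis by simp
  next
    case False
    then have "z \<in> slit a" using V(2) by blast
    from diff_quotient_product[OF f(3) v cut_product(3) open_slit this]
    show ?thesis by (simp add: w'_def d_def)
  qed
  ultimately show ?case by blast
next
  case (cut_add w1 w2)
  then obtain w1' w2' where "cut a V w1'" "cut a V w2'" "\<And>z. (diff_quotient smul v w1 z \<longlongrightarrow> w1' z) (at 0)"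
    "\<And>z. (diff_quotient smul v w2 z \<longlongrightarrow> w2' z) (at 0)" by blast
  then show ?case
    by (intro exI[of _ "\<lambda>z. w1' z + w2' z"] conjI allI cut.cut_add diff_quotient_add)
qed

lemma cut_pderivative:
  assumes "cut a V w" "open V" "V \<union> slit a = UNIV" "v = 1 \<or> v = \<i>"
  shows "cut a V (pderivative smul v w)" and "(diff_quotient smul v w z \<longlongrightarrow> pderivative smul v w z) (at 0)"
proof -
  obtain w' where w': "cut a V w'" "\<And>z. (diff_quotient smul v w z \<longlongrightarrow> w' z) (at 0)"
    using cut_deriv[OF assms] by blast
  have "pderivative smul v w = w'" by (rule ext) (simp add: pderivative_def tendsto_Lim[OF _ w'(2)])
  with w' show "cut a V (pderivative smul v w)" "(diff_quotient smul v w z \<longlongrightarrow> pderivative smul v w z) (at 0)" by simp_all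
qed

lemma cut_C_on:
  assumes "cut a V w" and V: "open V" "V \<union> slit a = UNIV"
  shows "C_on smul k UNIV w"
  using assms(1)
proof (induction k arbitrary: w)
  case 0
  then show ?case by (simp add: cut_continuous V)
next
  case (Suc k)
  show ?case
    unfolding C_on.simps
  proof (intro ballI conjI)
    fix v :: complex assume "v \<in> {1, \<i>}"
    then have v: "v = 1 \<or> v = \<i>" by simp
    show "\<exists>l. (diff_quotient smul v w z \<longlongrightarrow> l) (at 0)" for z
      by (rule exI) (rule cut_pderivative(2)[OF Suc.prems V v])
    show "C_on smul k UNIV (pderivative smul v w)" by (rule Suc.IH[OF cut_pderivative(1)[OF Suc.prems V v]])
  qed
qed

lemma cut_mixed_pderivative:
  assumes "cut a V w" and V: "open V" "V \<union> slit a = UNIV"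
  shows "cut a V (mixed_pderivative smul \<beta> w)"
proof -
  have *: "cut a V ((pderivative smul v ^^ n) u)" if u: "cut a V u" and v: "v = 1 \<or> v = \<i>" for u v n
    by (induction n) (simp_all add: u cut_pderivative(1)[OF _ V v])
  show ?thesis unfolding mixed_pderivative_def by (intro * assms(1)) auto
qed

text \<open>All derivatives vanish on the outer region, and the rest of each
  \<open>Sn n {\<infinity>}\<close> is bounded. Continuity on a compact disc therefore already
  yields the weighted bounds, however fast the holomorphic factors grow.\<close>

lemma cut_Eexp:
  assumes w: "cut a V w" and V: "open V" "V \<union> slit a = UNIV" and outer: "outer_region a \<subseteq> V"
  shows "w \<in> Eexp smul p {\<infinity>}"
  unfolding Eexp_def
proof (intro CollectI conjI allI impI)
  show "w \<in> smooth_space smul (- cset {\<infinity>})"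
    by (simp add: smooth_space_def cut_C_on[OF w V])
  fix n m :: nat and \<alpha> assume n: "1 \<le> n"
  define R where "R = \<bar>a\<bar> + real n + 2"
  have "\<exists>B\<ge>0. \<forall>z\<in>cball 0 R. p \<alpha> (mixed_pderivative smul \<beta> w z) \<le> B" for \<beta>
    using compact_p_bounded[OF compact_cball[of 0 R] continuous_on_subset[OF cut_continuous[OF cut_mixed_pderivative[OF w V] V] subset_UNIV], of \<alpha> \<beta>]
    by metis
  then obtain B where B: "\<And>\<beta>. 0 \<le> B \<beta>" "\<And>\<beta> z. z \<in> cball 0 R ==> p \<alpha> (mixed_pderivative smul \<beta> w z) \<le> B \<beta>" by metis
  \<comment> \<open>Only finitely many multi-indices have order at most \<open>m\<close>, so the sum
    of their bounds is a common bound.\<close>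
  define M where "M = {\<beta> :: nat \<times> nat. fst \<beta> + snd \<beta> \<le> m}"
  have "M \<subseteq> {..m} \<times> {..m}" by (auto simp: M_def)
  then have fin: "finite M" by (rule finite_subset) simp
  show "bdd_above {p \<alpha> (mixed_pderivative smul \<beta> w z) * exp (- (1 / real n) * \<bar>Re z\<bar>) |z \<beta>.
      z \<in> Sn n {\<infinity>} \<and> fst \<beta> + snd \<beta> \<le> m}"
  proof (rule bdd_aboveI, clarify)
    fix z \<beta> assume z: "z \<in> Sn n {\<infinity>}" and \<beta>: "fst \<beta> + snd \<beta> \<le> m"
    have "p \<alpha> (mixed_pderivative smul \<beta> w z) \<le> B \<beta>"
    proof (cases "z \<in> outer_region a")
      case True
      then have "mixed_pderivative smul \<beta> w z = 0" using cut_zero[OF cut_mixed_pderivative[OF w V]] outer by blast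
      then show ?thesis by (simp add: p_zero B)
    next
      case False
      then show ?thesis using inner_region_bound[OF z False n] by (intro B) (simp add: R_def)
    qed
    also have "B \<beta> \<le> sum B M" by (rule member_le_sum) (use \<beta> fin B(1) in \<open>auto simp: M_def\<close>)
    finally show "p \<alpha> (mixed_pderivative smul \<beta> w z) * exp (- (1 / real n) * \<bar>Re z\<bar>) \<le> sum B M"
      by (rule exp_weight_le[OF p_nonneg])
  qed
qed

text \<open>Functionals reduce the differentiability to the scalar case, and continuity provides
  local boundedness. It is applied to the tempered representative off the half-line and to the
  solution \<open>u\<close> near it.\<close>

lemma Cauchy_Riemann_holomorphic_space:
  assumes "open \<Omega>" and zero: "\<And>z. z \<notin> \<Omega> ==> f z = 0" and f: "continuous_on \<Omega> f"
    and lim: "\<And>v z. v = 1 \<or> v = \<i> ==> z \<in> \<Omega> ==> (diff_quotient smul v f z \<longlongrightarrow> D v z) (at 0)"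
    and cont: "continuous_on \<Omega> (D \<i>)"
    and CR: "\<And>z. z \<in> \<Omega> ==> D 1 z + smul \<i> (D \<i> z) = 0"
  shows "f \<in> holomorphic_space smul \<Omega>"
proof (rule holomorphic_spaceI[OF \<open>open \<Omega>\<close> zero])
  fix e' assume e: "e' \<in> cdual smul"
  show "(\<lambda>z. e' (f z)) holomorphic_on \<Omega>"
  proof (rule Cauchy_Riemann_holomorphic[OF \<open>open \<Omega>\<close>])
    fix v z :: complex assume vz: "v = 1 \<or> v = \<i>" "z \<in> \<Omega>"
    have "((\<lambda>h. e' (diff_quotient smul v f z h)) \<longlongrightarrow> e' (D v z)) (at 0)"
      by (rule cdual_tendsto[OF e lim[OF vz]])
    then show "((\<lambda>h. of_real (inverse h) * (e' (f (z + of_real h * v)) - e' (f z))) \<longlongrightarrow> e' (D v z)) (at 0)"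
      by (simp only: diff_quotient_def cdual_scale[OF e] cdual_diff[OF e])
  next
    show "continuous_on \<Omega> (\<lambda>z. e' (D \<i> z))" using cont cdual_tendsto[OF e] unfolding continuous_on_def by blast
    fix z assume "z \<in> \<Omega>"
    then have "e' (D 1 z + smul \<i> (D \<i> z)) = 0" by (simp only: CR cdual_zero[OF e])
    then show "e' (D 1 z) + \<i> * e' (D \<i> z) = 0" by (simp only: cdual_add[OF e] cdual_scale[OF e])
  qed
next
  fix z \<alpha> assume "z \<in> \<Omega>"
  then obtain r where r: "0 < r" "cball z r \<subseteq> \<Omega>" using \<open>open \<Omega>\<close> open_contains_cball by blast
  obtain B where "\<And>w. w \<in> cball z r ==> p \<alpha> (f w) \<le> B"
    by (rule compact_p_bounded[OF compact_cball continuous_on_subset[OF f r(2)]]) (rule that)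
  with r show "\<exists>B. \<exists>r>0. cball z r \<subseteq> \<Omega> \<and> (\<forall>w\<in>cball z r. p \<alpha> (f w) \<le> B)"
    by (intro exI[of _ B] exI[of _ r]) simp
qed

text \<open>The cut-off function \<open>\<kappa>\<close> is constant near the half-line, so \<open>dbar (\<kappa> f)\<close> is smooth on the plane;
  subtracting a tempered solution \<open>u\<close> of \<open>dbar u = dbar (\<kappa> f)\<close> yields the tempered representative \<open>\<kappa>f - u\<close>.\<close>

lemma tempered_representative:
  assumes adm: "admissible smul p" and f: "f \<in> holomorphic_space smul (slit a)"
  obtains G h where "G \<in> Oexp smul p {ereal a..}" "h \<in> holomorphic_space smul UNIV" "\<And>z. z \<in> slit a ==> f z - G z = h z"
proof -
  define \<kappa> where "\<kappa> = cutoff a"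
  obtain f1 f2 where d: "smf f1" "smf f2" "\<And>z. (\<kappa> has_derivative (\<lambda>h. f1 z * Re h + f2 z * Im h)) (at z)"
    using smf_partial[OF smf_cutoff] unfolding \<kappa>_def by blast
  define V where "V = inner_nbhd a \<union> outer_region a"
  have V: "open V" "V \<union> slit a = UNIV" "outer_region a \<subseteq> V"
    using open_regions slit_inner by (auto simp: V_def)
  have d0: "f1 z = 0" "f2 z = 0" if "z \<in> V" for z
  proof -
    have "f1 z = 0 \<and> f2 z = 0"
    proof (cases "z \<in> inner_nbhd a")
      case True
      then show ?thesis
        using smf_local_zero[OF open_regions(1) _ d(3) True, where c = 1] cutoff_inner by (auto simp: \<kappa>_def)
    next
      case False
      then have z: "z \<in> outer_region a" using that by (simp add: V_def)
      then show ?thesis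
        using smf_local_zero[OF open_regions(2) _ d(3) z, where c = 0] cutoff_outer by (auto simp: \<kappa>_def)
    qed
    then show "f1 z = 0" "f2 z = 0" by auto
  qed
  \<comment> \<open>This is \<open>dbar (\<kappa> f)\<close>: as \<open>f\<close> is holomorphic,
    only the derivatives of \<kappa> contribute. Writing it as two products with real factors puts
    it into the class \<open>cut\<close>.\<close>
  define w where "w z = smul (of_real (f1 z)) (smul (1 / 2) (f z)) + smul (of_real (f2 z)) (smul (\<i> / 2) (f z))" for z
  have w: "cut a V w" unfolding w_def[abs_def] by (intro cut.intros d d0 holomorphic_space_scale f)
  \<comment> \<open>For this compact set \<open>cset\<close> is empty, so the equation is solved on
    the whole plane, with control off the strip at infinity.\<close>
  have "compact {\<infinity> :: ereal}" by simp
  then have "\<exists>u\<in>Eexp smul p {\<infinity>}. \<forall>z \<in> - cset {\<infinity>}. dbar smul u z = w z"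
    using adm[unfolded admissible_def, rule_format, of "{\<infinity>}"] cut_Eexp[OF w V] by blast
  then obtain u where u: "u \<in> Eexp smul p {\<infinity>}" "\<And>z. dbar smul u z = w z" by auto
  have C: "C_on smul k UNIV u" for k using u(1) by (simp add: Eexp_def smooth_space_def)
  have u_cont: "continuous_on UNIV u" using C[of 0] by simp
  have u_lim: "(diff_quotient smul v u z \<longlongrightarrow> pderivative smul v u z) (at 0)"
    and u_pd: "continuous_on UNIV (pderivative smul v u)" if "v = 1 \<or> v = \<i>" for v z
  proof -
    have "\<exists>l. (diff_quotient smul v u z \<longlongrightarrow> l) (at 0)" using C[of 1] that by auto
    then show "(diff_quotient smul v u z \<longlongrightarrow> pderivative smul v u z) (at 0)"
      unfolding pderivative_def by (auto simp: tendsto_Lim)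
    show "continuous_on UNIV (pderivative smul v u)" using C[of 1] that by auto
  qed
  define G where "G z = (if z \<in> slit a then smul (of_real (\<kappa> z)) (f z) - u z else 0)" for z
  define D where "D v z = smul (of_real (if v = 1 then f1 z else f2 z)) (f z) + smul (of_real (\<kappa> z)) (smul v (vderiv (slit a) f z))
     - pderivative smul v u z" for v z
  have G: "G \<in> holomorphic_space smul (slit a)"
  proof (rule Cauchy_Riemann_holomorphic_space[where D = D])
    show "G z = 0" if "z \<notin> slit a" for z using that by (simp add: G_def)
    have "continuous_on (slit a) (\<lambda>z. smul (of_real (\<kappa> z)) (f z) - u z)"
      unfolding \<kappa>_def
      by (intro continuous_on_diff_lc continuous_on_scale_lc continuous_intros smf_continuous smf_cutoff holomorphic_space_continuous[OF f]
            continuous_on_subset[OF u_cont]) simp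
    then show "continuous_on (slit a) G" by (rule continuous_on_eq) (simp add: G_def)
    show "(diff_quotient smul v G z \<longlongrightarrow> D v z) (at 0)" if v: "v = 1 \<or> v = \<i>" and z: "z \<in> slit a" for v z
    proof (rule diff_quotient_cong[OF open_slit z])
      show "G w = smul (of_real (\<kappa> w)) (f w) - u w" if "w \<in> slit a" for w using that by (simp add: G_def)
      show "(diff_quotient smul v (\<lambda>w. smul (of_real (\<kappa> w)) (f w) - u w) z \<longlongrightarrow> D v z) (at 0)"
        unfolding D_def by (rule diff_quotient_diff[OF diff_quotient_product[OF d(3) v f open_slit z] u_lim[OF v]])
    qed
    show "continuous_on (slit a) (D \<i>)"
      unfolding D_def \<kappa>_def
      by (intro continuous_on_diff_lc continuous_on_add_lc continuous_on_scale_lc continuous_intros) 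
         (auto intro!: smf_continuous smf_cutoff d holomorphic_space_continuous[OF f] 
            holomorphic_space_continuous[OF vderiv_holomorphic[OF f]] continuous_on_subset[OF u_pd])
    show "D 1 z + smul \<i> (D \<i> z) = 0" for z
    proof (rule cdual_eqI)
      fix e' assume e: "e' \<in> cdual smul"
      have half: "b1 + \<i> * b2 = x1 * y + \<i> * (x2 * y)"
        if "1 / 2 * (b1 + \<i> * b2) = x1 * (1 / 2 * y) + x2 * (\<i> / 2 * y)" for b1 b2 x1 x2 y :: complex
      proof -
        have "b1 + \<i> * b2 = 2 * (1 / 2 * (b1 + \<i> * b2))" by simp
        also have "\<dots> = x1 * y + \<i> * (x2 * y)" unfolding that by (simp add: algebra_simps)
        finally show ?thesis .
      qed
      have "e' (dbar smul u z) = e' (w z)" by (simp only: u(2))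
      then have du: "e' (pderivative smul 1 u z) + \<i> * e' (pderivative smul \<i> u z) = of_real (f1 z) * e' (f z) + \<i> * (of_real (f2 z) * e' (f z))"
        unfolding dbar_def w_def cdual_add[OF e] cdual_scale[OF e] by (rule half)
      have key: "x * y + c * (1 * y') - q1 + \<i> * (x2 * y + c * (\<i> * y') - q2) = (x * y + \<i> * (x2 * y)) - (q1 + \<i> * q2)" for x y c y' q1 x2 q2 :: complex
        by (simp add: algebra_simps)
      have "e' (D 1 z + smul \<i> (D \<i> z)) = of_real (f1 z) * e' (f z) + of_real (\<kappa> z) * (1 * e' (vderiv (slit a) f z)) - e' (pderivative smul 1 u z)
          + \<i> * (of_real (f2 z) * e' (f z) + of_real (\<kappa> z) * (\<i> * e' (vderiv (slit a) f z)) - e' (pderivative smul \<i> u z))"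
        by (simp add: D_def cdual_add[OF e] cdual_scale[OF e] cdual_diff[OF e] mult.assoc)
      also have "\<dots> = 0" unfolding key du by simp
      finally show "e' (D 1 z + smul \<i> (D \<i> z)) = e' 0" by (simp only: cdual_zero[OF e])
    qed
  qed simp
  \<comment> \<open>Off the half-line this is \<open>(1 - \<kappa>) f + u\<close>. Near the
    half-line \<kappa> is 1, so \<open>h\<close> coincides with \<open>u\<close>, which is
    holomorphic there because the right-hand side of its equation vanishes.\<close>
  define h where "h z = (if z \<in> slit a then f z - G z else u z)" for z
  have h: "h \<in> holomorphic_space smul UNIV"
  proof (rule holomorphic_space_localI)
    fix z
    show "\<exists>\<Omega>' f'. open \<Omega>' \<and> z \<in> \<Omega>' \<and> f' \<in> holomorphic_space smul \<Omega>' \<and> (\<forall>w\<in>\<Omega>'. h w = f' w)"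
    proof (cases "z \<in> slit a")
      case True
      show ?thesis
        by (intro exI[of _ "slit a"] exI[of _ "\<lambda>z. f z - G z"] conjI open_slit True holomorphic_space_diff f G) (simp add: h_def)
    next
      case False
      define u' where "u' z = (if z \<in> inner_nbhd a then u z else 0)" for z
      have u': "u' \<in> holomorphic_space smul (inner_nbhd a)"
      proof (rule Cauchy_Riemann_holomorphic_space[where D = "\<lambda>v. pderivative smul v u", OF open_regions(1)])
        show "u' z = 0" if "z \<notin> inner_nbhd a" for z using that by (simp add: u'_def)
        show "continuous_on (inner_nbhd a) u'"
          by (rule continuous_on_eq[OF continuous_on_subset[OF u_cont subset_UNIV]]) (simp add: u'_def)
        show "(diff_quotient smul v u' z \<longlongrightarrow> pderivative smul v u z) (at 0)" if v: "v = 1 \<or> v = \<i>" and z: "z \<in> inner_nbhd a" for v z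
          by (rule diff_quotient_cong[OF open_regions(1) z _ u_lim[OF v]]) (simp add: u'_def)
        show "continuous_on (inner_nbhd a) (pderivative smul \<i> u)" by (rule continuous_on_subset[OF u_pd]) auto
        fix z assume "z \<in> inner_nbhd a"
        then have "dbar smul u z = 0" using cut_zero[OF w] by (simp add: u V_def)
        then show "pderivative smul 1 u z + smul \<i> (pderivative smul \<i> u z) = 0"
          by (simp add: dbar_def)
      qed
      show ?thesis
      proof (intro exI conjI ballI)
        show "open (inner_nbhd a)" by (rule open_regions)
        show "z \<in> inner_nbhd a" by (rule slit_inner[OF False])
        show "u' \<in> holomorphic_space smul (inner_nbhd a)" by (rule u')
        show "h y = u' y" if "y \<in> inner_nbhd a" for y
          using that by (simp add: h_def u'_def G_def \<kappa>_def cutoff_inner)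
      qed
    qed
  qed simp
  have G': "G \<in> Oexp smul p {ereal a..}"
    unfolding Oexp_def slit_cset
  proof (intro CollectI conjI G allI impI)
    fix n :: nat and \<alpha> assume n: "1 \<le> n"
    have "bdd_above {p \<alpha> (mixed_pderivative smul \<beta> u z) * exp (- (1 / real n) * \<bar>Re z\<bar>) |z \<beta>. z \<in> Sn n {\<infinity>} \<and> fst \<beta> + snd \<beta> \<le> 0}"
      by (rule u(1)[unfolded Eexp_def mem_Collect_eq, THEN conjunct2, rule_format, OF n])
    then obtain M where M: "\<And>y. y \<in> {p \<alpha> (mixed_pderivative smul \<beta> u z) * exp (- (1 / real n) * \<bar>Re z\<bar>) |z \<beta>. z \<in> Sn n {\<infinity>} \<and> fst \<beta> + snd \<beta> \<le> 0} ==> y \<le> M"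
      unfolding bdd_above_def by blast
    have uM: "p \<alpha> (u z) * exp (- (1 / real n) * \<bar>Re z\<bar>) \<le> M" if "z \<in> Sn n {\<infinity>}" for z
      by (rule M) (use that in \<open>auto simp: mixed_pderivative_def intro!: exI[of _ z] exI[of _ "(0, 0)"]\<close>)
    \<comment> \<open>The bounded region where \<kappa> \<open>f\<close> has to be estimated.
      Removing the open tube keeps it compact and away from the half-line, where \<open>f\<close>
      may be singular.\<close>
    define Q where "Q = cball 0 (\<bar>a\<bar> + real n + 2) - tube a (1 / real n)"
    have Q: "compact Q" unfolding Q_def by (intro compact_diff compact_cball open_tube)
    have "Q \<subseteq> slit a"
    proof
      fix z assume "z \<in> Q"
      then have "z \<notin> tube a (1 / real n)" by (simp add: Q_def)
      moreover have "of_real x \<in> tube a (1 / real n)" if "a \<le> x" for x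
        using that n by (auto simp: tube_def intro!: exI[of _ x])
      ultimately show "z \<in> slit a" unfolding slit_def by blast
    qed
    then have "continuous_on Q (\<lambda>z. smul (of_real (\<kappa> z)) (f z))"
      unfolding \<kappa>_def
      by (intro continuous_on_scale_lc continuous_intros smf_continuous smf_cutoff continuous_on_subset[OF holomorphic_space_continuous[OF f]])
    then obtain B where B: "0 \<le> B" "\<And>z. z \<in> Q ==> p \<alpha> (smul (of_real (\<kappa> z)) (f z)) \<le> B"
      by (rule compact_p_bounded[OF Q]) (rule that)
    show "bdd_above ((\<lambda>z. p \<alpha> (G z) * exp (- (1 / real n) * \<bar>Re z\<bar>)) ` Sn n {ereal a..})"
    proof (rule bdd_aboveI2)
      fix z assume "z \<in> Sn n {ereal a..}"
      then have z: "z \<in> Sn n {\<infinity>}" "z \<notin> tube a (1 / real n)" using Sn_half_subset by auto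
      have "p \<alpha> (smul (of_real (\<kappa> z)) (f z)) \<le> B"
      proof (cases "z \<in> outer_region a")
        case True
        then show ?thesis using B(1) by (simp add: \<kappa>_def cutoff_outer p_zero)
      next
        case False
        then show ?thesis using inner_region_bound[OF z(1) False n] z(2) by (intro B(2)) (simp add: Q_def)
      qed
      then have "p \<alpha> (smul (of_real (\<kappa> z)) (f z)) * exp (- (1 / real n) * \<bar>Re z\<bar>) \<le> B" by (rule exp_weight_le[OF p_nonneg])
      moreover have "p \<alpha> (G z) \<le> p \<alpha> (smul (of_real (\<kappa> z)) (f z)) + p \<alpha> (u z)"
        by (simp add: G_def p_diff_le p_zero add_nonneg_nonneg)
      then have "p \<alpha> (G z) * exp (- (1 / real n) * \<bar>Re z\<bar>)
          \<le> p \<alpha> (smul (of_real (\<kappa> z)) (f z)) * exp (- (1 / real n) * \<bar>Re z\<bar>) + p \<alpha> (u z) * exp (- (1 / real n) * \<bar>Re z\<bar>)"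
        unfolding distrib_right[symmetric] by (rule mult_right_mono) simp
      ultimately show "p \<alpha> (G z) * exp (- (1 / real n) * \<bar>Re z\<bar>) \<le> B + M" using uM[OF z(1)] by linarith
    qed
  qed
  show thesis by (rule that[OF G' h]) (simp add: h_def)
qed

end

section \<open>Weighted spaces of holomorphic functions\<close>

context seq_complete_lcHs
begin

text \<open>The common shape of \<open>Oexp\<close> and of all four cases of \<open>FO\<close>, so
  that the linear structure and the reflection are treated once.\<close>

definition weighted :: "complex set => (nat => complex set) => (nat => complex => real) => (complex => 'a) set" where
  "weighted \<Omega> S W = {f \<in> holomorphic_space smul \<Omega>. \<forall>n\<ge>1. \<forall>\<alpha>. \<exists>C. \<forall>z\<in>S n. p \<alpha> (f z) \<le> C * exp (W n z)}"

lemma weightedI: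
  "f \<in> holomorphic_space smul \<Omega> ==> (\<And>n \<alpha>. 1 \<le> n ==> \<exists>C. \<forall>z\<in>S n. p \<alpha> (f z) \<le> C * exp (W n z)) ==> f \<in> weighted \<Omega> S W"
  by (simp add: weighted_def)

lemma weighted_holomorphic: "f \<in> weighted \<Omega> S W ==> f \<in> holomorphic_space smul \<Omega>"
  by (simp add: weighted_def)

lemma weightedE:
  assumes "f \<in> weighted \<Omega> S W" "1 \<le> n"
  obtains C where "0 \<le> C" "\<And>z. z \<in> S n ==> p \<alpha> (f z) \<le> C * exp (W n z)"
proof -
  obtain C where C: "\<And>z. z \<in> S n ==> p \<alpha> (f z) \<le> C * exp (W n z)" using assms unfolding weighted_def by blast
  have "C * exp (W n z) \<le> max C 0 * exp (W n z)" for z by (rule mult_right_mono) auto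
  then show thesis by (intro that[of "max C 0"] order_trans[OF C]) simp_all
qed

lemma weighted_zero: "(\<lambda>z. 0) \<in> weighted \<Omega> S W"
proof (rule weightedI)
  show "(\<lambda>z. 0) \<in> holomorphic_space smul \<Omega>" by (auto simp: holomorphic_space_def)
  show "\<exists>C. \<forall>z\<in>S n. p \<alpha> 0 \<le> C * exp (W n z)" for n \<alpha> by (rule exI[of _ 0]) simp
qed

lemma weighted_add:
  assumes f: "f \<in> weighted \<Omega> S W" and g: "g \<in> weighted \<Omega> S W"
  shows "(\<lambda>z. f z + g z) \<in> weighted \<Omega> S W"
proof (rule weightedI)
  show "(\<lambda>z. f z + g z) \<in> holomorphic_space smul \<Omega>" by (intro holomorphic_space_add weighted_holomorphic[OF f] weighted_holomorphic[OF g])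
  fix n :: nat and \<alpha> assume n: "1 \<le> n"
  obtain C where C: "\<And>z. z \<in> S n ==> p \<alpha> (f z) \<le> C * exp (W n z)" by (rule weightedE[OF f n]) (rule that)
  obtain D where D: "\<And>z. z \<in> S n ==> p \<alpha> (g z) \<le> D * exp (W n z)" by (rule weightedE[OF g n]) (rule that)
  have "p \<alpha> (f z + g z) \<le> (C + D) * exp (W n z)" if z: "z \<in> S n" for z
    unfolding distrib_right by (rule order_trans[OF seminorm_add add_mono[OF C[OF z] D[OF z]]])
  then show "\<exists>C. \<forall>z\<in>S n. p \<alpha> (f z + g z) \<le> C * exp (W n z)" by (intro exI[of _ "C + D"]) simp
qed

lemma weighted_scale:
  assumes f: "f \<in> weighted \<Omega> S W"
  shows "(\<lambda>z. smul c (f z)) \<in> weighted \<Omega> S W"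
proof (rule weightedI)
  show "(\<lambda>z. smul c (f z)) \<in> holomorphic_space smul \<Omega>" by (intro holomorphic_space_scale weighted_holomorphic[OF f])
  fix n :: nat and \<alpha> assume n: "1 \<le> n"
  obtain C where C: "\<And>z. z \<in> S n ==> p \<alpha> (f z) \<le> C * exp (W n z)" by (rule weightedE[OF f n]) (rule that)
  have "p \<alpha> (smul c (f z)) \<le> (cmod c * C) * exp (W n z)" if z: "z \<in> S n" for z
    unfolding seminorm_scale mult.assoc by (rule mult_left_mono[OF C[OF z]]) simp
  then show "\<exists>C. \<forall>z\<in>S n. p \<alpha> (smul c (f z)) \<le> C * exp (W n z)" by (intro exI[of _ "cmod c * C"]) simp
qed

lemma weighted_diff:
  assumes f: "f \<in> weighted \<Omega> S W" and g: "g \<in> weighted \<Omega> S W"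
  shows "(\<lambda>z. f z - g z) \<in> weighted \<Omega> S W"
  using weighted_add[OF f weighted_scale[OF g, of "-1"]] by (simp add: scale_minus_left)

lemma holomorphic_space_reflect:
  assumes f: "f \<in> holomorphic_space smul \<Omega>" and \<Omega>: "\<And>z. z \<in> \<Omega>' \<longleftrightarrow> - z \<in> \<Omega>"
  shows "(\<lambda>z. f (- z)) \<in> holomorphic_space smul \<Omega>'"
  unfolding holomorphic_space_def
proof (intro CollectI conjI ballI allI impI)
  fix z assume "z \<in> \<Omega>'"
  then obtain l where l: "((\<lambda>w. smul (inverse (w - - z)) (f w - f (- z))) \<longlongrightarrow> l) (at (- z))"
    using holomorphic_spaceD[OF f] \<Omega> by blast
  have "filterlim (\<lambda>w. - w) (at (- z)) (at z)"
    unfolding filterlim_at by (auto simp: eventually_at_filter intro!: tendsto_intros)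
  from tendsto_minus_lc[OF filterlim_compose[OF l this]]
  have "((\<lambda>w. - smul (inverse (- w - - z)) (f (- w) - f (- z))) \<longlongrightarrow> - l) (at z)" .
  moreover have "- smul (inverse (- w - - z)) x = smul (inverse (w - z)) x" for w x
  proof -
    have "inverse (- w - - z) = - inverse (w - z)" by (simp flip: inverse_minus_eq)
    then show ?thesis by (simp only: scale_minus_left minus_minus)
  qed
  ultimately show "\<exists>l. ((\<lambda>w. smul (inverse (w - z)) (f (- w) - f (- z))) \<longlongrightarrow> l) (at z)" by auto
next
  fix z assume "z \<notin> \<Omega>'"
  then show "f (- z) = 0" using \<Omega> holomorphic_space_zero[OF f] by blast
qed

lemma weighted_reflect:
  assumes f: "f \<in> weighted \<Omega> S W" and \<Omega>: "\<And>z. z \<in> \<Omega>' \<longleftrightarrow> - z \<in> \<Omega>"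
    and S: "\<And>n z. z \<in> S' n ==> - z \<in> S n" and W: "\<And>n z. W n (- z) = W' n z"
  shows "(\<lambda>z. f (- z)) \<in> weighted \<Omega>' S' W'"
proof (rule weightedI)
  show "(\<lambda>z. f (- z)) \<in> holomorphic_space smul \<Omega>'" by (rule holomorphic_space_reflect[OF weighted_holomorphic[OF f] \<Omega>])
  fix n :: nat and \<alpha> assume n: "1 \<le> n"
  obtain C where C: "\<And>z. z \<in> S n ==> p \<alpha> (f z) \<le> C * exp (W n z)" by (rule weightedE[OF f n]) (rule that)
  have "p \<alpha> (f (- z)) \<le> C * exp (W' n z)" if "z \<in> S' n" for z
    using C[OF S[OF that]] by (simp only: W)
  then show "\<exists>C. \<forall>z\<in>S' n. p \<alpha> (f (- z)) \<le> C * exp (W' n z)" by blast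
qed

lemma bdd_above_weight:
  assumes "\<And>z. e z = - w z"
  shows "bdd_above ((\<lambda>z. (g z :: real) * exp (e z)) ` S) \<longleftrightarrow> (\<exists>C. \<forall>z\<in>S. g z \<le> C * exp (w z))"
proof -
  have "g z * exp (e z) \<le> C \<longleftrightarrow> g z \<le> C * exp (w z)" for z C
    by (simp add: assms exp_minus field_simps)
  then show ?thesis by (auto simp: bdd_above_def)
qed

section \<open>The spaces of the theorem as weighted spaces\<close>

lemma Oexp_weighted: "Oexp smul p K = weighted (- cset K) (\<lambda>n. Sn n K) (\<lambda>n z. \<bar>Re z\<bar> / real n)"
proof -
  have *: "bdd_above ((\<lambda>z. p \<alpha> (f z) * exp (- (1 / real n) * \<bar>Re z\<bar>)) ` S) \<longleftrightarrow> (\<exists>C. \<forall>z\<in>S. p \<alpha> (f z) \<le> C * exp (\<bar>Re z\<bar> / real n))"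
    for f :: "complex => 'a" and n \<alpha> S by (rule bdd_above_weight) simp
  show ?thesis by (simp only: Oexp_def weighted_def *)
qed

lemma FO_right:
  assumes "\<infinity> \<in> K" "\<And>k. (if Inf K = \<infinity> then real k else real_of_ereal (Inf K)) = b k"
  shows "FO smul p K = weighted {z. Im z < 0} (\<lambda>k. {z. Im z \<le> - (1 / real k)}) (\<lambda>k z. cmod z / real k - b k * \<bar>Im z\<bar>)"
proof -
  have *: "bdd_above ((\<lambda>z. p \<alpha> (f z) * exp (- (1 / real k) * cmod z + b k * \<bar>Im z\<bar>)) ` S)
      \<longleftrightarrow> (\<exists>C. \<forall>z\<in>S. p \<alpha> (f z) \<le> C * exp (cmod z / real k - b k * \<bar>Im z\<bar>))"
    for f :: "complex => 'a" and k \<alpha> S by (rule bdd_above_weight) simp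
  show ?thesis by (simp only: FO_def weighted_def halfplane_def Let_def assms if_True *)
qed

lemma FO_left:
  assumes "\<infinity> \<notin> K" "\<And>k. (if Sup K = - \<infinity> then - real k else real_of_ereal (Sup K)) = b k"
  shows "FO smul p K = weighted {z. 0 < Im z} (\<lambda>k. {z. 1 / real k \<le> Im z}) (\<lambda>k z. cmod z / real k + b k * \<bar>Im z\<bar>)"
proof -
  have *: "bdd_above ((\<lambda>z. p \<alpha> (f z) * exp (- (1 / real k) * cmod z - b k * \<bar>Im z\<bar>)) ` S)
      \<longleftrightarrow> (\<exists>C. \<forall>z\<in>S. p \<alpha> (f z) \<le> C * exp (cmod z / real k + b k * \<bar>Im z\<bar>))"
    for f :: "complex => 'a" and k \<alpha> S by (rule bdd_above_weight) simp
  show ?thesis by (simp only: FO_def weighted_def halfplane_def Let_def assms if_False *)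
qed

lemma FO_half:
  "FO smul p {ereal a..} = weighted {z. Im z < 0} (\<lambda>k. {z. Im z \<le> - (1 / real k)}) (\<lambda>k z. cmod z / real k - a * \<bar>Im z\<bar>)"
  by (rule FO_right) (simp_all add: Inf_atLeast)

lemma FO_infinity:
  "FO smul p {\<infinity>} = weighted {z. Im z < 0} (\<lambda>k. {z. Im z \<le> - (1 / real k)}) (\<lambda>k z. cmod z / real k - real k * \<bar>Im z\<bar>)"
  by (rule FO_right) simp_all

lemma FO_half_left:
  "FO smul p {..ereal a} = weighted {z. 0 < Im z} (\<lambda>k. {z. 1 / real k \<le> Im z}) (\<lambda>k z. cmod z / real k + a * \<bar>Im z\<bar>)"
  by (rule FO_left) simp_all

lemma FO_minus_infinity:
  "FO smul p {-\<infinity>} = weighted {z. 0 < Im z} (\<lambda>k. {z. 1 / real k \<le> Im z}) (\<lambda>k z. cmod z / real k + - real k * \<bar>Im z\<bar>)"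
  by (rule FO_left) simp_all

text \<open>The neighbourhood is enclosed in a closed half-strip, which then also contains its
  closure. The bound \<open>a - 1\<close> comes from the radius \<open>1 / m \<le> 1\<close>, and
  \<open>m\<close> is where the strip at infinity begins.\<close>

lemma Sn_half_mem:
  assumes m: "1 \<le> m" and z: "\<bar>Im z\<bar> < real m" "1 / real m < \<bar>Im z\<bar> \<or> Re z < min (a - 1) (real m)"
  shows "z \<in> Sn m {ereal a..}"
proof -
  have U: "Unbhd (1 / real m) {ereal a..} \<subseteq> {z. \<bar>Im z\<bar> \<le> 1 / real m} \<inter> {z. min (a - 1) (real m) \<le> Re z}"
  proof
    fix w assume "w \<in> Unbhd (1 / real m) {ereal a..}"
    then consider x where "a \<le> x" "cmod (w - of_real x) < 1 / real m" | "real m < Re w" "\<bar>Im w\<bar> < 1 / real m"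
      by (auto simp: Unbhd_half tube_def)
    then show "w \<in> {z. \<bar>Im z\<bar> \<le> 1 / real m} \<inter> {z. min (a - 1) (real m) \<le> Re z}"
    proof cases
      case 1
      have "1 / real m \<le> 1" using m by simp
      then show ?thesis
        using 1 abs_Im_le_cmod[of "w - of_real x"] abs_Re_le_cmod[of "w - of_real x"] by (auto simp: min_def)
    qed auto
  qed
  have "closed {z. \<bar>Im z\<bar> \<le> 1 / real m}" "closed {z. min (a - 1) (real m) \<le> Re z}"
    by (intro closed_Collect_le continuous_intros)+
  then have "closure (Unbhd (1 / real m) {ereal a..}) \<subseteq> {z. \<bar>Im z\<bar> \<le> 1 / real m} \<inter> {z. min (a - 1) (real m) \<le> Re z}"
    by (intro closure_minimal[OF U] closed_Int)
  then show ?thesis using z by (auto simp: Sn_def)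
qed

lemma Oexp_Wsp:
  assumes G: "G \<in> Oexp smul p {ereal a..}"
  shows "G \<in> Wsp a"
proof -
  note G' = G[unfolded Oexp_weighted slit_cset]
  have "growth a (\<lambda>z. p \<alpha> (G z))" for \<alpha>
    unfolding growth_def
  proof (intro allI impI)
    fix n :: nat assume n: "1 \<le> n"
    \<comment> \<open>The index \<open>n + 1\<close> is used because \<open>growth\<close> allows
      equality in its bounds on the height, while \<open>Sn n\<close> is bounded by strict
      inequalities and by the complement of a closure.\<close>
    obtain C where C: "0 \<le> C" "\<And>z. z \<in> Sn (n + 1) {ereal a..} ==> p \<alpha> (G z) \<le> C * exp (\<bar>Re z\<bar> / real (n + 1))"
      by (rule weightedE[OF G', of "n + 1" \<alpha>]) (simp, rule that)
    have "p \<alpha> (G z) \<le> C * exp (\<bar>Re z\<bar> / real n)" if z: "1 / real n \<le> \<bar>Im z\<bar>" "\<bar>Im z\<bar> \<le> real n" for z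
    proof -
      have "1 / real (n + 1) < 1 / real n" using n by (intro divide_strict_left_mono) auto
      then have "z \<in> Sn (n + 1) {ereal a..}" using z by (intro Sn_half_mem) auto
      then have "p \<alpha> (G z) \<le> C * exp (\<bar>Re z\<bar> / real (n + 1))" by (rule C(2))
      also have "\<bar>Re z\<bar> / real (n + 1) \<le> \<bar>Re z\<bar> / real n" using n by (intro divide_left_mono) auto
      then have "C * exp (\<bar>Re z\<bar> / real (n + 1)) \<le> C * exp (\<bar>Re z\<bar> / real n)" using C(1) by (intro mult_left_mono) auto
      finally show ?thesis .
    qed
    then show "\<exists>C. \<forall>z. a \<le> Re z --> 1 / real n \<le> \<bar>Im z\<bar> --> \<bar>Im z\<bar> \<le> real n --> p \<alpha> (G z) \<le> C * exp (\<bar>Re z\<bar> / real n)" by blast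
  qed
  then show ?thesis using weighted_holomorphic[OF G'] by (simp add: Wsp_def)
qed

text \<open>What \<open>Sn n {\<infinity>}\<close> contains beyond the corresponding set for the
  half-line, taken with index \<open>n + 1\<close>, is bounded, and there the continuous function
  \<open>h\<close> is bounded. An entire difference of tempered functions is thus tempered.\<close>

lemma Oexp_entire:
  assumes G: "G \<in> Oexp smul p {ereal a..}" and h: "h \<in> holomorphic_space smul UNIV" and eq: "\<And>z. z \<in> slit a ==> G z = h z"
  shows "h \<in> Oexp smul p {\<infinity>}"
  unfolding Oexp_weighted cset_infinite
proof (rule weightedI)
  show "h \<in> holomorphic_space smul (- {})" using h by simp
  note G' = G[unfolded Oexp_weighted slit_cset]
  fix n :: nat and \<alpha> assume n: "1 \<le> n"
  obtain C where C: "0 \<le> C" "\<And>z. z \<in> Sn (n + 1) {ereal a..} ==> p \<alpha> (G z) \<le> C * exp (\<bar>Re z\<bar> / real (n + 1))"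
    by (rule weightedE[OF G', of "n + 1" \<alpha>]) (simp, rule that)
  define R where "R = \<bar>a\<bar> + real n + 3"
  obtain B where B: "0 \<le> B" "\<And>z. z \<in> cball 0 R ==> p \<alpha> (h z) \<le> B"
    by (rule compact_p_bounded[OF compact_cball continuous_on_subset[OF holomorphic_space_continuous[OF h] subset_UNIV]]) (rule that)
  have "p \<alpha> (h z) \<le> (B + C) * exp (\<bar>Re z\<bar> / real n)" if z: "z \<in> Sn n {\<infinity>}" for z
  proof -
    have e1: "1 \<le> exp (\<bar>Re z\<bar> / real n)" by simp
    have im: "\<bar>Im z\<bar> < real n" using z by (simp add: Sn_def)
    have less: "1 / real (n + 1) < 1 / real n" using n by (intro divide_strict_left_mono) auto
    show ?thesis
    proof (cases "1 / real n \<le> \<bar>Im z\<bar> \<or> Re z < min (a - 1) (real n)")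
      case True
      then have zS: "z \<in> Sn (n + 1) {ereal a..}" using im less by (intro Sn_half_mem) auto
      then have "z \<in> slit a" using True n by (auto simp: slit_iff)
      then have "p \<alpha> (h z) \<le> C * exp (\<bar>Re z\<bar> / real (n + 1))" using C(2)[OF zS] eq by simp
      also have "\<bar>Re z\<bar> / real (n + 1) \<le> \<bar>Re z\<bar> / real n" using n by (intro divide_left_mono) auto
      then have "C * exp (\<bar>Re z\<bar> / real (n + 1)) \<le> C * exp (\<bar>Re z\<bar> / real n)" using C(1) by (intro mult_left_mono) auto
      also have "\<dots> \<le> (B + C) * exp (\<bar>Re z\<bar> / real n)" using B(1) by (intro mult_right_mono) auto
      finally show ?thesis .
    next
      case False
      then have "\<bar>Im z\<bar> < 1 / real n" "Re z \<le> real n" "min (a - 1) (real n) \<le> Re z" using Sn_infinity[OF z] by auto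
      moreover have "1 / real n \<le> 1" using n by simp
      ultimately have "z \<in> cball 0 R" using cmod_le[of z] by (auto simp: R_def min_def split: if_splits)
      then have "p \<alpha> (h z) \<le> (B + C) * 1" using B(2) C(1) by (simp add: add_increasing2)
      also have "\<dots> \<le> (B + C) * exp (\<bar>Re z\<bar> / real n)" using B(1) C(1) e1 by (intro mult_left_mono) auto
      finally show ?thesis .
    qed
  qed
  then show "\<exists>C. \<forall>z\<in>Sn n {\<infinity>}. p \<alpha> (h z) \<le> C * exp (\<bar>Re z\<bar> / real n)" by blast
qed

lemma Oexp_empty_bound:
  assumes h: "h \<in> Oexp smul p {}" and n: "1 \<le> (n::nat)"
  shows "\<exists>C. \<forall>z. a \<le> Re z --> \<bar>Im z\<bar> \<le> real n --> p \<alpha> (h z) \<le> C * exp (\<bar>Re z\<bar> / real n)"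
proof -
  note h' = h[unfolded Oexp_weighted]
  obtain C where C: "0 \<le> C" "\<And>z. z \<in> Sn (n + 1) {} ==> p \<alpha> (h z) \<le> C * exp (\<bar>Re z\<bar> / real (n + 1))"
    by (rule weightedE[OF h', of "n + 1" \<alpha>]) (simp, rule that)
  have "p \<alpha> (h z) \<le> C * exp (\<bar>Re z\<bar> / real n)" if z: "\<bar>Im z\<bar> \<le> real n" for z
  proof -
    \<comment> \<open>The index is raised because \<open>Sn\<close> bounds the height
      strictly.\<close>
    have "z \<in> Sn (n + 1) {}" using z by (simp add: Sn_def Unbhd_def edist_empty)
    then have "p \<alpha> (h z) \<le> C * exp (\<bar>Re z\<bar> / real (n + 1))" by (rule C(2))
    also have "\<bar>Re z\<bar> / real (n + 1) \<le> \<bar>Re z\<bar> / real n" using n by (intro divide_left_mono) auto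
    then have "C * exp (\<bar>Re z\<bar> / real (n + 1)) \<le> C * exp (\<bar>Re z\<bar> / real n)" using C(1) by (intro mult_left_mono) auto
    finally show ?thesis .
  qed
  then show ?thesis by blast
qed

section \<open>The transform on a right half-line\<close>

text \<open>The Fourier transform as a relation for a general set, so that the algebra of quotients
  covers both half-lines. The integrals are demanded for every width, whereas \<open>fourier\<close>
  asks for small widths only.\<close>

definition transforms :: "real set => (complex => 'a) => (complex => 'a) => bool" where
  "transforms A G T \<longleftrightarrow> T \<in> FO smul p (closure (ereal ` A)) \<and>
     (\<forall>\<zeta>\<in>halfplane (closure (ereal ` A)). \<forall>c>0. has_Pettis_integral smul lborel
        (\<lambda>t. smul (vector_derivative (contour (closure (ereal ` A)) c) (at t))
               (smul (exp (- \<i> * contour (closure (ereal ` A)) c t * \<zeta>)) (G (contour (closure (ereal ` A)) c t)))) (T \<zeta>))"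

text \<open>For functions holomorphic off \<open>A\<close> this says that the hyperfunction class is
  zero.\<close>

definition extends :: "real set => (complex => 'a) => bool" where
  "extends A f \<longleftrightarrow> (\<exists>h\<in>holomorphic_space smul UNIV. \<forall>z. z \<notin> of_real ` A --> f z = h z)"

lemma closure_half: "closure (ereal ` {a..}) = {ereal a..}"
proof
  show "closure (ereal ` {a..}) \<subseteq> {ereal a..}" by (rule closure_minimal) auto
  have "((\<lambda>n. ereal (a + real n)) \<longlongrightarrow> \<infinity>) sequentially"
  proof -
    have "filterlim (\<lambda>n. a + real n) at_top sequentially"
      by (rule filterlim_tendsto_add_at_top[OF tendsto_const filterlim_real_sequentially])
    then show ?thesis by (simp add: tendsto_PInfty_eq_at_top)
  qed
  moreover have "ereal (a + real n) \<in> ereal ` {a..}" for n by auto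
  ultimately have "\<infinity> \<in> closure (ereal ` {a..})"
    unfolding closure_sequential by (intro exI[of _ "\<lambda>n. ereal (a + real n)"] conjI allI)
  moreover have "ereal ` {a..} \<subseteq> closure (ereal ` {a..})" by (rule closure_subset)
  moreover have "{ereal a..} \<subseteq> insert \<infinity> (ereal ` {a..})"
  proof
    fix x assume "x \<in> {ereal a..}"
    then show "x \<in> insert \<infinity> (ereal ` {a..})" by (cases x) auto
  qed
  ultimately show "{ereal a..} \<subseteq> closure (ereal ` {a..})" by blast
qed

lemma half_minus: "{ereal a..} - ereal ` {a..} = {\<infinity>}"
proof -
  have "x = \<infinity>" if "ereal a \<le> x" "x \<notin> ereal ` {a..}" for x
    using that by (cases x) auto
  then show ?thesis by auto
qed

lemma contour_half: "contour {ereal a..} c = hook a c"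
  by (simp add: fun_eq_iff contour_def hook_def Inf_atLeast)

text \<open>At its two corners the contour has no derivative, and \<open>vector_derivative\<close>
  is arbitrary there; altering finitely many values removes the discrepancy with
  \<open>hookd\<close>.\<close>

lemma Pettis_discrete_difference:
  assumes g: "has_Pettis_integral smul lborel g x" and "finite S" and eq: "\<And>t::real. t \<notin> S ==> f t = g t"
  shows "has_Pettis_integral smul lborel f x"
  unfolding has_Pettis_integral_def
proof (intro ballI conjI)
  fix e' assume e: "e' \<in> cdual smul"
  have g': "integrable lborel (\<lambda>t. e' (g t))" "integral\<^sup>L lborel (\<lambda>t. e' (g t)) = e' x"
    using g e by (auto simp: has_Pettis_integral_def)
  have S: "countable S" using \<open>finite S\<close> by (rule countable_finite)
  show "integrable lborel (\<lambda>t. e' (f t))"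
    using g'(1) by (subst integrable_discrete_difference[OF S, where g = "\<lambda>t. e' (g t)"]) (auto simp: eq)
  show "integral\<^sup>L lborel (\<lambda>t. e' (f t)) = e' x"
    using g'(2) by (subst integral_discrete_difference[OF S, where g = "\<lambda>t. e' (g t)"]) (auto simp: eq)
qed

lemma transforms_unique:
  assumes T: "transforms A G T" and T': "transforms A G T'"
  shows "T = T'"
proof
  fix \<zeta>
  show "T \<zeta> = T' \<zeta>"
  proof (cases "\<zeta> \<in> halfplane (closure (ereal ` A))")
    case True
    show ?thesis
      by (rule Pettis_unique[OF T[unfolded transforms_def, THEN conjunct2, rule_format, OF True zero_less_one]
            T'[unfolded transforms_def, THEN conjunct2, rule_format, OF True zero_less_one]])
  next
    case False
    have "T \<in> holomorphic_space smul (halfplane (closure (ereal ` A)))" "T' \<in> holomorphic_space smul (halfplane (closure (ereal ` A)))"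
      using T T' by (simp_all add: transforms_def FO_def)
    then show ?thesis using holomorphic_space_zero[OF _ False] by metis
  qed
qed

lemma transforms_FT:
  assumes G: "G \<in> Oexp smul p {ereal a..}"
  shows "transforms {a..} G (FT a G)"
  unfolding transforms_def closure_half contour_half
proof (intro conjI ballI allI impI)
  note W = Oexp_Wsp[OF G]
  show "FT a G \<in> FO smul p {ereal a..}"
    unfolding FO_half
  proof (rule weightedI[OF FT_holomorphic[OF W]])
    fix k :: nat and \<alpha> assume "1 \<le> k"
    then have k: "1 \<le> real k" by simp
    obtain C where "\<And>\<zeta>. Im \<zeta> \<le> - (1 / real k) ==> p \<alpha> (FT a G \<zeta>) \<le> C * exp (cmod \<zeta> / real k - a * \<bar>Im \<zeta>\<bar>)"
      by (rule FT_bound[OF W k]) (rule that)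
    then show "\<exists>C. \<forall>z\<in>{z. Im z \<le> - (1 / real k)}. p \<alpha> (FT a G z) \<le> C * exp (cmod z / real k - a * \<bar>Im z\<bar>)" by blast
  qed
  fix \<zeta> and c :: real assume "\<zeta> \<in> halfplane {ereal a..}" and c: "0 < c"
  then have \<zeta>: "Im \<zeta> < 0" by (simp add: halfplane_def)
  show "has_Pettis_integral smul lborel
      (\<lambda>t. smul (vector_derivative (hook a c) (at t)) (smul (exp (- \<i> * hook a c t * \<zeta>)) (G (hook a c t)))) (FT a G \<zeta>)"
    by (rule Pettis_discrete_difference[OF FT_Pettis[OF W \<zeta> c], of "{-1, 1}"]) (simp_all add: vector_derivative_hook)
qed

lemma transforms_iff:
  assumes "G \<in> Oexp smul p {ereal a..}"
  shows "transforms {a..} G T \<longleftrightarrow> T = FT a G"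
  using transforms_FT[OF assms] transforms_unique by blast

section \<open>Kernel and range of the transform modulo the space for the point at infinity\<close>

lemma FT_entire_bound:
  assumes \<phi>: "\<phi> \<in> Wsp a" and h: "h \<in> holomorphic_space smul UNIV" and eq: "\<And>z. z \<in> slit a ==> h z = \<phi> z"
  shows "FT a \<phi> \<in> FO smul p {\<infinity>}"
  unfolding FO_infinity
proof (rule weightedI[OF FT_holomorphic[OF \<phi>]])
  fix k :: nat and \<alpha> assume "1 \<le> k"
  then have k: "1 \<le> real k" by simp
  \<comment> \<open>The endpoint is moved to at least \<open>k\<close>, because the space for
    \<open>{\<infinity>}\<close> demands the decay rate \<open>k\<close> together with the index
    \<open>k\<close>.\<close>
  define b where "b = max a (real k)"
  have b: "a \<le> b" "real k \<le> b" by (auto simp: b_def)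
  have W: "(\<lambda>z. if z \<in> slit b then h z else 0) \<in> Wsp b" by (rule Wsp_entire(1)[OF \<phi> h _ b(1)]) (rule eq)
  have FT_eq: "FT b (\<lambda>z. if z \<in> slit b then h z else 0) = FT a \<phi>" by (rule Wsp_entire(2)[OF \<phi> h _ b(1)]) (rule eq)
  obtain C where C: "0 \<le> C" "\<And>\<zeta>. Im \<zeta> \<le> - (1 / real k) ==> p \<alpha> (FT a \<phi> \<zeta>) \<le> C * exp (cmod \<zeta> / real k - b * \<bar>Im \<zeta>\<bar>)"
    by (rule FT_bound[OF W k, of \<alpha>, unfolded FT_eq]) (rule that)
  have "p \<alpha> (FT a \<phi> \<zeta>) \<le> C * exp (cmod \<zeta> / real k - real k * \<bar>Im \<zeta>\<bar>)" if "Im \<zeta> \<le> - (1 / real k)" for \<zeta>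
  proof -
    have "real k * \<bar>Im \<zeta>\<bar> \<le> b * \<bar>Im \<zeta>\<bar>" by (rule mult_right_mono[OF b(2) abs_ge_zero])
    then have "C * exp (cmod \<zeta> / real k - b * \<bar>Im \<zeta>\<bar>) \<le> C * exp (cmod \<zeta> / real k - real k * \<bar>Im \<zeta>\<bar>)"
      using C(1) by (intro mult_left_mono) auto
    with C(2)[OF that] show ?thesis by (rule order_trans)
  qed
  then show "\<exists>C. \<forall>z\<in>{z. Im z \<le> - (1 / real k)}. p \<alpha> (FT a \<phi> z) \<le> C * exp (cmod z / real k - real k * \<bar>Im z\<bar>)" by blast
qed

lemma Msp_shift:
  assumes f: "f \<in> holomorphic_space smul {z. Im z < 0}"
    and bound: "\<And>k \<alpha>. 1 \<le> k ==> \<exists>C. \<forall>\<zeta>. Im \<zeta> \<le> - 1 --> p \<alpha> (f \<zeta>) \<le> C * exp (cmod \<zeta> / real k - b * \<bar>Im \<zeta>\<bar>)"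
  shows "(\<lambda>s. f (s - \<i>)) \<in> Msp b"
  unfolding Msp_def
proof (intro CollectI conjI ballI allI)
  have sub: "(\<lambda>s. s - \<i>) ` lower \<subseteq> {z. Im z < 0}" by (auto simp: lower_def)
  show "continuous_on lower (\<lambda>s. f (s - \<i>))"
    by (rule continuous_on_compose2[OF holomorphic_space_continuous[OF f] _ sub]) (intro continuous_intros)
  show "(\<lambda>s. e' (f (s - \<i>))) holomorphic_on lower" if e: "e' \<in> cdual smul" for e'
    using holomorphic_on_compose_gen[OF _ cdual_holomorphic[OF f open_halfspace_Im_lt e] sub]
    by (simp add: o_def holomorphic_on_diff)
  show "mgrowth b (\<lambda>s. p \<alpha> (f (s - \<i>)))" for \<alpha>
    unfolding mgrowth_def
  proof (intro allI impI)
    fix k :: nat assume k: "1 \<le> k"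
    obtain C where C: "\<And>\<zeta>. Im \<zeta> \<le> - 1 ==> p \<alpha> (f \<zeta>) \<le> C * exp (cmod \<zeta> / real k - b * \<bar>Im \<zeta>\<bar>)"
      using bound[OF k] by blast
    \<comment> \<open>The constant \<open>exp (1 - b)\<close> comes from the shift:
      \<open>\<bar>Im (s - i)\<bar> = 1 - Im s\<close> contributes \<open>- b\<close>, and
      \<open>cmod (s - i) / k\<close> exceeds \<open>cmod s / k\<close> by at most 1.\<close>
    have "p \<alpha> (f (s - \<i>)) \<le> (\<bar>C\<bar> * exp (1 - b)) * exp (cmod s / real k + b * Im s)" if s: "Im s \<le> 0" for s
    proof -
      have "cmod (s - \<i>) \<le> cmod s + 1" using norm_triangle_ineq4[of s \<i>] by simp
      then have "cmod (s - \<i>) / real k \<le> (cmod s + 1) / real k" by (rule divide_right_mono) simp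
      also have "\<dots> \<le> cmod s / real k + 1" using k by (simp add: add_divide_distrib)
      finally have "cmod (s - \<i>) / real k - b * \<bar>Im (s - \<i>)\<bar> \<le> (1 - b) + (cmod s / real k + b * Im s)"
        using s by (simp add: right_diff_distrib)
      then have "\<bar>C\<bar> * exp (cmod (s - \<i>) / real k - b * \<bar>Im (s - \<i>)\<bar>) \<le> \<bar>C\<bar> * exp ((1 - b) + (cmod s / real k + b * Im s))"
        by (intro mult_left_mono) auto
      moreover have "p \<alpha> (f (s - \<i>)) \<le> C * exp (cmod (s - \<i>) / real k - b * \<bar>Im (s - \<i>)\<bar>)" using s by (intro C) simp
      moreover have "\<dots> \<le> \<bar>C\<bar> * exp (cmod (s - \<i>) / real k - b * \<bar>Im (s - \<i>)\<bar>)" by (rule mult_right_mono) auto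
      ultimately show ?thesis by (simp only: exp_add mult.assoc)
    qed
    then show "\<exists>C. \<forall>s. Im s \<le> 0 --> p \<alpha> (f (s - \<i>)) \<le> C * exp (cmod s / real k + b * Im s)" by blast
  qed
qed

lemma FO_half_Msp:
  assumes f: "f \<in> FO smul p {ereal a..}"
  shows "(\<lambda>s. f (s - \<i>)) \<in> Msp a"
proof (rule Msp_shift)
  note f' = f[unfolded FO_half]
  show "f \<in> holomorphic_space smul {z. Im z < 0}" by (rule weighted_holomorphic[OF f'])
  fix k :: nat and \<alpha> assume k: "1 \<le> k"
  obtain C where C: "\<And>z. z \<in> {z. Im z \<le> - (1 / real k)} ==> p \<alpha> (f z) \<le> C * exp (cmod z / real k - a * \<bar>Im z\<bar>)"
    by (rule weightedE[OF f' k]) (rule that)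
  have "1 / real k \<le> 1" using k by simp
  then show "\<exists>C. \<forall>\<zeta>. Im \<zeta> \<le> - 1 --> p \<alpha> (f \<zeta>) \<le> C * exp (cmod \<zeta> / real k - a * \<bar>Im \<zeta>\<bar>)"
    by (intro exI[of _ C] allI impI C) simp
qed

lemma FO_infinity_Msp:
  assumes f: "f \<in> FO smul p {\<infinity>}"
  shows "(\<lambda>s. f (s - \<i>)) \<in> Msp b"
proof (rule Msp_shift)
  note f' = f[unfolded FO_infinity]
  show "f \<in> holomorphic_space smul {z. Im z < 0}" by (rule weighted_holomorphic[OF f'])
  fix k :: nat and \<alpha> assume k: "1 \<le> k"
  obtain m where m: "b \<le> real m" using real_arch_simple by blast
  \<comment> \<open>The index must serve two purposes: at least \<open>m\<close> for the decay rate
    \<open>b\<close>, at least \<open>k\<close> for the subexponential term.\<close>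
  define n where "n = max k m"
  have n: "1 \<le> n" "b \<le> real n" "real k \<le> real n" using k m by (auto simp: n_def)
  obtain C where C: "0 \<le> C" "\<And>z. z \<in> {z. Im z \<le> - (1 / real n)} ==> p \<alpha> (f z) \<le> C * exp (cmod z / real n - real n * \<bar>Im z\<bar>)"
    by (rule weightedE[OF f' n(1)]) (rule that)
  have "p \<alpha> (f \<zeta>) \<le> C * exp (cmod \<zeta> / real k - b * \<bar>Im \<zeta>\<bar>)" if \<zeta>: "Im \<zeta> \<le> - 1" for \<zeta>
  proof -
    have "1 / real n \<le> 1" using n(1) by simp
    then have "p \<alpha> (f \<zeta>) \<le> C * exp (cmod \<zeta> / real n - real n * \<bar>Im \<zeta>\<bar>)" using \<zeta> by (intro C) simp
    moreover have "cmod \<zeta> / real n \<le> cmod \<zeta> / real k" using n(3) k by (intro divide_left_mono) auto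
    moreover have "b * \<bar>Im \<zeta>\<bar> \<le> real n * \<bar>Im \<zeta>\<bar>" using n(2) by (rule mult_right_mono) simp
    ultimately show ?thesis
      using mult_left_mono[OF _ C(1), of "exp (cmod \<zeta> / real n - real n * \<bar>Im \<zeta>\<bar>)" "exp (cmod \<zeta> / real k - b * \<bar>Im \<zeta>\<bar>)"] by auto
  qed
  then show "\<exists>C. \<forall>\<zeta>. Im \<zeta> \<le> - 1 --> p \<alpha> (f \<zeta>) \<le> C * exp (cmod \<zeta> / real k - b * \<bar>Im \<zeta>\<bar>)" by blast
qed

text \<open>The shift by \<open>\<i>\<close> makes the functions available up to the real axis, where the inverse transform
  integrates them; it corresponds to the factor \<open>exp (- z)\<close>.\<close>

lemma FT_inverse:
  assumes F: "(\<lambda>s. f (s - \<i>)) \<in> Msp a"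
  defines "g \<equiv> (\<lambda>z. smul (of_real (1 / (2 * pi))) (LE a (\<lambda>s. f (s - \<i>)) z))"
  shows "g \<in> Wsp a" and "Im \<zeta> < 0 ==> FT a g \<zeta> = f (\<zeta> - \<i>)"
proof -
  show "g \<in> Wsp a" unfolding g_def by (rule Wsp_scale[OF LE_Wsp[OF F]])
  assume "Im \<zeta> < 0"
  then show "FT a g \<zeta> = f (\<zeta> - \<i>)"
    unfolding g_def FT_scale[OF LE_Wsp[OF F]] FT_LE[OF F \<open>Im \<zeta> < 0\<close>] by (simp flip: of_real_mult)
qed

text \<open>The inverse transform \<open>g\<close> of the shifted transform and
  \<open>exp (- z) G\<close> have the same transform, so by \<open>FT_injective\<close> their
  difference continues to an entire function. Since the transform decays faster than every
  exponential, \<open>g\<close> is entire by \<open>LE_entire\<close>, and hence so is the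
  continuation of \<open>G\<close>.\<close>

lemma FT_FO_infinity:
  assumes G: "G \<in> Wsp a" and T: "FT a G \<in> FO smul p {\<infinity>}"
  obtains h where "h \<in> holomorphic_space smul UNIV" "\<And>z. z \<in> slit a ==> h z = G z"
proof -
  define F where "F s = FT a G (s - \<i>)" for s
  have F: "F \<in> Msp b" for b unfolding F_def[abs_def] by (rule FO_infinity_Msp[OF T])
  define g where "g z = smul (of_real (1 / (2 * pi))) (LE a F z)" for z
  have g: "g \<in> Wsp a" "\<And>\<zeta>. Im \<zeta> < 0 ==> FT a g \<zeta> = FT a G (\<zeta> - \<i>)"
    using FT_inverse[OF F[of a, unfolded F_def[abs_def]]] unfolding g_def[abs_def] F_def[abs_def] by auto
  have zero: "FT a (\<lambda>z. g z - smul (exp (- z)) (G z)) \<zeta> = 0" if "Im \<zeta> < 0" for \<zeta>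
    by (simp add: FT_diff[OF g(1) Wsp_exp(1)[OF G]] g(2)[OF that] Wsp_exp(2)[OF G that])
  obtain h where h: "h \<in> holomorphic_space smul UNIV" "\<And>z. z \<in> slit a ==> h z = g z - smul (exp (- z)) (G z)"
    by (rule FT_injective[OF Wsp_diff[OF g(1) Wsp_exp(1)[OF G]]]) (erule zero, rule that)
  define H where "H z = smul (exp z) (smul (of_real (1 / (2 * pi))) (RE (- \<i>) F z) - h z)" for z
  show thesis
  proof (rule that)
    show "H \<in> holomorphic_space smul UNIV"
      unfolding H_def[abs_def]
      by (intro holomorphic_space_scale_fun holomorphic_space_diff holomorphic_space_scale LE_entire(1)[OF F] h(1) holomorphic_intros open_UNIV)
    show "H z = G z" if z: "z \<in> slit a" for z
      by (simp add: H_def LE_entire(2)[OF F z] h(2)[OF z] g_def exp_minus)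
  qed
qed

text \<open>Formally \<open>exp z * g\<close> is a preimage of \<open>f\<close>, but it need not be
  tempered. A tempered member \<open>G\<close> of its class differs from it by an entire function.
  Multiplied by \<open>exp (- z)\<close> both sides lie in \<open>Wsp\<close>, and
  \<open>FT_entire_bound\<close> shows that the shifted transforms differ by an element of the space
  for \<open>{\<infinity>}\<close>.\<close>

lemma FT_surjective:
  assumes adm: "admissible smul p" and f: "f \<in> FO smul p {ereal a..}"
  obtains G where "G \<in> Oexp smul p {ereal a..}" "(\<lambda>\<zeta>. FT a G \<zeta> - f \<zeta>) \<in> FO smul p {\<infinity>}"
proof -
  define g where "g z = smul (of_real (1 / (2 * pi))) (LE a (\<lambda>s. f (s - \<i>)) z)" for z
  have g: "g \<in> Wsp a" "\<And>\<zeta>. Im \<zeta> < 0 ==> FT a g \<zeta> = f (\<zeta> - \<i>)"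
    using FT_inverse[OF FO_half_Msp[OF f]] unfolding g_def[abs_def] by auto
  have "(\<lambda>z. smul (exp z) (g z)) \<in> holomorphic_space smul (slit a)"
    using g(1) by (intro holomorphic_space_scale_fun holomorphic_intros open_slit) (simp add: Wsp_def)
  then obtain G h where G: "G \<in> Oexp smul p {ereal a..}" and h: "h \<in> holomorphic_space smul UNIV"
    "\<And>z. z \<in> slit a ==> smul (exp z) (g z) - G z = h z"
    by (rule tempered_representative[OF adm]) (rule that)
  note W = Oexp_Wsp[OF G]
  define \<psi> where "\<psi> z = smul (exp (- z)) (G z) - g z" for z
  have \<psi>: "\<psi> \<in> Wsp a" unfolding \<psi>_def by (rule Wsp_diff[OF Wsp_exp(1)[OF W] g(1)])
  have FT\<psi>: "FT a \<psi> \<zeta> = FT a G (\<zeta> - \<i>) - f (\<zeta> - \<i>)" if "Im \<zeta> < 0" for \<zeta>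
    unfolding \<psi>_def[abs_def] by (simp add: FT_diff[OF Wsp_exp(1)[OF W] g(1)] g(2)[OF that] Wsp_exp(2)[OF W that])
  have "FT a \<psi> \<in> FO smul p {\<infinity>}"
  proof (rule FT_entire_bound[OF \<psi>])
    show "(\<lambda>z. smul (- exp (- z)) (h z)) \<in> holomorphic_space smul UNIV"
      by (intro holomorphic_space_scale_fun h(1) holomorphic_intros open_UNIV)
    show "smul (- exp (- z)) (h z) = \<psi> z" if "z \<in> slit a" for z
      unfolding h(2)[OF that, symmetric] \<psi>_def by (simp add: scale_right_diff_distrib exp_minus)
  qed
  note \<psi>FO = this[unfolded FO_infinity]
  have D: "(\<lambda>\<zeta>. FT a G \<zeta> - f \<zeta>) \<in> FO smul p {ereal a..}"
    using transforms_FT[OF G] f unfolding transforms_def closure_half FO_half by (intro weighted_diff) auto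
  note D' = D[unfolded FO_half]
  show thesis
  proof (rule that[OF G])
    show "(\<lambda>\<zeta>. FT a G \<zeta> - f \<zeta>) \<in> FO smul p {\<infinity>}"
      unfolding FO_infinity
    proof (rule weightedI[OF weighted_holomorphic[OF D']])
      fix k :: nat and \<alpha> assume k: "1 \<le> k"
      then have k': "1 \<le> 2 * k" by simp
      obtain C1 where C1: "0 \<le> C1" "\<And>z. z \<in> {z. Im z \<le> - (1 / real k)} ==> p \<alpha> (FT a G z - f z) \<le> C1 * exp (cmod z / real k - a * \<bar>Im z\<bar>)"
        by (rule weightedE[OF D' k]) (rule that)
      \<comment> \<open>The information on the difference is about \<psi>, that is, after the shift.
        With index \<open>2 k\<close> it covers the points \<open>z\<close> with
        \<open>Im z \<le> - 1 - 1 / (2 k)\<close>; the strip between this line and the height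
        \<open>- 1 / k\<close> is left to \<open>C1\<close>.\<close>
      obtain C2 where C2: "0 \<le> C2" "\<And>z. z \<in> {z. Im z \<le> - (1 / real (2 * k))} ==> p \<alpha> (FT a \<psi> z) \<le> C2 * exp (cmod z / real (2 * k) - real (2 * k) * \<bar>Im z\<bar>)"
        by (rule weightedE[OF \<psi>FO k']) (rule that)
      define M1 where "M1 = C1 * exp (2 * (real k + \<bar>a\<bar>))"
      define M2 where "M2 = C2 * exp (1 + 2 * real k)"
      have M: "0 \<le> M1" "0 \<le> M2" using C1 C2 by (auto simp: M1_def M2_def)
      have "p \<alpha> (FT a G z - f z) \<le> (M1 + M2) * exp (cmod z / real k - real k * \<bar>Im z\<bar>)" if z: "Im z \<le> - (1 / real k)" for z
      proof (cases "Im z \<le> - 1 - 1 / real (2 * k)")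
        case True
        define w where "w = z + \<i>"
        have w: "Im w \<le> - (1 / real (2 * k))" "w - \<i> = z" using True by (simp_all add: w_def)
        have "0 < 1 / real (2 * k)" using k by simp
        then have w0: "Im w < 0" using w(1) by linarith
        have "p \<alpha> (FT a G z - f z) = p \<alpha> (FT a \<psi> w)" by (simp add: FT\<psi>[OF w0] w(2))
        also have "\<dots> \<le> C2 * exp (cmod w / real (2 * k) - real (2 * k) * \<bar>Im w\<bar>)" using w(1) by (intro C2) simp
        also have "\<dots> \<le> C2 * exp ((1 + 2 * real k) + (cmod z / real k - real k * \<bar>Im z\<bar>))"
        proof -
          have "cmod w \<le> cmod z + 1" unfolding w_def using norm_triangle_ineq[of z \<i>] by simp
          then have "cmod w / real (2 * k) \<le> (cmod z + 1) / real (2 * k)" by (rule divide_right_mono) simp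
          also have "\<dots> \<le> (cmod z + 1) / real k" using k by (intro divide_left_mono) auto
          also have "\<dots> \<le> cmod z / real k + 1" using k by (simp add: add_divide_distrib)
          finally have 1: "cmod w / real (2 * k) \<le> cmod z / real k + 1" .
          have "\<bar>Im z\<bar> \<le> \<bar>Im w\<bar> + 1" by (simp add: w_def)
          then have "real k * \<bar>Im z\<bar> \<le> real k * (\<bar>Im w\<bar> + 1)" by (rule mult_left_mono) simp
          also have "\<dots> \<le> real (2 * k) * \<bar>Im w\<bar> + 2 * real k" by (simp add: distrib_left)
          finally have "cmod w / real (2 * k) - real (2 * k) * \<bar>Im w\<bar> \<le> (1 + 2 * real k) + (cmod z / real k - real k * \<bar>Im z\<bar>)"
            using 1 by linarith
          then show ?thesis using C2(1) by (intro mult_left_mono) auto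
        qed
        also have "\<dots> = M2 * exp (cmod z / real k - real k * \<bar>Im z\<bar>)" by (simp only: M2_def exp_add mult.assoc)
        also have "\<dots> \<le> (M1 + M2) * exp (cmod z / real k - real k * \<bar>Im z\<bar>)" using M by (intro mult_right_mono) auto
        finally show ?thesis .
      next
        case False
        have "1 / real (2 * k) \<le> 1" using k by simp
        moreover have "0 \<le> 1 / real k" by simp
        ultimately have im: "\<bar>Im z\<bar> \<le> 2" using False z by linarith
        have "p \<alpha> (FT a G z - f z) \<le> C1 * exp (cmod z / real k - a * \<bar>Im z\<bar>)" using z by (intro C1) simp
        also have "\<dots> \<le> C1 * exp (2 * (real k + \<bar>a\<bar>) + (cmod z / real k - real k * \<bar>Im z\<bar>))"
        proof -
          \<comment> \<open>In the remaining strip the height is at most 2, so exchanging the rate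
            \<open>a\<close> for \<open>k\<close> costs a constant factor only.\<close>
          have "(real k - a) * \<bar>Im z\<bar> \<le> (real k + \<bar>a\<bar>) * \<bar>Im z\<bar>" by (rule mult_right_mono) auto
          also have "\<dots> \<le> (real k + \<bar>a\<bar>) * 2" by (rule mult_left_mono[OF im]) simp
          finally have "cmod z / real k - a * \<bar>Im z\<bar> \<le> 2 * (real k + \<bar>a\<bar>) + (cmod z / real k - real k * \<bar>Im z\<bar>)"
            by (simp add: algebra_simps)
          then show ?thesis using C1(1) by (intro mult_left_mono) auto
        qed
        also have "\<dots> = M1 * exp (cmod z / real k - real k * \<bar>Im z\<bar>)" by (simp only: M1_def exp_add mult.assoc)
        also have "\<dots> \<le> (M1 + M2) * exp (cmod z / real k - real k * \<bar>Im z\<bar>)" using M by (intro mult_right_mono) auto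
        finally show ?thesis .
      qed
      then show "\<exists>C. \<forall>z\<in>{z. Im z \<le> - (1 / real k)}. p \<alpha> (FT a G z - f z) \<le> C * exp (cmod z / real k - real k * \<bar>Im z\<bar>)" by blast
    qed
  qed
qed

end

section \<open>Quotients\<close>

text \<open>Operations on classes are defined as unions over all representatives. Such a union
  collapses to one class as soon as the underlying map respects the relations.\<close>

lemma UN_equiv_class:
  assumes r: "equiv X r" and s: "equiv Y s" and f: "f \<in> X"
    and resp: "\<And>g. (f, g) \<in> r ==> (\<phi> f, \<phi> g) \<in> s"
  shows "(\<Union>g\<in>r `` {f}. s `` {\<phi> g}) = s `` {\<phi> f}"
proof -
  have "s `` {\<phi> g} = s `` {\<phi> f}" if "g \<in> r `` {f}" for g
    using equiv_class_eq[OF s resp] that by blast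
  moreover have "f \<in> r `` {f}" by (rule equiv_class_self[OF r f])
  ultimately show ?thesis by blast
qed

context lcHs
begin

definition fun_subspace :: "(complex => 'e) set => bool" where
  "fun_subspace X \<longleftrightarrow> (\<lambda>z. 0) \<in> X \<and> (\<forall>f\<in>X. \<forall>g\<in>X. (\<lambda>z. f z + g z) \<in> X) \<and> (\<forall>c. \<forall>f\<in>X. (\<lambda>z. smul c (f z)) \<in> X)"

lemma fun_subspace_zero: "fun_subspace X ==> (\<lambda>z. 0) \<in> X"
  and fun_subspace_add: "fun_subspace X ==> f \<in> X ==> g \<in> X ==> (\<lambda>z. f z + g z) \<in> X"
  and fun_subspace_scale: "fun_subspace X ==> f \<in> X ==> (\<lambda>z. smul c (f z)) \<in> X"
  by (simp_all add: fun_subspace_def)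

lemma fun_subspace_diff: "fun_subspace X ==> f \<in> X ==> g \<in> X ==> (\<lambda>z. f z - g z) \<in> X"
  using fun_subspace_add[of X f "\<lambda>z. smul (-1) (g z)"] fun_subspace_scale[of X g "-1"] by (simp add: scale_minus_left)

lemma modrelI:
  "f \<in> X ==> g \<in> X ==> h \<in> Y ==> (\<And>z. z \<in> \<Omega> ==> f z - g z = h z) ==> (f, g) \<in> modrel \<Omega> X Y"
  by (auto simp: modrel_def)

lemma modrelE:
  assumes "(f, g) \<in> modrel \<Omega> X Y"
  obtains h where "f \<in> X" "g \<in> X" "h \<in> Y" "\<And>z. z \<in> \<Omega> ==> f z - g z = h z"
  using assms by (auto simp: modrel_def)

lemma modrel_equiv:
  assumes X: "fun_subspace X" and Y: "fun_subspace Y"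
  shows "equiv X (modrel \<Omega> X Y)"
proof (rule equivI)
  show "modrel \<Omega> X Y \<subseteq> X \<times> X" by (auto simp: modrel_def)
  show "refl_on X (modrel \<Omega> X Y)"
    by (rule refl_onI) (rule modrelI[OF _ _ fun_subspace_zero[OF Y]], simp_all)
  show "sym (modrel \<Omega> X Y)"
  proof (rule symI)
    fix f g assume "(f, g) \<in> modrel \<Omega> X Y"
    then obtain h where h: "f \<in> X" "g \<in> X" "h \<in> Y" "\<And>z. z \<in> \<Omega> ==> f z - g z = h z" by (rule modrelE) (rule that)
    show "(g, f) \<in> modrel \<Omega> X Y"
    proof (rule modrelI[OF h(2,1) fun_subspace_scale[OF Y h(3)]])
      show "g z - f z = smul (-1) (h z)" if "z \<in> \<Omega>" for z by (simp add: h(4)[OF that, symmetric] scale_minus_left)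
    qed
  qed
  show "trans (modrel \<Omega> X Y)"
  proof (rule transI)
    fix f g k assume "(f, g) \<in> modrel \<Omega> X Y" "(g, k) \<in> modrel \<Omega> X Y"
    then obtain h h' where h: "f \<in> X" "k \<in> X" "h \<in> Y" "h' \<in> Y" "\<And>z. z \<in> \<Omega> ==> f z - g z = h z" "\<And>z. z \<in> \<Omega> ==> g z - k z = h' z"
      by (elim modrelE) (rule that)
    show "(f, k) \<in> modrel \<Omega> X Y"
    proof (rule modrelI[OF h(1,2) fun_subspace_add[OF Y h(3,4)]])
      show "f z - k z = h z + h' z" if "z \<in> \<Omega>" for z using h(5)[OF that] h(6)[OF that] by (simp flip: h(5,6) add: that)
    qed
  qed
qed

lemma modrel_add:
  assumes X: "fun_subspace X" and Y: "fun_subspace Y" and "(f, g) \<in> modrel \<Omega> X Y" "(f', g') \<in> modrel \<Omega> X Y"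
  shows "((\<lambda>z. f z + f' z), (\<lambda>z. g z + g' z)) \<in> modrel \<Omega> X Y"
proof -
  obtain h where h: "f \<in> X" "g \<in> X" "h \<in> Y" "\<And>z. z \<in> \<Omega> ==> f z - g z = h z" using assms(3) by (rule modrelE) (rule that)
  obtain h' where h': "f' \<in> X" "g' \<in> X" "h' \<in> Y" "\<And>z. z \<in> \<Omega> ==> f' z - g' z = h' z" using assms(4) by (rule modrelE) (rule that)
  show ?thesis
  proof (rule modrelI[OF fun_subspace_add[OF X h(1) h'(1)] fun_subspace_add[OF X h(2) h'(2)] fun_subspace_add[OF Y h(3) h'(3)]])
    show "f z + f' z - (g z + g' z) = h z + h' z" if "z \<in> \<Omega>" for z
      using h(4)[OF that] h'(4)[OF that] by (simp add: add_diff_add)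
  qed
qed

lemma modrel_scale:
  assumes X: "fun_subspace X" and Y: "fun_subspace Y" and "(f, g) \<in> modrel \<Omega> X Y"
  shows "((\<lambda>z. smul c (f z)), (\<lambda>z. smul c (g z))) \<in> modrel \<Omega> X Y"
proof -
  obtain h where h: "f \<in> X" "g \<in> X" "h \<in> Y" "\<And>z. z \<in> \<Omega> ==> f z - g z = h z" using assms(3) by (rule modrelE) (rule that)
  show ?thesis
  proof (rule modrelI[OF fun_subspace_scale[OF X h(1)] fun_subspace_scale[OF X h(2)] fun_subspace_scale[OF Y h(3)]])
    show "smul c (f z) - smul c (g z) = smul c (h z)" if "z \<in> \<Omega>" for z
      using h(4)[OF that] by (simp flip: scale_right_diff_distrib)
  qed
qed

lemma class_scale_modrel:
  assumes X: "fun_subspace X" and Y: "fun_subspace Y" and f: "f \<in> X"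
  shows "class_scale smul (modrel \<Omega> X Y) c (modrel \<Omega> X Y `` {f}) = modrel \<Omega> X Y `` {\<lambda>z. smul c (f z)}"
  unfolding class_scale_def
  by (rule UN_equiv_class[OF modrel_equiv[OF X Y] modrel_equiv[OF X Y] f, where \<phi> = "\<lambda>f z. smul c (f z)"]) (rule modrel_scale[OF X Y])

lemma class_add_modrel:
  assumes X: "fun_subspace X" and Y: "fun_subspace Y" and f: "f \<in> X" and g: "g \<in> X"
  shows "class_add (modrel \<Omega> X Y) (modrel \<Omega> X Y `` {f}) (modrel \<Omega> X Y `` {g}) = modrel \<Omega> X Y `` {\<lambda>z. f z + g z}"
proof -
  note eq = modrel_equiv[OF X Y, of \<Omega>]
  have "(g, g) \<in> modrel \<Omega> X Y" "\<And>f. f \<in> X ==> (f, f) \<in> modrel \<Omega> X Y"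
    using eq g by (auto simp: equiv_def refl_on_def)
  note self = this
  have "(\<Union>g'\<in>modrel \<Omega> X Y `` {g}. modrel \<Omega> X Y `` {\<lambda>z. f' z + g' z}) = modrel \<Omega> X Y `` {\<lambda>z. f' z + g z}" if "f' \<in> X" for f'
    by (rule UN_equiv_class[OF eq eq g, where \<phi> = "\<lambda>g z. f' z + g z"]) (rule modrel_add[OF X Y self(2)[OF that]])
  note inner = this
  have mem: "f' \<in> X" if "f' \<in> modrel \<Omega> X Y `` {f}" for f' using that by (auto elim: modrelE)
  have "class_add (modrel \<Omega> X Y) (modrel \<Omega> X Y `` {f}) (modrel \<Omega> X Y `` {g})
      = (\<Union>f'\<in>modrel \<Omega> X Y `` {f}. modrel \<Omega> X Y `` {\<lambda>z. f' z + g z})"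
    unfolding class_add_def by (intro SUP_cong refl inner mem)
  also have "\<dots> = modrel \<Omega> X Y `` {\<lambda>z. f z + g z}"
    by (rule UN_equiv_class[OF eq eq f, where \<phi> = "\<lambda>f z. f z + g z"]) (rule modrel_add[OF X Y _ self(1)])
  finally show ?thesis .
qed

end

context seq_complete_lcHs
begin

lemma fun_subspace_weighted: "fun_subspace (weighted \<Omega> S W)"
  unfolding fun_subspace_def by (intro conjI ballI allI weighted_zero weighted_add weighted_scale)

lemma fun_subspace_holomorphic: "fun_subspace (holomorphic_space smul \<Omega>)"
  unfolding fun_subspace_def
  by (intro conjI ballI allI holomorphic_space_add holomorphic_space_scale) (auto simp: holomorphic_space_def)

lemma fun_subspace_Oexp: "fun_subspace (Oexp smul p K)"
  unfolding Oexp_weighted by (rule fun_subspace_weighted)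

lemma fun_subspace_FO: "fun_subspace (FO smul p K)"
proof (cases "\<infinity> \<in> K")
  case True
  show ?thesis unfolding FO_right[OF True refl] by (rule fun_subspace_weighted)
next
  case False
  show ?thesis unfolding FO_left[OF False refl] by (rule fun_subspace_weighted)
qed

lemma transforms_add:
  assumes T: "transforms A G T" and T': "transforms A G' T'"
  shows "transforms A (\<lambda>z. G z + G' z) (\<lambda>\<zeta>. T \<zeta> + T' \<zeta>)"
  unfolding transforms_def
proof (intro conjI ballI allI impI)
  show "(\<lambda>\<zeta>. T \<zeta> + T' \<zeta>) \<in> FO smul p (closure (ereal ` A))"
    using T T' unfolding transforms_def by (intro fun_subspace_add[OF fun_subspace_FO]) auto
  fix \<zeta> and c :: real assume \<zeta>: "\<zeta> \<in> halfplane (closure (ereal ` A))" and c: "0 < c"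
  show "has_Pettis_integral smul lborel
        (\<lambda>t. smul (vector_derivative (contour (closure (ereal ` A)) c) (at t))
               (smul (exp (- \<i> * contour (closure (ereal ` A)) c t * \<zeta>))
                 (G (contour (closure (ereal ` A)) c t) + G' (contour (closure (ereal ` A)) c t)))) (T \<zeta> + T' \<zeta>)"
    unfolding scale_right_distrib
    by (rule Pettis_add[OF T[unfolded transforms_def, THEN conjunct2, rule_format, OF \<zeta> c]
            T'[unfolded transforms_def, THEN conjunct2, rule_format, OF \<zeta> c]])
qed

lemma transforms_scale:
  assumes T: "transforms A G T"
  shows "transforms A (\<lambda>z. smul d (G z)) (\<lambda>\<zeta>. smul d (T \<zeta>))"
  unfolding transforms_def
proof (intro conjI ballI allI impI)
  show "(\<lambda>\<zeta>. smul d (T \<zeta>)) \<in> FO smul p (closure (ereal ` A))"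
    using T unfolding transforms_def by (intro fun_subspace_scale[OF fun_subspace_FO]) auto
  fix \<zeta> and c :: real assume \<zeta>: "\<zeta> \<in> halfplane (closure (ereal ` A))" and c: "0 < c"
  have comm: "smul u (smul v (smul d x)) = smul d (smul u (smul v x))" for u v x
    by (simp add: mult_ac)
  show "has_Pettis_integral smul lborel
        (\<lambda>t. smul (vector_derivative (contour (closure (ereal ` A)) c) (at t))
               (smul (exp (- \<i> * contour (closure (ereal ` A)) c t * \<zeta>))
                 (smul d (G (contour (closure (ereal ` A)) c t))))) (smul d (T \<zeta>))"
    unfolding comm
    by (rule Pettis_scale[OF T[unfolded transforms_def, THEN conjunct2, rule_format, OF \<zeta> c]])
qed

lemma transforms_diff:
  assumes T: "transforms A G T" and T': "transforms A G' T'"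
  shows "transforms A (\<lambda>z. G z - G' z) (\<lambda>\<zeta>. T \<zeta> - T' \<zeta>)"
  using transforms_add[OF T transforms_scale[OF T', of "-1"]] by (simp add: scale_minus_left)

end

section \<open>The isomorphism for an abstract half-line\<close>

text \<open>The analytic facts that the quotient argument consumes. \<open>representative\<close>
  and \<open>Oexp_rest\<close> make the canonical map into the hyperfunctions bijective,
  \<open>transforms_zero\<close> gives independence of the representative,
  \<open>transforms_kernel\<close> well-definedness and injectivity, \<open>transforms_range\<close>
  surjectivity.\<close>

locale asymptotic_transform = seq_complete_lcHs smul p
  for smul :: "complex => 'e::{ab_group_add,t2_space} => 'e" and p :: "'i => 'e => real" +
  fixes A :: "real set"
  assumes cset_A: "cset (closure (ereal ` A)) = of_real ` A"
    and cset_rest: "cset (closure (ereal ` A) - ereal ` A) = {}"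
    and halfplane_rest: "halfplane (closure (ereal ` A) - ereal ` A) = halfplane (closure (ereal ` A))"
    and representative: "f \<in> holomorphic_space smul (- (of_real ` A))
      ==> \<exists>G\<in>Oexp smul p (closure (ereal ` A)). extends A (\<lambda>z. f z - G z)"
    and Oexp_rest: "G \<in> Oexp smul p (closure (ereal ` A)) ==> h \<in> holomorphic_space smul UNIV
      ==> (\<And>z. z \<notin> of_real ` A ==> G z = h z) ==> h \<in> Oexp smul p (closure (ereal ` A) - ereal ` A)"
    and transforms_ex: "G \<in> Oexp smul p (closure (ereal ` A)) ==> \<exists>T. transforms A G T"
    and transforms_zero: "G \<in> Oexp smul p (closure (ereal ` A)) ==> h \<in> Oexp smul p {}
      ==> (\<And>z. z \<notin> of_real ` A ==> G z = h z) ==> transforms A G T ==> T = (\<lambda>\<zeta>. 0)"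
    and transforms_kernel: "G \<in> Oexp smul p (closure (ereal ` A)) ==> transforms A G T
      ==> T \<in> FO smul p (closure (ereal ` A) - ereal ` A) \<longleftrightarrow> extends A G"
    and transforms_range: "f \<in> FO smul p (closure (ereal ` A))
      ==> \<exists>G\<in>Oexp smul p (closure (ereal ` A)). \<exists>T. transforms A G T \<and> (\<lambda>\<zeta>. T \<zeta> - f \<zeta>) \<in> FO smul p (closure (ereal ` A) - ereal ` A)"
begin

abbreviation "K \<equiv> closure (ereal ` A)"
abbreviation "hr \<equiv> hyper_rel smul A"
abbreviation "er \<equiv> exp_rel smul p A"
abbreviation "fr \<equiv> FO_rel smul p A"

lemma equiv_hr: "equiv (holomorphic_space smul (- (of_real ` A))) hr"
  unfolding hyper_rel_def by (intro modrel_equiv fun_subspace_holomorphic)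

lemma equiv_er: "equiv (Oexp smul p K) er"
  unfolding exp_rel_def by (intro modrel_equiv fun_subspace_Oexp)

lemma equiv_fr: "equiv (FO smul p K) fr"
  unfolding FO_rel_def by (intro modrel_equiv fun_subspace_FO)

lemma Oexp_holomorphic: "G \<in> Oexp smul p K ==> G \<in> holomorphic_space smul (- (of_real ` A))"
  by (simp add: Oexp_def cset_A)

lemma hr_iff:
  assumes "f \<in> holomorphic_space smul (- (of_real ` A))" "g \<in> holomorphic_space smul (- (of_real ` A))"
  shows "(f, g) \<in> hr \<longleftrightarrow> extends A (\<lambda>z. f z - g z)"
  using assms by (auto simp: hyper_rel_def modrel_def extends_def)

text \<open>Congruence is demanded on the half-plane only; since all functions involved vanish
  elsewhere, it amounts to membership of the difference itself.\<close>

lemma fr_iff: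
  assumes f: "f \<in> FO smul p K" and g: "g \<in> FO smul p K"
  shows "(f, g) \<in> fr \<longleftrightarrow> (\<lambda>\<zeta>. f \<zeta> - g \<zeta>) \<in> FO smul p (K - ereal ` A)"
proof
  have holo: "h z = 0" if "h \<in> FO smul p L" "z \<notin> halfplane L" for h z L
    using that by (simp add: FO_def holomorphic_space_def)
  assume "(f, g) \<in> fr"
  then obtain h where h: "h \<in> FO smul p (K - ereal ` A)" "\<And>z. z \<in> halfplane K ==> f z - g z = h z"
    unfolding FO_rel_def by (rule modrelE) (rule that)
  have "f z - g z = h z" for z
    using holo[OF f] holo[OF g] holo[OF h(1)] h(2) by (cases "z \<in> halfplane K") (simp_all add: halfplane_rest)
  with h(1) show "(\<lambda>\<zeta>. f \<zeta> - g \<zeta>) \<in> FO smul p (K - ereal ` A)" by simp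
next
  assume "(\<lambda>\<zeta>. f \<zeta> - g \<zeta>) \<in> FO smul p (K - ereal ` A)"
  with f g show "(f, g) \<in> fr" unfolding FO_rel_def by (rule modrelI) simp
qed

text \<open>A difference of tempered functions that continues to an entire function is tempered by
  \<open>Oexp_rest\<close>. This is the injectivity of the canonical map
  \<open>R_map\<close>.\<close>

lemma er_iff:
  assumes f: "f \<in> Oexp smul p K" and g: "g \<in> Oexp smul p K"
  shows "(f, g) \<in> er \<longleftrightarrow> (f, g) \<in> hr"
proof
  assume "(f, g) \<in> er"
  then obtain h where h: "h \<in> Oexp smul p (K - ereal ` A)" "\<And>z. z \<in> - cset K ==> f z - g z = h z"
    unfolding exp_rel_def by (rule modrelE) (rule that)
  have "h \<in> holomorphic_space smul UNIV" using h(1) by (simp add: Oexp_def cset_rest)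
  then show "(f, g) \<in> hr"
    unfolding hyper_rel_def using h(2) by (intro modrelI[OF Oexp_holomorphic[OF f] Oexp_holomorphic[OF g]]) (simp_all add: cset_A)
next
  assume "(f, g) \<in> hr"
  then obtain h where h: "h \<in> holomorphic_space smul UNIV" "\<And>z. z \<in> - (of_real ` A) ==> f z - g z = h z"
    unfolding hyper_rel_def by (rule modrelE) (rule that)
  have "h \<in> Oexp smul p (K - ereal ` A)"
    by (rule Oexp_rest[OF fun_subspace_diff[OF fun_subspace_Oexp f g] h(1)]) (simp add: h(2))
  then show "(f, g) \<in> er"
    unfolding exp_rel_def using h(2) by (intro modrelI[OF f g]) (simp_all add: cset_A)
qed

lemma R_map_class:
  assumes G: "G \<in> Oexp smul p K"
  shows "R_map smul A (er `` {G}) = hr `` {G}"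
  unfolding R_map_def
proof (rule UN_equiv_class[OF equiv_er equiv_hr G])
  fix g assume g: "(G, g) \<in> er"
  then have "g \<in> Oexp smul p K" unfolding exp_rel_def by (auto elim: modrelE)
  then show "(G, g) \<in> hr" using g er_iff[OF G] by simp
qed

lemma R_inv_class:
  assumes G: "G \<in> Oexp smul p K" and f: "(G, f) \<in> hr"
  shows "R_inv smul p A (hr `` {f}) = er `` {G}"
  unfolding R_inv_def
proof (rule inv_into_f_eq)
  show "inj_on (R_map smul A) (Oexp smul p K // er)"
  proof (rule inj_onI)
    fix P Q assume "P \<in> Oexp smul p K // er" "Q \<in> Oexp smul p K // er" and eq: "R_map smul A P = R_map smul A Q"
    then obtain g g' where g: "g \<in> Oexp smul p K" "P = er `` {g}" "g' \<in> Oexp smul p K" "Q = er `` {g'}"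
      by (auto elim!: quotientE)
    have "hr `` {g} = hr `` {g'}" using eq g R_map_class by simp
    then have "(g, g') \<in> hr" using eq_equiv_class[OF _ equiv_hr] Oexp_holomorphic[OF g(3)] by blast
    then show "P = Q" unfolding g(2,4) using er_iff[OF g(1,3)] by (intro equiv_class_eq[OF equiv_er]) simp
  qed
  show "er `` {G} \<in> Oexp smul p K // er" using G by (rule quotientI)
  show "R_map smul A (er `` {G}) = hr `` {f}"
    unfolding R_map_class[OF G] by (rule equiv_class_eq[OF equiv_hr f])
qed

text \<open>The choice is determined by \<open>transforms_unique\<close>, also outside the
  half-plane, where every candidate vanishes.\<close>

definition trafo :: "(complex => 'e) => complex => 'e" where
  "trafo G = (SOME T. transforms A G T)"

lemma trafo: "G \<in> Oexp smul p K ==> transforms A G (trafo G)"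
  unfolding trafo_def by (rule someI_ex[OF transforms_ex])

lemma trafo_FO: "G \<in> Oexp smul p K ==> trafo G \<in> FO smul p K"
  using trafo by (simp add: transforms_def)

lemma trafo_add: "G \<in> Oexp smul p K ==> H \<in> Oexp smul p K ==> trafo (\<lambda>z. G z + H z) = (\<lambda>\<zeta>. trafo G \<zeta> + trafo H \<zeta>)"
  by (rule transforms_unique[OF trafo[OF fun_subspace_add[OF fun_subspace_Oexp]] transforms_add[OF trafo trafo]])

lemma trafo_scale: "G \<in> Oexp smul p K ==> trafo (\<lambda>z. smul c (G z)) = (\<lambda>\<zeta>. smul c (trafo G \<zeta>))"
  by (rule transforms_unique[OF trafo[OF fun_subspace_scale[OF fun_subspace_Oexp]] transforms_scale[OF trafo]])

text \<open>Applying \<open>transforms_kernel\<close> to the difference gives both directions: one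
  makes the map on classes well defined, the other makes it injective.\<close>

lemma trafo_class:
  assumes G: "G \<in> Oexp smul p K" and H: "H \<in> Oexp smul p K"
  shows "(trafo G, trafo H) \<in> fr \<longleftrightarrow> (G, H) \<in> hr"
proof -
  have "(trafo G, trafo H) \<in> fr \<longleftrightarrow> extends A (\<lambda>z. G z - H z)"
    unfolding fr_iff[OF trafo_FO[OF G] trafo_FO[OF H]]
    by (rule transforms_kernel[OF fun_subspace_diff[OF fun_subspace_Oexp G H] transforms_diff[OF trafo[OF G] trafo[OF H]]])
  then show ?thesis using hr_iff[OF Oexp_holomorphic[OF G] Oexp_holomorphic[OF H]] by simp
qed

text \<open>All members of the class share one transform by \<open>transforms_zero\<close>. The
  described value is unique because a condition eventually true for widths tending to 0 from the
  right holds for at least one positive width, and a Pettis integral is unique.\<close>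

lemma fourier_class:
  assumes G: "G \<in> Oexp smul p K"
  shows "fourier smul K (bv_rel smul p K `` {G}) = trafo G"
proof
  fix \<zeta>
  define Q where "Q F c x \<longleftrightarrow> has_Pettis_integral smul lborel
          (\<lambda>t. smul (vector_derivative (contour K c) (at t)) (smul (exp (- \<i> * contour K c t * \<zeta>)) (F (contour K c t)))) x" for F c x
  show "fourier smul K (bv_rel smul p K `` {G}) \<zeta> = trafo G \<zeta>"
  proof (cases "\<zeta> \<in> halfplane K")
    case True
    have Q: "Q F c (trafo F \<zeta>)" if "F \<in> Oexp smul p K" "0 < c" for F c
      unfolding Q_def by (rule trafo[OF that(1), unfolded transforms_def, THEN conjunct2, rule_format, OF True that(2)])
    have eq: "trafo F = trafo G" "F \<in> Oexp smul p K" if F: "F \<in> bv_rel smul p K `` {G}" for F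
    proof -
      have "(G, F) \<in> modrel (- cset K) (Oexp smul p K) (Oexp smul p {})" using F by (simp add: bv_rel_def)
      then obtain h where h: "F \<in> Oexp smul p K" "h \<in> Oexp smul p {}" "\<And>z. z \<in> - cset K ==> G z - F z = h z"
        by (rule modrelE) (rule that)
      have "(\<lambda>\<zeta>. trafo G \<zeta> - trafo F \<zeta>) = (\<lambda>\<zeta>. 0)"
        by (rule transforms_zero[OF fun_subspace_diff[OF fun_subspace_Oexp G h(1)] h(2) _ transforms_diff[OF trafo[OF G] trafo[OF h(1)]]])
           (simp add: h(3) cset_A)
      then show "trafo F = trafo G" "F \<in> Oexp smul p K" using h(1) by (simp_all add: fun_eq_iff)
    qed
    have self: "G \<in> bv_rel smul p K `` {G}"
      unfolding bv_rel_def by (rule equiv_class_self[OF modrel_equiv[OF fun_subspace_Oexp fun_subspace_Oexp] G])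
    have pos: "\<forall>\<^sub>F c in at_right (0::real). 0 < c" by (rule eventually_at_right_less)
    have "(THE x. \<forall>F\<in>bv_rel smul p K `` {G}. \<forall>\<^sub>F c in at_right 0. Q F c x) = trafo G \<zeta>"
    proof (rule the_equality)
      show "\<forall>F\<in>bv_rel smul p K `` {G}. \<forall>\<^sub>F c in at_right 0. Q F c (trafo G \<zeta>)"
      proof
        fix F assume F: "F \<in> bv_rel smul p K `` {G}"
        show "\<forall>\<^sub>F c in at_right 0. Q F c (trafo G \<zeta>)"
          using pos by eventually_elim (rule Q[OF eq(2)[OF F], unfolded eq(1)[OF F]])
      qed
      fix x assume "\<forall>F\<in>bv_rel smul p K `` {G}. \<forall>\<^sub>F c in at_right 0. Q F c x"
      then have "\<forall>\<^sub>F c in at_right 0. Q G c x" using self by blast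
      with pos have "\<forall>\<^sub>F c in at_right 0. 0 < c \<and> Q G c x" by (rule eventually_conj)
      then obtain c where c: "0 < c" "Q G c x"
        using eventually_happens trivial_limit_at_right_real by blast
      show "x = trafo G \<zeta>" by (rule Pettis_unique[OF c(2)[unfolded Q_def] Q[OF G c(1), unfolded Q_def]])
    qed
    then show ?thesis using True by (simp add: fourier_def Q_def)
  next
    case False
    have "trafo G \<in> holomorphic_space smul (halfplane K)" using trafo_FO[OF G] by (simp add: FO_def)
    then show ?thesis using False holomorphic_space_zero by (simp add: fourier_def)
  qed
qed

lemma asymp_fourier_class:
  assumes G: "G \<in> Oexp smul p K" and f: "(G, f) \<in> hr"
  shows "asymp_fourier smul p A (hr `` {f}) = fr `` {trafo G}"
  unfolding asymp_fourier_def R_inv_class[OF G f]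
proof -
  have mem: "H \<in> Oexp smul p K" if "H \<in> er `` {G}" for H using that unfolding exp_rel_def by (auto elim: modrelE)
  have "(\<Union>H\<in>er `` {G}. fr `` {fourier smul K (bv_rel smul p K `` {H})}) = (\<Union>H\<in>er `` {G}. fr `` {trafo H})"
    by (intro SUP_cong refl) (simp add: fourier_class[OF mem])
  also have "\<dots> = fr `` {trafo G}"
  proof (rule UN_equiv_class[OF equiv_er equiv_fr G])
    fix H assume H: "(G, H) \<in> er"
    then have "H \<in> Oexp smul p K" by (intro mem) simp
    then show "(trafo G, trafo H) \<in> fr" using H trafo_class[OF G] er_iff[OF G] by simp
  qed
  finally show "(\<Union>H\<in>er `` {G}. fr `` {fourier smul K (bv_rel smul p K `` {H})}) = fr `` {trafo G}" .
qed

lemma representativeE: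
  assumes f: "f \<in> holomorphic_space smul (- (of_real ` A))"
  obtains G where "G \<in> Oexp smul p K" "(G, f) \<in> hr"
proof -
  obtain G where G: "G \<in> Oexp smul p K" "extends A (\<lambda>z. f z - G z)" using representative[OF f] by blast
  then have "(f, G) \<in> hr" using hr_iff[OF f Oexp_holomorphic] by simp
  then have "(G, f) \<in> hr" using equiv_hr by (meson equivE symD)
  with G(1) show thesis by (rule that)
qed

theorem asymp_fourier_iso:
  "linear_iso_quotient smul (asymp_fourier smul p A) (holomorphic_space smul (- (of_real ` A))) hr (FO smul p K) fr"
  unfolding linear_iso_quotient_def
proof (intro conjI ballI allI)
  let ?H = "holomorphic_space smul (- (of_real ` A))"
  \<comment> \<open>Each class is handled through a tempered member \<open>G\<close>: while
    \<open>f\<close> names the class, \<open>G\<close> computes its image.\<close>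
  have rep: thesis
    if P: "P \<in> ?H // hr" and elim: "\<And>f G. f \<in> ?H ==> P = hr `` {f} ==> G \<in> Oexp smul p K ==> (G, f) \<in> hr
      ==> asymp_fourier smul p A P = fr `` {trafo G} ==> thesis" for P thesis
  proof -
    obtain f where f: "f \<in> ?H" "P = hr `` {f}" using P by (rule quotientE)
    obtain G where G: "G \<in> Oexp smul p K" "(G, f) \<in> hr" by (rule representativeE[OF f(1)])
    show thesis by (rule elim[OF f G]) (simp only: f(2) asymp_fourier_class[OF G])
  qed
  note subs = fun_subspace_holomorphic fun_subspace_FO fun_subspace_Oexp
  show "bij_betw (asymp_fourier smul p A) (?H // hr) (FO smul p K // fr)"
  proof (rule bij_betwI')
    fix P Q assume P: "P \<in> ?H // hr" and Q: "Q \<in> ?H // hr"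
    obtain f G where f: "f \<in> ?H" "P = hr `` {f}" "G \<in> Oexp smul p K" "(G, f) \<in> hr" "asymp_fourier smul p A P = fr `` {trafo G}"
      by (rule rep[OF P])
    obtain g H where g: "g \<in> ?H" "Q = hr `` {g}" "H \<in> Oexp smul p K" "(H, g) \<in> hr" "asymp_fourier smul p A Q = fr `` {trafo H}"
      by (rule rep[OF Q])
    have "P = hr `` {G}" "Q = hr `` {H}"
      using equiv_class_eq[OF equiv_hr f(4)] equiv_class_eq[OF equiv_hr g(4)] f(2) g(2) by simp_all
    then have "P = Q \<longleftrightarrow> (G, H) \<in> hr"
      using eq_equiv_class_iff[OF equiv_hr Oexp_holomorphic[OF f(3)] Oexp_holomorphic[OF g(3)]] by simp
    moreover have "asymp_fourier smul p A P = asymp_fourier smul p A Q \<longleftrightarrow> (trafo G, trafo H) \<in> fr"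
      unfolding f(5) g(5) by (rule eq_equiv_class_iff[OF equiv_fr trafo_FO[OF f(3)] trafo_FO[OF g(3)]])
    ultimately show "(asymp_fourier smul p A P = asymp_fourier smul p A Q) = (P = Q)"
      using trafo_class[OF f(3) g(3)] by simp
  next
    fix P assume P: "P \<in> ?H // hr"
    obtain f G where f: "f \<in> ?H" "P = hr `` {f}" "G \<in> Oexp smul p K" "(G, f) \<in> hr" "asymp_fourier smul p A P = fr `` {trafo G}"
      by (rule rep[OF P])
    show "asymp_fourier smul p A P \<in> FO smul p K // fr"
      unfolding f(5) by (rule quotientI[OF trafo_FO[OF f(3)]])
  next
    fix Q assume "Q \<in> FO smul p K // fr"
    then obtain g where g: "g \<in> FO smul p K" "Q = fr `` {g}" by (rule quotientE)
    obtain G T where G: "G \<in> Oexp smul p K" "transforms A G T" "(\<lambda>\<zeta>. T \<zeta> - g \<zeta>) \<in> FO smul p (K - ereal ` A)"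
      using transforms_range[OF g(1)] by blast
    have T: "T = trafo G" by (rule transforms_unique[OF G(2) trafo[OF G(1)]])
    have "(trafo G, g) \<in> fr" using G(3) fr_iff[OF trafo_FO[OF G(1)] g(1)] by (simp add: T)
    then have "Q = fr `` {trafo G}" unfolding g(2) by (rule equiv_class_eq[OF equiv_fr, symmetric])
    also have "\<dots> = asymp_fourier smul p A (hr `` {G})"
      using equiv_class_self[OF equiv_hr Oexp_holomorphic[OF G(1)]] by (intro asymp_fourier_class[OF G(1), symmetric]) simp
    finally show "\<exists>P\<in>?H // hr. Q = asymp_fourier smul p A P" using quotientI[OF Oexp_holomorphic[OF G(1)]] by blast
  qed
  show "asymp_fourier smul p A (class_add hr P Q) = class_add fr (asymp_fourier smul p A P) (asymp_fourier smul p A Q)"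
    if P: "P \<in> ?H // hr" and Q: "Q \<in> ?H // hr" for P Q
  proof -
    obtain f G where f: "f \<in> ?H" "P = hr `` {f}" "G \<in> Oexp smul p K" "(G, f) \<in> hr" "asymp_fourier smul p A P = fr `` {trafo G}"
      by (rule rep[OF P])
    obtain g H where g: "g \<in> ?H" "Q = hr `` {g}" "H \<in> Oexp smul p K" "(H, g) \<in> hr" "asymp_fourier smul p A Q = fr `` {trafo H}"
      by (rule rep[OF Q])
    have "class_add hr P Q = hr `` {\<lambda>z. f z + g z}"
      unfolding f(2) g(2) hyper_rel_def by (rule class_add_modrel[OF subs(1) subs(1) f(1) g(1)[unfolded hyper_rel_def]])
    moreover have "((\<lambda>z. G z + H z), (\<lambda>z. f z + g z)) \<in> hr"
      using f(4) g(4) unfolding hyper_rel_def by (rule modrel_add[OF subs(1) subs(1)])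
    ultimately have "asymp_fourier smul p A (class_add hr P Q) = fr `` {\<lambda>\<zeta>. trafo G \<zeta> + trafo H \<zeta>}"
      using asymp_fourier_class[OF fun_subspace_add[OF subs(3) f(3) g(3)]] by (simp add: trafo_add[OF f(3) g(3)])
    also have "\<dots> = class_add fr (fr `` {trafo G}) (fr `` {trafo H})"
      unfolding FO_rel_def by (rule class_add_modrel[OF subs(2) subs(2) trafo_FO[OF f(3)] trafo_FO[OF g(3)], symmetric])
    finally show ?thesis by (simp only: f(5) g(5))
  qed
  show "asymp_fourier smul p A (class_scale smul hr c P) = class_scale smul fr c (asymp_fourier smul p A P)"
    if P: "P \<in> ?H // hr" for c P
  proof -
    obtain f G where f: "f \<in> ?H" "P = hr `` {f}" "G \<in> Oexp smul p K" "(G, f) \<in> hr" "asymp_fourier smul p A P = fr `` {trafo G}"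
      by (rule rep[OF P])
    have "class_scale smul hr c P = hr `` {\<lambda>z. smul c (f z)}"
      unfolding f(2) hyper_rel_def by (rule class_scale_modrel[OF subs(1) subs(1) f(1)])
    moreover have "((\<lambda>z. smul c (G z)), (\<lambda>z. smul c (f z))) \<in> hr"
      using f(4) unfolding hyper_rel_def by (rule modrel_scale[OF subs(1) subs(1)])
    ultimately have "asymp_fourier smul p A (class_scale smul hr c P) = fr `` {\<lambda>\<zeta>. smul c (trafo G \<zeta>)}"
      using asymp_fourier_class[OF fun_subspace_scale[OF subs(3) f(3)]] by (simp add: trafo_scale[OF f(3)])
    also have "\<dots> = class_scale smul fr c (fr `` {trafo G})"
      unfolding FO_rel_def by (rule class_scale_modrel[OF subs(2) subs(2) trafo_FO[OF f(3)], symmetric])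
    finally show ?thesis by (simp only: f(5))
  qed
qed

end

section \<open>Reflection\<close>

lemma cset_uminus: "z \<in> cset (uminus ` K) \<longleftrightarrow> - z \<in> cset K"
proof -
  have "ereal x \<in> uminus ` K \<longleftrightarrow> ereal (- x) \<in> K" for x
    by (metis ereal_uminus_uminus image_iff uminus_ereal.simps(1))
  then have *: "z \<in> cset (uminus ` K) \<longleftrightarrow> (\<exists>x. z = of_real x \<and> ereal (- x) \<in> K)" by (simp add: cset_def)
  show ?thesis
    unfolding * unfolding cset_def mem_Collect_eq
  proof
    assume "\<exists>x. z = of_real x \<and> ereal (- x) \<in> K"
    then obtain x where "z = of_real x" "ereal (- x) \<in> K" by blast
    then show "\<exists>x. - z = of_real x \<and> ereal x \<in> K" by (intro exI[of _ "- x"]) simp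
  next
    assume "\<exists>x. - z = of_real x \<and> ereal x \<in> K"
    then obtain x where x: "- z = of_real x" "ereal x \<in> K" by blast
    have "z = - (- z)" by simp
    also have "\<dots> = of_real (- x)" unfolding x(1) by simp
    finally have "z = of_real (- x)" .
    with x(2) show "\<exists>x. z = of_real x \<and> ereal (- x) \<in> K" by (intro exI[of _ "- x"]) simp
  qed
qed

lemma Unbhd_uminus: "z \<in> Unbhd c (uminus ` K) \<longleftrightarrow> - z \<in> Unbhd c K"
proof -
  have "(\<exists>w\<in>cset (uminus ` K). cmod (z - w) < c) \<longleftrightarrow> (\<exists>w\<in>cset K. cmod (- z - w) < c)"
  proof
    assume "\<exists>w\<in>cset (uminus ` K). cmod (z - w) < c"
    then obtain w where "w \<in> cset (uminus ` K)" "cmod (z - w) < c" by blast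
    then show "\<exists>w\<in>cset K. cmod (- z - w) < c"
      by (intro bexI[of _ "- w"]) (simp_all add: cset_uminus norm_minus_commute)
  next
    assume "\<exists>w\<in>cset K. cmod (- z - w) < c"
    then obtain w where w: "w \<in> cset K" "cmod (- z - w) < c" by blast
    then have "cmod (z - - w) < c" using norm_minus_cancel[of "z - - w"] by simp
    then show "\<exists>w\<in>cset (uminus ` K). cmod (z - w) < c"
      using w(1) by (intro bexI[of _ "- w"]) (simp_all add: cset_uminus)
  qed
  moreover have "\<infinity> \<in> uminus ` K \<longleftrightarrow> -\<infinity> \<in> K" "-\<infinity> \<in> uminus ` K \<longleftrightarrow> \<infinity> \<in> K"
    by (metis ereal_uminus_uminus image_iff)+
  ultimately show ?thesis by (auto simp: Unbhd_def edist_less)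
qed

lemma Sn_uminus: "z \<in> Sn n (uminus ` K) \<longleftrightarrow> - z \<in> Sn n K"
proof -
  have mem: "w \<in> uminus ` S \<longleftrightarrow> - w \<in> S" for w :: complex and S by force
  have "Unbhd c (uminus ` K) = uminus ` Unbhd c K" for c
    by (intro set_eqI) (simp only: Unbhd_uminus mem)
  moreover have "closure (uminus ` S) = uminus ` closure S" for S :: "complex set"
    by (rule closure_injective_linear_image[symmetric]) (simp_all add: linear_uminus)
  ultimately show ?thesis by (simp add: Sn_def mem)
qed

lemma uminus_half: "uminus ` {ereal (- a)..} = {..ereal a}" "uminus ` {..ereal a} = {ereal (- a)..}"
proof -
  have *: "x \<in> uminus ` S \<longleftrightarrow> - x \<in> S" for x :: ereal and S by (metis ereal_uminus_uminus image_iff)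
  have "ereal (- a) \<le> - x \<longleftrightarrow> x \<le> ereal a" "- x \<le> ereal a \<longleftrightarrow> ereal (- a) \<le> x" for x by (cases x; auto)+
  then show "uminus ` {ereal (- a)..} = {..ereal a}" "uminus ` {..ereal a} = {ereal (- a)..}"
    unfolding set_eq_iff * by simp_all
qed

context seq_complete_lcHs
begin

lemma Oexp_reflect: "f \<in> Oexp smul p K ==> (\<lambda>z. f (- z)) \<in> Oexp smul p (uminus ` K)"
  unfolding Oexp_weighted by (erule weighted_reflect) (simp_all add: cset_uminus Sn_uminus)

lemma FO_reflect:
  "f \<in> FO smul p {ereal (- a)..} ==> (\<lambda>z. f (- z)) \<in> FO smul p {..ereal a}"
  "f \<in> FO smul p {..ereal a} ==> (\<lambda>z. f (- z)) \<in> FO smul p {ereal (- a)..}"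
  "f \<in> FO smul p {\<infinity>} ==> (\<lambda>z. f (- z)) \<in> FO smul p {-\<infinity>}"
  "f \<in> FO smul p {-\<infinity>} ==> (\<lambda>z. f (- z)) \<in> FO smul p {\<infinity>}"
  unfolding FO_half FO_half_left FO_infinity FO_minus_infinity
  by (erule weighted_reflect; simp)+

lemma slit_reflect: "z \<in> - (of_real ` {..a}) \<longleftrightarrow> - z \<in> slit (- a)"
proof -
  have "z \<in> of_real ` {..a} \<longleftrightarrow> Im z = 0 \<and> Re z \<le> a"
    by (auto simp: complex_eq_iff intro!: image_eqI[of _ _ "Re z"])
  then show ?thesis by (auto simp: slit_iff)
qed

lemma closure_half_left: "closure (ereal ` {..a}) = {..ereal a}"
proof
  show "closure (ereal ` {..a}) \<subseteq> {..ereal a}" by (rule closure_minimal) auto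
  have "((\<lambda>n. ereal (- a + real n)) \<longlongrightarrow> \<infinity>) sequentially"
  proof -
    have "filterlim (\<lambda>n. - a + real n) at_top sequentially"
      by (rule filterlim_tendsto_add_at_top[OF tendsto_const filterlim_real_sequentially])
    then show ?thesis by (simp add: tendsto_PInfty_eq_at_top)
  qed
  then have "((\<lambda>n. - ereal (- a + real n)) \<longlongrightarrow> - \<infinity>) sequentially" by (rule tendsto_uminus_ereal)
  moreover have "- ereal (- a + real n) \<in> ereal ` {..a}" for n by auto
  ultimately have "- \<infinity> \<in> closure (ereal ` {..a})"
    unfolding closure_sequential by (intro exI[of _ "\<lambda>n. - ereal (- a + real n)"] conjI allI)
  moreover have "ereal ` {..a} \<subseteq> closure (ereal ` {..a})" by (rule closure_subset)
  moreover have "{..ereal a} \<subseteq> insert (- \<infinity>) (ereal ` {..a})"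
  proof
    fix x assume "x \<in> {..ereal a}"
    then show "x \<in> insert (- \<infinity>) (ereal ` {..a})" by (cases x) auto
  qed
  ultimately show "{..ereal a} \<subseteq> closure (ereal ` {..a})" by blast
qed

lemma half_minus_left: "{..ereal a} - ereal ` {..a} = {-\<infinity>}"
proof -
  have "x = -\<infinity>" if "x \<le> ereal a" "x \<notin> ereal ` {..a}" for x
    using that by (cases x) auto
  then show ?thesis by auto
qed

lemma contour_half_left: "contour {..ereal a} c t = - hook (- a) c t"
  by (simp add: contour_def hook_def)

text \<open>The contour of the left half-line is the negative of the contour starting at
  \<open>- a\<close>. The product of the contour point and \<zeta> is unchanged if both change sign,
  while the derivative of the contour changes sign; this accounts for the factor
  \<open>-1\<close>.\<close>

lemma transforms_left:
  assumes G: "G \<in> Oexp smul p {..ereal a}"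
  shows "transforms {..a} G (\<lambda>\<zeta>. smul (-1) (FT (- a) (\<lambda>z. G (- z)) (- \<zeta>)))"
proof -
  have G': "(\<lambda>z. G (- z)) \<in> Oexp smul p {ereal (- a)..}" using Oexp_reflect[OF G] by (simp add: uminus_half)
  note T = transforms_FT[OF G', unfolded transforms_def closure_half]
  show ?thesis
    unfolding transforms_def closure_half_left
  proof (intro conjI ballI allI impI)
    show "(\<lambda>\<zeta>. smul (-1) (FT (- a) (\<lambda>z. G (- z)) (- \<zeta>))) \<in> FO smul p {..ereal a}"
      by (rule fun_subspace_scale[OF fun_subspace_FO FO_reflect(1)[OF conjunct1[OF T]]])
    fix \<zeta> and c :: real assume "\<zeta> \<in> halfplane {..ereal a}" and c: "0 < c"
    then have \<zeta>: "Im (- \<zeta>) < 0" by (simp add: halfplane_def)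
    show "has_Pettis_integral smul lborel
        (\<lambda>t. smul (vector_derivative (contour {..ereal a} c) (at t))
               (smul (exp (- \<i> * contour {..ereal a} c t * \<zeta>)) (G (contour {..ereal a} c t))))
        (smul (-1) (FT (- a) (\<lambda>z. G (- z)) (- \<zeta>)))"
    proof (rule Pettis_discrete_difference[OF Pettis_scale[OF FT_Pettis[OF Oexp_Wsp[OF G'] \<zeta> c]], of "{-1, 1}"])
      fix t :: real assume t: "t \<notin> {-1, 1}"
      have "(contour {..ereal a} c has_vector_derivative - hookd c t) (at t)"
        unfolding contour_half_left[abs_def] by (rule has_vector_derivative_minus[OF hook_deriv[OF t]])
      then have "vector_derivative (contour {..ereal a} c) (at t) = - hookd c t" by (rule vector_derivative_at)
      then show "smul (vector_derivative (contour {..ereal a} c) (at t))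
               (smul (exp (- \<i> * contour {..ereal a} c t * \<zeta>)) (G (contour {..ereal a} c t)))
          = smul (-1) (smul (hookd c t * exp (- \<i> * hook (- a) c t * - \<zeta>)) (G (- hook (- a) c t)))"
        by (simp add: contour_half_left)
    qed simp
  qed
qed

lemma asymptotic_transform_right:
  assumes adm: "admissible smul p"
  shows "asymptotic_transform smul p {a..}"
proof (unfold_locales, unfold closure_half half_minus slit_def[symmetric])
  show "cset {ereal a..} = of_real ` {a..}" by (rule cset_half)
  show "cset {\<infinity>} = {}" by simp
  show "halfplane {\<infinity>} = halfplane {ereal a..}" by (simp add: halfplane_def)
  have not_mem: "z \<notin> of_real ` {a..} \<longleftrightarrow> z \<in> slit a" for z by (simp add: slit_def)
  show "\<exists>G\<in>Oexp smul p {ereal a..}. extends {a..} (\<lambda>z. f z - G z)" if "f \<in> holomorphic_space smul (slit a)" for f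
    unfolding extends_def not_mem by (rule tempered_representative[OF adm that]) blast
  fix G assume G: "G \<in> Oexp smul p {ereal a..}"
  note W = Oexp_Wsp[OF G]
  show "\<exists>T. transforms {a..} G T" using transforms_FT[OF G] by blast
  show "h \<in> Oexp smul p {\<infinity>}" if "h \<in> holomorphic_space smul UNIV" "\<And>z. z \<notin> of_real ` {a..} ==> G z = h z" for h
    by (rule Oexp_entire[OF G that(1)]) (rule that(2), simp add: not_mem)
  show "T = (\<lambda>\<zeta>. 0)" if h: "h \<in> Oexp smul p {}" and eq: "\<And>z. z \<notin> of_real ` {a..} ==> G z = h z" and T: "transforms {a..} G T" for h T
  proof -
    have "T = FT a G" using T transforms_iff[OF G] by simp
    moreover have "h \<in> holomorphic_space smul UNIV" using h by (simp add: Oexp_def)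
    then have "FT a G \<zeta> = 0" for \<zeta>
      by (rule FT_zero[OF W]) (simp_all add: eq not_mem Oexp_empty_bound[OF h])
    ultimately show ?thesis by auto
  qed
  show "T \<in> FO smul p {\<infinity>} \<longleftrightarrow> extends {a..} G" if "transforms {a..} G T" for T
  proof -
    have T: "T = FT a G" using that transforms_iff[OF G] by simp
    show ?thesis
      unfolding T extends_def not_mem
    proof
      assume "FT a G \<in> FO smul p {\<infinity>}"
      then obtain h where "h \<in> holomorphic_space smul UNIV" "\<And>z. z \<in> slit a ==> h z = G z"
        by (rule FT_FO_infinity[OF W]) (rule that)
      then show "\<exists>h\<in>holomorphic_space smul UNIV. \<forall>z. z \<in> slit a --> G z = h z" by (intro bexI[of _ h]) simp_all
    next
      assume "\<exists>h\<in>holomorphic_space smul UNIV. \<forall>z. z \<in> slit a --> G z = h z"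
      then obtain h where "h \<in> holomorphic_space smul UNIV" "\<forall>z. z \<in> slit a --> G z = h z" by blast
      then show "FT a G \<in> FO smul p {\<infinity>}" by (intro FT_entire_bound[OF W]) simp_all
    qed
  qed
next
  fix f assume f: "f \<in> FO smul p {ereal a..}"
  obtain G where G: "G \<in> Oexp smul p {ereal a..}" "(\<lambda>\<zeta>. FT a G \<zeta> - f \<zeta>) \<in> FO smul p {\<infinity>}"
    by (rule FT_surjective[OF adm f])
  then show "\<exists>G\<in>Oexp smul p {ereal a..}. \<exists>T. transforms {a..} G T \<and> (\<lambda>\<zeta>. T \<zeta> - f \<zeta>) \<in> FO smul p {\<infinity>}"
    using transforms_FT by blast
qed

lemma asymptotic_transform_left:
  assumes adm: "admissible smul p"
  shows "asymptotic_transform smul p {..a}"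
proof -
  interpret R: asymptotic_transform smul p "{- a..}" by (rule asymptotic_transform_right[OF adm])
  note R_simps = closure_half half_minus
  have mem: "z \<notin> of_real ` {..a} \<longleftrightarrow> - z \<in> slit (- a)" "z \<notin> of_real ` {- a..} \<longleftrightarrow> z \<in> slit (- a)" for z
    using slit_reflect[of z a] by (simp_all add: slit_def)
  \<comment> \<open>Entire functions are preserved by the reflection, so the vanishing of
    hyperfunction classes transfers between the two half-lines.\<close>
  have ext: "extends {..a} (\<lambda>z. f (- z)) \<longleftrightarrow> extends {- a..} f" for f
  proof
    assume "extends {..a} (\<lambda>z. f (- z))"
    then obtain h where h: "h \<in> holomorphic_space smul UNIV" "\<And>z. - z \<in> slit (- a) ==> f (- z) = h z"
      by (auto simp: extends_def mem)
    show "extends {- a..} f"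
      unfolding extends_def mem
      using holomorphic_space_reflect[OF h(1), of UNIV] h(2)[of "- z" for z] by (intro bexI[of _ "\<lambda>z. h (- z)"]) simp_all
  next
    assume "extends {- a..} f"
    then obtain h where h: "h \<in> holomorphic_space smul UNIV" "\<And>z. z \<in> slit (- a) ==> f z = h z"
      by (auto simp: extends_def mem)
    show "extends {..a} (\<lambda>z. f (- z))"
      unfolding extends_def mem
      using holomorphic_space_reflect[OF h(1), of UNIV] h(2) by (intro bexI[of _ "\<lambda>z. h (- z)"]) simp_all
  qed
  have Oexp_right: "(\<lambda>z. G (- z)) \<in> Oexp smul p {ereal (- a)..}" if "G \<in> Oexp smul p {..ereal a}" for G
    using Oexp_reflect[OF that] by (simp add: uminus_half)
  have Oexp_left: "(\<lambda>z. G (- z)) \<in> Oexp smul p {..ereal a}" if "G \<in> Oexp smul p {ereal (- a)..}" for G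
    using Oexp_reflect[OF that] by (simp add: uminus_half)
  show ?thesis
  proof (unfold_locales, unfold closure_half_left half_minus_left)
    show "cset {..ereal a} = of_real ` {..a}" by (auto simp: cset_def)
    show "cset {-\<infinity>} = {}" by (auto simp: cset_def)
    show "halfplane {-\<infinity>} = halfplane {..ereal a}" by (simp add: halfplane_def)
    show "\<exists>G\<in>Oexp smul p {..ereal a}. extends {..a} (\<lambda>z. f z - G z)" if f: "f \<in> holomorphic_space smul (- (of_real ` {..a}))" for f
    proof -
      have "(\<lambda>z. f (- z)) \<in> holomorphic_space smul (- (of_real ` {- a..}))"
        by (rule holomorphic_space_reflect[OF f]) (simp add: mem)
      then obtain G where G: "G \<in> Oexp smul p {ereal (- a)..}" "extends {- a..} (\<lambda>z. f (- z) - G z)"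
        using R.representative unfolding R_simps by blast
      then show ?thesis using ext[of "\<lambda>z. f (- z) - G z"] by (intro bexI[OF _ Oexp_left[OF G(1)]]) simp
    qed
    fix G assume G: "G \<in> Oexp smul p {..ereal a}"
    note G' = Oexp_right[OF G]
    note T_def = transforms_unique[OF _ transforms_left[OF G]]
    show "\<exists>T. transforms {..a} G T" using transforms_left[OF G] by blast
    show "h \<in> Oexp smul p {-\<infinity>}" if h: "h \<in> holomorphic_space smul UNIV" "\<And>z. z \<notin> of_real ` {..a} ==> G z = h z" for h
    proof -
      have "(\<lambda>z. h (- z)) \<in> Oexp smul p {\<infinity>}"
        by (rule Oexp_entire[OF G' holomorphic_space_reflect[OF h(1)]]) (simp_all add: h(2) mem)
      from Oexp_reflect[OF this] show ?thesis by simp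
    qed
    show "T = (\<lambda>\<zeta>. 0)" if h: "h \<in> Oexp smul p {}" and eq: "\<And>z. z \<notin> of_real ` {..a} ==> G z = h z" and T: "transforms {..a} G T" for h T
    proof -
      have h': "(\<lambda>z. h (- z)) \<in> Oexp smul p {}" using Oexp_reflect[OF h] by simp
      have "FT (- a) (\<lambda>z. G (- z)) = (\<lambda>\<zeta>. 0)"
        using R.transforms_zero[unfolded R_simps, OF G' h' _ transforms_FT[OF G']] eq by (simp add: mem)
      then show ?thesis unfolding T_def[OF T] by simp
    qed
    show "T \<in> FO smul p {-\<infinity>} \<longleftrightarrow> extends {..a} G" if T: "transforms {..a} G T" for T
    proof -
      let ?S = "FT (- a) (\<lambda>z. G (- z))"
      have "T \<in> FO smul p {-\<infinity>} \<longleftrightarrow> ?S \<in> FO smul p {\<infinity>}"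
      proof
        assume "T \<in> FO smul p {-\<infinity>}"
        from fun_subspace_scale[OF fun_subspace_FO FO_reflect(4)[OF this], of "-1"]
        show "?S \<in> FO smul p {\<infinity>}" by (simp add: T_def[OF T])
      next
        assume "?S \<in> FO smul p {\<infinity>}"
        from fun_subspace_scale[OF fun_subspace_FO FO_reflect(3)[OF this], of "-1"]
        show "T \<in> FO smul p {-\<infinity>}" by (simp only: T_def[OF T])
      qed
      also have "\<dots> \<longleftrightarrow> extends {- a..} (\<lambda>z. G (- z))"
        by (rule R.transforms_kernel[unfolded R_simps, OF G' transforms_FT[OF G']])
      also have "\<dots> \<longleftrightarrow> extends {..a} G" using ext[of "\<lambda>z. G (- z)"] by simp
      finally show ?thesis .
    qed
  next
    fix f assume f: "f \<in> FO smul p {..ereal a}"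
    \<comment> \<open>The sign anticipates the factor \<open>-1\<close> in
      \<open>transforms_left\<close>.\<close>
    have "(\<lambda>\<zeta>. smul (-1) (f (- \<zeta>))) \<in> FO smul p {ereal (- a)..}"
      by (rule fun_subspace_scale[OF fun_subspace_FO FO_reflect(2)[OF f]])
    then obtain G where G: "G \<in> Oexp smul p {ereal (- a)..}" "(\<lambda>\<zeta>. FT (- a) G \<zeta> - smul (-1) (f (- \<zeta>))) \<in> FO smul p {\<infinity>}"
      by (rule FT_surjective[OF adm])
    note H = Oexp_left[OF G(1)]
    have "transforms {..a} (\<lambda>z. G (- z)) (\<lambda>\<zeta>. smul (-1) (FT (- a) G (- \<zeta>)))"
      using transforms_left[OF H] by simp
    moreover have "(\<lambda>\<zeta>. smul (-1) (FT (- a) G (- \<zeta>)) - f \<zeta>) \<in> FO smul p {-\<infinity>}"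
      using fun_subspace_scale[OF fun_subspace_FO FO_reflect(3)[OF G(2)], of "-1"]
      by (simp add: scale_minus_left scale_right_distrib)
    ultimately show "\<exists>G\<in>Oexp smul p {..ereal a}. \<exists>T. transforms {..a} G T \<and> (\<lambda>\<zeta>. T \<zeta> - f \<zeta>) \<in> FO smul p {-\<infinity>}"
      using H by blast
  qed
qed

end

theorem theorem5p2:
  fixes smul :: "complex \<Rightarrow> 'e::{ab_group_add,t2_space} \<Rightarrow> 'e"
    and p :: "'i \<Rightarrow> 'e \<Rightarrow> real"
    and A :: "real set"
    and a :: real
  assumes "seq_complete_lcHs smul p"
    and "admissible smul p"
    and "A = {..a} \<or> A = {a..}"
  shows "linear_iso_quotient smul (asymp_fourier smul p A)
           (holomorphic_space smul (- (complex_of_real ` A))) (hyper_rel smul A)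
           (FO smul p (closure (ereal ` A))) (FO_rel smul p A)"
proof -
  interpret seq_complete_lcHs smul p by (rule assms(1))
  have "asymptotic_transform smul p A"
    using assms(3) asymptotic_transform_left[OF assms(2)] asymptotic_transform_right[OF assms(2)] by blast
  then show ?thesis by (rule asymptotic_transform.asymp_fourier_iso)
qed

end
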